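(* Let $n\in\mathbb{N}$, and assume that the $U$-cylindrical $H$-fractional process $Z$ lives in the finite Wiener chaos $\mathcal{H}^{\oplus n}$ and that the Banach space $X$ is $n$-good and has the approximation property. Let $G:X^*\times U\to\mathcal{D}^H(T)$ be weakly integrable with respect to $Z$ and let $\overline G:X^*\to\mathcal{D}^H(T;U)$ be the operator associated with $G$. Then $G$ is integrable with respect to $Z$ if and only if $\overline G^*\in\gamma(\mathcal{D}^H(T;U);X)$. In that case, for every $r>0$ it holds that $$\|\xi\|_{L^r(\Omega;X)}\eqsim\|\overline G^*\|_{\gamma(\mathcal{D}^H(T;U);X)},$$ where $\xi$ is the integral of $G$ with respect to $Z$.
   Context: $A\eqsim B$ means $c_1A\le B\le c_2A$ with finite positive constants $c_1,c_2$; here the constants do not depend on $G$. Wiener chaos: $V$ is a real separable Hilbert space, $(\Omega,\mathcal{F},\mathbb{P})$ carries a $V$-isonormal Gaussian process $(W(v))_{v\in V}$ generating $\mathcal{F}$ (augmented by the $\mathbb{P}$-zero sets); $H_k(x)=\frac{(-1)^k}{k!}e^{x^2/2}\frac{d^k}{dx^k}(e^{-x^2/2})$; $\mathcal{H}_k$ is the closed linear subspace of $L^2(\Omega)$ generated by $\{H_k(W(v)):\|v\|_V=1\}$; $\mathcal{H}^{\oplus n}=\bigoplus_{i=0}^n\mathcal{H}_i$. Setting: $H\in(0,1)$, $U$ is a separable Hilbert space, $X$ a Banach space, $\mathfrak{T}$ is $\mathbb{R}$, $[0,\infty)$ or $[0,\tau]$, $T\subseteq\mathfrak{T}$ is an interval.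 A $U$-cylindrical $H$-fractional process $Z=(Z_t)_{t\in\mathfrak{T}}$ is a family of bounded linear operators $Z_t:U\to L^2(\Omega)$ such that each $Z_t(u)$ is centered and $\mathbb{E}Z_s(u)Z_t(v)=R_H(s,t)\langle u,v\rangle_U$, with $R_H(s,t)=\frac12(|s|^{2H}+|t|^{2H}-|t-s|^{2H})$. It lives in $\mathcal{H}^{\oplus n}$ if $Z_t(u)\in\mathcal{H}^{\oplus n}$ for all $t$, $u$. $\mathcal{D}^H(T)$ is the Hilbert space obtained by completing the real step functions $\sum_jf_j\mathbf 1_{[t_{j-1},t_j)}$ ($t_j\in T$) in the inner product determined by $\langle\mathbf 1_{[a,b)},\mathbf 1_{[c,d)}\rangle=\frac12(|d-a|^{2H}+|b-c|^{2H}-|d-b|^{2H}-|c-a|^{2H})$. For $u\in U$, $g\mapsto\int_Tg\,dZ(u)$ is the continuous linear extension to $\mathcal{D}^H(T)$ of $\mathbf 1_{[a,b)}\mapsto Z_b(u)-Z_a(u)$. $\mathcal{D}^H(T;U)=\mathcal{D}^H(T)\otimes_2U$ is the Hilbert tensor product and $I_T:\mathcal{D}^H(T;U)\to L^2(\Omega)$ is the linear isometry with $I_T(g\otimes u)=\int_Tg\,dZ(u)$. A bilinear map $G:X^*\times U\to\mathcal{D}^H(T)$ is weakly integrable if there is $C>0$ such that the Hilbert–Schmidt norm satisfies $\|G(\varphi,\cdot)\|_{\mathcal{L}_2(U;\mathcal{D}^H(T))}\le C\|\varphi\|_{X^*}$ for all $\varphi\in X^*$. Then there is a unique bounded linear operator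 $\overline G:X^*\to\mathcal{D}^H(T;U)$ with $\langle\overline G\varphi,g\otimes u\rangle_{\mathcal{D}^H(T;U)}=\langle G(\varphi,u),g\rangle_{\mathcal{D}^H(T)}$ for all $\varphi,g,u$. Its adjoint $\overline G^*$ maps $\mathcal{D}^H(T;U)$ into $X^{**}$; $\overline G^*\in\gamma(\mathcal{D}^H(T;U);X)$ means that it takes values in $X$ and is $\gamma$-radonifying. A weakly integrable $G$ is integrable with respect to $Z$ if there is $\xi\in L^0(\Omega;X)$ (the integral of $G$) with $\langle\varphi,\xi\rangle=I_T(\overline G\varphi)$ a.s. for every $\varphi\in X^*$. $\gamma(\mathcal{V};X)$, for a Hilbert space $\mathcal{V}$, is the space of $\gamma$-radonifying operators: the closure of the finite rank operators in the norm given for $R=\sum_{k=1}^m\langle\cdot,e_k\rangle x_k$ ($\{e_k\}$ orthonormal) by $\|R\|_{\gamma}^2=\mathbb{E}\|\sum_k\gamma_kx_k\|_X^2$, $\gamma_k$ independent standard Gaussian. $X$ is $n$-good if there are finite positive constants $c_1,c_2$ such that $c_1\|\sum_k\varepsilon^{(2)}_kx_k\|_{L^2(\Omega;X)}\le\|\sum_k\varepsilon^{(1)}_kx_k\|_{L^2(\Omega;X)}\le c_2\|\sum_k\varepsilon^{(2)}_kx_k\|_{L^2(\Omega;X)}$ for every $m$, every two orthonormal sets $\{\varepsilon^{(1)}_k\}_{k=1}^m,\{\varepsilon^{(2)}_k\}_{k=1}^m\subseteq\mathcal{H}^{\oplus n}$, and every $\{x_k\}_{k=1}^m\subseteq X$.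 $X$ has the approximation property if for every $\varepsilon>0$ and compact $C\subseteq X$ there is a finite rank $T\in\mathcal{L}(X)$ with $\sup_{x\in C}\|x-Tx\|_X\le\varepsilon$. *)

theory Defs
  imports "HOL-Probability.Probability"
begin

section \<open>Random variables\<close>

text \<open>
  Elements of \<open>L\<^sup>2(\<Omega>)\<close> are represented by functions; equality in \<open>L\<^sup>2(\<Omega>)\<close> is equality almost
  everywhere, and the sets of random variables below are closed under it.
\<close>

definition L2 :: "'o measure \<Rightarrow> ('o \<Rightarrow> real) set" where
  "L2 M = {f \<in> borel_measurable M. integrable M (\<lambda>\<omega>. (f \<omega>)\<^sup>2)}"

definition L2_norm :: "'o measure \<Rightarrow> ('o \<Rightarrow> real) \<Rightarrow> real" where
  "L2_norm M f = sqrt (\<integral>\<omega>. (f \<omega>)\<^sup>2 \<partial>M)"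

definition L2_linear :: "'o measure \<Rightarrow> ('a::real_vector \<Rightarrow> 'o \<Rightarrow> real) \<Rightarrow> bool" where
  "L2_linear M A \<longleftrightarrow>
     (\<forall>x. A x \<in> L2 M) \<and>
     (\<forall>x y. AE \<omega> in M. A (x + y) \<omega> = A x \<omega> + A y \<omega>) \<and>
     (\<forall>c x. AE \<omega> in M. A (c *\<^sub>R x) \<omega> = c * A x \<omega>)"

definition L2_bounded_linear :: "'o measure \<Rightarrow> ('a::real_normed_vector \<Rightarrow> 'o \<Rightarrow> real) \<Rightarrow> bool" where
  "L2_bounded_linear M A \<longleftrightarrow> L2_linear M A \<and> (\<exists>K. \<forall>x. L2_norm M (A x) \<le> K * norm x)"

definition L2_closed_span :: "'o measure \<Rightarrow> ('o \<Rightarrow> real) set \<Rightarrow> ('o \<Rightarrow> real) set" where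
  "L2_closed_span M A = {f \<in> L2 M. \<forall>\<epsilon>>0. \<exists>(m::nat) c g. (\<forall>i<m. g i \<in> A) \<and>
     L2_norm M (\<lambda>\<omega>. f \<omega> - (\<Sum>i<m. c i * g i \<omega>)) < \<epsilon>}"

definition L2_orthonormal :: "'o measure \<Rightarrow> nat \<Rightarrow> (nat \<Rightarrow> 'o \<Rightarrow> real) \<Rightarrow> bool" where
  "L2_orthonormal M m e \<longleftrightarrow> (\<forall>i<m. e i \<in> L2 M) \<and>
     (\<forall>i<m. \<forall>j<m. (\<integral>\<omega>. e i \<omega> * e j \<omega> \<partial>M) = (if i = j then 1 else 0))"

text \<open>
  The target space need not be separable, so \<open>L\<^sup>0(\<Omega>; X)\<close> consists of the strongly measurable functions.
  Convergence is required everywhere (each class modulo null sets has such a representative), which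
  makes the norm measurable even if the measure is not complete.
\<close>

definition strongly_measurable :: "'o measure \<Rightarrow> ('o \<Rightarrow> 'x::topological_space) \<Rightarrow> bool" where
  "strongly_measurable M \<xi> \<longleftrightarrow>
     (\<exists>s. (\<forall>i. simple_function M (s i)) \<and> (\<forall>\<omega>\<in>space M. (\<lambda>i. s i \<omega>) \<longlonglongrightarrow> \<xi> \<omega>))"

definition Lr_norm :: "'o measure \<Rightarrow> real \<Rightarrow> ('o \<Rightarrow> 'x::real_normed_vector) \<Rightarrow> ennreal" where
  "Lr_norm M r \<xi> =
     (let J = (\<integral>\<^sup>+\<omega>. ennreal (norm (\<xi> \<omega>) powr r) \<partial>M)
      in if J = \<top> then \<top> else ennreal (enn2real J powr (1 / r)))"


section \<open>Wiener chaos\<close>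

definition centered_gaussian :: "'o measure \<Rightarrow> ('o \<Rightarrow> real) \<Rightarrow> bool" where
  "centered_gaussian M Y \<longleftrightarrow> Y \<in> borel_measurable M \<and>
     ((AE \<omega> in M. Y \<omega> = 0) \<or> (\<exists>\<sigma>>0. distributed M lborel Y (\<lambda>x. ennreal (normal_density 0 \<sigma> x))))"

definition isonormal_process :: "'o measure \<Rightarrow> ('v::real_inner \<Rightarrow> 'o \<Rightarrow> real) \<Rightarrow> bool" where
  "isonormal_process M W \<longleftrightarrow>
     (\<forall>(m::nat) c v. centered_gaussian M (\<lambda>\<omega>. \<Sum>i<m. c i * W (v i) \<omega>)) \<and>
     (\<forall>v w. (\<integral>\<omega>. W v \<omega> * W w \<omega> \<partial>M) = inner v w)"

definition generated_up_to_null :: "'o measure \<Rightarrow> ('v \<Rightarrow> 'o \<Rightarrow> real) \<Rightarrow> bool" where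
  "generated_up_to_null M W \<longleftrightarrow>
     sets M = sigma_sets (space M)
       ({W v -` B \<inter> space M | v B. B \<in> sets borel} \<union> null_sets M)"

definition hermite :: "nat \<Rightarrow> real \<Rightarrow> real" where
  "hermite k x = (-1) ^ k / fact k * exp (x\<^sup>2 / 2) * (deriv ^^ k) (\<lambda>y. exp (- y\<^sup>2 / 2)) x"

definition chaos :: "'o measure \<Rightarrow> ('v::real_inner \<Rightarrow> 'o \<Rightarrow> real) \<Rightarrow> nat \<Rightarrow> ('o \<Rightarrow> real) set" where
  "chaos M W k = L2_closed_span M {(\<lambda>\<omega>. hermite k (W v \<omega>)) | v. norm v = 1}"

definition chaos_upto :: "'o measure \<Rightarrow> ('v::real_inner \<Rightarrow> 'o \<Rightarrow> real) \<Rightarrow> nat \<Rightarrow> ('o \<Rightarrow> real) set" where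
  "chaos_upto M W n = {f \<in> L2 M. \<exists>g. (\<forall>i\<le>n. g i \<in> chaos M W i) \<and>
     (AE \<omega> in M. f \<omega> = (\<Sum>i\<le>n. g i \<omega>))}"


section \<open>Geometry of the Banach space\<close>

definition n_good :: "'o measure \<Rightarrow> ('v::real_inner \<Rightarrow> 'o \<Rightarrow> real) \<Rightarrow> nat \<Rightarrow> 'x::banach itself \<Rightarrow> bool" where
  "n_good M W n X \<longleftrightarrow> (\<exists>c1>0. \<exists>c2>0. \<forall>m e1 e2. \<forall>x :: nat \<Rightarrow> 'x.
     L2_orthonormal M m e1 \<and> (\<forall>k<m. e1 k \<in> chaos_upto M W n) \<and>
     L2_orthonormal M m e2 \<and> (\<forall>k<m. e2 k \<in> chaos_upto M W n) \<longrightarrow>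
       ennreal c1 * Lr_norm M 2 (\<lambda>\<omega>. \<Sum>k<m. e2 k \<omega> *\<^sub>R x k)
         \<le> Lr_norm M 2 (\<lambda>\<omega>. \<Sum>k<m. e1 k \<omega> *\<^sub>R x k) \<and>
       Lr_norm M 2 (\<lambda>\<omega>. \<Sum>k<m. e1 k \<omega> *\<^sub>R x k)
         \<le> ennreal c2 * Lr_norm M 2 (\<lambda>\<omega>. \<Sum>k<m. e2 k \<omega> *\<^sub>R x k))"

definition approximation_property :: "'x::banach itself \<Rightarrow> bool" where
  "approximation_property X \<longleftrightarrow> (\<forall>\<epsilon>>0. \<forall>C :: 'x set. compact C \<longrightarrow>
     (\<exists>T :: 'x \<Rightarrow>\<^sub>L 'x. (\<exists>B. finite B \<and> range (blinfun_apply T) \<subseteq> span B) \<and>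
        (\<forall>x\<in>C. norm (x - T x) \<le> \<epsilon>)))"


section \<open>Fractional processes and stochastic integrals\<close>

definition time_domain :: "real set \<Rightarrow> bool" where
  "time_domain S \<longleftrightarrow> S = UNIV \<or> S = {0..} \<or> (\<exists>\<tau>>0. S = {0..\<tau>})"

definition frac_cov :: "real \<Rightarrow> real \<Rightarrow> real \<Rightarrow> real" where
  "frac_cov H s t =
     (\<bar>s\<bar> powr (2 * H) + \<bar>t\<bar> powr (2 * H) - \<bar>t - s\<bar> powr (2 * H)) / 2"

definition cylindrical_frac_process ::
  "'o measure \<Rightarrow> real \<Rightarrow> real set \<Rightarrow> (real \<Rightarrow> 'u::real_inner \<Rightarrow> 'o \<Rightarrow> real) \<Rightarrow> bool" where
  "cylindrical_frac_process M H S Z \<longleftrightarrow>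
     (\<forall>t\<in>S. L2_bounded_linear M (Z t)) \<and>
     (\<forall>t\<in>S. \<forall>u. (\<integral>\<omega>. Z t u \<omega> \<partial>M) = 0) \<and>
     (\<forall>s\<in>S. \<forall>t\<in>S. \<forall>u v. (\<integral>\<omega>. Z s u \<omega> * Z t v \<omega> \<partial>M) = frac_cov H s t * inner u v)"

definition lives_in_chaos ::
  "'o measure \<Rightarrow> ('v::real_inner \<Rightarrow> 'o \<Rightarrow> real) \<Rightarrow> nat \<Rightarrow> real set \<Rightarrow> (real \<Rightarrow> 'u \<Rightarrow> 'o \<Rightarrow> real) \<Rightarrow> bool" where
  "lives_in_chaos M W n S Z \<longleftrightarrow> (\<forall>t\<in>S. \<forall>u. Z t u \<in> chaos_upto M W n)"

definition step_functions :: "real set \<Rightarrow> (real \<Rightarrow> real) set" where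
  "step_functions T = {(\<lambda>x. \<Sum>j=1..m. f j * indicator {t (j - 1)..<t j} x) | (m::nat) f t.
     \<forall>j\<in>{1..m}. t (j - 1) \<in> T \<and> t j \<in> T \<and> t (j - 1) \<le> t j}"

text \<open>
  The type \<open>'d\<close> together with \<open>emb\<close> is the completion of the step functions, which determines it up to
  a unique isometry; likewise for the Hilbert tensor product.  A completion depending on \<open>H\<close> and \<open>T\<close>
  cannot be a type of its own.
\<close>

definition is_DH ::
  "real \<Rightarrow> real set \<Rightarrow> ((real \<Rightarrow> real) \<Rightarrow> 'd::{real_inner, complete_space}) \<Rightarrow> bool" where
  "is_DH H T emb \<longleftrightarrow>
     (\<forall>f\<in>step_functions T. \<forall>g\<in>step_functions T. emb (\<lambda>x. f x + g x) = emb f + emb g) \<and>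
     (\<forall>c. \<forall>f\<in>step_functions T. emb (\<lambda>x. c * f x) = c *\<^sub>R emb f) \<and>
     (\<forall>a\<in>T. \<forall>b\<in>T. \<forall>c\<in>T. \<forall>d\<in>T. a \<le> b \<longrightarrow> c \<le> d \<longrightarrow>
        inner (emb (indicator {a..<b})) (emb (indicator {c..<d})) =
          (\<bar>d - a\<bar> powr (2 * H) + \<bar>b - c\<bar> powr (2 * H)
            - \<bar>d - b\<bar> powr (2 * H) - \<bar>c - a\<bar> powr (2 * H)) / 2) \<and>
     closure (emb ` step_functions T) = UNIV"

definition is_hilbert_tensor ::
  "('d::{real_inner, complete_space} \<Rightarrow> 'u::{real_inner, complete_space}
     \<Rightarrow> 'e::{real_inner, complete_space}) \<Rightarrow> bool" where
  "is_hilbert_tensor tens \<longleftrightarrow> bilinear tens \<and>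
     (\<forall>g u g' u'. inner (tens g u) (tens g' u') = inner g g' * inner u u') \<and>
     closure (span {tens g u | g u. True}) = UNIV"

text \<open>\<open>J g u\<close> stands for \<open>\<integral>\<^sub>T g dZ(u)\<close>.\<close>

definition is_scalar_integral ::
  "'o measure \<Rightarrow> (real \<Rightarrow> 'u \<Rightarrow> 'o \<Rightarrow> real) \<Rightarrow> real set \<Rightarrow> ((real \<Rightarrow> real) \<Rightarrow> 'd::real_normed_vector)
     \<Rightarrow> ('d \<Rightarrow> 'u \<Rightarrow> 'o \<Rightarrow> real) \<Rightarrow> bool" where
  "is_scalar_integral M Z T emb J \<longleftrightarrow> (\<forall>u. L2_bounded_linear M (\<lambda>g. J g u) \<and>
     (\<forall>a\<in>T. \<forall>b\<in>T. a \<le> b \<longrightarrow>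
        (AE \<omega> in M. J (emb (indicator {a..<b})) u \<omega> = Z b u \<omega> - Z a u \<omega>)))"

definition is_tensor_integral ::
  "'o measure \<Rightarrow> ('d \<Rightarrow> 'u \<Rightarrow> 'e::real_normed_vector) \<Rightarrow> ('d \<Rightarrow> 'u \<Rightarrow> 'o \<Rightarrow> real)
     \<Rightarrow> ('e \<Rightarrow> 'o \<Rightarrow> real) \<Rightarrow> bool" where
  "is_tensor_integral M tens J I \<longleftrightarrow> L2_linear M I \<and>
     (\<forall>h. L2_norm M (I h) = norm h) \<and>
     (\<forall>g u. AE \<omega> in M. I (tens g u) \<omega> = J g u \<omega>)"


section \<open>Weak integrability and integrability\<close>

definition orthonormal_basis :: "'u::real_inner set \<Rightarrow> bool" where
  "orthonormal_basis B \<longleftrightarrow>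
     (\<forall>e\<in>B. norm e = 1) \<and> pairwise orthogonal B \<and> closure (span B) = UNIV"

definition hilbert_schmidt :: "('u::real_inner \<Rightarrow> 'd::real_inner) \<Rightarrow> bool" where
  "hilbert_schmidt A \<longleftrightarrow> bounded_linear A \<and>
     (\<forall>B. orthonormal_basis B \<longrightarrow> (\<lambda>e. (norm (A e))\<^sup>2) summable_on B)"

text \<open>The value does not depend on the basis.\<close>

definition hs_norm :: "('u::real_inner \<Rightarrow> 'd::real_inner) \<Rightarrow> real" where
  "hs_norm A = sqrt (\<Sum>\<^sub>\<infinity>e\<in>(SOME B. orthonormal_basis B). (norm (A e))\<^sup>2)"

definition weakly_integrable ::
  "(('x::real_normed_vector \<Rightarrow>\<^sub>L real) \<Rightarrow> 'u::real_inner \<Rightarrow> 'd::real_inner) \<Rightarrow> bool" where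
  "weakly_integrable G \<longleftrightarrow> bilinear G \<and>
     (\<exists>C>0. \<forall>\<phi>. hilbert_schmidt (G \<phi>) \<and> hs_norm (G \<phi>) \<le> C * norm \<phi>)"

definition associated_operator ::
  "('d::real_inner \<Rightarrow> 'u \<Rightarrow> 'e::real_inner) \<Rightarrow> (('x::real_normed_vector \<Rightarrow>\<^sub>L real) \<Rightarrow> 'u \<Rightarrow> 'd)
     \<Rightarrow> (('x \<Rightarrow>\<^sub>L real) \<Rightarrow>\<^sub>L 'e) \<Rightarrow> bool" where
  "associated_operator tens G Gbar \<longleftrightarrow>
     (\<forall>\<phi> g u. inner (blinfun_apply Gbar \<phi>) (tens g u) = inner (G \<phi> u) g)"

text \<open>The associated operator is unique, since the elementary tensors span a dense subspace.\<close>

definition is_integral ::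
  "'o measure \<Rightarrow> ('d::real_inner \<Rightarrow> 'u \<Rightarrow> 'e::real_inner) \<Rightarrow> ('e \<Rightarrow> 'o \<Rightarrow> real)
     \<Rightarrow> (('x::real_normed_vector \<Rightarrow>\<^sub>L real) \<Rightarrow> 'u \<Rightarrow> 'd) \<Rightarrow> ('o \<Rightarrow> 'x) \<Rightarrow> bool" where
  "is_integral M tens I G \<xi> \<longleftrightarrow> strongly_measurable M \<xi> \<and>
     (\<exists>Gbar. associated_operator tens G Gbar \<and>
       (\<forall>\<phi>. AE \<omega> in M. blinfun_apply \<phi> (\<xi> \<omega>) = I (blinfun_apply Gbar \<phi>) \<omega>))"

definition integrable_wrt ::
  "'o measure \<Rightarrow> ('d::real_inner \<Rightarrow> 'u::real_inner \<Rightarrow> 'e::real_inner) \<Rightarrow> ('e \<Rightarrow> 'o \<Rightarrow> real)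
     \<Rightarrow> (('x::real_normed_vector \<Rightarrow>\<^sub>L real) \<Rightarrow> 'u \<Rightarrow> 'd) \<Rightarrow> bool" where
  "integrable_wrt M tens I G \<longleftrightarrow> weakly_integrable G \<and> (\<exists>\<xi>. is_integral M tens I G \<xi>)"


section \<open>Radonifying operators\<close>

definition finite_rank_rep ::
  "('e::real_inner \<Rightarrow>\<^sub>L 'x::real_normed_vector) \<Rightarrow> nat \<Rightarrow> (nat \<Rightarrow> 'e) \<Rightarrow> (nat \<Rightarrow> 'x) \<Rightarrow> bool" where
  "finite_rank_rep R m e x \<longleftrightarrow>
     (\<forall>i<m. \<forall>j<m. inner (e i) (e j) = (if i = j then 1 else 0)) \<and>
     (\<forall>h. R h = (\<Sum>k<m. inner h (e k) *\<^sub>R x k))"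

definition finite_rank :: "('e::real_inner \<Rightarrow>\<^sub>L 'x::real_normed_vector) \<Rightarrow> bool" where
  "finite_rank R \<longleftrightarrow> (\<exists>m e x. finite_rank_rep R m e x)"

definition gaussian_sum_norm :: "nat \<Rightarrow> (nat \<Rightarrow> 'x::real_normed_vector) \<Rightarrow> real" where
  "gaussian_sum_norm m x =
     sqrt (\<integral>\<gamma>. (norm (\<Sum>k<m. \<gamma> k *\<^sub>R x k))\<^sup>2
       \<partial>(Pi\<^sub>M {..<m} (\<lambda>_. density lborel (\<lambda>y. ennreal (std_normal_density y)))))"

text \<open>By rotation invariance of the Gaussian measure the value is the same for all representations.\<close>

definition gamma_norm_fin :: "('e::real_inner \<Rightarrow>\<^sub>L 'x::real_normed_vector) \<Rightarrow> real" where
  "gamma_norm_fin R = (THE c. \<exists>m e x. finite_rank_rep R m e x \<and> c = gaussian_sum_norm m x)"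

text \<open>
  The norm above dominates the operator norm, so a Cauchy sequence of finite rank operators for it
  converges in operator norm; the completion is thereby realized inside the bounded operators.
\<close>

definition gamma_approx ::
  "(nat \<Rightarrow> 'e::real_inner \<Rightarrow>\<^sub>L 'x::real_normed_vector) \<Rightarrow> ('e \<Rightarrow>\<^sub>L 'x) \<Rightarrow> bool" where
  "gamma_approx S R \<longleftrightarrow> (\<forall>k. finite_rank (S k)) \<and>
     (\<forall>\<epsilon>>0. \<exists>N. \<forall>i\<ge>N. \<forall>j\<ge>N. gamma_norm_fin (S i - S j) < \<epsilon>) \<and> S \<longlonglongrightarrow> R"

definition gamma_radonifying :: "('e::real_inner \<Rightarrow>\<^sub>L 'x::real_normed_vector) \<Rightarrow> bool" where
  "gamma_radonifying R \<longleftrightarrow> (\<exists>S. gamma_approx S R)"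

definition gamma_norm :: "('e::real_inner \<Rightarrow>\<^sub>L 'x::real_normed_vector) \<Rightarrow> real" where
  "gamma_norm R = (THE c. \<exists>S. gamma_approx S R \<and> (\<lambda>k. gamma_norm_fin (S k)) \<longlonglongrightarrow> c)"

definition bidual_embedding :: "'x::real_normed_vector \<Rightarrow> ('x \<Rightarrow>\<^sub>L real) \<Rightarrow>\<^sub>L real" where
  "bidual_embedding x = Blinfun (\<lambda>\<phi>. blinfun_apply \<phi> x)"

lemma bidual_embedding_apply [simp]: "blinfun_apply (bidual_embedding x) \<phi> = blinfun_apply \<phi> x"
  unfolding bidual_embedding_def
  by (simp add: bounded_linear_Blinfun_apply blinfun.bounded_linear_left)

text \<open>The adjoint, with the Hilbert space identified with its dual.\<close>

definition banach_adjoint ::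
  "('y::real_normed_vector \<Rightarrow>\<^sub>L 'e::real_inner) \<Rightarrow> 'e \<Rightarrow> ('y \<Rightarrow>\<^sub>L real)" where
  "banach_adjoint B h = blinfun_inner_left h o\<^sub>L B"

lemma banach_adjoint_apply [simp]: "blinfun_apply (banach_adjoint B h) y = inner (B y) h"
  by (simp add: banach_adjoint_def)

text \<open>\<open>R\<close> is the adjoint of \<open>B\<close>, which takes values in \<open>X \<subseteq> X\<^sup>*\<^sup>*\<close>.\<close>

definition adjoint_in_X ::
  "(('x::real_normed_vector \<Rightarrow>\<^sub>L real) \<Rightarrow>\<^sub>L 'e::real_inner) \<Rightarrow> ('e \<Rightarrow>\<^sub>L 'x) \<Rightarrow> bool" where
  "adjoint_in_X B R \<longleftrightarrow> (\<forall>h. banach_adjoint B h = bidual_embedding (R h))"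

end

theory Submission
  imports Defs "HOL-Computational_Algebra.Polynomial"
begin

text \<open>
  For a finite rank operator \<open>A = \<Sum>\<^sub>k \<langle>\<cdot>, e\<^sub>k\<rangle> x\<^sub>k\<close> with orthonormal \<open>e\<^sub>k\<close>, the integral is the \<open>X\<close>-valued sum
  \<open>\<Sum>\<^sub>k I(e\<^sub>k) x\<^sub>k\<close>, while the \<open>\<gamma>\<close>-norm of \<open>A\<close> is the \<open>L\<^sup>2\<close>-norm of \<open>\<Sum>\<^sub>k \<gamma>\<^sub>k x\<^sub>k\<close>.  Since \<open>I\<close> is an isometry
  into the chaos of order \<open>n\<close>, goodness of \<open>X\<close> compares the two sums, as the Gaussian family can be taken
  as \<open>W(v\<^sub>k)\<close> with orthonormal \<open>v\<^sub>k\<close> (\<open>chaos_sum_gaussian_comparison\<close>).  This requires \<open>n \<ge> 1\<close> and arbitrarily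
  long orthonormal families in \<open>V\<close>.  Otherwise the chaos of order \<open>n\<close> consists of polynomials of bounded degree in
  finitely many variables, orthonormal families in the domain of \<open>I\<close> have bounded length, and both sums are
  comparable with \<open>\<Sum>\<^sub>k \<parallel>x\<^sub>k\<parallel>\<close>.

  The second ingredient is that on a finite chaos all notions of size agree, in every Banach space:
  a bound in probability yields bounds of all moments, with constants that depend on \<open>n\<close> and the order of the moment alone.  The proof
  is an argument in the manner of Fernique.  Let \<open>F\<close> be a polynomial of degree at most \<open>n\<close> in Gaussian variables, and rotate
  the process in the plane of two independent copies by the angle \<open>\<theta>\<close>.  Then \<open>F\<close> at the angles \<open>\<theta>\<close> and \<open>\<theta> + \<pi>/2\<close>
  gives two independent copies of \<open>F\<close>, and \<open>F\<close> is a trigonometric polynomial of degree at most \<open>n\<close> in \<open>\<theta>\<close>.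
  If one member of each of \<open>2n+1\<close> such pairs has norm at most \<open>c\<close>, interpolation
  bounds the norm of \<open>F\<close> by \<open>C c\<close>.  Hence \<open>P(\<parallel>F\<parallel> > C c) \<le> (2n+1) P(\<parallel>F\<parallel> > c)\<^sup>2\<close>, an inequality which survives limits in
  probability (\<open>self_improving_limit\<close>) and gives the moments by iteration (\<open>self_improving_moment\<close>).

  Both directions follow.  If finite rank operators are Cauchy in the \<open>\<gamma>\<close>-norm, their integrals
  converge, and testing with functionals identifies the limit as the integral of \<open>G\<close> (\<open>gamma_approx_integral\<close>).
  Conversely let \<open>\<xi>\<close> be the integral of \<open>G\<close>.  The law of \<open>\<xi>\<close> is tight, so the approximation property gives finite rank
  operators \<open>T\<^sub>k\<close> on \<open>X\<close> such that \<open>T\<^sub>k \<xi>\<close> tends to \<open>\<xi>\<close> in probability.  Now \<open>T\<^sub>k \<xi>\<close> is the integral of a finite rank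
  operator.  The differences of these integrals live in the chaos, so convergence in probability makes the operators Cauchy
  in the \<open>\<gamma>\<close>-norm (\<open>represents_imp_radonifying\<close>).

  The approximation property also supplies the functionals which separate random variables
  (\<open>functionals_separate\<close>): the finite rank operators are built from coordinate functionals.
\<close>


section \<open>Square integrable random variables\<close>

lemma L2_D: "f \<in> L2 M \<Longrightarrow> f \<in> borel_measurable M" "f \<in> L2 M \<Longrightarrow> integrable M (\<lambda>\<omega>. (f \<omega>)\<^sup>2)"
  by (auto simp: L2_def)

lemma L2_mult_integrable:
  assumes f: "f \<in> L2 M" and g: "g \<in> L2 M"
  shows "integrable M (\<lambda>\<omega>. f \<omega> * g \<omega>)"
proof (rule Bochner_Integration.integrable_bound)
  show "integrable M (\<lambda>\<omega>. (f \<omega>)\<^sup>2 + (g \<omega>)\<^sup>2)"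
    using f g by (auto dest: L2_D)
  show "(\<lambda>\<omega>. f \<omega> * g \<omega>) \<in> borel_measurable M"
    using L2_D(1)[OF f] L2_D(1)[OF g] by measurable
  have "norm (a * b) \<le> norm (a\<^sup>2 + b\<^sup>2)" for a b :: real
  proof -
    have "0 \<le> (\<bar>a\<bar> - \<bar>b\<bar>)\<^sup>2" by simp
    then have "2 * (\<bar>a\<bar> * \<bar>b\<bar>) \<le> a\<^sup>2 + b\<^sup>2" by (simp add: power2_diff)
    moreover have "0 \<le> \<bar>a\<bar> * \<bar>b\<bar>" by simp
    ultimately have "\<bar>a\<bar> * \<bar>b\<bar> \<le> a\<^sup>2 + b\<^sup>2" by linarith
    then show ?thesis by (simp add: abs_mult)
  qed
  then show "AE \<omega> in M. norm (f \<omega> * g \<omega>) \<le> norm ((f \<omega>)\<^sup>2 + (g \<omega>)\<^sup>2)" by simp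
qed

lemma L2_add: "f \<in> L2 M \<Longrightarrow> g \<in> L2 M \<Longrightarrow> (\<lambda>\<omega>. f \<omega> + g \<omega>) \<in> L2 M"
  using L2_mult_integrable[of f M g] unfolding L2_def
  by (auto simp: power2_sum mult.assoc)

lemma L2_cmult: "f \<in> L2 M \<Longrightarrow> (\<lambda>\<omega>. c * f \<omega>) \<in> L2 M"
  unfolding L2_def by (auto simp: power_mult_distrib)

lemma L2_zero: "(\<lambda>\<omega>. 0) \<in> L2 M"
  unfolding L2_def by auto

lemma L2_diff: "f \<in> L2 M \<Longrightarrow> g \<in> L2 M \<Longrightarrow> (\<lambda>\<omega>. f \<omega> - g \<omega>) \<in> L2 M"
  using L2_add[OF _ L2_cmult[of g M "-1"], of f] by simp

lemma L2_sum: "(\<And>i. i \<in> A \<Longrightarrow> f i \<in> L2 M) \<Longrightarrow> (\<lambda>\<omega>. \<Sum>i\<in>A. f i \<omega>) \<in> L2 M"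
  by (induction A rule: infinite_finite_induct) (auto intro: L2_zero L2_add)

lemma L2_norm_nonneg: "0 \<le> L2_norm M f"
  by (simp add: L2_norm_def)

lemma L2_norm_power2: "(L2_norm M f)\<^sup>2 = (\<integral>\<omega>. (f \<omega>)\<^sup>2 \<partial>M)"
  by (simp add: L2_norm_def)

lemma L2_norm_cmult: "L2_norm M (\<lambda>\<omega>. c * f \<omega>) = \<bar>c\<bar> * L2_norm M f"
  by (simp add: L2_norm_def power_mult_distrib real_sqrt_mult)

lemma L2_norm_mono:
  assumes g: "g \<in> L2 M" and [measurable]: "f \<in> borel_measurable M"
    and le: "AE \<omega> in M. \<bar>f \<omega>\<bar> \<le> \<bar>g \<omega>\<bar>"
  shows "f \<in> L2 M" "L2_norm M f \<le> L2_norm M g"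
proof -
  have sq: "AE \<omega> in M. (f \<omega>)\<^sup>2 \<le> (g \<omega>)\<^sup>2"
    using le by eventually_elim (simp add: abs_le_square_iff)
  have i: "integrable M (\<lambda>\<omega>. (f \<omega>)\<^sup>2)"
    by (rule Bochner_Integration.integrable_bound[OF L2_D(2)[OF g]]) (use sq in auto)
  then show "f \<in> L2 M" by (simp add: L2_def)
  show "L2_norm M f \<le> L2_norm M g"
    unfolding L2_norm_def by (intro real_sqrt_le_mono integral_mono_AE i L2_D(2)[OF g] sq)
qed

lemma L2_norm_cong_AE:
  assumes "f \<in> borel_measurable M" "g \<in> borel_measurable M" "AE \<omega> in M. \<bar>f \<omega>\<bar> = \<bar>g \<omega>\<bar>"
  shows "L2_norm M f = L2_norm M g"
  unfolding L2_norm_def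
  by (intro arg_cong[where f=sqrt] integral_cong_AE)
     (use assms in \<open>auto elim!: eventually_mono simp: power2_eq_iff abs_eq_iff\<close>)

lemma L2_cong_AE:
  assumes "f \<in> L2 M" "g \<in> borel_measurable M" "AE \<omega> in M. g \<omega> = f \<omega>"
  shows "g \<in> L2 M"
  by (rule L2_norm_mono(1)[OF assms(1,2)]) (use assms(3) in auto)

text \<open>The discriminant argument, with both coefficients kept so that the case \<open>\<integral>g\<^sup>2 = 0\<close>
  is covered.\<close>

lemma L2_cauchy_schwarz:
  assumes f: "f \<in> L2 M" and g: "g \<in> L2 M"
  shows "(\<integral>\<omega>. f \<omega> * g \<omega> \<partial>M) \<le> L2_norm M f * L2_norm M g"
proof -
  define a b c where "a = (\<integral>\<omega>. (f \<omega>)\<^sup>2 \<partial>M)" and "b = (\<integral>\<omega>. (g \<omega>)\<^sup>2 \<partial>M)"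
    and "c = (\<integral>\<omega>. f \<omega> * g \<omega> \<partial>M)"
  have a0: "0 \<le> a" and b0: "0 \<le> b" by (auto simp: a_def b_def)
  have quad: "0 \<le> a * s\<^sup>2 - 2 * s * t * c + b * t\<^sup>2" for s t
  proof -
    have "0 \<le> (\<integral>\<omega>. (s * f \<omega> - t * g \<omega>)\<^sup>2 \<partial>M)" by simp
    also have "(\<lambda>\<omega>. (s * f \<omega> - t * g \<omega>)\<^sup>2) = (\<lambda>\<omega>. s\<^sup>2 * (f \<omega>)\<^sup>2 - 2 * s * t * (f \<omega> * g \<omega>) + t\<^sup>2 * (g \<omega>)\<^sup>2)"
      by (auto simp: power2_eq_square algebra_simps)
    also have "(\<integral>\<omega>. s\<^sup>2 * (f \<omega>)\<^sup>2 - 2 * s * t * (f \<omega> * g \<omega>) + t\<^sup>2 * (g \<omega>)\<^sup>2 \<partial>M)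
        = s\<^sup>2 * a - 2 * s * t * c + t\<^sup>2 * b"
      using L2_D(2)[OF f] L2_D(2)[OF g] L2_mult_integrable[OF f g]
      by (simp add: a_def b_def c_def)
    finally show ?thesis by (simp add: algebra_simps)
  qed
  have "c\<^sup>2 \<le> a * b"
  proof (cases "b = 0")
    case True
    have "c = 0"
    proof (rule ccontr)
      assume "c \<noteq> 0"
      have "0 \<le> a - 2 * ((a + 1) / (2 * c)) * c"
        using quad[of 1 "(a + 1) / (2 * c)"] True by simp
      then show False using \<open>c \<noteq> 0\<close> by simp
    qed
    then show ?thesis using True by simp
  next
    case False
    then have "b > 0" using b0 by simp
    have "0 \<le> b * (a * b - c\<^sup>2)"
      using quad[of b c] by (simp add: power2_eq_square algebra_simps)
    then show ?thesis using \<open>b > 0\<close> by (simp add: zero_le_mult_iff)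
  qed
  then have "\<bar>c\<bar> \<le> sqrt (a * b)"
    by (metis real_sqrt_abs real_sqrt_le_iff)
  then show ?thesis
    unfolding L2_norm_def by (simp add: a_def b_def c_def real_sqrt_mult)
qed

lemma L2_norm_add_le:
  assumes f: "f \<in> L2 M" and g: "g \<in> L2 M"
  shows "L2_norm M (\<lambda>\<omega>. f \<omega> + g \<omega>) \<le> L2_norm M f + L2_norm M g"
proof (rule power2_le_imp_le)
  have "(L2_norm M (\<lambda>\<omega>. f \<omega> + g \<omega>))\<^sup>2 = (\<integral>\<omega>. (f \<omega>)\<^sup>2 + 2 * (f \<omega> * g \<omega>) + (g \<omega>)\<^sup>2 \<partial>M)"
    unfolding L2_norm_power2 by (intro arg_cong[where f="integral\<^sup>L M"] ext) (simp add: power2_eq_square algebra_simps)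
  also have "\<dots> = (L2_norm M f)\<^sup>2 + 2 * (\<integral>\<omega>. f \<omega> * g \<omega> \<partial>M) + (L2_norm M g)\<^sup>2"
    using L2_D(2)[OF f] L2_D(2)[OF g] L2_mult_integrable[OF f g]
    by (simp add: L2_norm_power2)
  also have "\<dots> \<le> (L2_norm M f + L2_norm M g)\<^sup>2"
    using L2_cauchy_schwarz[OF f g] by (simp add: power2_sum)
  finally show "(L2_norm M (\<lambda>\<omega>. f \<omega> + g \<omega>))\<^sup>2 \<le> (L2_norm M f + L2_norm M g)\<^sup>2" .
qed (simp add: L2_norm_nonneg)

lemma L2_norm_sum_le:
  assumes "\<And>i. i \<in> A \<Longrightarrow> f i \<in> L2 M"
  shows "L2_norm M (\<lambda>\<omega>. \<Sum>i\<in>A. f i \<omega>) \<le> (\<Sum>i\<in>A. L2_norm M (f i))"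
  using assms
proof (induction A rule: infinite_finite_induct)
  case (insert x F)
  have "L2_norm M (\<lambda>\<omega>. f x \<omega> + (\<Sum>i\<in>F. f i \<omega>)) \<le> L2_norm M (f x) + L2_norm M (\<lambda>\<omega>. \<Sum>i\<in>F. f i \<omega>)"
    using insert by (intro L2_norm_add_le L2_sum) auto
  also have "\<dots> \<le> L2_norm M (f x) + (\<Sum>i\<in>F. L2_norm M (f i))"
    using insert by auto
  finally show ?case using insert by simp
qed (auto simp: L2_norm_def)

lemma (in prob_space) L2_chebyshev:
  assumes f: "f \<in> L2 M" and c: "0 < c"
  shows "prob {\<omega>\<in>space M. c < \<bar>f \<omega>\<bar>} \<le> (L2_norm M f / c)\<^sup>2"
proof -
  have [measurable]: "f \<in> borel_measurable M" using f by (rule L2_D)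
  have "prob {\<omega>\<in>space M. c < \<bar>f \<omega>\<bar>} \<le> prob {\<omega>\<in>space M. c\<^sup>2 \<le> (f \<omega>)\<^sup>2}"
    using c by (intro finite_measure_mono) (auto simp: abs_le_square_iff[symmetric])
  also have "\<dots> \<le> (\<integral>\<omega>. (f \<omega>)\<^sup>2 \<partial>M) / c\<^sup>2"
    using c by (intro integral_Markov_inequality_measure[where A="space M"] L2_D(2)[OF f]) auto
  also have "\<dots> = (L2_norm M f / c)\<^sup>2"
    by (simp add: power_divide L2_norm_power2)
  finally show ?thesis .
qed

section \<open>Strong measurability and convergence in probability\<close>

lemma strongly_measurable_compose2:
  assumes "strongly_measurable M f" "strongly_measurable M g"
    and h: "\<And>s t a b. s \<longlonglongrightarrow> a \<Longrightarrow> t \<longlonglongrightarrow> b \<Longrightarrow> (\<lambda>i. h (s i) (t i)) \<longlonglongrightarrow> h a b"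
  shows "strongly_measurable M (\<lambda>\<omega>. h (f \<omega>) (g \<omega>))"
proof -
  obtain s t where "\<forall>i. simple_function M (s i)" "\<forall>\<omega>\<in>space M. (\<lambda>i. s i \<omega>) \<longlonglongrightarrow> f \<omega>"
    "\<forall>i. simple_function M (t i)" "\<forall>\<omega>\<in>space M. (\<lambda>i. t i \<omega>) \<longlonglongrightarrow> g \<omega>"
    using assms by (auto simp: strongly_measurable_def)
  then show ?thesis
    unfolding strongly_measurable_def
    by (intro exI[of _ "\<lambda>i \<omega>. h (s i \<omega>) (t i \<omega>)"]) (auto intro: simple_function_compose2 h)
qed

lemma strongly_measurable_const: "strongly_measurable M (\<lambda>\<omega>. c)"
  unfolding strongly_measurable_def by (intro exI[of _ "\<lambda>i \<omega>. c"]) auto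

lemma strongly_measurable_add:
  fixes f g :: "'o \<Rightarrow> 'x::real_normed_vector"
  shows "strongly_measurable M f \<Longrightarrow> strongly_measurable M g \<Longrightarrow> strongly_measurable M (\<lambda>\<omega>. f \<omega> + g \<omega>)"
  by (erule strongly_measurable_compose2[where h="(+)"]) (auto intro: tendsto_add)

lemma strongly_measurable_diff:
  fixes f g :: "'o \<Rightarrow> 'x::real_normed_vector"
  shows "strongly_measurable M f \<Longrightarrow> strongly_measurable M g \<Longrightarrow> strongly_measurable M (\<lambda>\<omega>. f \<omega> - g \<omega>)"
  by (erule strongly_measurable_compose2[where h="(-)"]) (auto intro: tendsto_diff)

lemma strongly_measurable_real:
  fixes f :: "'o \<Rightarrow> real"
  shows "f \<in> borel_measurable M \<Longrightarrow> strongly_measurable M f"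
  unfolding strongly_measurable_def
  using borel_measurable_implies_sequence_metric[of f M 0] by blast

lemma strongly_measurable_scaleR:
  fixes x :: "'x::real_normed_vector"
  shows "f \<in> borel_measurable M \<Longrightarrow> strongly_measurable M (\<lambda>\<omega>. f \<omega> *\<^sub>R x)"
  by (rule strongly_measurable_compose2[where h="scaleR", OF strongly_measurable_real strongly_measurable_const])
     (auto intro: tendsto_scaleR)

lemma strongly_measurable_sum:
  fixes f :: "'i \<Rightarrow> 'o \<Rightarrow> 'x::real_normed_vector"
  assumes "\<And>i. i \<in> A \<Longrightarrow> strongly_measurable M (f i)"
  shows "strongly_measurable M (\<lambda>\<omega>. \<Sum>i\<in>A. f i \<omega>)"
  using assms by (induction A rule: infinite_finite_induct)
    (auto intro: strongly_measurable_const strongly_measurable_add)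

lemma strongly_measurable_blinfun:
  fixes A :: "'x::real_normed_vector \<Rightarrow>\<^sub>L 'y::real_normed_vector"
  shows "strongly_measurable M f \<Longrightarrow> strongly_measurable M (\<lambda>\<omega>. A (f \<omega>))"
  by (erule strongly_measurable_compose2[where h="\<lambda>a b. A a", OF _ strongly_measurable_const[of M "0::real"]])
     (auto intro: tendsto_intros)

lemma strongly_measurable_borel:
  fixes f :: "'o \<Rightarrow> real"
  assumes "strongly_measurable M f"
  shows "f \<in> borel_measurable M"
proof -
  obtain s where s: "\<And>i. simple_function M (s i)" "\<forall>\<omega>\<in>space M. (\<lambda>i. s i \<omega>) \<longlonglongrightarrow> f \<omega>"
    using assms by (auto simp: strongly_measurable_def)
  show ?thesis
    by (rule borel_measurable_LIMSEQ_metric[where f=s]) (use s borel_measurable_simple_function in auto)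
qed

lemma strongly_measurable_norm:
  fixes f :: "'o \<Rightarrow> 'x::real_normed_vector"
  assumes "strongly_measurable M f"
  shows "(\<lambda>\<omega>. norm (f \<omega>)) \<in> borel_measurable M"
  by (rule strongly_measurable_borel, rule strongly_measurable_compose2[where h="\<lambda>a b. norm a",
        OF assms strongly_measurable_const[of M "0::real"]]) (auto intro: tendsto_intros)

definition (in prob_space) tail :: "('a \<Rightarrow> 'x::real_normed_vector) \<Rightarrow> real \<Rightarrow> real" where
  "tail F c = prob {\<omega>\<in>space M. c < norm (F \<omega>)}"

definition (in prob_space) conv_prob :: "(nat \<Rightarrow> 'a \<Rightarrow> 'x::real_normed_vector) \<Rightarrow> ('a \<Rightarrow> 'x) \<Rightarrow> bool" where
  "conv_prob F f \<longleftrightarrow> (\<forall>c>0. (\<lambda>k. tail (\<lambda>\<omega>. F k \<omega> - f \<omega>) c) \<longlonglongrightarrow> 0)"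

context prob_space
begin

lemma tail_nonneg: "0 \<le> tail F c" and tail_le_1: "tail F c \<le> 1"
  by (auto simp: tail_def)

lemma tail_sets: "strongly_measurable M F \<Longrightarrow> {\<omega>\<in>space M. c < norm (F \<omega>)} \<in> events"
  using strongly_measurable_norm[of M F] by measurable

lemma tail_mono: 
  assumes "strongly_measurable M F" "c \<le> d"
  shows "tail F d \<le> tail F c"
  unfolding tail_def using assms by (intro finite_measure_mono tail_sets) auto

lemma tail_AE_le:
  assumes "strongly_measurable M F" "strongly_measurable M G" "AE \<omega> in M. norm (F \<omega>) \<le> norm (G \<omega>)"
  shows "tail F c \<le> tail G c"
  unfolding tail_def
  by (intro finite_measure_mono_AE tail_sets assms) (use assms(3) in auto)

lemma tail_cong_AE:
  assumes "strongly_measurable M F" "strongly_measurable M G" "AE \<omega> in M. F \<omega> = G \<omega>"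
  shows "tail F c = tail G c"
  by (intro antisym tail_AE_le assms) (use assms(3) in auto)

lemma tail_add:
  assumes F: "strongly_measurable M F" and G: "strongly_measurable M G" 
    and H: "strongly_measurable M H"
    and le: "\<And>\<omega>. \<omega> \<in> space M \<Longrightarrow> norm (H \<omega>) \<le> norm (F \<omega>) + norm (G \<omega>)" and ab: "a + b \<le> c"
  shows "tail H c \<le> tail F a + tail G b"
proof -
  have "prob {\<omega>\<in>space M. c < norm (H \<omega>)} \<le> prob ({\<omega>\<in>space M. a < norm (F \<omega>)} \<union> {\<omega>\<in>space M. b < norm (G \<omega>)})"
    using ab by (intro finite_measure_mono sets.Un tail_sets F G) (force dest: le)
  also have "\<dots> \<le> prob {\<omega>\<in>space M. a < norm (F \<omega>)} + prob {\<omega>\<in>space M. b < norm (G \<omega>)}"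
    by (intro measure_Un_le tail_sets F G)
  finally show ?thesis by (simp add: tail_def)
qed

lemma tail_triangle:
  assumes F: "strongly_measurable M F" and G: "strongly_measurable M G" and ab: "a + b \<le> c"
  shows "tail F c \<le> tail G a + tail (\<lambda>\<omega>. F \<omega> - G \<omega>) b"
proof (rule tail_add[OF G strongly_measurable_diff[OF F G] F _ ab])
  fix \<omega> show "norm (F \<omega>) \<le> norm (G \<omega>) + norm (F \<omega> - G \<omega>)"
    by (metis add.commute diff_add_cancel norm_triangle_ineq)
qed

lemma tail_minus: "tail (\<lambda>\<omega>. F \<omega> - G \<omega>) c = tail (\<lambda>\<omega>. G \<omega> - F \<omega>) c"
  by (simp add: tail_def norm_minus_commute)

lemma tail_chebyshev:
  assumes "(\<lambda>\<omega>. norm (F \<omega>)) \<in> L2 M" "0 < c"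
  shows "tail F c \<le> (L2_norm M (\<lambda>\<omega>. norm (F \<omega>)) / c)\<^sup>2"
  using L2_chebyshev[OF assms] by (simp add: tail_def)

lemma tail_zero_imp_AE:
  assumes F: "strongly_measurable M F" and z: "\<And>c. 0 < c \<Longrightarrow> tail F c = 0"
  shows "AE \<omega> in M. F \<omega> = 0"
proof -
  have "AE \<omega> in M. \<not> (1 / real (Suc k) < norm (F \<omega>))" for k
  proof -
    have "{\<omega>\<in>space M. 1 / real (Suc k) < norm (F \<omega>)} \<in> null_sets M"
      using z[of "1 / real (Suc k)"] tail_sets[OF F, of "1 / real (Suc k)"]
      by (auto simp: tail_def null_sets_def emeasure_eq_measure)
    from AE_not_in[OF this] show ?thesis by (auto elim!: eventually_mono AE_mp)
  qed
  then have "AE \<omega> in M. \<forall>k. \<not> (1 / real (Suc k) < norm (F \<omega>))"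
    by (simp add: AE_all_countable)
  then show ?thesis
  proof eventually_elim
    case (elim \<omega>)
    show ?case
    proof (rule ccontr)
      assume "F \<omega> \<noteq> 0"
      then obtain k where "inverse (real (Suc k)) < norm (F \<omega>)"
        using reals_Archimedean[of "norm (F \<omega>)"] by auto
      then show False using elim by (auto simp: inverse_eq_divide)
    qed
  qed
qed

lemma conv_probD:
  assumes "conv_prob F f" "0 < c" "0 < d"
  shows "eventually (\<lambda>k. tail (\<lambda>\<omega>. F k \<omega> - f \<omega>) c < d) sequentially"
  using assms by (auto simp: conv_prob_def intro: order_tendstoD)

lemma conv_prob_unique:
  assumes F: "\<And>k. strongly_measurable M (F k)" and f: "strongly_measurable M f" and g: "strongly_measurable M g"
    and cf: "conv_prob F f" and cg: "conv_prob F g"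
  shows "AE \<omega> in M. f \<omega> = g \<omega>"
proof -
  have "tail (\<lambda>\<omega>. f \<omega> - g \<omega>) c = 0" if c: "0 < c" for c
  proof -
    have "(\<lambda>k. tail (\<lambda>\<omega>. F k \<omega> - f \<omega>) (c/2) + tail (\<lambda>\<omega>. F k \<omega> - g \<omega>) (c/2)) \<longlonglongrightarrow> 0 + 0"
      using cf cg c by (intro tendsto_add) (auto simp: conv_prob_def)
    moreover have "tail (\<lambda>\<omega>. f \<omega> - g \<omega>) c \<le> tail (\<lambda>\<omega>. F k \<omega> - f \<omega>) (c/2) + tail (\<lambda>\<omega>. F k \<omega> - g \<omega>) (c/2)" for k
      by (rule tail_add) (auto intro!: strongly_measurable_diff F f g simp: field_simps, metis norm_triangle_ineq3 dist_norm dist_commute dist_triangle2)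
    ultimately have "tail (\<lambda>\<omega>. f \<omega> - g \<omega>) c \<le> 0 + 0"
      by (intro LIMSEQ_le_const) auto
    then show ?thesis using tail_nonneg[of "\<lambda>\<omega>. f \<omega> - g \<omega>" c] by linarith
  qed
  from tail_zero_imp_AE[OF strongly_measurable_diff[OF f g] this] show ?thesis by auto
qed

lemma conv_prob_diff:
  assumes "\<And>k. strongly_measurable M (F k)" "\<And>k. strongly_measurable M (G k)" 
    "strongly_measurable M f" "strongly_measurable M g"
    and cf: "conv_prob F f" and cg: "conv_prob G g"
  shows "conv_prob (\<lambda>k \<omega>. F k \<omega> - G k \<omega>) (\<lambda>\<omega>. f \<omega> - g \<omega>)"
  unfolding conv_prob_def
proof safe
  fix c :: real assume c: "0 < c"
  show "(\<lambda>k. tail (\<lambda>\<omega>. F k \<omega> - G k \<omega> - (f \<omega> - g \<omega>)) c) \<longlonglongrightarrow> 0"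
  proof (rule tendsto_sandwich[OF _ _ tendsto_const])
    show "(\<lambda>k. tail (\<lambda>\<omega>. F k \<omega> - f \<omega>) (c/2) + tail (\<lambda>\<omega>. G k \<omega> - g \<omega>) (c/2)) \<longlonglongrightarrow> 0"
      using tendsto_add[of "\<lambda>k. tail (\<lambda>\<omega>. F k \<omega> - f \<omega>) (c/2)" 0 _ "\<lambda>k. tail (\<lambda>\<omega>. G k \<omega> - g \<omega>) (c/2)" 0] cf cg c
      by (auto simp: conv_prob_def)
    show "\<forall>\<^sub>F k in sequentially. tail (\<lambda>\<omega>. F k \<omega> - G k \<omega> - (f \<omega> - g \<omega>)) c
        \<le> tail (\<lambda>\<omega>. F k \<omega> - f \<omega>) (c/2) + tail (\<lambda>\<omega>. G k \<omega> - g \<omega>) (c/2)"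
    proof (intro always_eventually allI tail_add)
      fix k \<omega>
      have "norm ((F k \<omega> - f \<omega>) - (G k \<omega> - g \<omega>)) \<le> norm (F k \<omega> - f \<omega>) + norm (G k \<omega> - g \<omega>)"
        by (rule norm_triangle_ineq4)
      then show "norm (F k \<omega> - G k \<omega> - (f \<omega> - g \<omega>)) \<le> norm (F k \<omega> - f \<omega>) + norm (G k \<omega> - g \<omega>)"
        by (simp add: algebra_simps)
    qed (auto intro!: strongly_measurable_diff assms)
  qed (auto intro!: always_eventually tail_nonneg)
qed

lemma conv_prob_blinfun:
  fixes A :: "'x::real_normed_vector \<Rightarrow>\<^sub>L 'y::real_normed_vector"
  assumes F: "\<And>k. strongly_measurable M (F k)" and f: "strongly_measurable M f"
    and cf: "conv_prob F f"
  shows "conv_prob (\<lambda>k \<omega>. A (F k \<omega>)) (\<lambda>\<omega>. A (f \<omega>))"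
  unfolding conv_prob_def
proof safe
  fix c :: real assume c: "0 < c"
  define d where "d = c / (norm A + 1)"
  have d: "0 < d" unfolding d_def using c by (simp add: add_nonneg_pos)
  have "tail (\<lambda>\<omega>. A (F k \<omega>) - A (f \<omega>)) c \<le> tail (\<lambda>\<omega>. F k \<omega> - f \<omega>) d" for k
    unfolding tail_def
  proof (intro finite_measure_mono tail_sets strongly_measurable_diff F f subsetI)
    fix \<omega> assume "\<omega> \<in> {\<omega> \<in> space M. c < norm (A (F k \<omega>) - A (f \<omega>))}"
    then have sp: "\<omega> \<in> space M" and "c < norm (A (F k \<omega> - f \<omega>))" by (auto simp: blinfun.diff_right)
    note this(2)
    also have "norm (A (F k \<omega> - f \<omega>)) \<le> norm A * norm (F k \<omega> - f \<omega>)" by (rule norm_blinfun)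
    also have "\<dots> \<le> (norm A + 1) * norm (F k \<omega> - f \<omega>)" by (intro mult_right_mono) auto
    finally have "d < norm (F k \<omega> - f \<omega>)"
      unfolding d_def by (subst pos_divide_less_eq) (auto simp: mult.commute add_nonneg_pos)
    with sp show "\<omega> \<in> {\<omega> \<in> space M. d < norm (F k \<omega> - f \<omega>)}" by auto
  qed
  note le = this
  show "(\<lambda>k. tail (\<lambda>\<omega>. A (F k \<omega>) - A (f \<omega>)) c) \<longlonglongrightarrow> 0"
  proof (rule tendsto_sandwich[OF _ _ tendsto_const])
    show "(\<lambda>k. tail (\<lambda>\<omega>. F k \<omega> - f \<omega>) d) \<longlonglongrightarrow> 0" using cf d by (simp add: conv_prob_def)
    show "\<forall>\<^sub>F k in sequentially. tail (\<lambda>\<omega>. A (F k \<omega>) - A (f \<omega>)) c \<le> tail (\<lambda>\<omega>. F k \<omega> - f \<omega>) d"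
      using le by (intro always_eventually allI)
  qed (intro always_eventually allI tail_nonneg)
qed

lemma conv_prob_L2:
  assumes "\<And>k. (\<lambda>\<omega>. norm (F k \<omega> - f \<omega>)) \<in> L2 M"
    and "(\<lambda>k. L2_norm M (\<lambda>\<omega>. norm (F k \<omega> - f \<omega>))) \<longlonglongrightarrow> 0"
  shows "conv_prob F f"
  unfolding conv_prob_def
proof safe
  fix c :: real assume c: "0 < c"
  show "(\<lambda>k. tail (\<lambda>\<omega>. F k \<omega> - f \<omega>) c) \<longlonglongrightarrow> 0"
  proof (rule tendsto_sandwich[OF _ _ tendsto_const])
    have "(\<lambda>k. (L2_norm M (\<lambda>\<omega>. norm (F k \<omega> - f \<omega>)) / c)\<^sup>2) \<longlonglongrightarrow> (0 / c)\<^sup>2"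
      by (intro tendsto_intros assms) (use c in auto)
    then show "(\<lambda>k. (L2_norm M (\<lambda>\<omega>. norm (F k \<omega> - f \<omega>)) / c)\<^sup>2) \<longlonglongrightarrow> 0" by simp
    show "\<forall>\<^sub>F k in sequentially. tail (\<lambda>\<omega>. F k \<omega> - f \<omega>) c \<le> (L2_norm M (\<lambda>\<omega>. norm (F k \<omega> - f \<omega>)) / c)\<^sup>2"
      by (intro always_eventually allI tail_chebyshev assms c)
  qed (auto intro!: always_eventually tail_nonneg)
qed

text \<open>Pointwise convergence of the simple functions on the whole space gives convergence in probability:
  the sets on which some later approximant is still \<open>c\<close> away decrease to the empty set.\<close>

lemma simple_function_approx:
  fixes f :: "'a \<Rightarrow> 'x::real_normed_vector"
  assumes f: "strongly_measurable M f" and cd: "0 < c" "0 < d"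
  obtains s where "simple_function M s" "tail (\<lambda>\<omega>. f \<omega> - s \<omega>) c < d"
proof -
  obtain s where s: "\<And>i. simple_function M (s i)" "\<And>\<omega>. \<omega>\<in>space M \<Longrightarrow> (\<lambda>i. s i \<omega>) \<longlonglongrightarrow> f \<omega>"
    using f by (auto simp: strongly_measurable_def)
  have sm: "strongly_measurable M (s i)" for i
    unfolding strongly_measurable_def using s(1) by (intro exI[of _ "\<lambda>_. s i"]) auto
  define B where "B i = {\<omega>\<in>space M. c < norm (f \<omega> - s i \<omega>)}" for i
  have B: "B i \<in> events" for i
    unfolding B_def by (intro tail_sets strongly_measurable_diff f sm)
  define A where "A n = (\<Union>i\<in>{n..}. B i)" for n
  have A: "A n \<in> events" for n unfolding A_def by (intro sets.countable_UN') (auto simp: B)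
  have "(\<lambda>n. prob (A n)) \<longlonglongrightarrow> prob (\<Inter>n. A n)"
    by (rule finite_Lim_measure_decseq) (use A in \<open>auto simp: decseq_def A_def intro: order_trans\<close>)
  also have "(\<Inter>n. A n) = {}"
  proof safe
    fix \<omega> assume *: "\<omega> \<in> (\<Inter>n. A n)"
    then have sp: "\<omega> \<in> space M" by (auto simp: A_def B_def)
    from LIMSEQ_D[OF s(2)[OF sp] cd(1)] obtain n where n: "\<And>i. i \<ge> n \<Longrightarrow> norm (s i \<omega> - f \<omega>) < c" by auto
    from * have "\<omega> \<in> A n" by auto
    then obtain i where "i \<ge> n" "c < norm (f \<omega> - s i \<omega>)" by (auto simp: A_def B_def)
    with n[of i] show "\<omega> \<in> {}" by (simp add: norm_minus_commute)
  qed
  finally have "(\<lambda>n. prob (A n)) \<longlonglongrightarrow> 0" by simp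
  from order_tendstoD(2)[OF this cd(2)] obtain n where n: "prob (A n) < d"
    by (auto simp: eventually_sequentially)
  have "tail (\<lambda>\<omega>. f \<omega> - s n \<omega>) c \<le> prob (A n)"
    unfolding tail_def using A by (intro finite_measure_mono) (auto simp: A_def B_def)
  with n that[OF s(1)[of n]] show ?thesis by simp
qed

lemma simple_strongly_measurable: "simple_function M s \<Longrightarrow> strongly_measurable M s"
  unfolding strongly_measurable_def by (intro exI[of _ "\<lambda>_. s"]) auto

text \<open>A rapidly convergent subsequence can be replaced by simple functions. Their increments are summable
  almost surely by Borel--Cantelli, hence they converge on an event \<open>G\<close> of full measure; off \<open>G\<close>
  they are set to zero, since a strongly measurable function must be a limit at every point.\<close>

lemma conv_prob_complete:
  fixes F :: "nat \<Rightarrow> 'a \<Rightarrow> 'x::banach"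
  assumes F: "\<And>k. strongly_measurable M (F k)"
    and cauchy: "\<And>c d. 0 < c \<Longrightarrow> 0 < d \<Longrightarrow> \<exists>N. \<forall>i\<ge>N. \<forall>j\<ge>N. tail (\<lambda>\<omega>. F i \<omega> - F j \<omega>) c < d"
  obtains f where "strongly_measurable M f" "conv_prob F f"
proof -
  have "\<exists>N. \<forall>k. (\<forall>i\<ge>N k. \<forall>j\<ge>N k. tail (\<lambda>\<omega>. F i \<omega> - F j \<omega>) ((1/2)^k) < (1/2)^k) \<and> N k < N (Suc k)"
  proof (rule dependent_nat_choice)
    show "\<exists>x. \<forall>i\<ge>x. \<forall>j\<ge>x. tail (\<lambda>\<omega>. F i \<omega> - F j \<omega>) ((1 / 2) ^ 0) < (1 / 2) ^ 0"
      by (rule cauchy) auto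
    fix x k
    obtain N where N: "\<forall>i\<ge>N. \<forall>j\<ge>N. tail (\<lambda>\<omega>. F i \<omega> - F j \<omega>) ((1 / 2) ^ Suc k) < (1 / 2) ^ Suc k"
      using cauchy[of "(1/2)^Suc k" "(1/2)^Suc k"] by auto
    then show "\<exists>y. (\<forall>i\<ge>y. \<forall>j\<ge>y. tail (\<lambda>\<omega>. F i \<omega> - F j \<omega>) ((1 / 2) ^ Suc k) < (1 / 2) ^ Suc k) \<and> x < y"
      by (intro exI[of _ "max N (Suc x)"]) auto
  qed
  then obtain N where N: "\<And>k i j. i \<ge> N k \<Longrightarrow> j \<ge> N k \<Longrightarrow> tail (\<lambda>\<omega>. F i \<omega> - F j \<omega>) ((1/2)^k) < (1/2)^k"
    "\<And>k. N k < N (Suc k)" by blast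
  have "\<exists>s. simple_function M s \<and> tail (\<lambda>\<omega>. F (N k) \<omega> - s \<omega>) ((1/2)^k) < (1/2)^k" for k
    using simple_function_approx[OF F[of "N k"], of "(1/2)^k" "(1/2)^k"] by (metis zero_less_power half_gt_zero_iff zero_less_one)
  then obtain s where s: "\<And>k. simple_function M (s k)" "\<And>k. tail (\<lambda>\<omega>. F (N k) \<omega> - s k \<omega>) ((1/2)^k) < (1/2)^k"
    by metis
  have sm: "strongly_measurable M (s k)" for k by (rule simple_strongly_measurable[OF s(1)])
  have step: "tail (\<lambda>\<omega>. s (Suc k) \<omega> - s k \<omega>) (3 * (1/2)^k) \<le> 3 * (1/2)^k" for k
  proof -
    have "tail (\<lambda>\<omega>. s (Suc k) \<omega> - s k \<omega>) (3 * (1/2)^k)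
        \<le> tail (\<lambda>\<omega>. F (N k) \<omega> - s k \<omega>) ((1/2)^k) + tail (\<lambda>\<omega>. s (Suc k) \<omega> - F (N k) \<omega>) (2 * (1/2)^k)"
      by (rule tail_add) (auto intro!: strongly_measurable_diff F sm simp: field_simps,
         metis add.commute diff_add_cancel diff_diff_eq2 norm_triangle_ineq)
    also have "tail (\<lambda>\<omega>. s (Suc k) \<omega> - F (N k) \<omega>) (2 * (1/2)^k)
      \<le> tail (\<lambda>\<omega>. s (Suc k) \<omega> - F (N (Suc k)) \<omega>) ((1/2)^Suc k) + tail (\<lambda>\<omega>. F (N (Suc k)) \<omega> - F (N k) \<omega>) ((1/2)^k)"
      by (rule tail_add) (auto intro!: strongly_measurable_diff F sm simp: field_simps,
         metis add.commute diff_add_cancel diff_diff_eq2 norm_triangle_ineq)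
    also have "tail (\<lambda>\<omega>. s (Suc k) \<omega> - F (N (Suc k)) \<omega>) ((1/2)^Suc k) \<le> (1/2)^Suc k"
      using s(2)[of "Suc k"] by (subst tail_minus) simp
    also have "(1/2::real)^Suc k \<le> (1/2)^k" by simp
    also have "tail (\<lambda>\<omega>. F (N (Suc k)) \<omega> - F (N k) \<omega>) ((1/2)^k) \<le> (1/2)^k"
      using N(1)[of k "N (Suc k)" "N k"] N(2)[of k] by auto
    also have "tail (\<lambda>\<omega>. F (N k) \<omega> - s k \<omega>) ((1/2)^k) \<le> (1/2)^k" using s(2)[of k] by simp
    finally show ?thesis by simp
  qed
  define B where "B k = {\<omega>\<in>space M. 3 * (1/2)^k < norm (s (Suc k) \<omega> - s k \<omega>)}" for k
  have B: "B k \<in> events" for k unfolding B_def by (intro tail_sets strongly_measurable_diff sm)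
  have "AE \<omega> in M. eventually (\<lambda>k. \<omega> \<in> space M - B k) sequentially"
  proof (rule borel_cantelli_AE1)
    show "B k \<in> events" "emeasure M (B k) < \<infinity>" for k by (auto simp: B less_top[symmetric])
    have "summable (\<lambda>k. 3 * (1/2)^k :: real)" by (intro summable_mult summable_geometric) auto
    then show "summable (\<lambda>k. prob (B k))"
      by (rule summable_comparison_test'[where N=0]) (use step in \<open>auto simp: tail_def B_def\<close>)
  qed
  moreover have summ: "summable (\<lambda>k. norm (s (Suc k) \<omega> - s k \<omega>))" if "eventually (\<lambda>k. \<omega> \<in> space M - B k) sequentially" for \<omega>
  proof -
    have "summable (\<lambda>k. 3 * (1/2)^k :: real)" by (intro summable_mult summable_geometric) auto
    then show ?thesis
      by (rule summable_comparison_test_ev[rotated]) (use that in \<open>auto elim!: eventually_mono simp: B_def\<close>)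
  qed
  ultimately have AEs: "AE \<omega> in M. summable (\<lambda>k. norm (s (Suc k) \<omega> - s k \<omega>))"
    by (rule eventually_mono) assumption
  define G where "G = {\<omega>\<in>space M. summable (\<lambda>k. norm (s (Suc k) \<omega> - s k \<omega>))}"
  have nm[measurable]: "(\<lambda>\<omega>. norm (s (Suc k) \<omega> - s k \<omega>)) \<in> borel_measurable M" for k
    by (intro strongly_measurable_norm strongly_measurable_diff sm)
  have G: "G \<in> events" unfolding G_def summable_iff_convergent Cauchy_convergent_iff[symmetric] by measurable
  define t where "t k \<omega> = (if \<omega> \<in> G then s k \<omega> else 0)" for k \<omega>
  have ts: "simple_function M (t k)" for k
    unfolding t_def using G by (intro simple_function_If_set s(1)) auto
  define f where "f \<omega> = lim (\<lambda>k. t k \<omega>)" for \<omega>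
  have lim: "(\<lambda>k. t k \<omega>) \<longlonglongrightarrow> f \<omega>" for \<omega>
  proof (cases "\<omega> \<in> G")
    case True
    then have "summable (\<lambda>k. s (Suc k) \<omega> - s k \<omega>)" by (auto simp: G_def intro: summable_norm_cancel)
    then have "convergent (\<lambda>n. \<Sum>k<n. s (Suc k) \<omega> - s k \<omega>)" by (simp add: summable_iff_convergent)
    then have "convergent (\<lambda>n. s n \<omega> - s 0 \<omega>)" using sum_lessThan_telescope[of "\<lambda>k. s k \<omega>"] by simp
    then have "convergent (\<lambda>n. (s n \<omega> - s 0 \<omega>) + s 0 \<omega>)" by (intro convergent_add convergent_const)
    then have "convergent (\<lambda>n. t n \<omega>)" using True by (simp add: t_def)
    then show ?thesis by (simp add: f_def convergent_LIMSEQ_iff)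
  next
    case False then show ?thesis by (simp add: t_def f_def)
  qed
  have fs: "strongly_measurable M f" unfolding strongly_measurable_def using ts lim by blast
  have tm: "strongly_measurable M (t k)" for k by (rule simple_strongly_measurable[OF ts])
  have stAE: "AE \<omega> in M. s k \<omega> = t k \<omega>" for k
    using AEs AE_space by eventually_elim (auto simp: t_def G_def)
  have ft: "conv_prob t f"
    unfolding conv_prob_def
  proof safe
    fix c :: real assume c: "0 < c"
    define D where "D n = (\<Union>i\<in>{n..}. {\<omega>\<in>space M. c < norm (t i \<omega> - f \<omega>)})" for n
    have D: "D n \<in> events" for n unfolding D_def
      by (intro sets.countable_UN') (auto intro!: tail_sets strongly_measurable_diff tm fs)
    have "(\<lambda>n. prob (D n)) \<longlonglongrightarrow> prob (\<Inter>n. D n)"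
      by (rule finite_Lim_measure_decseq) (use D in \<open>auto simp: decseq_def D_def intro: order_trans\<close>)
    also have "(\<Inter>n. D n) = {}"
    proof safe
      fix \<omega> assume *: "\<omega> \<in> (\<Inter>n. D n)"
      from LIMSEQ_D[OF lim c] obtain n where n: "\<And>i. i \<ge> n \<Longrightarrow> norm (t i \<omega> - f \<omega>) < c" by auto
      from * have "\<omega> \<in> D n" by auto
      then obtain i where "i \<ge> n" "c < norm (t i \<omega> - f \<omega>)" by (auto simp: D_def)
      with n[of i] show "\<omega> \<in> {}" by simp
    qed
    finally have "(\<lambda>n. prob (D n)) \<longlonglongrightarrow> 0" by simp
    note D0 = this
    have le: "tail (\<lambda>\<omega>. t k \<omega> - f \<omega>) c \<le> prob (D k)" for k
      unfolding tail_def using D by (intro finite_measure_mono) (auto simp: D_def)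
    show "(\<lambda>k. tail (\<lambda>\<omega>. t k \<omega> - f \<omega>) c) \<longlonglongrightarrow> 0"
      by (rule tendsto_sandwich[OF _ _ tendsto_const D0]; intro always_eventually allI le tail_nonneg)
  qed
  have "conv_prob F f"
    unfolding conv_prob_def
  proof safe
    fix c :: real assume c: "0 < c"
    show "(\<lambda>i. tail (\<lambda>\<omega>. F i \<omega> - f \<omega>) c) \<longlonglongrightarrow> 0"
    proof (rule LIMSEQ_I)
      fix d :: real assume d: "0 < d"
      have p0: "(\<lambda>k. (1/2::real)^k) \<longlonglongrightarrow> 0" by (rule LIMSEQ_power_zero) auto
      have "eventually (\<lambda>k. (1/2::real)^k < c/3 \<and> (1/2::real)^k < d/3 \<and> tail (\<lambda>\<omega>. t k \<omega> - f \<omega>) (c/3) < d/3) sequentially"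
        by (intro eventually_conj order_tendstoD[OF p0] conv_probD[OF ft]) (use c d in auto)
      then obtain k where k: "(1/2::real)^k < c/3" "(1/2::real)^k < d/3" "tail (\<lambda>\<omega>. t k \<omega> - f \<omega>) (c/3) < d/3"
        by (auto simp: eventually_sequentially)
      show "\<exists>n0. \<forall>i\<ge>n0. norm (tail (\<lambda>\<omega>. F i \<omega> - f \<omega>) c - 0) < d"
      proof (intro exI[of _ "N k"] allI impI)
        fix i assume i: "i \<ge> N k"
        have "tail (\<lambda>\<omega>. F i \<omega> - f \<omega>) c \<le> tail (\<lambda>\<omega>. F i \<omega> - F (N k) \<omega>) (c/3) + tail (\<lambda>\<omega>. F (N k) \<omega> - f \<omega>) (2*c/3)"
          by (rule tail_add) (auto intro!: strongly_measurable_diff F fs simp: field_simps,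
             metis add.commute diff_add_cancel diff_diff_eq2 norm_triangle_ineq)
        also have "tail (\<lambda>\<omega>. F (N k) \<omega> - f \<omega>) (2*c/3) \<le> tail (\<lambda>\<omega>. F (N k) \<omega> - t k \<omega>) (c/3) + tail (\<lambda>\<omega>. t k \<omega> - f \<omega>) (c/3)"
          by (rule tail_add) (auto intro!: strongly_measurable_diff F tm fs simp: field_simps,
             metis add.commute diff_add_cancel diff_diff_eq2 norm_triangle_ineq)
        also have "tail (\<lambda>\<omega>. F (N k) \<omega> - t k \<omega>) (c/3) = tail (\<lambda>\<omega>. F (N k) \<omega> - s k \<omega>) (c/3)"
          by (rule tail_cong_AE) (use stAE[of k] in \<open>auto intro!: strongly_measurable_diff F tm sm\<close>)
        also have "\<dots> \<le> tail (\<lambda>\<omega>. F (N k) \<omega> - s k \<omega>) ((1/2)^k)"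
          using k by (intro tail_mono strongly_measurable_diff F sm) auto
        also have "\<dots> < d/3" using s(2)[of k] k by linarith
        also have "tail (\<lambda>\<omega>. F i \<omega> - F (N k) \<omega>) (c/3) \<le> tail (\<lambda>\<omega>. F i \<omega> - F (N k) \<omega>) ((1/2)^k)"
          using k by (intro tail_mono strongly_measurable_diff F) auto
        also have "\<dots> < d/3" using N(1)[of k i "N k"] i k by linarith
        also note k(3)
        finally show "norm (tail (\<lambda>\<omega>. F i \<omega> - f \<omega>) c - 0) < d"
          using tail_nonneg[of "\<lambda>\<omega>. F i \<omega> - f \<omega>" c] by simp
      qed
    qed
  qed
  with fs that show ?thesis by blast
qed

end



section \<open>Joint laws and characteristic functions\<close>

lemma (in prob_space) integrable_prod_indicator_cos:
  assumes A: "finite A" and [measurable]: "\<And>i. i \<in> A \<Longrightarrow> X i \<in> borel_measurable M"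
    and B: "\<And>i. i \<in> A \<Longrightarrow> B i \<in> sets borel" and [measurable]: "Y \<in> borel_measurable M"
  shows "integrable M (\<lambda>\<omega>. (\<Prod>i\<in>A. indicator (B i) (X i \<omega>)) * cos (Y \<omega> :: real))"
    and "(\<lambda>\<omega>. (\<Prod>i\<in>A. indicator (B i) (X i \<omega>)) :: real) \<in> borel_measurable M"
proof -
  show m[measurable]: "(\<lambda>\<omega>. (\<Prod>i\<in>A. indicator (B i) (X i \<omega>)) :: real) \<in> borel_measurable M"
  proof (rule borel_measurable_prod)
    fix i assume i: "i \<in> A"
    have [measurable]: "X i \<in> borel_measurable M" "B i \<in> sets borel" using assms(2) B i by auto
    show "(\<lambda>\<omega>. indicator (B i) (X i \<omega>)::real) \<in> borel_measurable M" by measurable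
  qed
  have "\<bar>\<Prod>i\<in>A. indicator (B i) (X i \<omega>)\<bar> \<le> (1::real)" for \<omega>
    unfolding abs_prod by (rule prod_le_1) (auto simp: indicator_def)
  then have "\<bar>(\<Prod>i\<in>A. indicator (B i) (X i \<omega>)) * cos (Y \<omega>)\<bar> \<le> (1::real)" for \<omega>
    unfolding abs_mult by (intro mult_le_one) auto
  then show "integrable M (\<lambda>\<omega>. (\<Prod>i\<in>A. indicator (B i) (X i \<omega>)) * cos (Y \<omega> :: real))"
    by (intro integrable_const_bound[where B=1]) auto
qed

lemma cos_shift_sin: "cos (- (pi / 2) + x) = sin (x::real)" "cos (x - pi / 2) = sin x"
  by (simp_all add: cos_add cos_diff)

lemma Re_exp_i: "Re (exp (\<i> * complex_of_real x)) = cos x" and Im_exp_i: "Im (exp (\<i> * complex_of_real x)) = sin x" for x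
  by (simp_all add: Re_exp Im_exp)

text \<open>A finite measure on the line is determined by its Fourier transform. The measures here are the laws
  of \<open>X\<close> and \<open>Y\<close> under the densities \<open>u\<close> and \<open>v\<close>, normalized to mass one.\<close>

lemma weighted_law_unique:
  fixes X :: "'a \<Rightarrow> real" and Y :: "'b \<Rightarrow> real" and u :: "'a \<Rightarrow> real" and v :: "'b \<Rightarrow> real"
  assumes "prob_space M" "prob_space N"
    and [measurable]: "X \<in> borel_measurable M" "Y \<in> borel_measurable N"
      "u \<in> borel_measurable M" "v \<in> borel_measurable N"
    and u: "\<And>x. 0 \<le> u x" "\<And>x. u x \<le> K" and v: "\<And>x. 0 \<le> v x" "\<And>x. v x \<le> K"
    and pos: "0 < (\<integral>x. u x \<partial>M)"
    and cos: "\<And>s. (\<integral>x. u x * cos (s * X x) \<partial>M) = (\<integral>x. v x * cos (s * Y x) \<partial>N)"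
    and sin: "\<And>s. (\<integral>x. u x * sin (s * X x) \<partial>M) = (\<integral>x. v x * sin (s * Y x) \<partial>N)"
    and B[measurable]: "B \<in> sets borel"
  shows "(\<integral>x. u x * indicator B (X x) \<partial>M) = (\<integral>x. v x * indicator B (Y x) \<partial>N)"
proof -
  interpret M: prob_space M by fact
  interpret N: prob_space N by fact
  define m where "m = (\<integral>x. u x \<partial>M)"
  have mN: "m = (\<integral>x. v x \<partial>N)" using cos[of 0] by (simp add: m_def)
  have m: "0 < m" using pos by (simp add: m_def)
  define D where "D = distr (density M (\<lambda>x. ennreal (u x / m))) borel X"
  define E where "E = distr (density N (\<lambda>x. ennreal (v x / m))) borel Y"
  have iu: "integrable M u" using u by (intro M.integrable_const_bound[where B=K]) auto
  have iv: "integrable N v" using v by (intro N.integrable_const_bound[where B=K]) auto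
  have DI: "(\<integral>x. f x \<partial>D) = (\<integral>x. (u x / m) *\<^sub>R f (X x) \<partial>M)" if [measurable]: "f \<in> borel_measurable borel"
    for f :: "real \<Rightarrow> 'z::{banach, second_countable_topology}"
    unfolding D_def using u m by (simp add: integral_distr integral_density)
  have EI: "(\<integral>x. f x \<partial>E) = (\<integral>x. (v x / m) *\<^sub>R f (Y x) \<partial>N)" if [measurable]: "f \<in> borel_measurable borel"
    for f :: "real \<Rightarrow> 'z::{banach, second_countable_topology}"
    unfolding E_def using v m by (simp add: integral_distr integral_density)
  have D1: "prob_space D" unfolding D_def
  proof (rule prob_space.prob_space_distr)
    show "prob_space (density M (\<lambda>x. ennreal (u x / m)))"
    proof
      have "(\<integral>\<^sup>+x. ennreal (u x / m) \<partial>M) = ennreal (\<integral>x. u x / m \<partial>M)"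
        using iu u m by (intro nn_integral_eq_integral) auto
      then show "emeasure (density M (\<lambda>x. ennreal (u x / m))) (space (density M (\<lambda>x. ennreal (u x / m)))) = 1"
        using m by (subst emeasure_density) (auto simp: m_def cong: nn_integral_cong)
    qed
  qed auto
  have E1: "prob_space E" unfolding E_def
  proof (rule prob_space.prob_space_distr)
    show "prob_space (density N (\<lambda>x. ennreal (v x / m)))"
    proof
      have "(\<integral>\<^sup>+x. ennreal (v x / m) \<partial>N) = ennreal (\<integral>x. v x / m \<partial>N)"
        using iv v m by (intro nn_integral_eq_integral) auto
      then show "emeasure (density N (\<lambda>x. ennreal (v x / m))) (space (density N (\<lambda>x. ennreal (v x / m)))) = 1"
        using m by (subst emeasure_density) (auto simp: mN cong: nn_integral_cong)
    qed
  qed auto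
  have rD: "real_distribution D"
    using D1 by (auto simp: real_distribution_def real_distribution_axioms_def D_def)
  have rE: "real_distribution E"
    using E1 by (auto simp: real_distribution_def real_distribution_axioms_def E_def)
  have "char D = char E"
  proof
    fix s
    interpret D: real_distribution D by (rule rD)
    interpret E: real_distribution E by (rule rE)
    have "Re (char D s) = Re (char E s)"
    proof -
      have "Re (char D s) = (\<integral>x. cos (s * x) \<partial>D)"
        unfolding char_def using integral_Re[OF D.integrable_iexp[of "\<lambda>x. s * x"]] by (simp add: Re_exp_i del: of_real_mult)
      also have "\<dots> = (\<integral>x. u x * cos (s * X x) \<partial>M) / m" by (subst DI) auto
      also have "\<dots> = (\<integral>x. cos (s * x) \<partial>E)" by (subst EI) (auto simp: cos)
      also have "\<dots> = Re (char E s)"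
        unfolding char_def using integral_Re[OF E.integrable_iexp[of "\<lambda>x. s * x"]] by (simp add: Re_exp_i del: of_real_mult)
      finally show ?thesis .
    qed
    moreover have "Im (char D s) = Im (char E s)"
    proof -
      have "Im (char D s) = (\<integral>x. sin (s * x) \<partial>D)"
        unfolding char_def using integral_Im[OF D.integrable_iexp[of "\<lambda>x. s * x"]] by (simp add: Im_exp_i del: of_real_mult)
      also have "\<dots> = (\<integral>x. u x * sin (s * X x) \<partial>M) / m" by (subst DI) auto
      also have "\<dots> = (\<integral>x. sin (s * x) \<partial>E)" by (subst EI) (auto simp: sin)
      also have "\<dots> = Im (char E s)"
        unfolding char_def using integral_Im[OF E.integrable_iexp[of "\<lambda>x. s * x"]] by (simp add: Im_exp_i del: of_real_mult)
      finally show ?thesis .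
    qed
    ultimately show "char D s = char E s" by (simp add: complex_eq_iff)
  qed
  from Levy_uniqueness[OF rD rE this] have DE: "D = E" .
  have "(\<integral>x. u x * indicator B (X x) \<partial>M) = m * (\<integral>x. indicator B x \<partial>D)"
    using m by (subst DI) auto
  also have "\<dots> = (\<integral>x. v x * indicator B (Y x) \<partial>N)"
    unfolding DE using m by (subst EI) auto
  finally show ?thesis .
qed

text \<open>The indices pass one at a time from the trigonometric factor to the product of indicators. For the
  index \<open>a\<close> the formula \<open>2 cos p cos q = cos (p + q) + cos (p - q)\<close> reduces the Fourier transform
  of \<open>X a\<close>, under a density made of the other indices, to integrals of the previous kind, and
  one-dimensional uniqueness turns it into an indicator.\<close>

lemma cramer_wold_step:
  fixes X :: "'i \<Rightarrow> 'a \<Rightarrow> real" and Y :: "'i \<Rightarrow> 'b \<Rightarrow> real"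
  assumes M: "prob_space M" and N: "prob_space N" and J: "finite J"
    and X: "\<And>i. i \<in> J \<Longrightarrow> X i \<in> borel_measurable M"
    and Y: "\<And>i. i \<in> J \<Longrightarrow> Y i \<in> borel_measurable N"
    and eq: "\<And>t c. (\<integral>\<omega>. cos (c + (\<Sum>i\<in>J. t i * X i \<omega>)) \<partial>M) = (\<integral>\<omega>. cos (c + (\<Sum>i\<in>J. t i * Y i \<omega>)) \<partial>N)"
    and A: "A \<subseteq> J" and B: "\<And>i. i \<in> J \<Longrightarrow> B i \<in> sets borel"
  shows "(\<integral>\<omega>. (\<Prod>i\<in>A. indicator (B i) (X i \<omega>)) * cos (c + (\<Sum>i\<in>J - A. t i * X i \<omega>)) \<partial>M)
       = (\<integral>\<omega>. (\<Prod>i\<in>A. indicator (B i) (Y i \<omega>)) * cos (c + (\<Sum>i\<in>J - A. t i * Y i \<omega>)) \<partial>N)"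
proof -
  interpret M: prob_space M by fact
  interpret N: prob_space N by fact
  have "finite A" using A J finite_subset by auto
  then show ?thesis using A
  proof (induction A arbitrary: c t)
    case empty then show ?case using eq by simp
  next
    case (insert a A)
    have a: "a \<in> J" "a \<notin> A" "A \<subseteq> J" and finA: "finite A" using insert by auto
    define R where "R = J - insert a A"
    have JA: "J - A = insert a R" "a \<notin> R" "finite R" using a J by (auto simp: R_def)
    have [measurable]: "X a \<in> borel_measurable M" "Y a \<in> borel_measurable N" "B a \<in> sets borel"
      using X Y B a by auto
    define PX where "PX \<omega> = (\<Prod>i\<in>A. indicator (B i) (X i \<omega>) :: real)" for \<omega>
    define PY where "PY \<omega> = (\<Prod>i\<in>A. indicator (B i) (Y i \<omega>) :: real)" for \<omega>
    define LX where "LX \<omega> = c + (\<Sum>i\<in>R. t i * X i \<omega>)" for \<omega>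
    define LY where "LY \<omega> = c + (\<Sum>i\<in>R. t i * Y i \<omega>)" for \<omega>
    have [measurable]: "LX \<in> borel_measurable M" unfolding LX_def
      by (intro borel_measurable_add borel_measurable_const borel_measurable_sum borel_measurable_times X) (auto simp: R_def)
    have [measurable]: "LY \<in> borel_measurable N" unfolding LY_def
      by (intro borel_measurable_add borel_measurable_const borel_measurable_sum borel_measurable_times Y) (auto simp: R_def)
    have PXi: "integrable M (\<lambda>\<omega>. PX \<omega> * cos (Z \<omega>))" if "Z \<in> borel_measurable M" for Z
      unfolding PX_def by (rule M.integrable_prod_indicator_cos) (use finA a X B that in auto)
    have PYi: "integrable N (\<lambda>\<omega>. PY \<omega> * cos (Z \<omega>))" if "Z \<in> borel_measurable N" for Z
      unfolding PY_def by (rule N.integrable_prod_indicator_cos) (use finA a Y B that in auto)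
    have [measurable]: "PX \<in> borel_measurable M"
      unfolding PX_def by (rule M.integrable_prod_indicator_cos(2)[of _ _ _ "\<lambda>_. 0"]) (use finA a X B in auto)
    have [measurable]: "PY \<in> borel_measurable N"
      unfolding PY_def by (rule N.integrable_prod_indicator_cos(2)[of _ _ _ "\<lambda>_. 0"]) (use finA a Y B in auto)
    have PX01: "0 \<le> PX \<omega>" "PX \<omega> \<le> 1" for \<omega> unfolding PX_def by (auto intro!: prod_nonneg prod_le_1)
    have PY01: "0 \<le> PY \<omega>" "PY \<omega> \<le> 1" for \<omega> unfolding PY_def by (auto intro!: prod_nonneg prod_le_1)
    have IH: "(\<integral>\<omega>. PX \<omega> * cos (d + s * X a \<omega> + (\<Sum>i\<in>R. r i * X i \<omega>)) \<partial>M)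
            = (\<integral>\<omega>. PY \<omega> * cos (d + s * Y a \<omega> + (\<Sum>i\<in>R. r i * Y i \<omega>)) \<partial>N)" for d s r
    proof -
      have e: "(\<Sum>i\<in>R. (r(a := s)) i * X i \<omega>) = (\<Sum>i\<in>R. r i * X i \<omega>)" for \<omega>
        using JA by (intro sum.cong) auto
      have e': "(\<Sum>i\<in>R. (r(a := s)) i * Y i \<omega>) = (\<Sum>i\<in>R. r i * Y i \<omega>)" for \<omega>
        using JA by (intro sum.cong) auto
      show ?thesis using insert.IH[OF a(3), of d "r(a := s)"] JA
        by (simp add: PX_def PY_def e e' add.assoc del: fun_upd_apply) (simp add: algebra_simps)
    qed
    have IH0: "(\<integral>\<omega>. PX \<omega> * cos (d + s * X a \<omega>) \<partial>M) = (\<integral>\<omega>. PY \<omega> * cos (d + s * Y a \<omega>) \<partial>N)" for d s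
      using IH[of d s "\<lambda>_. 0"] by simp
    have IH1: "(\<integral>\<omega>. cos (d + s * X a \<omega>) \<partial>M) = (\<integral>\<omega>. cos (d + s * Y a \<omega>) \<partial>N)" for d s
      using eq[of d "\<lambda>i. if i = a then s else 0"] a(1) J by (simp add: if_distrib[of "\<lambda>x. x * _"] sum.delta cong: if_cong)
    have IH2: "(\<integral>\<omega>. PX \<omega> * cos (d + s * X a \<omega> + LX \<omega>) \<partial>M) = (\<integral>\<omega>. PY \<omega> * cos (d + s * Y a \<omega> + LY \<omega>) \<partial>N)" for d s
      using IH[of "d + c" s t] by (simp add: LX_def LY_def add.assoc add.left_commute)
    have IH2': "(\<integral>\<omega>. PX \<omega> * cos (d + s * X a \<omega> - LX \<omega>) \<partial>M) = (\<integral>\<omega>. PY \<omega> * cos (d + s * Y a \<omega> - LY \<omega>) \<partial>N)" for d s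
      using IH[of "d - c" s "\<lambda>i. - t i"] by (simp add: LX_def LY_def sum_negf algebra_simps)
    \<comment> \<open>The weight has to be nonnegative and of positive mass, hence the two added terms;
      their contributions are known from the induction hypothesis as well.\<close>
    define u where "u \<omega> = 1 + PX \<omega> * (1 + cos (LX \<omega>))" for \<omega>
    define v where "v \<omega> = 1 + PY \<omega> * (1 + cos (LY \<omega>))" for \<omega>
    have expandX: "u \<omega> * cos (d + s * X a \<omega>) = cos (d + s * X a \<omega>) + PX \<omega> * cos (d + s * X a \<omega>)
        + 1/2 * (PX \<omega> * cos (d + s * X a \<omega> + LX \<omega>)) + 1/2 * (PX \<omega> * cos (d + s * X a \<omega> - LX \<omega>))" for \<omega> d s
      unfolding u_def cos_add[of "d + s * X a \<omega>" "LX \<omega>"] cos_diff[of "d + s * X a \<omega>" "LX \<omega>"] by (simp add: algebra_simps)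
    have expandY: "v \<omega> * cos (d + s * Y a \<omega>) = cos (d + s * Y a \<omega>) + PY \<omega> * cos (d + s * Y a \<omega>)
        + 1/2 * (PY \<omega> * cos (d + s * Y a \<omega> + LY \<omega>)) + 1/2 * (PY \<omega> * cos (d + s * Y a \<omega> - LY \<omega>))" for \<omega> d s
      unfolding v_def cos_add[of "d + s * Y a \<omega>" "LY \<omega>"] cos_diff[of "d + s * Y a \<omega>" "LY \<omega>"] by (simp add: algebra_simps)
    have iM: "integrable M (\<lambda>\<omega>. cos (d + s * X a \<omega>))" for d s
      by (intro M.integrable_const_bound[where B=1]) auto
    have iN: "integrable N (\<lambda>\<omega>. cos (d + s * Y a \<omega>))" for d s
      by (intro N.integrable_const_bound[where B=1]) auto
    have main: "(\<integral>\<omega>. u \<omega> * cos (d + s * X a \<omega>) \<partial>M) = (\<integral>\<omega>. v \<omega> * cos (d + s * Y a \<omega>) \<partial>N)" for d s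
    proof -
      have "(\<integral>\<omega>. u \<omega> * cos (d + s * X a \<omega>) \<partial>M) = (\<integral>\<omega>. cos (d + s * X a \<omega>) \<partial>M) + (\<integral>\<omega>. PX \<omega> * cos (d + s * X a \<omega>) \<partial>M)
        + 1/2 * (\<integral>\<omega>. PX \<omega> * cos (d + s * X a \<omega> + LX \<omega>) \<partial>M) + 1/2 * (\<integral>\<omega>. PX \<omega> * cos (d + s * X a \<omega> - LX \<omega>) \<partial>M)"
        unfolding expandX using iM[of d s] PXi[of "\<lambda>\<omega>. d + s * X a \<omega>"] PXi[of "\<lambda>\<omega>. d + s * X a \<omega> + LX \<omega>"]
          PXi[of "\<lambda>\<omega>. d + s * X a \<omega> - LX \<omega>"] by simp
      also have "\<dots> = (\<integral>\<omega>. cos (d + s * Y a \<omega>) \<partial>N) + (\<integral>\<omega>. PY \<omega> * cos (d + s * Y a \<omega>) \<partial>N)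
        + 1/2 * (\<integral>\<omega>. PY \<omega> * cos (d + s * Y a \<omega> + LY \<omega>) \<partial>N) + 1/2 * (\<integral>\<omega>. PY \<omega> * cos (d + s * Y a \<omega> - LY \<omega>) \<partial>N)"
        by (simp only: IH0 IH1 IH2 IH2')
      also have "\<dots> = (\<integral>\<omega>. v \<omega> * cos (d + s * Y a \<omega>) \<partial>N)"
        unfolding expandY using iN[of d s] PYi[of "\<lambda>\<omega>. d + s * Y a \<omega>"] PYi[of "\<lambda>\<omega>. d + s * Y a \<omega> + LY \<omega>"]
          PYi[of "\<lambda>\<omega>. d + s * Y a \<omega> - LY \<omega>"] by simp
      finally show ?thesis .
    qed
    have ub: "1 \<le> u \<omega>" "u \<omega> \<le> 3" for \<omega>
    proof -
      have "0 \<le> 1 + cos (LX \<omega>)" "1 + cos (LX \<omega>) \<le> 2" using cos_ge_minus_one[of "LX \<omega>"] cos_le_one[of "LX \<omega>"] by linarith+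
      then have "0 \<le> PX \<omega> * (1 + cos (LX \<omega>))" "PX \<omega> * (1 + cos (LX \<omega>)) \<le> 1 * 2"
        using PX01[of \<omega>] mult_mono[of "PX \<omega>" 1 "1 + cos (LX \<omega>)" 2] by auto
      then show "1 \<le> u \<omega>" "u \<omega> \<le> 3" by (auto simp: u_def)
    qed
    have vb: "1 \<le> v \<omega>" "v \<omega> \<le> 3" for \<omega>
    proof -
      have "0 \<le> 1 + cos (LY \<omega>)" "1 + cos (LY \<omega>) \<le> 2" using cos_ge_minus_one[of "LY \<omega>"] cos_le_one[of "LY \<omega>"] by linarith+
      then have "0 \<le> PY \<omega> * (1 + cos (LY \<omega>))" "PY \<omega> * (1 + cos (LY \<omega>)) \<le> 1 * 2"
        using PY01[of \<omega>] mult_mono[of "PY \<omega>" 1 "1 + cos (LY \<omega>)" 2] by auto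
      then show "1 \<le> v \<omega>" "v \<omega> \<le> 3" by (auto simp: v_def)
    qed
    have [measurable]: "u \<in> borel_measurable M" "v \<in> borel_measurable N"
      unfolding u_def[abs_def] v_def[abs_def] by measurable
    have uv3: "\<bar>u \<omega>\<bar> \<le> 3" "0 \<le> u \<omega>" "\<bar>v \<omega>'\<bar> \<le> 3" "0 \<le> v \<omega>'" for \<omega> \<omega>'
      using ub[of \<omega>] vb[of \<omega>'] by auto
    have P3: "\<bar>1 + PX \<omega>\<bar> \<le> 3" "0 \<le> 1 + PX \<omega>" "1 + PX \<omega> \<le> 2" "\<bar>1 + PY \<omega>'\<bar> \<le> 3" "0 \<le> 1 + PY \<omega>'" "1 + PY \<omega>' \<le> 2"
      "\<bar>1 + PX \<omega>\<bar> \<le> 2" for \<omega> \<omega>'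
      using PX01[of \<omega>] PY01[of \<omega>'] by auto
    have "integrable M u" using uv3 by (intro M.integrable_const_bound[where B=3]) auto
    then have pos: "0 < (\<integral>\<omega>. u \<omega> \<partial>M)"
      using M.integral_ge_const[of u 1] ub by (auto intro: less_le_trans[OF zero_less_one])
    have law: "(\<integral>\<omega>. u \<omega> * indicator (B a) (X a \<omega>) \<partial>M) = (\<integral>\<omega>. v \<omega> * indicator (B a) (Y a \<omega>) \<partial>N)"
    proof (rule weighted_law_unique[OF M N, where K=3])
      show "(\<integral>x. u x * cos (s * X a x) \<partial>M) = (\<integral>x. v x * cos (s * Y a x) \<partial>N)" for s using main[of 0 s] by simp
      show "(\<integral>x. u x * sin (s * X a x) \<partial>M) = (\<integral>x. v x * sin (s * Y a x) \<partial>N)" for s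
        using main[of "-(pi/2)" s] by (simp add: cos_shift_sin)
    qed (use pos ub vb uv3 in auto)
    \<comment> \<open>Subtracting the law under the density \<open>1 + PX\<close> leaves \<open>PX * cos LX\<close>.\<close>
    have ibM: "integrable M (\<lambda>\<omega>. 1 + PX \<omega>)" using P3 by (intro M.integrable_const_bound[where B=2]) auto
    have two: "(\<integral>\<omega>. (1 + PX \<omega>) * indicator (B a) (X a \<omega>) \<partial>M) = (\<integral>\<omega>. (1 + PY \<omega>) * indicator (B a) (Y a \<omega>) \<partial>N)"
    proof (rule weighted_law_unique[OF M N, where K=2])
      have gen: "(\<integral>x. (1 + PX x) * cos (d + s * X a x) \<partial>M) = (\<integral>x. (1 + PY x) * cos (d + s * Y a x) \<partial>N)" for d s
        using IH1[of d s] IH0[of d s] iM iN PXi PYi by (simp add: distrib_right)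
      show "(\<integral>x. (1 + PX x) * cos (s * X a x) \<partial>M) = (\<integral>x. (1 + PY x) * cos (s * Y a x) \<partial>N)" for s using gen[of 0 s] by simp
      show "(\<integral>x. (1 + PX x) * sin (s * X a x) \<partial>M) = (\<integral>x. (1 + PY x) * sin (s * Y a x) \<partial>N)" for s
        using gen[of "-(pi/2)" s] by (simp add: cos_shift_sin)
      show "0 < (\<integral>x. 1 + PX x \<partial>M)"
        using M.integral_ge_const[OF ibM, of 1] PX01 by (auto intro: less_le_trans[OF zero_less_one])
    qed (use P3 in auto)
    have iXB: "integrable M (\<lambda>\<omega>. g \<omega> * indicator (B a) (X a \<omega>))" if "g \<in> borel_measurable M" "\<And>\<omega>. \<bar>g \<omega>\<bar> \<le> 3" for g :: "'a \<Rightarrow> real"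
      using that by (intro M.integrable_const_bound[where B=3]) (auto simp: indicator_def)
    have iYB: "integrable N (\<lambda>\<omega>. g \<omega> * indicator (B a) (Y a \<omega>))" if "g \<in> borel_measurable N" "\<And>\<omega>. \<bar>g \<omega>\<bar> \<le> 3" for g :: "'b \<Rightarrow> real"
      using that by (intro N.integrable_const_bound[where B=3]) (auto simp: indicator_def)
    have "(\<integral>\<omega>. PX \<omega> * indicator (B a) (X a \<omega>) * cos (LX \<omega>) \<partial>M)
        = (\<integral>\<omega>. u \<omega> * indicator (B a) (X a \<omega>) - (1 + PX \<omega>) * indicator (B a) (X a \<omega>) \<partial>M)"
      by (intro arg_cong[where f="integral\<^sup>L M"] ext) (simp add: u_def algebra_simps)
    also have "\<dots> = (\<integral>\<omega>. u \<omega> * indicator (B a) (X a \<omega>) \<partial>M) - (\<integral>\<omega>. (1 + PX \<omega>) * indicator (B a) (X a \<omega>) \<partial>M)"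
      by (intro Bochner_Integration.integral_diff iXB) (use uv3 P3 in auto)
    also have "\<dots> = (\<integral>\<omega>. v \<omega> * indicator (B a) (Y a \<omega>) \<partial>N) - (\<integral>\<omega>. (1 + PY \<omega>) * indicator (B a) (Y a \<omega>) \<partial>N)"
      by (simp only: law two)
    also have "\<dots> = (\<integral>\<omega>. v \<omega> * indicator (B a) (Y a \<omega>) - (1 + PY \<omega>) * indicator (B a) (Y a \<omega>) \<partial>N)"
      by (intro Bochner_Integration.integral_diff[symmetric] iYB) (use uv3 P3 in auto)
    also have "\<dots> = (\<integral>\<omega>. PY \<omega> * indicator (B a) (Y a \<omega>) * cos (LY \<omega>) \<partial>N)"
      by (intro arg_cong[where f="integral\<^sup>L N"] ext) (simp add: v_def algebra_simps)
    finally show ?case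
      using insert.hyps by (simp add: PX_def PY_def LX_def LY_def R_def mult.commute)
  qed
qed

text \<open>The Cramer--Wold device: with all indices in the product of indicators, the laws agree on boxes.\<close>

lemma joint_law_unique:
  fixes X :: "'i \<Rightarrow> 'a \<Rightarrow> real" and Y :: "'i \<Rightarrow> 'b \<Rightarrow> real"
  assumes M: "prob_space M" and N: "prob_space N" and J: "finite J"
    and X: "\<And>i. i \<in> J \<Longrightarrow> X i \<in> borel_measurable M"
    and Y: "\<And>i. i \<in> J \<Longrightarrow> Y i \<in> borel_measurable N"
    and eq: "\<And>t c. (\<integral>\<omega>. cos (c + (\<Sum>i\<in>J. t i * X i \<omega>)) \<partial>M) = (\<integral>\<omega>. cos (c + (\<Sum>i\<in>J. t i * Y i \<omega>)) \<partial>N)"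
  shows "distr M (PiM J (\<lambda>_. borel)) (\<lambda>\<omega>. \<lambda>i\<in>J. X i \<omega>) = distr N (PiM J (\<lambda>_. borel)) (\<lambda>\<omega>. \<lambda>i\<in>J. Y i \<omega>)"
proof -
  interpret M: prob_space M by fact
  interpret N: prob_space N by fact
  have [measurable]: "(\<lambda>\<omega>. \<lambda>i\<in>J. X i \<omega>) \<in> measurable M (PiM J (\<lambda>_. borel))"
    "(\<lambda>\<omega>. \<lambda>i\<in>J. Y i \<omega>) \<in> measurable N (PiM J (\<lambda>_. borel))"
    using X Y by (auto intro: measurable_restrict)
  interpret DM: prob_space "distr M (PiM J (\<lambda>_. borel)) (\<lambda>\<omega>. \<lambda>i\<in>J. X i \<omega>)" by (rule M.prob_space_distr) simp
  show ?thesis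
  proof (rule measure_eqI_PiM_finite[OF J])
    fix B :: "'i \<Rightarrow> real set" assume B: "\<And>i. i \<in> J \<Longrightarrow> B i \<in> sets borel"
    have [measurable]: "Pi\<^sub>E J B \<in> sets (PiM J (\<lambda>_. borel))" using B J by (intro sets_PiM_I_finite) auto
    have iX: "(\<Prod>i\<in>J. indicator (B i) (X i \<omega>)) = (indicator ((\<lambda>\<omega>. \<lambda>i\<in>J. X i \<omega>) -` Pi\<^sub>E J B \<inter> space M) \<omega> :: real)"
      if "\<omega> \<in> space M" for \<omega> using that J by (auto simp: indicator_def PiE_iff prod_zero_iff)
    have iY: "(\<Prod>i\<in>J. indicator (B i) (Y i \<omega>)) = (indicator ((\<lambda>\<omega>. \<lambda>i\<in>J. Y i \<omega>) -` Pi\<^sub>E J B \<inter> space N) \<omega> :: real)"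
      if "\<omega> \<in> space N" for \<omega> using that J by (auto simp: indicator_def PiE_iff prod_zero_iff)
    have "measure M ((\<lambda>\<omega>. \<lambda>i\<in>J. X i \<omega>) -` Pi\<^sub>E J B \<inter> space M) = (\<integral>\<omega>. (\<Prod>i\<in>J. indicator (B i) (X i \<omega>)) \<partial>M)"
      by (subst Bochner_Integration.integral_cong[OF refl iX]) auto
    also have "\<dots> = (\<integral>\<omega>. (\<Prod>i\<in>J. indicator (B i) (Y i \<omega>)) \<partial>N)"
      using cramer_wold_step[OF M N J X Y eq subset_refl B, where c=0 and t="\<lambda>_. 0"] by simp
    also have "\<dots> = measure N ((\<lambda>\<omega>. \<lambda>i\<in>J. Y i \<omega>) -` Pi\<^sub>E J B \<inter> space N)"
      by (subst Bochner_Integration.integral_cong[OF refl iY]) auto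
    finally show "emeasure (distr M (PiM J (\<lambda>_. borel)) (\<lambda>\<omega>. \<lambda>i\<in>J. X i \<omega>)) (Pi\<^sub>E J B)
        = emeasure (distr N (PiM J (\<lambda>_. borel)) (\<lambda>\<omega>. \<lambda>i\<in>J. Y i \<omega>)) (Pi\<^sub>E J B)"
      by (simp add: emeasure_distr M.emeasure_eq_measure N.emeasure_eq_measure)
  next
    show "range (\<lambda>_::nat. Pi\<^sub>E J (\<lambda>_. UNIV)) \<subseteq> prod_algebra J (\<lambda>_. borel :: real measure)"
      using J by (auto intro!: prod_algebraI_finite)
    show "(\<Union>i::nat. Pi\<^sub>E J (\<lambda>_. UNIV)) = space (PiM J (\<lambda>_. borel :: real measure))" by (auto simp: space_PiM)
  qed auto
qed



section \<open>Gaussian variables\<close>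

lemma std_normal_cos: "(\<integral>x. cos (s * x) \<partial>std_normal_distribution) = exp (- s\<^sup>2 / 2)"
  and std_normal_sin: "(\<integral>x. sin (s * x) \<partial>std_normal_distribution) = 0"
proof -
  interpret real_distribution std_normal_distribution by (rule real_dist_normal_dist)
  have "char std_normal_distribution s = complex_of_real (exp (- s\<^sup>2 / 2))"
    by (simp add: char_std_normal_distribution)
  then have re: "Re (char std_normal_distribution s) = exp (- s\<^sup>2 / 2)" and im: "Im (char std_normal_distribution s) = 0"
    by auto
  show "(\<integral>x. cos (s * x) \<partial>std_normal_distribution) = exp (- s\<^sup>2 / 2)"
    using re integral_Re[OF integrable_iexp[of "\<lambda>x. s * x"]]
    unfolding char_def by (simp add: Re_exp_i del: of_real_mult)
  show "(\<integral>x. sin (s * x) \<partial>std_normal_distribution) = 0"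
    using im integral_Im[OF integrable_iexp[of "\<lambda>x. s * x"]]
    unfolding char_def by (simp add: Im_exp_i del: of_real_mult)
qed

lemma std_normal_cos_shift: "(\<integral>x. cos (c + s * x) \<partial>std_normal_distribution) = exp (- s\<^sup>2 / 2) * cos c"
proof -
  interpret real_distribution std_normal_distribution by (rule real_dist_normal_dist)
  have "integrable std_normal_distribution (\<lambda>x. cos (s * x))" "integrable std_normal_distribution (\<lambda>x. sin (s * x))"
    by (auto intro!: integrable_const_bound[where B=1])
  then show ?thesis by (simp add: cos_add std_normal_cos std_normal_sin)
qed

context prob_space
begin

lemma centered_gaussian_cases:
  assumes "centered_gaussian M Y"
  obtains (zero) "AE \<omega> in M. Y \<omega> = 0"
  | (normal) \<sigma> X where "0 < \<sigma>" "X \<in> borel_measurable M" "distr M borel X = std_normal_distribution" "\<And>\<omega>. Y \<omega> = \<sigma> * X \<omega>"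
proof -
  consider "AE \<omega> in M. Y \<omega> = 0" | \<sigma> where "\<sigma> > 0" "distributed M lborel Y (\<lambda>x. ennreal (normal_density 0 \<sigma> x))"
    using assms by (auto simp: centered_gaussian_def)
  then show ?thesis
  proof cases
    case 1 then show ?thesis by (rule zero)
  next
    case (2 \<sigma>)
    then have "distributed M lborel (\<lambda>x. (Y x - 0) / \<sigma>) (\<lambda>x. ennreal (std_normal_density x))"
      by (subst normal_standard_normal_convert[symmetric]) auto
    then have d: "distr M lborel (\<lambda>x. Y x / \<sigma>) = std_normal_distribution"
      by (simp add: distributed_def)
    have "distr M borel (\<lambda>x. Y x / \<sigma>) = distr M lborel (\<lambda>x. Y x / \<sigma>)" by (intro distr_cong) auto
    with d show ?thesis
      using 2 assms by (intro normal[of \<sigma> "\<lambda>\<omega>. Y \<omega> / \<sigma>"]) (auto simp: centered_gaussian_def)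
  qed
qed

lemma centered_gaussian_power_integrable:
  assumes "centered_gaussian M Y"
  shows "integrable M (\<lambda>\<omega>. Y \<omega> ^ k)"
  using assms
proof (cases rule: centered_gaussian_cases)
  case zero
  have [measurable]: "Y \<in> borel_measurable M" using assms by (simp add: centered_gaussian_def)
  have "integrable M (\<lambda>\<omega>. 0 ^ k :: real)" by simp
  then show ?thesis
    by (subst integrable_cong_AE[where g="\<lambda>\<omega>. 0 ^ k"]) (use zero in auto)
next
  case (normal \<sigma> X)
  have [measurable]: "X \<in> borel_measurable M" by fact
  have "integrable (distr M borel X) (\<lambda>x. x ^ k)"
    unfolding normal by (rule integrable_std_normal_distribution_moment)
  then have "integrable M (\<lambda>\<omega>. X \<omega> ^ k)" by (subst (asm) integrable_distr_eq) auto
  then show ?thesis by (simp add: normal power_mult_distrib)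
qed

lemma centered_gaussian_L2: "centered_gaussian M Y \<Longrightarrow> Y \<in> L2 M"
  using centered_gaussian_power_integrable[of Y 2] by (simp add: L2_def centered_gaussian_def)

lemma centered_gaussian_cos:
  assumes "centered_gaussian M Y"
  shows "(\<integral>\<omega>. cos (c + Y \<omega>) \<partial>M) = exp (- (\<integral>\<omega>. (Y \<omega>)\<^sup>2 \<partial>M) / 2) * cos c"
  using assms
proof (cases rule: centered_gaussian_cases)
  case zero
  have [measurable]: "Y \<in> borel_measurable M" using assms by (simp add: centered_gaussian_def)
  have "(\<integral>\<omega>. cos (c + Y \<omega>) \<partial>M) = (\<integral>\<omega>. cos c \<partial>M)" by (rule integral_cong_AE) (use zero in auto)
  moreover have "(\<integral>\<omega>. (Y \<omega>)\<^sup>2 \<partial>M) = (\<integral>\<omega>. 0 \<partial>M)" by (rule integral_cong_AE) (use zero in auto)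
  ultimately show ?thesis by (simp add: prob_space)
next
  case (normal \<sigma> X)
  have [measurable]: "X \<in> borel_measurable M" by fact
  have "(\<integral>\<omega>. cos (c + Y \<omega>) \<partial>M) = (\<integral>x. cos (c + \<sigma> * x) \<partial>distr M borel X)"
    by (subst integral_distr) (auto simp: normal)
  also have "\<dots> = exp (- \<sigma>\<^sup>2 / 2) * cos c" unfolding normal by (rule std_normal_cos_shift)
  also have "(\<integral>\<omega>. (X \<omega>)\<^sup>2 \<partial>M) = (\<integral>x. x ^ (2 * 1) \<partial>distr M borel X)"
    by (subst integral_distr) auto
  then have "(\<integral>\<omega>. (X \<omega>)\<^sup>2 \<partial>M) = 1"
    unfolding normal by (subst (asm) std_normal_distribution_even_moments) auto
  then have "(\<integral>\<omega>. (Y \<omega>)\<^sup>2 \<partial>M) = \<sigma>\<^sup>2" by (simp add: normal power_mult_distrib)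
  ultimately show ?thesis by simp
qed

end

locale gaussian_space = prob_space M for M :: "'o measure" +
  fixes W :: "'v::real_inner \<Rightarrow> 'o \<Rightarrow> real"
  assumes isonormal: "isonormal_process M W"
begin

lemma W_gaussian: "centered_gaussian M (W v)"
proof -
  have "\<forall>(m::nat) c v. centered_gaussian M (\<lambda>\<omega>. \<Sum>i<m. c i * W (v i) \<omega>)"
    using isonormal by (simp add: isonormal_process_def)
  from this[rule_format, of "\<lambda>_. 1" "\<lambda>_. v" "Suc 0"] show ?thesis by simp
qed

lemma W_measurable[measurable]: "W v \<in> borel_measurable M"
  using W_gaussian by (simp add: centered_gaussian_def)

lemma W_L2: "W v \<in> L2 M"
  by (rule centered_gaussian_L2[OF W_gaussian])

lemma W_sum_gaussian: "centered_gaussian M (\<lambda>\<omega>. \<Sum>i<(m::nat). c i * W (v i) \<omega>)"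
  using isonormal by (simp add: isonormal_process_def)

lemma W_cov: "(\<integral>\<omega>. W v \<omega> * W w \<omega> \<partial>M) = inner v w"
  using isonormal by (simp add: isonormal_process_def)

lemma W_sum_variance:
  "(\<integral>\<omega>. (\<Sum>i<(m::nat). c i * W (v i) \<omega>)\<^sup>2 \<partial>M) = (norm (\<Sum>i<m. c i *\<^sub>R v i))\<^sup>2"
proof -
  have "(\<integral>\<omega>. (\<Sum>i<m. c i * W (v i) \<omega>)\<^sup>2 \<partial>M)
     = (\<integral>\<omega>. (\<Sum>i<m. \<Sum>j<m. c i * c j * (W (v i) \<omega> * W (v j) \<omega>)) \<partial>M)"
    by (simp add: power2_eq_square sum_product ac_simps)
  also have "\<dots> = (\<Sum>i<m. \<Sum>j<m. c i * c j * inner (v i) (v j))"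
    using L2_mult_integrable[OF W_L2 W_L2] by (simp add: W_cov)
  also have "\<dots> = (norm (\<Sum>i<m. c i *\<^sub>R v i))\<^sup>2"
    by (simp add: power2_norm_eq_inner inner_sum_left inner_sum_right sum_distrib_left inner_commute ac_simps)
  finally show ?thesis .
qed

lemma W_sum_cos:
  "(\<integral>\<omega>. cos (d + (\<Sum>i<(m::nat). c i * W (v i) \<omega>)) \<partial>M) = exp (- (norm (\<Sum>i<m. c i *\<^sub>R v i))\<^sup>2 / 2) * cos d"
  by (subst centered_gaussian_cos[OF W_sum_gaussian]) (simp add: W_sum_variance)

lemma W_poly_integrable: "integrable M (\<lambda>\<omega>. poly p (W v \<omega>))"
  unfolding poly_altdef by (intro Bochner_Integration.integrable_sum integrable_mult_right centered_gaussian_power_integrable W_gaussian)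

lemma W_poly_L2: "(\<lambda>\<omega>. poly p (W v \<omega>)) \<in> L2 M"
proof -
  have [measurable]: "(\<lambda>\<omega>. poly p (W v \<omega>)) \<in> borel_measurable M"
    by (rule borel_measurable_integrable[OF W_poly_integrable])
  show ?thesis unfolding L2_def using W_poly_integrable[of "p * p" v] by (simp add: power2_eq_square)
qed

lemma pair_char:
  "(\<integral>z. cos (d + ((\<Sum>i<(m::nat). a i * W (v i) (fst z)) + (\<Sum>i<m. b i * W (v i) (snd z)))) \<partial>(M \<Otimes>\<^sub>M M))
   = exp (- ((norm (\<Sum>i<m. a i *\<^sub>R v i))\<^sup>2 + (norm (\<Sum>i<m. b i *\<^sub>R v i))\<^sup>2) / 2) * cos d"
proof -
  interpret P: pair_prob_space M M ..
  have i: "integrable (M \<Otimes>\<^sub>M M) (\<lambda>z. cos (d + ((\<Sum>i<m. a i * W (v i) (fst z)) + (\<Sum>i<m. b i * W (v i) (snd z)))))"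
    by (intro P.P.integrable_const_bound[where B=1]) auto
  have "(\<integral>z. cos (d + ((\<Sum>i<m. a i * W (v i) (fst z)) + (\<Sum>i<m. b i * W (v i) (snd z)))) \<partial>(M \<Otimes>\<^sub>M M))
     = (\<integral>x. (\<integral>y. cos (d + ((\<Sum>i<m. a i * W (v i) x) + (\<Sum>i<m. b i * W (v i) y))) \<partial>M) \<partial>M)"
    using P.integral_fst'[OF i] by simp
  also have "\<dots> = (\<integral>x. exp (- (norm (\<Sum>i<m. b i *\<^sub>R v i))\<^sup>2 / 2) * cos (d + (\<Sum>i<m. a i * W (v i) x)) \<partial>M)"
    using W_sum_cos[of "d + (\<Sum>i<m. a i * W (v i) _)" b v m] by (simp add: add.assoc)
  also have "\<dots> = exp (- (norm (\<Sum>i<m. b i *\<^sub>R v i))\<^sup>2 / 2) * (exp (- (norm (\<Sum>i<m. a i *\<^sub>R v i))\<^sup>2 / 2) * cos d)"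
    by (simp add: W_sum_cos)
  finally show ?thesis by (simp add: exp_add[symmetric] mult.assoc[symmetric] add_divide_distrib)
qed

text \<open>Two independent copies of the process, rotated in their plane, are again two independent copies: a
  rotation preserves \<open>\<parallel>\<alpha>\<parallel>\<^sup>2 +
  \<parallel>\<beta>\<parallel>\<^sup>2\<close>, on which alone the characteristic function depends.\<close>

lemma rotated_law:
  fixes v :: "nat \<Rightarrow> 'v" and m :: nat and c s :: real
  assumes cs: "c\<^sup>2 + s\<^sup>2 = 1"
  shows "distr (M \<Otimes>\<^sub>M M) (PiM ({..<m} \<times> UNIV) (\<lambda>_. borel))
      (\<lambda>z. \<lambda>p\<in>{..<m} \<times> UNIV. if snd p then c * W (v (fst p)) (fst z) + s * W (v (fst p)) (snd z)
                              else - s * W (v (fst p)) (fst z) + c * W (v (fst p)) (snd z))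
    = distr (M \<Otimes>\<^sub>M M) (PiM ({..<m} \<times> UNIV) (\<lambda>_. borel))
      (\<lambda>z. \<lambda>p\<in>{..<m} \<times> UNIV. if snd p then W (v (fst p)) (fst z) else W (v (fst p)) (snd z))"
proof (rule joint_law_unique)
  interpret P: pair_prob_space M M ..
  show "prob_space (M \<Otimes>\<^sub>M M)" "prob_space (M \<Otimes>\<^sub>M M)" by (rule P.P.prob_space_axioms)+
  fix t :: "nat \<times> bool \<Rightarrow> real" and d :: real
  define a b where "a i = c * t (i, True) - s * t (i, False)" and "b i = s * t (i, True) + c * t (i, False)" for i
  define \<alpha> \<beta> where "\<alpha> = (\<Sum>i<m. t (i, True) *\<^sub>R v i)" and "\<beta> = (\<Sum>i<m. t (i, False) *\<^sub>R v i)"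
  have split: "(\<Sum>p\<in>{..<m} \<times> (UNIV :: bool set). f p) = (\<Sum>i<m. f (i, True) + f (i, False))" for f :: "nat \<times> bool \<Rightarrow> real"
  proof -
    have "(\<Sum>p\<in>{..<m} \<times> (UNIV :: bool set). f p) = (\<Sum>(i, b)\<in>{..<m} \<times> (UNIV :: bool set). f (i, b))"
      by (simp add: case_prod_unfold)
    also have "\<dots> = (\<Sum>i<m. \<Sum>b\<in>UNIV. f (i, b))" by (rule sum.cartesian_product[symmetric])
    finally show ?thesis by (simp add: UNIV_bool add.commute)
  qed
  have e1: "(\<Sum>p\<in>{..<m} \<times> UNIV. t p * (if snd p then c * W (v (fst p)) (fst z) + s * W (v (fst p)) (snd z)
              else - s * W (v (fst p)) (fst z) + c * W (v (fst p)) (snd z)))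
     = (\<Sum>i<m. a i * W (v i) (fst z)) + (\<Sum>i<m. b i * W (v i) (snd z))" for z
    unfolding split a_def b_def sum.distrib[symmetric] by (intro sum.cong) (auto simp: algebra_simps)
  have e2: "(\<Sum>p\<in>{..<m} \<times> UNIV. t p * (if snd p then W (v (fst p)) (fst z) else W (v (fst p)) (snd z)))
     = (\<Sum>i<m. t (i, True) * W (v i) (fst z)) + (\<Sum>i<m. t (i, False) * W (v i) (snd z))" for z
    unfolding split sum.distrib[symmetric] by (intro sum.cong) auto
  have "(\<Sum>i<m. a i *\<^sub>R v i) = c *\<^sub>R \<alpha> - s *\<^sub>R \<beta>" "(\<Sum>i<m. b i *\<^sub>R v i) = s *\<^sub>R \<alpha> + c *\<^sub>R \<beta>"
    by (simp_all add: a_def b_def \<alpha>_def \<beta>_def scaleR_sum_right sum_subtractf[symmetric] sum.distrib[symmetric] algebra_simps)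
  then have "(norm (\<Sum>i<m. a i *\<^sub>R v i))\<^sup>2 + (norm (\<Sum>i<m. b i *\<^sub>R v i))\<^sup>2
      = (c\<^sup>2 + s\<^sup>2) * ((norm \<alpha>)\<^sup>2 + (norm \<beta>)\<^sup>2)"
    by (simp only: power2_norm_eq_inner)
       (simp add: inner_add_left inner_add_right inner_diff_left inner_diff_right inner_commute
          power2_eq_square[of c] power2_eq_square[of s] algebra_simps)
  then have n: "(norm (\<Sum>i<m. a i *\<^sub>R v i))\<^sup>2 + (norm (\<Sum>i<m. b i *\<^sub>R v i))\<^sup>2 = (norm \<alpha>)\<^sup>2 + (norm \<beta>)\<^sup>2"
    using cs by simp
  show "(\<integral>z. cos (d + (\<Sum>p\<in>{..<m} \<times> UNIV. t p * (if snd p then c * W (v (fst p)) (fst z) + s * W (v (fst p)) (snd z)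
              else - s * W (v (fst p)) (fst z) + c * W (v (fst p)) (snd z)))) \<partial>(M \<Otimes>\<^sub>M M))
     = (\<integral>z. cos (d + (\<Sum>p\<in>{..<m} \<times> UNIV. t p * (if snd p then W (v (fst p)) (fst z) else W (v (fst p)) (snd z)))) \<partial>(M \<Otimes>\<^sub>M M))"
    unfolding e1 e2 pair_char n \<alpha>_def[symmetric] \<beta>_def[symmetric] ..
qed (auto split: if_splits)

end

section \<open>Hermite polynomials\<close>

lemma deriv_gauss_iter:
  "\<exists>p. degree p \<le> k \<and> (deriv ^^ k) (\<lambda>y. exp (- y\<^sup>2 / 2)) = (\<lambda>x::real. poly p x * exp (- x\<^sup>2 / 2))"
proof (induction k)
  case 0
  show ?case by (intro exI[of _ 1]) auto
next
  case (Suc k)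
  then obtain p where p: "degree p \<le> k" "(deriv ^^ k) (\<lambda>y. exp (- y\<^sup>2 / 2)) = (\<lambda>x::real. poly p x * exp (- x\<^sup>2 / 2))" by auto
  define q where "q = pderiv p - [:0, 1:] * p"
  have "degree q \<le> Suc k" unfolding q_def
  proof (rule degree_diff_le)
    show "degree (pderiv p) \<le> Suc k" using p(1) by (simp add: degree_pderiv)
    show "degree ([:0, 1:] * p) \<le> Suc k" using p(1) degree_mult_le[of "[:0, 1:]" p] by auto
  qed
  moreover have "(deriv ^^ Suc k) (\<lambda>y. exp (- y\<^sup>2 / 2)) = (\<lambda>x::real. poly q x * exp (- x\<^sup>2 / 2))"
  proof
    fix x :: real
    have "((\<lambda>x. poly p x * exp (- x\<^sup>2 / 2)) has_field_derivative (poly q x * exp (- x\<^sup>2 / 2))) (at x)"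
      unfolding q_def by (auto intro!: derivative_eq_intros simp: algebra_simps)
    then show "(deriv ^^ Suc k) (\<lambda>y. exp (- y\<^sup>2 / 2)) x = poly q x * exp (- x\<^sup>2 / 2)"
      unfolding funpow.simps(2) o_apply p(2) by (rule DERIV_imp_deriv)
  qed
  ultimately show ?case by blast
qed

lemma hermite_poly: "\<exists>p. degree p \<le> k \<and> hermite k = poly p"
proof -
  obtain p where p: "degree p \<le> k" "(deriv ^^ k) (\<lambda>y. exp (- y\<^sup>2 / 2)) = (\<lambda>x::real. poly p x * exp (- x\<^sup>2 / 2))"
    using deriv_gauss_iter by blast
  have "hermite k = poly (smult ((-1) ^ k / fact k) p)"
    unfolding hermite_def p(2) by (rule ext) (simp add: exp_minus field_simps)
  moreover have "degree (smult ((-1) ^ k / fact k) p) \<le> k" using p(1) degree_smult_le order_trans by blast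
  ultimately show ?thesis by blast
qed

lemma hermite_0: "hermite 0 x = 1"
  by (simp add: hermite_def exp_minus)

lemma hermite_1: "hermite (Suc 0) x = x"
proof -
  have "((\<lambda>x. exp (- x\<^sup>2 / 2)) has_field_derivative (- x * exp (- x\<^sup>2 / 2))) (at x)" for x :: real
    by (auto intro!: derivative_eq_intros)
  then have "deriv (\<lambda>x. exp (- x\<^sup>2 / 2)) x = - x * exp (- x\<^sup>2 / 2)" by (rule DERIV_imp_deriv)
  then show ?thesis by (simp add: hermite_def exp_minus)
qed

lemma hermite_measurable[measurable]: "hermite k \<in> borel_measurable borel"
proof -
  obtain p where "hermite k = poly p" using hermite_poly by blast
  moreover have "(\<lambda>x. poly p x) \<in> borel_measurable borel"
    by (intro borel_measurable_continuous_onI continuous_intros)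
  ultimately show ?thesis by simp
qed

section \<open>Interpolation on the circle\<close>

text \<open>Lagrange interpolation: \<open>q\<close> minus its interpolant has more roots than its degree allows.\<close>

lemma poly_interpolation_at_0:
  fixes S :: "real set"
  assumes S: "finite S" "card S = Suc D"
  shows "\<exists>L. \<forall>q. degree q \<le> D \<longrightarrow> poly q 0 = (\<Sum>s\<in>S. L s * poly q s)"
proof -
  define l where "l s = smult (1 / (\<Prod>u\<in>S - {s}. s - u)) (\<Prod>u\<in>S - {s}. [:- u, 1:])" for s
  have l1: "poly (l s) s = 1" if "s \<in> S" for s
  proof -
    have "(\<Prod>u\<in>S - {s}. s - u) \<noteq> 0" using S by (simp add: prod_zero_iff)
    then show ?thesis by (simp add: l_def poly_prod)
  qed
  have l0: "poly (l s) u = 0" if "s \<in> S" "u \<in> S" "u \<noteq> s" for s u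
    using that S by (auto simp: l_def poly_prod prod_zero_iff)
  have dl: "degree (l s) \<le> D" if "s \<in> S" for s
  proof -
    have "degree (\<Prod>u\<in>S - {s}. [:- u, 1:]) \<le> sum (degree \<circ> (\<lambda>u. [:- u, 1:])) (S - {s})"
      by (rule degree_prod_sum_le) (use S in auto)
    also have "\<dots> = D" using S that by (simp add: card_Diff_singleton)
    finally show ?thesis unfolding l_def using degree_smult_le order_trans by blast
  qed
  show ?thesis
  proof (intro exI[of _ "\<lambda>s. poly (l s) 0"] allI impI)
    fix q :: "real poly" assume q: "degree q \<le> D"
    define r where "r = q - (\<Sum>s\<in>S. smult (poly q s) (l s))"
    have dr: "degree r \<le> D"
      unfolding r_def by (intro degree_diff_le q degree_sum_le) (use S dl degree_smult_le order_trans in blast)+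
    have zr: "poly r u = 0" if u: "u \<in> S" for u
    proof -
      have "(\<Sum>s\<in>S. poly q s * poly (l s) u) = (\<Sum>s\<in>S. if s = u then poly q s else 0)"
        using u l0 l1 by (intro sum.cong) auto
      then show ?thesis using S u by (simp add: r_def poly_sum)
    qed
    have "r = 0"
    proof (rule ccontr)
      assume r: "r \<noteq> 0"
      have "card S \<le> card {x. poly r x = 0}"
        using zr poly_roots_finite[OF r] by (intro card_mono) auto
      also have "\<dots> \<le> degree r" by (rule card_poly_roots_bound[OF r])
      finally show False using S dr by simp
    qed
    then have "q = (\<Sum>s\<in>S. smult (poly q s) (l s))" by (simp add: r_def)
    then have "poly q 0 = poly (\<Sum>s\<in>S. smult (poly q s) (l s)) 0" by simp
    then show "poly q 0 = (\<Sum>s\<in>S. poly (l s) 0 * poly q s)" by (simp add: poly_sum mult.commute)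
  qed
qed

text \<open>The unit circle in terms of \<open>t = tan (\<theta>/2)\<close>. A trigonometric polynomial of degree \<open>n\<close>
  becomes an algebraic polynomial of degree \<open>2n\<close> divided by \<open>(1 + t\<^sup>2)\<^sup>n\<close>, so ordinary
  interpolation applies.\<close>

definition circ_c :: "real \<Rightarrow> real" where "circ_c t = (1 - t\<^sup>2) / (1 + t\<^sup>2)"
definition circ_s :: "real \<Rightarrow> real" where "circ_s t = 2 * t / (1 + t\<^sup>2)"

lemma one_plus_sq_pos: "0 < 1 + (t::real)\<^sup>2"
  by (simp add: add_pos_nonneg)

lemma circ_unit: "(circ_c t)\<^sup>2 + (circ_s t)\<^sup>2 = 1"
proof -
  have "(1 - t\<^sup>2)\<^sup>2 + (2 * t)\<^sup>2 = (1 + t\<^sup>2)\<^sup>2" by (simp add: power2_eq_square algebra_simps)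
  then show ?thesis using one_plus_sq_pos[of t]
    by (simp add: circ_c_def circ_s_def power_divide add_divide_distrib[symmetric])
qed

text \<open>In the parameter \<open>t\<close>, a quarter turn is the Moebius map \<open>t \<mapsto> (1 + t)/(1 - t)\<close>, by the
  addition theorem of the tangent.\<close>

lemma circ_quarter:
  assumes "t < 1"
  shows "circ_c ((1 + t) / (1 - t)) = - circ_s t" "circ_s ((1 + t) / (1 - t)) = circ_c t"
proof -
  have p: "1 - t \<noteq> 0" using assms by simp
  have gen: "(a / q) / (b / q) = a / b" if "q \<noteq> 0" for a b q :: real using that by simp
  have e: "1 + ((1 + t) / (1 - t))\<^sup>2 = 2 * (1 + t\<^sup>2) / (1 - t)\<^sup>2"
    using p by (simp add: power_divide divide_simps) (simp add: power2_eq_square algebra_simps)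
  have e2: "1 - ((1 + t) / (1 - t))\<^sup>2 = - 4 * t / (1 - t)\<^sup>2"
    using p by (simp add: power_divide divide_simps) (simp add: power2_eq_square algebra_simps)
  have e3: "2 * ((1 + t) / (1 - t)) = 2 * (1 - t\<^sup>2) / (1 - t)\<^sup>2"
    using p by (simp add: power_divide divide_simps) (simp add: power2_eq_square algebra_simps)
  show "circ_c ((1 + t) / (1 - t)) = - circ_s t" unfolding circ_c_def circ_s_def e e2
    using p one_plus_sq_pos[of t] by (simp add: field_simps)
  show "circ_s ((1 + t) / (1 - t)) = circ_c t" 
  proof -
    have "circ_s ((1 + t) / (1 - t)) = (2 * (1 - t\<^sup>2) / (1 - t)\<^sup>2) / (2 * (1 + t\<^sup>2) / (1 - t)\<^sup>2)"
      unfolding circ_s_def e e3 ..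
    also have "\<dots> = 2 * (1 - t\<^sup>2) / (2 * (1 + t\<^sup>2))" by (rule gen) (use p in simp)
    finally show ?thesis by (simp only: circ_c_def mult_divide_mult_cancel_left)
  qed
qed

lemma poly_on_circle:
  fixes p :: "real poly"
  assumes "degree p \<le> n"
  shows "\<exists>q. degree q \<le> 2 * n \<and> (\<forall>t. poly q t = (1 + t\<^sup>2) ^ n * poly p (circ_c t * x + circ_s t * y))"
proof -
  define A where "A = [:x, 2 * y, - x:]"
  define B where "B = [:1, 0, 1::real:]"
  define q where "q = (\<Sum>j\<le>degree p. smult (coeff p j) (A ^ j * B ^ (n - j)))"
  have dA: "degree A \<le> 2" and dB: "degree B \<le> 2" by (auto simp: A_def B_def)
  have "degree (smult (coeff p j) (A ^ j * B ^ (n - j))) \<le> 2 * n" if "j \<le> degree p" for j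
  proof -
    have "degree (A ^ j * B ^ (n - j)) \<le> degree A * j + degree B * (n - j)"
      using degree_mult_le[of "A ^ j" "B ^ (n - j)"] degree_power_le[of A j] degree_power_le[of B "n - j"] by linarith
    also have "\<dots> \<le> 2 * j + 2 * (n - j)" using dA dB by (intro add_mono mult_right_mono) auto
    also have "\<dots> = 2 * n" using that assms by simp
    finally show ?thesis using degree_smult_le order_trans by blast
  qed
  then have "degree q \<le> 2 * n" unfolding q_def by (intro degree_sum_le) auto
  moreover have "poly q t = (1 + t\<^sup>2) ^ n * poly p (circ_c t * x + circ_s t * y)" for t
  proof -
    define u where "u = 1 + t\<^sup>2"
    have u: "u \<noteq> 0" using one_plus_sq_pos[of t] by (simp add: u_def)
    have cs: "circ_c t * x + circ_s t * y = poly A t / u"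
      unfolding circ_c_def circ_s_def u_def[symmetric] A_def by (simp add: add_divide_distrib[symmetric] power2_eq_square algebra_simps)
    have pB: "poly B t = u" by (simp add: B_def u_def power2_eq_square)
    have "u ^ n * (coeff p j * (poly A t / u) ^ j) = coeff p j * (poly A t ^ j * u ^ (n - j))" if "j \<le> degree p" for j
    proof -
      have "u ^ n = u ^ j * u ^ (n - j)" using that assms by (simp add: power_add[symmetric])
      then show ?thesis using u by (simp add: power_divide)
    qed
    note e = this
    have "poly q t = (\<Sum>j\<le>degree p. coeff p j * (poly A t ^ j * u ^ (n - j)))"
      by (simp add: q_def poly_sum pB)
    also have "\<dots> = (\<Sum>j\<le>degree p. u ^ n * (coeff p j * (poly A t / u) ^ j))"
      by (intro sum.cong refl e[symmetric]) simp
    also have "\<dots> = u ^ n * poly p (poly A t / u)" by (simp add: poly_altdef[of p] sum_distrib_left)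
    finally show ?thesis unfolding cs u_def[symmetric] .
  qed
  ultimately show ?thesis by blast
qed

text \<open>From each pair of parameters a quarter turn apart either one may be chosen: the chosen parameters
  are always distinct, hence interpolation nodes. One constant serves all choices because there are
  finitely many node sets.\<close>

lemma circle_interpolation:
  fixes n :: nat
  obtains t :: "nat \<Rightarrow> real" and C where "1 \<le> C" "\<And>j. 0 < t j \<and> t j \<le> 1 / 4"
    "\<And>(Q :: nat \<Rightarrow> real poly) (y :: nat \<Rightarrow> 'x::real_normed_vector) m c b.
       (\<And>i. i < m \<Longrightarrow> degree (Q i) \<le> 2 * n) \<Longrightarrow> 
       (\<And>j. j < 2 * n + 1 \<Longrightarrow> norm (\<Sum>i<m. poly (Q i) (if b j then t j else (1 + t j) / (1 - t j)) *\<^sub>R y i) \<le> c) \<Longrightarrow> 0 \<le> c \<Longrightarrow>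
       norm (\<Sum>i<m. poly (Q i) 0 *\<^sub>R y i) \<le> C * c"
proof -
  \<comment> \<open>All \<open>t j\<close> lie below 1 and all their partners \<open>u j\<close> above 1, so no two of these parameters coincide.\<close>
  define t :: "nat \<Rightarrow> real" where "t j = 1 / (real j + 4)" for j
  define u where "u j = (1 + t j) / (1 - t j)" for j
  have t01: "0 < t j" "t j < 1" for j by (auto simp: t_def)
  have tinj: "t i = t j \<longleftrightarrow> i = j" for i j by (auto simp: t_def)
  have u1: "1 < u j" for j using t01[of j] by (simp add: u_def)
  have uinj: "u i = u j \<longleftrightarrow> i = j" for i j
  proof -
    have "u i = u j \<longleftrightarrow> t i = t j" unfolding u_def using t01[of i] t01[of j] by (simp add: frac_eq_eq) (auto simp: algebra_simps)
    then show ?thesis using tinj by simp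
  qed
  have tu: "t i \<noteq> u j" for i j using t01[of i] u1[of j] by simp
  define Nodes where "Nodes = t ` {..<2*n+1} \<union> u ` {..<2*n+1}"
  have fN: "finite Nodes" by (simp add: Nodes_def)
  have "\<forall>S::real set. \<exists>l. finite S \<and> card S = Suc (2 * n) \<longrightarrow> (\<forall>q. degree q \<le> 2 * n \<longrightarrow> poly q 0 = (\<Sum>s\<in>S. l s * poly q s))"
  proof
    fix S :: "real set"
    show "\<exists>l. finite S \<and> card S = Suc (2 * n) \<longrightarrow> (\<forall>q. degree q \<le> 2 * n \<longrightarrow> poly q 0 = (\<Sum>s\<in>S. l s * poly q s))"
      using poly_interpolation_at_0[of S "2 * n"] by blast
  qed
  from choice[OF this] obtain L :: "real set \<Rightarrow> real \<Rightarrow> real" where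
    L: "\<And>S q. finite S \<Longrightarrow> card S = Suc (2 * n) \<Longrightarrow> degree q \<le> 2 * n \<Longrightarrow> poly q 0 = (\<Sum>s\<in>S. L S s * poly q s)" by blast
  define C where "C = 1 + (\<Sum>S\<in>Pow Nodes. \<Sum>s\<in>S. \<bar>L S s\<bar>)"
  have C1: "1 \<le> C" unfolding C_def by (simp add: sum_nonneg)
  show ?thesis
  proof (rule that[of C t])
    show "1 \<le> C" by (rule C1)
    show "0 < t j \<and> t j \<le> 1 / 4" for j by (simp add: t_def)
    fix Q :: "nat \<Rightarrow> real poly" and y :: "nat \<Rightarrow> 'x" and m c and b :: "nat \<Rightarrow> bool"
    assume Q: "\<And>i. i < m \<Longrightarrow> degree (Q i) \<le> 2 * n" and c: "0 \<le> c"
      and le: "\<And>j. j < 2 * n + 1 \<Longrightarrow> norm (\<Sum>i<m. poly (Q i) (if b j then t j else (1 + t j) / (1 - t j)) *\<^sub>R y i) \<le> c"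
    define w where "w j = (if b j then t j else u j)" for j
    define S where "S = w ` {..<2*n+1}"
    have wi: "inj_on w {..<2*n+1}"
      by (rule inj_onI) (auto simp: w_def tinj uinj tu tu[symmetric] split: if_splits)
    have S: "finite S" "card S = Suc (2 * n)" "S \<in> Pow Nodes"
      using card_image[OF wi] by (auto simp: S_def Nodes_def w_def)
    have "(\<Sum>i<m. poly (Q i) 0 *\<^sub>R y i) = (\<Sum>i<m. (\<Sum>s\<in>S. L S s * poly (Q i) s) *\<^sub>R y i)"
      using L[OF S(1,2) Q] by (intro sum.cong) auto
    also have "\<dots> = (\<Sum>i<m. \<Sum>s\<in>S. L S s *\<^sub>R (poly (Q i) s *\<^sub>R y i))"
      by (simp add: scaleR_sum_left)
    also have "\<dots> = (\<Sum>s\<in>S. L S s *\<^sub>R (\<Sum>i<m. poly (Q i) s *\<^sub>R y i))"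
      by (subst sum.swap) (simp add: scaleR_sum_right)
    finally have e: "(\<Sum>i<m. poly (Q i) 0 *\<^sub>R y i) = (\<Sum>s\<in>S. L S s *\<^sub>R (\<Sum>i<m. poly (Q i) s *\<^sub>R y i))" .
    have "norm (\<Sum>i<m. poly (Q i) 0 *\<^sub>R y i) \<le> (\<Sum>s\<in>S. norm (L S s *\<^sub>R (\<Sum>i<m. poly (Q i) s *\<^sub>R y i)))"
      unfolding e by (rule norm_sum)
    also have "\<dots> \<le> (\<Sum>s\<in>S. \<bar>L S s\<bar> * c)"
    proof (rule sum_mono)
      fix s assume "s \<in> S"
      then obtain j where "j < 2 * n + 1" "s = w j" by (auto simp: S_def)
      then have "norm (\<Sum>i<m. poly (Q i) s *\<^sub>R y i) \<le> c" using le[of j] unfolding w_def u_def by (simp only:)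
      then show "norm (L S s *\<^sub>R (\<Sum>i<m. poly (Q i) s *\<^sub>R y i)) \<le> \<bar>L S s\<bar> * c" by (simp add: mult_left_mono)
    qed
    also have "\<dots> = (\<Sum>s\<in>S. \<bar>L S s\<bar>) * c" by (simp add: sum_distrib_right)
    also have "\<dots> \<le> C * c"
    proof (rule mult_right_mono[OF _ c])
      have "(\<Sum>s\<in>S. \<bar>L S s\<bar>) \<le> (\<Sum>S\<in>Pow Nodes. \<Sum>s\<in>S. \<bar>L S s\<bar>)"
        using fN S(3) by (intro member_le_sum) (auto intro: sum_nonneg)
      then show "(\<Sum>s\<in>S. \<bar>L S s\<bar>) \<le> C" by (simp add: C_def)
    qed
    finally show "norm (\<Sum>i<m. poly (Q i) 0 *\<^sub>R y i) \<le> C * c" .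
  qed
qed



section \<open>Self-improving tails\<close>

text \<open>Iterating this inequality squares the tail again and again: as soon as \<open>N P(\<parallel>F\<parallel>
  > c) < 1\<close>, the tail of \<open>F\<close> decays faster than any power.\<close>

definition (in prob_space) self_improving :: "real \<Rightarrow> real \<Rightarrow> ('a \<Rightarrow> 'x::real_normed_vector) \<Rightarrow> bool" where
  "self_improving C N F \<longleftrightarrow> strongly_measurable M F \<and> (\<forall>c>0. tail F (C * c) \<le> N * (tail F c)\<^sup>2)"

text \<open>A vector-valued Hermite polynomial as a function of the values \<open>w\<close> of the process, so that it can
  also be evaluated at a rotated process. It is encoded as a list of terms because sums of polynomials
  are then concatenations.\<close>

definition hermite_sum :: "(nat \<times> 'v \<times> 'x::real_normed_vector) list \<Rightarrow> ('v \<Rightarrow> real) \<Rightarrow> 'x" where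
  "hermite_sum xs w = (\<Sum>(k, v, y)\<leftarrow>xs. hermite k (w v) *\<^sub>R y)"

lemma hermite_sum_nth:
  "hermite_sum xs w = (\<Sum>i<length xs. hermite (fst (xs ! i)) (w (fst (snd (xs ! i)))) *\<^sub>R snd (snd (xs ! i)))"
  unfolding hermite_sum_def by (subst sum_list_sum_nth) (auto simp: atLeast0LessThan case_prod_unfold intro!: sum.cong)

lemma (in prob_space) measure_pair_times:
  assumes "A \<in> events" "B \<in> events"
  shows "measure (M \<Otimes>\<^sub>M M) (A \<times> B) = prob A * prob B"
  unfolding measure_def emeasure_pair_measure_Times[OF assms] by (rule enn2real_mult)

text \<open>At the rotated process and at its quarter turn, the polynomial takes independent values with the law
  of \<open>F\<close>.\<close>

lemma (in gaussian_space) rotated_tail: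
  fixes k :: "nat \<Rightarrow> nat" and v :: "nat \<Rightarrow> 'v" and y :: "nat \<Rightarrow> 'x::real_normed_vector" and m :: nat and r s c :: real
  assumes rs: "r\<^sup>2 + s\<^sup>2 = 1"
  defines "F \<equiv> \<lambda>\<omega>. \<Sum>i<m. hermite (k i) (W (v i) \<omega>) *\<^sub>R y i"
  defines "G \<equiv> \<lambda>r s z. \<Sum>i<m. hermite (k i) (r * W (v i) (fst z) + s * W (v i) (snd z)) *\<^sub>R y i"
  shows "measure (M \<Otimes>\<^sub>M M) {z\<in>space (M \<Otimes>\<^sub>M M). c < norm (G r s z) \<and> c < norm (G (- s) r z)} = (tail F c)\<^sup>2"
    and "{z\<in>space (M \<Otimes>\<^sub>M M). c < norm (G r s z) \<and> c < norm (G (- s) r z)} \<in> sets (M \<Otimes>\<^sub>M M)"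
proof -
  interpret P: pair_prob_space M M ..
  let ?J = "{..<m} \<times> (UNIV :: bool set)"
  define H where "H b x = (\<Sum>i<m. hermite (k i) (x (i, b)) *\<^sub>R y i)" for b and x :: "nat \<times> bool \<Rightarrow> real"
  have "strongly_measurable (PiM ?J (\<lambda>_. borel)) (H b)" for b
    unfolding H_def
  proof (intro strongly_measurable_sum strongly_measurable_scaleR)
    fix i assume "i \<in> {..<m}"
    then have [measurable]: "(\<lambda>x. x (i, b)) \<in> measurable (PiM ?J (\<lambda>_. borel)) (borel :: real measure)"
      by (intro measurable_component_singleton) auto
    show "(\<lambda>x. hermite (k i) (x (i, b))) \<in> borel_measurable (PiM ?J (\<lambda>_. borel))" by measurable
  qed
  from strongly_measurable_norm[OF this]
  have [measurable]: "(\<lambda>x. norm (H b x)) \<in> borel_measurable (PiM ?J (\<lambda>_. borel))" for b .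
  define B where "B = {x\<in>space (PiM ?J (\<lambda>_. borel)). c < norm (H True x) \<and> c < norm (H False x)}"
  have B[measurable]: "B \<in> sets (PiM ?J (\<lambda>_. borel))" unfolding B_def by measurable
  let ?R = "\<lambda>z. \<lambda>p\<in>?J. if snd p then r * W (v (fst p)) (fst z) + s * W (v (fst p)) (snd z)
                              else - s * W (v (fst p)) (fst z) + r * W (v (fst p)) (snd z)"
  let ?I = "\<lambda>z. \<lambda>p\<in>?J. if snd p then W (v (fst p)) (fst z) else W (v (fst p)) (snd z)"
  have R[measurable]: "?R \<in> measurable (M \<Otimes>\<^sub>M M) (PiM ?J (\<lambda>_. borel))"
    by (intro measurable_restrict) (auto split: if_splits)
  have I[measurable]: "?I \<in> measurable (M \<Otimes>\<^sub>M M) (PiM ?J (\<lambda>_. borel))"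
    by (intro measurable_restrict) (auto split: if_splits)
  have HR: "H True (?R z) = G r s z" "H False (?R z) = G (- s) r z" for z
    unfolding H_def G_def by (auto intro!: sum.cong)
  have HI: "H True (?I z) = F (fst z)" "H False (?I z) = F (snd z)" for z
    unfolding H_def F_def by (auto intro!: sum.cong)
  have e1: "?R -` B \<inter> space (M \<Otimes>\<^sub>M M) = {z\<in>space (M \<Otimes>\<^sub>M M). c < norm (G r s z) \<and> c < norm (G (- s) r z)}"
    using measurable_space[OF R] unfolding B_def by (auto simp: HR simp del: restrict_apply)
  show "{z\<in>space (M \<Otimes>\<^sub>M M). c < norm (G r s z) \<and> c < norm (G (- s) r z)} \<in> sets (M \<Otimes>\<^sub>M M)"
    unfolding e1[symmetric] by measurable
  define A where "A = {\<omega>\<in>space M. c < norm (F \<omega>)}"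
  have "strongly_measurable M F"
    unfolding F_def by (intro strongly_measurable_sum strongly_measurable_scaleR) measurable
  then have A: "A \<in> sets M" unfolding A_def by (rule tail_sets)
  have e2: "?I -` B \<inter> space (M \<Otimes>\<^sub>M M) = A \<times> A"
    using measurable_space[OF I] unfolding B_def A_def by (auto simp: HI space_pair_measure simp del: restrict_apply)
  have "measure (M \<Otimes>\<^sub>M M) (?R -` B \<inter> space (M \<Otimes>\<^sub>M M)) = measure (M \<Otimes>\<^sub>M M) (?I -` B \<inter> space (M \<Otimes>\<^sub>M M))"
    using arg_cong[where f="\<lambda>D. measure D B", OF rotated_law[OF rs, of m v]] by (simp add: measure_distr)
  also have "\<dots> = prob A * prob A"
    unfolding e2 by (rule measure_pair_times[OF A A])
  finally show "measure (M \<Otimes>\<^sub>M M) {z\<in>space (M \<Otimes>\<^sub>M M). c < norm (G r s z) \<and> c < norm (G (- s) r z)} = (tail F c)\<^sup>2"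
    unfolding e1 by (simp add: tail_def A_def power2_eq_square)
qed

lemma circ_0: "circ_c 0 = 1" "circ_s 0 = 0"
  by (simp_all add: circ_c_def circ_s_def)

text \<open>If \<open>F\<close> exceeds \<open>C c\<close> at the first copy of the process, then interpolation from the rotated
  values forces one of the \<open>2n + 1\<close> pairs to exceed \<open>c\<close> at both members; each of these events has
  the probability \<open>P(\<parallel>F\<parallel> > c)\<^sup>2\<close>.\<close>

lemma (in gaussian_space) hermite_sum_self_improving:
  fixes n :: nat
  obtains C where "2 \<le> C"
    "\<And>xs :: (nat \<times> 'v \<times> 'x::real_normed_vector) list. (\<And>k v y. (k, v, y) \<in> set xs \<Longrightarrow> k \<le> n) \<Longrightarrow>
       self_improving C (real (2 * n + 1)) (\<lambda>\<omega>. hermite_sum xs (\<lambda>v. W v \<omega>))"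
proof -
  interpret P: pair_prob_space M M ..
  show ?thesis
  proof (rule circle_interpolation[where n=n and 'x='x])
    fix t :: "nat \<Rightarrow> real" and C0 assume C0: "1 \<le> C0" and t: "\<And>j. 0 < t j \<and> t j \<le> 1 / 4"
      and interp: "\<And>(Q :: nat \<Rightarrow> real poly) (y :: nat \<Rightarrow> 'x) m c b.
         (\<And>i. i < m \<Longrightarrow> degree (Q i) \<le> 2 * n) \<Longrightarrow> 
         (\<And>j. j < 2 * n + 1 \<Longrightarrow> norm (\<Sum>i<m. poly (Q i) (if b j then t j else (1 + t j) / (1 - t j)) *\<^sub>R y i) \<le> c) \<Longrightarrow> 0 \<le> c \<Longrightarrow>
         norm (\<Sum>i<m. poly (Q i) 0 *\<^sub>R y i) \<le> C0 * c"
    \<comment> \<open>The nodes satisfy \<open>0 < u \<le> 2\<close>, so the factor \<open>(1 + u\<^sup>2)\<^sup>n\<close> from clearing denominators is at most \<open>5\<^sup>n\<close>; adding 1 makes \<open>C \<ge> 2\<close>.\<close>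
    define C where "C = C0 * 5 ^ n + 1"
    have C2: "2 \<le> C" using mult_mono[of 1 C0 1 "5 ^ n"] C0 by (simp add: C_def)
    show ?thesis
    proof (rule that[OF C2])
      fix xs :: "(nat \<times> 'v \<times> 'x) list"
      assume xs: "\<And>k v y. (k, v, y) \<in> set xs \<Longrightarrow> k \<le> n"
      define m where "m = length xs"
      define k where "k i = fst (xs ! i)" for i
      define v where "v i = fst (snd (xs ! i))" for i
      define y where "y i = snd (snd (xs ! i))" for i
      have kn: "k i \<le> n" if "i < m" for i
        using xs[of "k i" "v i" "y i"] that by (simp add: k_def v_def y_def m_def)
      define F where "F \<omega> = (\<Sum>i<m. hermite (k i) (W (v i) \<omega>) *\<^sub>R y i)" for \<omega>
      have F: "(\<lambda>\<omega>. hermite_sum xs (\<lambda>v. W v \<omega>)) = F"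
        by (simp add: hermite_sum_nth F_def[abs_def] k_def v_def y_def m_def)
      define G where "G r s z = (\<Sum>i<m. hermite (k i) (r * W (v i) (fst z) + s * W (v i) (snd z)) *\<^sub>R y i)" for r s z
      have Fsm: "strongly_measurable M F"
        unfolding F_def[abs_def] by (intro strongly_measurable_sum strongly_measurable_scaleR) measurable
      have "tail F (C * c) \<le> real (2 * n + 1) * (tail F c)\<^sup>2" if c: "0 < c" for c
      proof -
        let ?P = "M \<Otimes>\<^sub>M M"
        define A where "A j = {z\<in>space ?P. c < norm (G (circ_c (t j)) (circ_s (t j)) z) \<and> c < norm (G (- circ_s (t j)) (circ_c (t j)) z)}" for j
        have A: "A j \<in> sets ?P" "measure ?P (A j) = (tail F c)\<^sup>2" for j
          unfolding A_def G_def F_def[abs_def] by (rule rotated_tail[OF circ_unit])+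
        have cover: "{\<omega>\<in>space M. C * c < norm (F \<omega>)} \<times> space M \<subseteq> (\<Union>j<2*n+1. A j)"
        proof (rule subsetI, rule ccontr)
          fix z assume z: "z \<in> {\<omega>\<in>space M. C * c < norm (F \<omega>)} \<times> space M" and "z \<notin> (\<Union>j<2*n+1. A j)"
          then have nA: "z \<notin> A j" if "j < 2 * n + 1" for j using that by auto
          have zs: "z \<in> space ?P" using z by (auto simp: space_pair_measure)
          define b where "b j \<longleftrightarrow> norm (G (circ_c (t j)) (circ_s (t j)) z) \<le> c" for j
          have nb: "norm (G (- circ_s (t j)) (circ_c (t j)) z) \<le> c" if "j < 2 * n + 1" "\<not> b j" for j
            using nA[OF that(1)] that(2) zs by (auto simp: A_def b_def)
          have "\<exists>q. degree q \<le> 2 * n \<and> (i < m \<longrightarrow> (\<forall>t. poly q t = (1 + t\<^sup>2) ^ n * hermite (k i) (circ_c t * W (v i) (fst z) + circ_s t * W (v i) (snd z))))" for i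
          proof (cases "i < m")
            case True
            obtain p where p: "degree p \<le> k i" "hermite (k i) = poly p" using hermite_poly by blast
            have "degree p \<le> n" using p(1) kn[OF True] by simp
            from poly_on_circle[OF this, of "W (v i) (fst z)" "W (v i) (snd z)"] show ?thesis unfolding p(2) by blast
          qed (auto intro: exI[of _ 0])
          then obtain Q where Q: "\<And>i. degree (Q i) \<le> 2 * n"
            "\<And>i t. i < m \<Longrightarrow> poly (Q i) t = (1 + t\<^sup>2) ^ n * hermite (k i) (circ_c t * W (v i) (fst z) + circ_s t * W (v i) (snd z))" by metis
          have QG: "(\<Sum>i<m. poly (Q i) u *\<^sub>R y i) = (1 + u\<^sup>2) ^ n *\<^sub>R G (circ_c u) (circ_s u) z" for u
            unfolding G_def scaleR_sum_right by (intro sum.cong) (auto simp: Q(2))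
          have "norm (\<Sum>i<m. poly (Q i) 0 *\<^sub>R y i) \<le> C0 * (5 ^ n * c)"
          proof (rule interp)
            show "degree (Q i) \<le> 2 * n" for i by (rule Q)
            show "0 \<le> 5 ^ n * c" using c by simp
            fix j assume j: "j < 2 * n + 1"
            define u where "u = (if b j then t j else (1 + t j) / (1 - t j))"
            have tj: "0 < t j" "t j \<le> 1 / 4" using t[of j] by auto
            have "(1 + t j) / (1 - t j) \<le> 2" "0 < (1 + t j) / (1 - t j)" using tj by (auto simp: field_simps)
            then have "0 < u" "u \<le> 2" using tj by (auto simp: u_def)
            then have "u\<^sup>2 \<le> 2\<^sup>2" by (intro power_mono) auto
            then have u5: "1 + u\<^sup>2 \<le> 5" by simp
            have "norm (G (circ_c u) (circ_s u) z) \<le> c"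
              using nb[OF j] circ_quarter[of "t j"] tj by (auto simp: u_def b_def)
            then have "(1 + u\<^sup>2) ^ n * norm (G (circ_c u) (circ_s u) z) \<le> 5 ^ n * c"
              using u5 one_plus_sq_pos[of u] by (intro mult_mono power_mono) auto
            then show "norm (\<Sum>i<m. poly (Q i) (if b j then t j else (1 + t j) / (1 - t j)) *\<^sub>R y i) \<le> 5 ^ n * c"
              unfolding u_def[symmetric] QG using one_plus_sq_pos[of u] by simp
          qed
          also have "(\<Sum>i<m. poly (Q i) 0 *\<^sub>R y i) = F (fst z)" unfolding QG by (simp add: circ_0 G_def F_def)
          finally have "norm (F (fst z)) \<le> C0 * 5 ^ n * c" by simp
          also have "\<dots> \<le> C * c" using c by (simp add: C_def)
          finally show False using z by auto
        qed
        have "tail F (C * c) = measure ?P ({\<omega>\<in>space M. C * c < norm (F \<omega>)} \<times> space M)"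
          unfolding tail_def by (subst measure_pair_times[OF tail_sets[OF Fsm] sets.top]) (simp add: prob_space)
        also have "\<dots> \<le> measure ?P (\<Union>j<2*n+1. A j)"
          using A cover by (intro P.P.finite_measure_mono) auto
        also have "\<dots> \<le> (\<Sum>j<2*n+1. measure ?P (A j))"
          using A by (intro P.P.finite_measure_subadditive_finite) auto
        also have "\<dots> = real (2 * n + 1) * (tail F c)\<^sup>2" by (simp add: A(2))
        finally show ?thesis .
      qed
      then show "self_improving C (real (2 * n + 1)) (\<lambda>\<omega>. hermite_sum xs (\<lambda>v. W v \<omega>))"
        unfolding F self_improving_def using Fsm by simp
    qed
  qed
qed

context prob_space
begin

text \<open>One factor 2 is lost in passing from the limit to a member of the sequence and another one on the
  way back.\<close>

lemma self_improving_limit: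
  assumes F: "\<And>k. self_improving C N (F k)" and N: "0 \<le> N" and C: "0 < C"
    and f: "strongly_measurable M f" and conv: "conv_prob F f"
  shows "self_improving (4 * C) N f"
  unfolding self_improving_def
proof (intro conjI f allI impI)
  fix c :: real assume c: "0 < c"
  have sm: "strongly_measurable M (F k)" for k using F by (simp add: self_improving_def)
  have le: "tail f (4 * C * c) \<le> N * (tail f c + tail (\<lambda>\<omega>. F k \<omega> - f \<omega>) c)\<^sup>2 + tail (\<lambda>\<omega>. F k \<omega> - f \<omega>) (2 * C * c)" for k
  proof -
    have "tail f (4 * C * c) \<le> tail (F k) (C * (2 * c)) + tail (\<lambda>\<omega>. f \<omega> - F k \<omega>) (2 * C * c)"
      by (rule tail_triangle[OF f sm]) simp
    also have "tail (F k) (C * (2 * c)) \<le> N * (tail (F k) (2 * c))\<^sup>2"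
      using F[of k] c by (simp add: self_improving_def)
    also have "tail (F k) (2 * c) \<le> tail f c + tail (\<lambda>\<omega>. F k \<omega> - f \<omega>) c"
      by (rule tail_triangle[OF sm f]) simp
    then have "N * (tail (F k) (2 * c))\<^sup>2 \<le> N * (tail f c + tail (\<lambda>\<omega>. F k \<omega> - f \<omega>) c)\<^sup>2"
      by (intro mult_left_mono power_mono N tail_nonneg)
    finally show ?thesis by (simp add: tail_minus[of f])
  qed
  have "(\<lambda>k. N * (tail f c + tail (\<lambda>\<omega>. F k \<omega> - f \<omega>) c)\<^sup>2 + tail (\<lambda>\<omega>. F k \<omega> - f \<omega>) (2 * C * c)) \<longlonglongrightarrow> N * (tail f c + 0)\<^sup>2 + 0"
    using conv c C unfolding conv_prob_def by (intro tendsto_intros) auto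
  from LIMSEQ_le_const[OF this] le show "tail f (4 * C * c) \<le> N * (tail f c)\<^sup>2" by auto
qed

text \<open>The moment of a variable whose tail at \<open>C\<^sup>k\<close> is at most \<open>2\<close> to the power \<open>- 2\<^sup>k\<close>,
  bounded by cutting at the levels \<open>C\<^sup>k\<close>.\<close>

definition moment_const :: "real \<Rightarrow> real \<Rightarrow> real" where
  "moment_const C p = 1 + (\<Sum>k. (C ^ Suc k) powr p * (1/2) ^ (2 ^ k))"

lemma moment_const_summable:
  assumes C: "2 \<le> (C::real)"
  shows "summable (\<lambda>k. (C ^ Suc k) powr p * (1/2) ^ (2 ^ k))"
proof -
  have "(\<lambda>k. C powr p * (1/2) ^ (2 ^ k)) \<longlonglongrightarrow> C powr p * 0"
  proof (intro tendsto_mult tendsto_const)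
    have "filterlim (\<lambda>k::nat. (2::nat) ^ k) sequentially sequentially"
      by (rule filterlim_subseq) (auto simp: strict_mono_def)
    from filterlim_compose[OF LIMSEQ_power_zero[of "1/2::real"] this]
    show "(\<lambda>k. (1/2::real) ^ (2 ^ k)) \<longlonglongrightarrow> 0" by simp
  qed
  from order_tendstoD(2)[OF this, of "1/2"] obtain K where K: "\<And>k. k \<ge> K \<Longrightarrow> C powr p * (1/2) ^ (2 ^ k) < 1/2"
    by (auto simp: eventually_sequentially)
  show ?thesis
  proof (rule summable_ratio_test[of "1/2" K])
    fix k assume k: "k \<ge> K"
    have "(C ^ Suc (Suc k)) powr p * (1/2) ^ (2 ^ Suc k) = (C powr p * (1/2) ^ (2 ^ k)) * ((C ^ Suc k) powr p * (1/2) ^ (2 ^ k))"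
      using C by (simp add: powr_mult power_add[symmetric] mult_2 mult.assoc mult.left_commute)
    also have "\<dots> \<le> 1/2 * ((C ^ Suc k) powr p * (1/2) ^ (2 ^ k))"
      using K[OF k] by (intro mult_right_mono) auto
    finally show "norm ((C ^ Suc (Suc k)) powr p * (1/2) ^ (2 ^ Suc k)) \<le> 1/2 * norm ((C ^ Suc k) powr p * (1/2) ^ (2 ^ k))"
      by simp
  qed simp
qed

lemma moment_const_ge1: "2 \<le> C \<Longrightarrow> 1 \<le> moment_const C p"
  unfolding moment_const_def using suminf_nonneg[OF moment_const_summable[of C p]] by simp

lemma self_improving_iterate:
  assumes F: "self_improving C N F" and N: "1 \<le> N" and C: "2 \<le> C" and c: "0 < c" and small: "N * tail F c \<le> 1/2"
  shows "tail F (C ^ k * c) \<le> (1/2) ^ (2 ^ k)"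
proof -
  have "N * tail F (C ^ k * c) \<le> (1/2) ^ (2 ^ k)"
  proof (induction k)
    case 0 then show ?case using small by simp
  next
    case (Suc k)
    have pos: "0 < C ^ k * c" using C c by simp
    have "N * tail F (C ^ Suc k * c) \<le> N * (N * (tail F (C ^ k * c))\<^sup>2)"
      using F pos N by (intro mult_left_mono) (auto simp: self_improving_def mult.assoc)
    also have "\<dots> = (N * tail F (C ^ k * c))\<^sup>2" by (simp add: power2_eq_square)
    also have "\<dots> \<le> ((1/2) ^ (2 ^ k))\<^sup>2" using Suc N tail_nonneg by (intro power_mono mult_nonneg_nonneg) auto
    also have "\<dots> = (1/2) ^ (2 ^ Suc k)" by (simp add: power_mult[symmetric] mult.commute)
    finally show ?case .
  qed
  moreover have "tail F (C ^ k * c) \<le> N * tail F (C ^ k * c)"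
    using mult_right_mono[OF N tail_nonneg[of F "C ^ k * c"]] by simp
  ultimately show ?thesis by linarith
qed

text \<open>The values of \<open>\<parallel>F\<parallel>\<close> between \<open>C\<^sup>k c\<close> and \<open>C\<^sup>k\<^sup>+\<^sup>1
  c\<close> contribute at most \<open>(C\<^sup>k\<^sup>+\<^sup>1 c)\<^sup>p P(\<parallel>F\<parallel> > C\<^sup>k
  c)\<close>, and these terms are summable by the iterated tail bound.\<close>

lemma self_improving_moment:
  assumes F: "self_improving C N F" and N: "1 \<le> N" and C: "2 \<le> C" and c: "0 < c" and small: "N * tail F c \<le> 1/2"
    and p: "0 < p"
  shows "(\<integral>\<^sup>+\<omega>. ennreal (norm (F \<omega>) powr p) \<partial>M) \<le> ennreal (moment_const C p * c powr p)"
proof -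
  have sm: "strongly_measurable M F" using F by (simp add: self_improving_def)
  have [measurable]: "(\<lambda>\<omega>. norm (F \<omega>)) \<in> borel_measurable M" by (rule strongly_measurable_norm[OF sm])
  define A where "A k = {\<omega>\<in>space M. C ^ k * c < norm (F \<omega>)}" for k
  have A[measurable]: "A k \<in> sets M" for k unfolding A_def by (rule tail_sets[OF sm])
  define b where "b k = (C ^ Suc k * c) powr p" for k
  have "ennreal (norm (F \<omega>) powr p) \<le> ennreal (c powr p) + (\<Sum>k. ennreal (b k) * indicator (A k) \<omega>)" if \<omega>: "\<omega> \<in> space M" for \<omega>
  proof (cases "norm (F \<omega>) \<le> c")
    case True
    then have "norm (F \<omega>) powr p \<le> c powr p" using p by (intro powr_mono2) auto
    then have "ennreal (norm (F \<omega>) powr p) \<le> ennreal (c powr p)" by (rule ennreal_leI)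
    also have "\<dots> \<le> ennreal (c powr p) + (\<Sum>k. ennreal (b k) * indicator (A k) \<omega>)" by simp
    finally show ?thesis .
  next
    case False
    have "\<exists>k. norm (F \<omega>) \<le> C ^ k * c"
    proof -
      obtain k where "norm (F \<omega>) / c < C ^ k" using real_arch_pow[of C "norm (F \<omega>) / c"] C by auto
      then show ?thesis using c by (intro exI[of _ k]) (simp add: field_simps)
    qed
    define k where "k = (LEAST k. norm (F \<omega>) \<le> C ^ k * c)"
    have k: "norm (F \<omega>) \<le> C ^ k * c" unfolding k_def by (rule LeastI_ex) fact
    have "k \<noteq> 0"
    proof
      assume "k = 0"
      with k False show False by simp
    qed
    then obtain j where j: "k = Suc j" by (cases k) auto
    have "\<not> norm (F \<omega>) \<le> C ^ j * c" using not_less_Least[of j "\<lambda>k. norm (F \<omega>) \<le> C ^ k * c"] j by (simp add: k_def)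
    then have "\<omega> \<in> A j" using \<omega> by (auto simp: A_def)
    have "norm (F \<omega>) powr p \<le> b j" unfolding b_def using k p j by (intro powr_mono2) auto
    then have "ennreal (norm (F \<omega>) powr p) \<le> ennreal (b j) * indicator (A j) \<omega>" using \<open>\<omega> \<in> A j\<close> by (simp add: ennreal_leI)
    also have "\<dots> \<le> (\<Sum>k. ennreal (b k) * indicator (A k) \<omega>)"
    proof -
      have "g j \<le> (\<Sum>k. g k)" for g :: "nat \<Rightarrow> ennreal"
        using sum_le_suminf[of g "{j}"] by (simp add: summableI)
      then show ?thesis .
    qed
    finally show ?thesis by (rule add_increasing[OF zero_le])
  qed
  then have "(\<integral>\<^sup>+\<omega>. ennreal (norm (F \<omega>) powr p) \<partial>M) \<le> (\<integral>\<^sup>+\<omega>. ennreal (c powr p) + (\<Sum>k. ennreal (b k) * indicator (A k) \<omega>) \<partial>M)"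
    by (intro nn_integral_mono) auto
  also have "\<dots> = ennreal (c powr p) + (\<Sum>k. ennreal (b k) * emeasure M (A k))"
    by (simp add: nn_integral_add nn_integral_suminf nn_integral_cmult_indicator emeasure_space_1)
  also have "(\<Sum>k. ennreal (b k) * emeasure M (A k)) \<le> (\<Sum>k. ennreal (c powr p * ((C ^ Suc k) powr p * (1/2) ^ (2 ^ k))))"
  proof (intro suminf_le summableI)
    fix k
    have "prob (A k) \<le> (1/2) ^ (2 ^ k)"
      using self_improving_iterate[OF F N C c small, of k] by (simp add: tail_def A_def)
    then have le: "b k * prob (A k) \<le> b k * (1/2) ^ (2 ^ k)" by (intro mult_left_mono) (auto simp: b_def)
    have "b k = c powr p * (C ^ Suc k) powr p" unfolding b_def using C c by (simp add: powr_mult)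
    with le have "b k * prob (A k) \<le> c powr p * ((C ^ Suc k) powr p * (1/2) ^ (2 ^ k))" by (simp only: mult.assoc)
    moreover have "0 \<le> b k" by (simp add: b_def)
    ultimately show "ennreal (b k) * emeasure M (A k) \<le> ennreal (c powr p * ((C ^ Suc k) powr p * (1/2) ^ (2 ^ k)))"
      unfolding emeasure_eq_measure by (subst ennreal_mult[symmetric]) (auto intro!: ennreal_leI)
  qed
  also have "\<dots> = ennreal (\<Sum>k. c powr p * ((C ^ Suc k) powr p * (1/2) ^ (2 ^ k)))"
    by (rule suminf_ennreal2, simp) (intro summable_mult moment_const_summable C)
  also have "ennreal (c powr p) + \<dots> = ennreal (c powr p + (\<Sum>k. c powr p * ((C ^ Suc k) powr p * (1/2) ^ (2 ^ k))))"
    by (intro ennreal_plus[symmetric] suminf_nonneg summable_mult moment_const_summable C allI mult_nonneg_nonneg) auto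
  also have "c powr p + (\<Sum>k. c powr p * ((C ^ Suc k) powr p * (1/2) ^ (2 ^ k))) = moment_const C p * c powr p"
    unfolding moment_const_def by (subst suminf_mult[OF moment_const_summable[OF C]]) (simp add: algebra_simps)
  finally show ?thesis by (simp add: add_left_mono)
qed

end



section \<open>Vector-valued sums\<close>

lemma simple_bochner_integral_sum_scaleR:
  fixes x :: "nat \<Rightarrow> 'x::real_normed_vector"
  assumes "\<And>k. k < m \<Longrightarrow> Bochner_Integration.simple_bochner_integrable M (s k :: 'o \<Rightarrow> real)"
  shows "Bochner_Integration.simple_bochner_integrable M (\<lambda>\<omega>. \<Sum>k<m. s k \<omega> *\<^sub>R x k) \<and>
    Bochner_Integration.simple_bochner_integral M (\<lambda>\<omega>. \<Sum>k<m. s k \<omega> *\<^sub>R x k) = (\<Sum>k<m. Bochner_Integration.simple_bochner_integral M (s k) *\<^sub>R x k)"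
  using assms
proof (induction m)
  case 0
  then show ?case
    by (auto simp: simple_bochner_integrable.simps simple_bochner_integral_def image_constant_conv)
next
  case (Suc m)
  have s: "Bochner_Integration.simple_bochner_integrable M (s m)" using Suc.prems by simp
  have i: "Bochner_Integration.simple_bochner_integrable M (\<lambda>\<omega>. s m \<omega> *\<^sub>R x m)"
    using simple_bochner_integrable_compose2[of "\<lambda>a b. a *\<^sub>R x m", OF _ s s] by simp
  have l: "Bochner_Integration.simple_bochner_integral M (\<lambda>\<omega>. s m \<omega> *\<^sub>R x m) = Bochner_Integration.simple_bochner_integral M (s m) *\<^sub>R x m"
    by (rule simple_bochner_integral_linear[where f="\<lambda>a. a *\<^sub>R x m", OF _ s])
       (simp add: bounded_linear.linear bounded_linear_scaleR_left)
  have IH: "Bochner_Integration.simple_bochner_integrable M (\<lambda>\<omega>. \<Sum>k<m. s k \<omega> *\<^sub>R x k)"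
    "Bochner_Integration.simple_bochner_integral M (\<lambda>\<omega>. \<Sum>k<m. s k \<omega> *\<^sub>R x k) = (\<Sum>k<m. Bochner_Integration.simple_bochner_integral M (s k) *\<^sub>R x k)"
    using Suc by auto
  show ?case
    using simple_bochner_integral_add[OF IH(1) i] simple_bochner_integrable_compose2[of "(+)", OF _ IH(1) i] IH(2) l by simp
qed

text \<open>Jensen's inequality for the norm. The values of the sum may lie in a nonseparable space, so the
  expectation is taken coefficientwise, and the triangle inequality is applied to simple functions
  approximating the coefficients in \<open>L\<^sup>1\<close>.\<close>

lemma norm_integral_sum_le:
  fixes x :: "nat \<Rightarrow> 'x::real_normed_vector"
  assumes h: "\<And>k. k < m \<Longrightarrow> integrable M (h k :: 'o \<Rightarrow> real)"
  shows "integrable M (\<lambda>\<omega>. norm (\<Sum>k<m. h k \<omega> *\<^sub>R x k))"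
    and "norm (\<Sum>k<m. (\<integral>\<omega>. h k \<omega> \<partial>M) *\<^sub>R x k) \<le> (\<integral>\<omega>. norm (\<Sum>k<m. h k \<omega> *\<^sub>R x k) \<partial>M)"
proof -
  have hm: "h k \<in> borel_measurable M" if "k < m" for k using h[OF that] by simp
  have meas[measurable]: "(\<lambda>\<omega>. norm (\<Sum>k<m. g k \<omega> *\<^sub>R x k)) \<in> borel_measurable M"
    if "\<And>k. k < m \<Longrightarrow> (g k :: 'o \<Rightarrow> real) \<in> borel_measurable M" for g
    by (intro strongly_measurable_norm strongly_measurable_sum strongly_measurable_scaleR) (use that in auto)
  have bound: "norm (\<Sum>k<m. a k *\<^sub>R x k) \<le> (\<Sum>k<m. \<bar>a k\<bar> * norm (x k))" for a
    by (rule order_trans[OF norm_sum]) simp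
  have int: "integrable M (\<lambda>\<omega>. norm (\<Sum>k<m. g k \<omega> *\<^sub>R x k))" if g: "\<And>k. k < m \<Longrightarrow> integrable M (g k :: 'o \<Rightarrow> real)" for g
  proof (rule Bochner_Integration.integrable_bound)
    show "integrable M (\<lambda>\<omega>. \<Sum>k<m. \<bar>g k \<omega>\<bar> * norm (x k))" by (intro Bochner_Integration.integrable_sum integrable_mult_left integrable_abs g) simp
    show "AE \<omega> in M. norm (norm (\<Sum>k<m. g k \<omega> *\<^sub>R x k)) \<le> norm (\<Sum>k<m. \<bar>g k \<omega>\<bar> * norm (x k))"
      using bound by (auto intro!: always_eventually order_trans[OF bound] abs_ge_self)
  qed (use g in \<open>auto intro!: meas\<close>)
  show "integrable M (\<lambda>\<omega>. norm (\<Sum>k<m. h k \<omega> *\<^sub>R x k))" by (rule int[OF h])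
  define P where "P k s \<longleftrightarrow> (\<forall>i. Bochner_Integration.simple_bochner_integrable M (s i)) \<and> (\<lambda>i. \<integral>\<^sup>+\<omega>. norm (h k \<omega> - s i \<omega>) \<partial>M) \<longlonglongrightarrow> 0
      \<and> (\<lambda>i. Bochner_Integration.simple_bochner_integral M (s i)) \<longlonglongrightarrow> (\<integral>\<omega>. h k \<omega> \<partial>M)" for k s
  have "\<exists>s. P k s" if k: "k < m" for k
    using has_bochner_integral_integrable[OF h[OF k]] unfolding P_def by (auto elim!: has_bochner_integral.cases)
  then have "\<forall>k\<in>{..<m}. \<exists>s. P k s" by blast
  from bchoice[OF this] obtain s where sP: "\<forall>k\<in>{..<m}. P k (s k)" by blast
  have s: "\<And>k i. k < m \<Longrightarrow> Bochner_Integration.simple_bochner_integrable M (s k i)"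
    "\<And>k. k < m \<Longrightarrow> (\<lambda>i. \<integral>\<^sup>+\<omega>. norm (h k \<omega> - s k i \<omega>) \<partial>M) \<longlonglongrightarrow> 0"
    "\<And>k. k < m \<Longrightarrow> (\<lambda>i. Bochner_Integration.simple_bochner_integral M (s k i)) \<longlonglongrightarrow> (\<integral>\<omega>. h k \<omega> \<partial>M)" for k i
    using sP by (auto simp: P_def)
  have si: "integrable M (s k i)" "Bochner_Integration.simple_bochner_integral M (s k i) = (\<integral>\<omega>. s k i \<omega> \<partial>M)" if "k < m" for k i
    using has_bochner_integral_simple_bochner_integrable[OF s(1)[OF that]]
    by (auto simp: has_bochner_integral_iff)
  have L1: "(\<lambda>i. \<integral>\<omega>. \<bar>h k \<omega> - s k i \<omega>\<bar> \<partial>M) \<longlonglongrightarrow> 0" if k: "k < m" for k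
  proof -
    have "(\<integral>\<^sup>+\<omega>. norm (h k \<omega> - s k i \<omega>) \<partial>M) = ennreal (\<integral>\<omega>. \<bar>h k \<omega> - s k i \<omega>\<bar> \<partial>M)" for i
      using h[OF k] si(1)[OF k] by (subst nn_integral_eq_integral) auto
    then have "(\<lambda>i. ennreal (\<integral>\<omega>. \<bar>h k \<omega> - s k i \<omega>\<bar> \<partial>M)) \<longlonglongrightarrow> ennreal 0" using s(2)[OF k] by simp
    then show ?thesis by (subst (asm) tendsto_ennreal_iff) auto
  qed
  have le: "norm (\<Sum>k<m. Bochner_Integration.simple_bochner_integral M (s k i) *\<^sub>R x k)
      \<le> (\<integral>\<omega>. norm (\<Sum>k<m. h k \<omega> *\<^sub>R x k) \<partial>M) + (\<Sum>k<m. (\<integral>\<omega>. \<bar>h k \<omega> - s k i \<omega>\<bar> \<partial>M) * norm (x k))" for i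
  proof -
    define S where "S = (\<lambda>\<omega>. \<Sum>k<m. s k i \<omega> *\<^sub>R x k)"
    have S: "Bochner_Integration.simple_bochner_integrable M S" "Bochner_Integration.simple_bochner_integral M S = (\<Sum>k<m. Bochner_Integration.simple_bochner_integral M (s k i) *\<^sub>R x k)"
      using simple_bochner_integral_sum_scaleR[of m M "\<lambda>k. s k i" x] s(1) by (auto simp: S_def)
    have nS: "Bochner_Integration.simple_bochner_integrable M (\<lambda>\<omega>. norm (S \<omega>))"
      using simple_bochner_integrable_compose2[of "\<lambda>a b. norm a", OF _ S(1) S(1)] by simp
    have "norm (Bochner_Integration.simple_bochner_integral M S) \<le> Bochner_Integration.simple_bochner_integral M (\<lambda>\<omega>. norm (S \<omega>))"
      by (rule simple_bochner_integral_norm_bound[OF S(1)])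
    also have "\<dots> = (\<integral>\<omega>. norm (S \<omega>) \<partial>M)"
      using has_bochner_integral_simple_bochner_integrable[OF nS] by (simp add: has_bochner_integral_iff)
    also have "\<dots> \<le> (\<integral>\<omega>. norm (\<Sum>k<m. h k \<omega> *\<^sub>R x k) + (\<Sum>k<m. \<bar>h k \<omega> - s k i \<omega>\<bar> * norm (x k)) \<partial>M)"
    proof (rule integral_mono)
      show "integrable M (\<lambda>\<omega>. norm (S \<omega>))" unfolding S_def by (rule int[OF si(1)])
      show "integrable M (\<lambda>\<omega>. norm (\<Sum>k<m. h k \<omega> *\<^sub>R x k) + (\<Sum>k<m. \<bar>h k \<omega> - s k i \<omega>\<bar> * norm (x k)))"
        by (intro Bochner_Integration.integrable_add Bochner_Integration.integrable_sum integrable_mult_left integrable_abs Bochner_Integration.integrable_diff int h si) auto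
      fix \<omega>
      have "norm (S \<omega>) \<le> norm (\<Sum>k<m. h k \<omega> *\<^sub>R x k) + norm (\<Sum>k<m. (h k \<omega> - s k i \<omega>) *\<^sub>R x k)"
        using norm_triangle_ineq4[of "\<Sum>k<m. h k \<omega> *\<^sub>R x k" "\<Sum>k<m. (h k \<omega> - s k i \<omega>) *\<^sub>R x k"]
        by (simp add: S_def scaleR_diff_left sum_subtractf)
      then show "norm (S \<omega>) \<le> norm (\<Sum>k<m. h k \<omega> *\<^sub>R x k) + (\<Sum>k<m. \<bar>h k \<omega> - s k i \<omega>\<bar> * norm (x k))"
        using bound[of "\<lambda>k. h k \<omega> - s k i \<omega>"] by linarith
    qed
    also have "\<dots> = (\<integral>\<omega>. norm (\<Sum>k<m. h k \<omega> *\<^sub>R x k) \<partial>M) + (\<Sum>k<m. (\<integral>\<omega>. \<bar>h k \<omega> - s k i \<omega>\<bar> \<partial>M) * norm (x k))"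
      using int[OF h] h si(1) by (subst Bochner_Integration.integral_add) (auto intro!: sum.cong)
    finally show ?thesis by (simp add: S)
  qed
  have lim1: "(\<lambda>i. norm (\<Sum>k<m. Bochner_Integration.simple_bochner_integral M (s k i) *\<^sub>R x k)) \<longlonglongrightarrow> norm (\<Sum>k<m. (\<integral>\<omega>. h k \<omega> \<partial>M) *\<^sub>R x k)"
    by (intro tendsto_norm tendsto_sum tendsto_scaleR tendsto_const s(3)) simp
  have "(\<lambda>i. (\<integral>\<omega>. norm (\<Sum>k<m. h k \<omega> *\<^sub>R x k) \<partial>M) + (\<Sum>k<m. (\<integral>\<omega>. \<bar>h k \<omega> - s k i \<omega>\<bar> \<partial>M) * norm (x k)))
      \<longlonglongrightarrow> (\<integral>\<omega>. norm (\<Sum>k<m. h k \<omega> *\<^sub>R x k) \<partial>M) + (\<Sum>k<m. 0 * norm (x k))"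
    by (intro tendsto_add tendsto_const tendsto_sum tendsto_mult L1) simp
  from LIMSEQ_le[OF lim1 this] le
  show "norm (\<Sum>k<m. (\<integral>\<omega>. h k \<omega> \<partial>M) *\<^sub>R x k) \<le> (\<integral>\<omega>. norm (\<Sum>k<m. h k \<omega> *\<^sub>R x k) \<partial>M)" by auto
qed

lemma L2_norm_sum_scaleR:
  fixes x :: "nat \<Rightarrow> 'x::real_normed_vector"
  assumes f: "\<And>k. k < m \<Longrightarrow> f k \<in> L2 M"
  shows "strongly_measurable M (\<lambda>\<omega>. \<Sum>k<m. f k \<omega> *\<^sub>R x k)"
    and "(\<lambda>\<omega>. norm (\<Sum>k<m. f k \<omega> *\<^sub>R x k)) \<in> L2 M"
    and "L2_norm M (\<lambda>\<omega>. norm (\<Sum>k<m. f k \<omega> *\<^sub>R x k)) \<le> (\<Sum>k<m. L2_norm M (f k) * norm (x k))"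
proof -
  show sm: "strongly_measurable M (\<lambda>\<omega>. \<Sum>k<m. f k \<omega> *\<^sub>R x k)"
    by (intro strongly_measurable_sum strongly_measurable_scaleR L2_D(1)[OF f]) simp
  have g: "(\<lambda>\<omega>. norm (x k) * \<bar>f k \<omega>\<bar>) \<in> L2 M" "L2_norm M (\<lambda>\<omega>. norm (x k) * \<bar>f k \<omega>\<bar>) = L2_norm M (f k) * norm (x k)" if "k < m" for k
  proof -
    have "(\<lambda>\<omega>. \<bar>f k \<omega>\<bar>) \<in> L2 M" using f[OF that] by (auto simp: L2_def)
    from L2_cmult[OF this] show "(\<lambda>\<omega>. norm (x k) * \<bar>f k \<omega>\<bar>) \<in> L2 M" .
    show "L2_norm M (\<lambda>\<omega>. norm (x k) * \<bar>f k \<omega>\<bar>) = L2_norm M (f k) * norm (x k)"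
      unfolding L2_norm_cmult by (simp add: L2_norm_def)
  qed
  have le: "AE \<omega> in M. \<bar>norm (\<Sum>k<m. f k \<omega> *\<^sub>R x k)\<bar> \<le> \<bar>\<Sum>k<m. norm (x k) * \<bar>f k \<omega>\<bar>\<bar>"
  proof (intro always_eventually allI)
    fix \<omega>
    have "norm (\<Sum>k<m. f k \<omega> *\<^sub>R x k) \<le> (\<Sum>k<m. norm (x k) * \<bar>f k \<omega>\<bar>)"
      by (rule order_trans[OF norm_sum]) (simp add: mult.commute)
    then show "\<bar>norm (\<Sum>k<m. f k \<omega> *\<^sub>R x k)\<bar> \<le> \<bar>\<Sum>k<m. norm (x k) * \<bar>f k \<omega>\<bar>\<bar>" by simp
  qed
  have G: "(\<lambda>\<omega>. \<Sum>k<m. norm (x k) * \<bar>f k \<omega>\<bar>) \<in> L2 M" by (rule L2_sum) (use g in auto)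
  show "(\<lambda>\<omega>. norm (\<Sum>k<m. f k \<omega> *\<^sub>R x k)) \<in> L2 M" by (rule L2_norm_mono(1)[OF G strongly_measurable_norm[OF sm] le])
  have "L2_norm M (\<lambda>\<omega>. norm (\<Sum>k<m. f k \<omega> *\<^sub>R x k)) \<le> L2_norm M (\<lambda>\<omega>. \<Sum>k<m. norm (x k) * \<bar>f k \<omega>\<bar>)"
    by (rule L2_norm_mono(2)[OF G strongly_measurable_norm[OF sm] le])
  also have "\<dots> \<le> (\<Sum>k<m. L2_norm M (f k) * norm (x k))"
    using L2_norm_sum_le[of "{..<m}" "\<lambda>k \<omega>. norm (x k) * \<bar>f k \<omega>\<bar>" M] g by simp
  finally show "L2_norm M (\<lambda>\<omega>. norm (\<Sum>k<m. f k \<omega> *\<^sub>R x k)) \<le> (\<Sum>k<m. L2_norm M (f k) * norm (x k))" .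
qed

text \<open>Testing the vector-valued sum with \<open>g\<close>. For orthonormal \<open>f\<close> this bounds each coefficient by the
  norm of the sum.\<close>

lemma norm_coefficient_le:
  fixes x :: "nat \<Rightarrow> 'x::real_normed_vector"
  assumes f: "\<And>k. k < m \<Longrightarrow> f k \<in> L2 M" and g: "g \<in> L2 M"
  shows "norm (\<Sum>k<m. (\<integral>\<omega>. g \<omega> * f k \<omega> \<partial>M) *\<^sub>R x k) \<le> L2_norm M g * L2_norm M (\<lambda>\<omega>. norm (\<Sum>k<m. f k \<omega> *\<^sub>R x k))"
proof -
  have "norm (\<Sum>k<m. (\<integral>\<omega>. g \<omega> * f k \<omega> \<partial>M) *\<^sub>R x k) \<le> (\<integral>\<omega>. norm (\<Sum>k<m. (g \<omega> * f k \<omega>) *\<^sub>R x k) \<partial>M)"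
    by (rule norm_integral_sum_le) (use f g in \<open>auto intro: L2_mult_integrable\<close>)
  also have "\<dots> = (\<integral>\<omega>. \<bar>g \<omega>\<bar> * norm (\<Sum>k<m. f k \<omega> *\<^sub>R x k) \<partial>M)"
    by (simp add: scaleR_scaleR[symmetric] scaleR_sum_right[symmetric] del: scaleR_scaleR)
  also have "\<dots> \<le> L2_norm M (\<lambda>\<omega>. \<bar>g \<omega>\<bar>) * L2_norm M (\<lambda>\<omega>. norm (\<Sum>k<m. f k \<omega> *\<^sub>R x k))"
    by (intro L2_cauchy_schwarz L2_norm_sum_scaleR f) (use g in \<open>auto simp: L2_def\<close>)
  also have "L2_norm M (\<lambda>\<omega>. \<bar>g \<omega>\<bar>) = L2_norm M g" by (simp add: L2_norm_def)
  finally show ?thesis .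
qed

section \<open>Orthonormal families\<close>

definition orthonormal_fam :: "nat \<Rightarrow> (nat \<Rightarrow> 'e::real_inner) \<Rightarrow> bool" where
  "orthonormal_fam m e \<longleftrightarrow> (\<forall>i<m. \<forall>j<m. inner (e i) (e j) = (if i = j then 1 else 0))"

lemma orthonormal_famD: "orthonormal_fam m e \<Longrightarrow> i < m \<Longrightarrow> j < m \<Longrightarrow> inner (e i) (e j) = (if i = j then 1 else 0)"
  by (simp add: orthonormal_fam_def)

lemma orthonormal_fam_norm: "orthonormal_fam m e \<Longrightarrow> i < m \<Longrightarrow> norm (e i) = 1"
  by (simp add: orthonormal_fam_def norm_eq_sqrt_inner)

lemma orthonormal_residual:
  assumes b: "orthonormal_fam N b" and j: "j < N"
  shows "inner (b j) (h - (\<Sum>i<N. inner h (b i) *\<^sub>R b i)) = 0"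
proof -
  have "inner (b j) (\<Sum>i<N. inner h (b i) *\<^sub>R b i) = (\<Sum>i<N. if i = j then inner h (b i) else 0)"
    unfolding inner_sum_right using orthonormal_famD[OF b j] by (intro sum.cong) auto
  then show ?thesis using j by (simp add: inner_diff_right inner_commute)
qed

lemma orthonormal_fam_snoc:
  assumes b: "orthonormal_fam N b" and u: "norm u = 1" "\<And>j. j < N \<Longrightarrow> inner (b j) u = 0"
  shows "orthonormal_fam (Suc N) (b(N := u))"
  using b u unfolding orthonormal_fam_def
  by (auto simp: less_Suc_eq inner_commute[of u] power2_norm_eq_inner[symmetric])

lemma orthonormal_expansion_norm:
  assumes b: "orthonormal_fam N b"
  shows "(norm (\<Sum>j<N. c j *\<^sub>R b j))\<^sup>2 = (\<Sum>j<N. (c j)\<^sup>2)"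
proof -
  have "(norm (\<Sum>j<N. c j *\<^sub>R b j))\<^sup>2 = (\<Sum>i<N. \<Sum>j<N. c i * (c j * inner (b i) (b j)))"
    by (simp add: power2_norm_eq_inner inner_sum_left inner_sum_right sum_distrib_left mult_ac inner_commute)
  also have "\<dots> = (\<Sum>i<N. \<Sum>j<N. if i = j then c i * c j else 0)"
    using b by (intro sum.cong) (auto simp: orthonormal_famD)
  finally show ?thesis by (simp add: power2_eq_square)
qed

text \<open>Gram--Schmidt, where vanishing residuals are skipped.\<close>

lemma common_orthonormal_family:
  fixes h :: "nat \<Rightarrow> 'e::real_inner"
  shows "\<exists>N b. orthonormal_fam N b \<and> (\<forall>i<k. h i = (\<Sum>j<N. inner (h i) (b j) *\<^sub>R b j))"
proof (induction k)
  case 0 show ?case by (auto simp: orthonormal_fam_def intro: exI[of _ 0])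
next
  case (Suc k)
  then obtain N b where b: "orthonormal_fam N b" and e: "\<And>i. i < k \<Longrightarrow> h i = (\<Sum>j<N. inner (h i) (b j) *\<^sub>R b j)" by blast
  define r where "r = h k - (\<Sum>i<N. inner (h k) (b i) *\<^sub>R b i)"
  have rb: "inner (b j) r = 0" if "j < N" for j unfolding r_def by (rule orthonormal_residual[OF b that])
  show ?case
  proof (cases "r = 0")
    case True
    then have "h k = (\<Sum>i<N. inner (h k) (b i) *\<^sub>R b i)" by (simp add: r_def)
    then show ?thesis using b e by (auto simp: less_Suc_eq)
  next
    case False
    define u where "u = r /\<^sub>R norm r"
    have u: "norm u = 1" "\<And>j. j < N \<Longrightarrow> inner (b j) u = 0" using False rb by (auto simp: u_def)
    have ex: "(\<Sum>j<Suc N. inner x ((b(N := u)) j) *\<^sub>R (b(N := u)) j) = (\<Sum>j<N. inner x (b j) *\<^sub>R b j) + inner x u *\<^sub>R u" for x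
      by simp
    have "h i = (\<Sum>j<Suc N. inner (h i) ((b(N := u)) j) *\<^sub>R (b(N := u)) j)" if i: "i < Suc k" for i
    proof (cases "i = k")
      case True
      have "inner (\<Sum>i<N. inner (h k) (b i) *\<^sub>R b i) r = 0" by (simp add: inner_sum_left rb)
      then have "inner (h k) r = inner r r" by (simp add: r_def inner_diff_left)
      then have "inner (h k) u = norm r" using False by (simp add: u_def power2_norm_eq_inner[symmetric] power2_eq_square field_simps)
      then have "inner (h k) u *\<^sub>R u = r" using False by (simp add: u_def)
      then show ?thesis unfolding ex True by (simp add: r_def)
    next
      case f: False
      with i have ik: "i < k" by simp
      have "inner (\<Sum>j<N. inner (h i) (b j) *\<^sub>R b j) u = 0" by (simp add: inner_sum_left u(2))
      then have "inner (h i) u = 0" using e[OF ik] by simp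
      then show ?thesis unfolding ex using e[OF ik] by simp
    qed
    then show ?thesis using orthonormal_fam_snoc[OF b u] by blast
  qed
qed

text \<open>Orthonormal families in a dense subspace approximate orthonormal families of the whole space. The
  Gram--Schmidt correction of a vector close to \<open>e m\<close> is small, because \<open>e m\<close> is orthogonal to the
  preceding vectors, which are already approximated.\<close>

lemma orthonormal_approx:
  fixes D :: "'e::real_inner set"
  assumes add: "\<And>x y. x \<in> D \<Longrightarrow> y \<in> D \<Longrightarrow> x + y \<in> D" and scale: "\<And>c x. x \<in> D \<Longrightarrow> c *\<^sub>R x \<in> D"
    and dense: "closure D = UNIV"
    and e: "orthonormal_fam m e" and \<epsilon>: "0 < \<epsilon>"
  shows "\<exists>e'. orthonormal_fam m e' \<and> (\<forall>i<m. e' i \<in> D \<and> norm (e' i - e i) < \<epsilon>)"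
  using e \<epsilon>
proof (induction m arbitrary: \<epsilon>)
  case 0 show ?case by (simp add: orthonormal_fam_def)
next
  case (Suc m)
  have em: "orthonormal_fam m e" using Suc.prems(1) by (auto simp: orthonormal_fam_def)
  \<comment> \<open>Each of the \<open>m\<close> corrections is at most \<open>2 \<delta>\<close>, so before normalization the error is at most \<open>(2m + 1) \<delta>\<close>, a quarter of \<open>min \<epsilon> 1\<close>.\<close>
  define \<delta> where "\<delta> = min \<epsilon> 1 / (4 * (2 * real m + 1))"
  have \<delta>: "0 < \<delta>" using Suc.prems(2) by (simp add: \<delta>_def)
  have "\<delta> \<le> min \<epsilon> 1 / (4 * 1)" unfolding \<delta>_def using Suc.prems(2) by (intro divide_left_mono) auto
  then have \<delta>': "\<delta> < \<epsilon>" using Suc.prems(2) by (auto simp: min_def split: if_splits)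
  obtain e' where e': "orthonormal_fam m e'" "\<And>i. i < m \<Longrightarrow> e' i \<in> D" "\<And>i. i < m \<Longrightarrow> norm (e' i - e i) < \<delta>"
    using Suc.IH[OF em \<delta>] by blast
  have "e m \<in> closure D" using dense by simp
  then obtain d where d: "d \<in> D" "dist d (e m) < \<delta>" using \<delta> closure_approachable by blast
  have nem: "norm (e m) = 1" using orthonormal_fam_norm[OF Suc.prems(1)] by simp
  define s where "s = (\<Sum>i<m. inner d (e' i) *\<^sub>R e' i)"
  define r where "r = d - s"
  have zero: "0 \<in> D" using scale[OF d(1), of 0] by simp
  have sumD: "(\<Sum>i<k. inner d (e' i) *\<^sub>R e' i) \<in> D" if "k \<le> m" for k
    using that by (induction k) (auto intro!: add scale e' zero)
  have rD: "r \<in> D" unfolding r_def s_def using add[OF d(1) scale[OF sumD[OF order_refl], of "-1"]] by simp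
  have small: "\<bar>inner d (e' i)\<bar> \<le> 2 * \<delta>" if i: "i < m" for i
  proof -
    have ei: "inner (e m) (e i) = 0" using Suc.prems(1) i by (simp add: orthonormal_famD)
    have "inner d (e' i) = inner (d - e m) (e' i) + inner (e m) (e' i - e i)"
      using ei by (simp add: inner_diff_left inner_diff_right)
    also have "\<bar>\<dots>\<bar> \<le> norm (d - e m) * norm (e' i) + norm (e m) * norm (e' i - e i)"
      by (intro order_trans[OF abs_triangle_ineq] add_mono Cauchy_Schwarz_ineq2)
    also have "\<dots> \<le> \<delta> + \<delta>"
      using d(2) e'(3)[OF i] orthonormal_fam_norm[OF e'(1) i] nem by (simp add: dist_norm)
    finally show ?thesis by simp
  qed
  have "norm s \<le> (\<Sum>i<m. \<bar>inner d (e' i)\<bar>)" unfolding s_def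
    by (rule order_trans[OF norm_sum]) (use orthonormal_fam_norm[OF e'(1)] in \<open>auto intro!: sum_mono\<close>)
  also have "\<dots> \<le> (\<Sum>i<m. 2 * \<delta>)" by (intro sum_mono small) simp
  finally have ns: "norm s \<le> 2 * real m * \<delta>" by (simp add: mult_ac)
  define \<eta> where "\<eta> = (2 * real m + 1) * \<delta>"
  have \<eta>: "\<eta> = min \<epsilon> 1 / 4" unfolding \<eta>_def \<delta>_def by (simp add: field_simps)
  have re: "norm (r - e m) \<le> \<eta>"
  proof -
    have "norm (r - e m) \<le> norm (d - e m) + norm s" unfolding r_def
      using norm_triangle_ineq4[of "d - e m" s] by (simp add: algebra_simps)
    then show ?thesis using d(2) ns by (simp add: \<eta>_def dist_norm algebra_simps)
  qed
  then have nr: "\<bar>norm r - 1\<bar> \<le> \<eta>" using norm_triangle_ineq3[of r "e m"] nem by linarith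
  have "\<eta> \<le> 1/4" "\<eta> \<le> \<epsilon> / 4" by (auto simp: \<eta>)
  then have r0: "r \<noteq> 0" using nr by auto
  define u where "u = r /\<^sub>R norm r"
  have nu: "norm u = 1" using r0 by (simp add: u_def)
  have "u - r = (1 - norm r) *\<^sub>R u" using r0 by (simp add: u_def algebra_simps)
  then have "norm (u - r) = \<bar>1 - norm r\<bar>" using nu by simp
  then have "norm (u - r) \<le> \<eta>" using nr by (simp add: abs_minus_commute)
  then have "norm (u - e m) \<le> 2 * \<eta>" using norm_triangle_ineq[of "u - r" "r - e m"] re by simp
  then have ue: "norm (u - e m) < \<epsilon>" using \<open>\<eta> \<le> \<epsilon> / 4\<close> Suc.prems(2) by linarith
  have "inner (e' j) u = 0" if "j < m" for j
    using orthonormal_residual[OF e'(1) that, of d] by (simp add: u_def r_def s_def)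
  from orthonormal_fam_snoc[OF e'(1) nu this] have "orthonormal_fam (Suc m) (e'(m := u))" .
  moreover have "\<forall>i<Suc m. (e'(m := u)) i \<in> D \<and> norm ((e'(m := u)) i - e i) < \<epsilon>"
    using e' ue rD scale \<delta>' by (auto simp: less_Suc_eq u_def intro: less_trans)
  ultimately show ?case by blast
qed

section \<open>Gaussian sums and finite rank operators\<close>

abbreviation std_gauss :: "nat \<Rightarrow> (nat \<Rightarrow> real) measure" where
  "std_gauss m \<equiv> PiM {..<m} (\<lambda>_. std_normal_distribution)"

lemma prob_space_std_gauss: "prob_space (std_gauss m)"
  by (intro prob_space_PiM prob_space_normal_density) simp

lemma std_gauss_component[measurable]: "i < m \<Longrightarrow> (\<lambda>\<gamma>. \<gamma> i) \<in> borel_measurable (std_gauss m)"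
  using measurable_component_singleton[of i "{..<m}" "\<lambda>_. std_normal_distribution"] by simp

lemma std_gauss_cos:
  "(\<integral>\<gamma>. cos (c + (\<Sum>i<m. t i * \<gamma> i)) \<partial>std_gauss m) = exp (- (\<Sum>i<m. (t i)\<^sup>2) / 2) * cos c"
proof -
  interpret P: prob_space "std_gauss m" by (rule prob_space_std_gauss)
  interpret N: real_distribution std_normal_distribution by (rule real_dist_normal_dist)
  interpret product_sigma_finite "\<lambda>_::nat. std_normal_distribution" by standard
  have ii: "integrable std_normal_distribution (\<lambda>x. iexp (t i * x))" for i
    by (rule N.integrable_iexp) auto
  have "(\<integral>\<gamma>. (\<Prod>i<m. iexp (t i * \<gamma> i)) \<partial>std_gauss m) = (\<Prod>i<m. \<integral>x. iexp (t i * x) \<partial>std_normal_distribution)"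
    by (rule product_integral_prod, simp, rule ii)
  also have "\<dots> = (\<Prod>i<m. complex_of_real (exp (- (t i)\<^sup>2 / 2)))"
    using char_std_normal_distribution by (simp add: char_def fun_eq_iff)
  also have "\<dots> = complex_of_real (exp (- (\<Sum>i<m. (t i)\<^sup>2) / 2))"
    by (simp add: exp_sum[symmetric] sum_negf sum_divide_distrib flip: of_real_prod)
  also have "(\<lambda>\<gamma>. \<Prod>i<m. iexp (t i * \<gamma> i)) = (\<lambda>\<gamma>. iexp (\<Sum>i<m. t i * \<gamma> i))"
    by (simp add: exp_sum[symmetric] sum_distrib_left)
  finally have e: "(\<integral>\<gamma>. iexp (\<Sum>i<m. t i * \<gamma> i) \<partial>std_gauss m) = complex_of_real (exp (- (\<Sum>i<m. (t i)\<^sup>2) / 2))" .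
  have [measurable]: "(\<lambda>\<gamma>. \<Sum>i<m. t i * \<gamma> i) \<in> borel_measurable (std_gauss m)"
    by (intro borel_measurable_sum borel_measurable_times) auto
  have i: "integrable (std_gauss m) (\<lambda>\<gamma>. iexp (\<Sum>i<m. t i * \<gamma> i))"
    by (rule P.integrable_iexp) auto
  have c: "(\<integral>\<gamma>. cos (\<Sum>i<m. t i * \<gamma> i) \<partial>std_gauss m) = exp (- (\<Sum>i<m. (t i)\<^sup>2) / 2)"
    using integral_Re[OF i] unfolding e Re_exp_i by simp
  have s: "(\<integral>\<gamma>. sin (\<Sum>i<m. t i * \<gamma> i) \<partial>std_gauss m) = 0"
    using integral_Im[OF i] unfolding e Im_exp_i by simp
  have "integrable (std_gauss m) (\<lambda>\<gamma>. cos (\<Sum>i<m. t i * \<gamma> i))" "integrable (std_gauss m) (\<lambda>\<gamma>. sin (\<Sum>i<m. t i * \<gamma> i))"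
    by (auto intro!: P.integrable_const_bound[where B=1])
  then show ?thesis by (simp add: cos_add c s)
qed

lemma gaussian_sum_norm_L2: "gaussian_sum_norm m x = L2_norm (std_gauss m) (\<lambda>\<gamma>. norm (\<Sum>k<m. \<gamma> k *\<^sub>R x k))"
  by (simp add: gaussian_sum_norm_def L2_norm_def)

text \<open>The norm of a Gaussian sum depends on the joint law of the coefficients only, so any standard
  Gaussian vector computes it.\<close>

lemma (in prob_space) gaussian_sum_norm_eq:
  fixes x :: "nat \<Rightarrow> 'x::real_normed_vector"
  assumes X: "\<And>i. i < m \<Longrightarrow> X i \<in> borel_measurable M"
    and char: "\<And>t c. (\<integral>\<omega>. cos (c + (\<Sum>i<m. t i * X i \<omega>)) \<partial>M) = exp (- (\<Sum>i<m. (t i)\<^sup>2) / 2) * cos c"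
  shows "gaussian_sum_norm m x = L2_norm M (\<lambda>\<omega>. norm (\<Sum>k<m. X k \<omega> *\<^sub>R x k))"
proof -
  let ?B = "PiM {..<m} (\<lambda>_. borel :: real measure)"
  interpret P: prob_space "std_gauss m" by (rule prob_space_std_gauss)
  have law: "distr M ?B (\<lambda>\<omega>. \<lambda>i\<in>{..<m}. X i \<omega>) = distr (std_gauss m) ?B (\<lambda>\<gamma>. \<lambda>i\<in>{..<m}. \<gamma> i)"
    by (rule joint_law_unique) (auto intro: prob_space_axioms P.prob_space_axioms X simp: char std_gauss_cos)
  have "strongly_measurable ?B (\<lambda>z. \<Sum>k<m. z k *\<^sub>R x k)"
    by (intro strongly_measurable_sum strongly_measurable_scaleR) (auto intro: measurable_component_singleton)
  from strongly_measurable_norm[OF this]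
  have [measurable]: "(\<lambda>z. norm (\<Sum>k<m. z k *\<^sub>R x k)) \<in> borel_measurable ?B" .
  have 1: "(\<lambda>\<omega>. \<lambda>i\<in>{..<m}. X i \<omega>) \<in> measurable M ?B" using X by (intro measurable_restrict) auto
  have 2: "(\<lambda>\<gamma>. \<lambda>i\<in>{..<m}. \<gamma> i) \<in> measurable (std_gauss m) ?B" by (intro measurable_restrict) auto
  have "(\<integral>\<omega>. (norm (\<Sum>k<m. X k \<omega> *\<^sub>R x k))\<^sup>2 \<partial>M) = (\<integral>z. (norm (\<Sum>k<m. z k *\<^sub>R x k))\<^sup>2 \<partial>distr M ?B (\<lambda>\<omega>. \<lambda>i\<in>{..<m}. X i \<omega>))"
    by (subst integral_distr[OF 1]) auto
  also have "\<dots> = (\<integral>\<gamma>. (norm (\<Sum>k<m. \<gamma> k *\<^sub>R x k))\<^sup>2 \<partial>std_gauss m)"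
    unfolding law by (subst integral_distr[OF 2]) auto
  finally show ?thesis by (simp add: gaussian_sum_norm_def L2_norm_def)
qed

lemma std_gauss_L2: "i < m \<Longrightarrow> (\<lambda>\<gamma>. \<gamma> i) \<in> L2 (std_gauss m)"
  and std_gauss_cov: "i < m \<Longrightarrow> j < m \<Longrightarrow> (\<integral>\<gamma>. \<gamma> i * \<gamma> j \<partial>std_gauss m) = (if i = j then 1 else 0)"
proof -
  interpret P: prob_space "std_gauss m" by (rule prob_space_std_gauss)
  interpret N: real_distribution std_normal_distribution by (rule real_dist_normal_dist)
  interpret product_sigma_finite "\<lambda>_::nat. std_normal_distribution" by standard
  have dist: "distr (std_gauss m) std_normal_distribution (\<lambda>\<gamma>. \<gamma> i) = std_normal_distribution" if "i < m" for i
    by (rule distr_PiM_component) (use that in \<open>auto intro!: prob_space_normal_density\<close>)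
  show L2: "(\<lambda>\<gamma>. \<gamma> i) \<in> L2 (std_gauss m)" if i: "i < m" for i
  proof -
    have "integrable (distr (std_gauss m) std_normal_distribution (\<lambda>\<gamma>. \<gamma> i)) (\<lambda>x. x\<^sup>2)"
      unfolding dist[OF i] by (rule integrable_std_normal_distribution_moment)
    then show ?thesis using i by (subst (asm) integrable_distr_eq) (auto simp: L2_def)
  qed
  have m1: "(\<integral>x. x \<partial>std_normal_distribution) = 0" using integral_std_normal_distribution_moment_odd[of 1] by simp
  have m2: "(\<integral>x. x * x \<partial>std_normal_distribution) = 1"
    using std_normal_distribution_even_moments(1)[of 1] by (simp add: power2_eq_square)
  have i1: "integrable std_normal_distribution (\<lambda>x. x)" using integrable_std_normal_distribution_moment[of 1] by simp
  have i2: "integrable std_normal_distribution (\<lambda>x. x * x)" using integrable_std_normal_distribution_moment[of 2] by (simp add: power2_eq_square)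
  show "(\<integral>\<gamma>. \<gamma> i * \<gamma> j \<partial>std_gauss m) = (if i = j then 1 else 0)" if ij: "i < m" "j < m"
  proof -
    define g where "g k x = (if k = i then x else 1) * (if k = j then x else (1::real))" for k :: nat and x :: real
    have gi: "integrable std_normal_distribution (g k)" for k
      unfolding g_def using i1 i2 by (cases "k = i"; cases "k = j") auto
    have "(\<integral>\<gamma>. (\<Prod>k<m. g k (\<gamma> k)) \<partial>std_gauss m) = (\<Prod>k<m. \<integral>x. g k x \<partial>std_normal_distribution)"
      by (rule product_integral_prod) (auto intro: gi)
    also have "(\<lambda>\<gamma>. \<Prod>k<m. g k (\<gamma> k)) = (\<lambda>\<gamma>. \<gamma> i * \<gamma> j)"
      using ij by (simp add: g_def prod.distrib prod.delta)
    also have "(\<Prod>k<m. \<integral>x. g k x \<partial>std_normal_distribution) = (if i = j then 1 else 0)"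
    proof (cases "i = j")
      case True
      have "(\<integral>x. g k x \<partial>std_normal_distribution) = 1" for k
        using True N.prob_space by (cases "k = i") (auto simp: g_def m2)
      then show ?thesis using True by simp
    next
      case False
      have "(\<integral>x. g i x \<partial>std_normal_distribution) = 0" using False m1 by (simp add: g_def)
      then show ?thesis using False ij by (auto simp: prod_zero_iff)
    qed
    finally show ?thesis .
  qed
qed

lemma finite_rank_rep_orthonormal: "finite_rank_rep R m e x \<Longrightarrow> orthonormal_fam m e"
  by (simp add: finite_rank_rep_def orthonormal_fam_def)

lemma sum_rebase:
  fixes y :: "nat \<Rightarrow> 'x::real_normed_vector"
  shows "(\<Sum>i<m. (\<Sum>j<N. a j * o' i j) *\<^sub>R y i) = (\<Sum>j<N. a j *\<^sub>R (\<Sum>i<m. o' i j *\<^sub>R y i))"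
proof -
  have "(\<Sum>i<m. (\<Sum>j<N. a j * o' i j) *\<^sub>R y i) = (\<Sum>i<m. \<Sum>j<N. a j *\<^sub>R (o' i j *\<^sub>R y i))"
    by (simp add: scaleR_sum_left)
  then show ?thesis by (subst (asm) sum.swap) (simp add: scaleR_sum_right)
qed

lemma finite_rank_rep_rebase:
  fixes R :: "'e::real_inner \<Rightarrow>\<^sub>L 'x::real_normed_vector" and u :: "nat \<Rightarrow> 'e" and y :: "nat \<Rightarrow> 'x"
  assumes b: "orthonormal_fam N b" and u: "\<And>i. i < m \<Longrightarrow> u i = (\<Sum>j<N. inner (u i) (b j) *\<^sub>R b j)"
    and R: "\<And>h. R h = (\<Sum>i<m. inner h (u i) *\<^sub>R y i)"
  shows "finite_rank_rep R N b (\<lambda>j. R (b j))"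
    and "R (b j) = (\<Sum>i<m. inner (u i) (b j) *\<^sub>R y i)"
proof -
  show Rb: "R (b j) = (\<Sum>i<m. inner (u i) (b j) *\<^sub>R y i)" for j by (simp add: R inner_commute)
  have "R h = (\<Sum>j<N. inner h (b j) *\<^sub>R R (b j))" for h
  proof -
    have "inner h (u i) = (\<Sum>j<N. inner h (b j) * inner (u i) (b j))" if "i < m" for i
      by (subst u[OF that]) (simp add: inner_sum_right mult.commute)
    then have "R h = (\<Sum>i<m. (\<Sum>j<N. inner h (b j) * inner (u i) (b j)) *\<^sub>R y i)"
      unfolding R by (intro sum.cong) auto
    also have "\<dots> = (\<Sum>j<N. inner h (b j) *\<^sub>R (\<Sum>i<m. inner (u i) (b j) *\<^sub>R y i))" by (rule sum_rebase)
    finally show ?thesis by (simp only: Rb)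
  qed
  then show "finite_rank_rep R N b (\<lambda>j. R (b j))" using b unfolding finite_rank_rep_def orthonormal_fam_def by blast
qed

text \<open>Two finite rank operators are compared on one orthonormal family that spans all the vectors in their
  representations.\<close>

lemma finite_rank_common:
  fixes R S :: "'e::real_inner \<Rightarrow>\<^sub>L 'x::real_normed_vector" and u v :: "nat \<Rightarrow> 'e" and y z :: "nat \<Rightarrow> 'x"
  assumes R: "\<And>h. R h = (\<Sum>i<m. inner h (u i) *\<^sub>R y i)" and S: "\<And>h. S h = (\<Sum>i<k. inner h (v i) *\<^sub>R z i)"
  obtains N b where "finite_rank_rep R N b (\<lambda>j. R (b j))" "finite_rank_rep S N b (\<lambda>j. S (b j))"
    "\<And>i. i < m \<Longrightarrow> u i = (\<Sum>j<N. inner (u i) (b j) *\<^sub>R b j)" "\<And>i. i < k \<Longrightarrow> v i = (\<Sum>j<N. inner (v i) (b j) *\<^sub>R b j)"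
proof -
  define h where "h i = (if i < m then u i else v (i - m))" for i
  obtain N b where b: "orthonormal_fam N b" and h: "\<And>i. i < m + k \<Longrightarrow> h i = (\<Sum>j<N. inner (h i) (b j) *\<^sub>R b j)"
    using common_orthonormal_family[of "m + k" h] by blast
  have u: "u i = (\<Sum>j<N. inner (u i) (b j) *\<^sub>R b j)" if "i < m" for i using h[of i] that by (simp add: h_def)
  have v: "v i = (\<Sum>j<N. inner (v i) (b j) *\<^sub>R b j)" if "i < k" for i using h[of "m + i"] that by (simp add: h_def)
  show ?thesis
    by (rule that[OF finite_rank_rep_rebase(1)[OF b u R] finite_rank_rep_rebase(1)[OF b v S] u v])
qed

lemma finite_rankI:
  fixes R :: "'e::real_inner \<Rightarrow>\<^sub>L 'x::real_normed_vector" and u :: "nat \<Rightarrow> 'e" and y :: "nat \<Rightarrow> 'x"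
  assumes R: "\<And>h. R h = (\<Sum>i<m. inner h (u i) *\<^sub>R y i)"
  shows "finite_rank R"
  using finite_rank_common[OF R R] by (metis finite_rank_def)

lemma finite_rank_common_rep:
  fixes R S :: "'e::real_inner \<Rightarrow>\<^sub>L 'x::real_normed_vector"
  assumes "finite_rank R" "finite_rank S"
  obtains N b where "finite_rank_rep R N b (\<lambda>j. R (b j))" "finite_rank_rep S N b (\<lambda>j. S (b j))"
proof -
  obtain m e x k f y where "finite_rank_rep R m e x" "finite_rank_rep S k f y" using assms by (auto simp: finite_rank_def)
  then have "\<And>h. R h = (\<Sum>i<m. inner h (e i) *\<^sub>R x i)" "\<And>h. S h = (\<Sum>i<k. inner h (f i) *\<^sub>R y i)"
    unfolding finite_rank_rep_def by blast+
  from finite_rank_common[OF this] that show ?thesis by metis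
qed

lemma finite_rank_rep_diff:
  assumes "finite_rank_rep R N b (\<lambda>j. R (b j))" "finite_rank_rep S N b (\<lambda>j. S (b j))"
  shows "finite_rank_rep (R - S) N b (\<lambda>j. (R - S) (b j))"
proof -
  have "(R - S) h = (\<Sum>k<N. inner h (b k) *\<^sub>R (R - S) (b k))" for h
  proof -
    have "R h = (\<Sum>k<N. inner h (b k) *\<^sub>R R (b k))" "S h = (\<Sum>k<N. inner h (b k) *\<^sub>R S (b k))"
      using assms unfolding finite_rank_rep_def by blast+
    then have "R h - S h = (\<Sum>k<N. inner h (b k) *\<^sub>R R (b k)) - (\<Sum>k<N. inner h (b k) *\<^sub>R S (b k))" by (rule arg_cong2)
    then show ?thesis by (simp only: blinfun.diff_left scaleR_diff_right sum_subtractf)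
  qed
  then show ?thesis using assms unfolding finite_rank_rep_def by blast
qed

lemma finite_rank_diff:
  assumes "finite_rank R" "finite_rank S"
  shows "finite_rank (R - S)"
proof -
  obtain N b where "finite_rank_rep R N b (\<lambda>j. R (b j))" "finite_rank_rep S N b (\<lambda>j. S (b j))"
    using finite_rank_common_rep[OF assms] .
  from finite_rank_rep_diff[OF this] show ?thesis by (auto simp: finite_rank_def)
qed

text \<open>Rotation invariance: the coordinates of a standard Gaussian vector of the span of \<open>b\<close> along the
  orthonormal vectors \<open>u i\<close> are standard Gaussian again.\<close>

lemma gaussian_sum_norm_rotate:
  fixes y :: "nat \<Rightarrow> 'x::real_normed_vector"
  assumes u: "orthonormal_fam m u" and b: "orthonormal_fam N b"
    and ub: "\<And>i. i < m \<Longrightarrow> u i = (\<Sum>j<N. inner (u i) (b j) *\<^sub>R b j)"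
  shows "gaussian_sum_norm N (\<lambda>j. \<Sum>i<m. inner (u i) (b j) *\<^sub>R y i) = gaussian_sum_norm m y"
proof -
  interpret P: prob_space "std_gauss N" by (rule prob_space_std_gauss)
  have "gaussian_sum_norm m y = L2_norm (std_gauss N) (\<lambda>\<gamma>. norm (\<Sum>i<m. (\<Sum>j<N. \<gamma> j * inner (u i) (b j)) *\<^sub>R y i))"
  proof (rule P.gaussian_sum_norm_eq)
    show "(\<lambda>\<gamma>. \<Sum>j<N. \<gamma> j * inner (u i) (b j)) \<in> borel_measurable (std_gauss N)" for i
      by (intro borel_measurable_sum borel_measurable_times) auto
    fix t :: "nat \<Rightarrow> real" and c :: real
    define s where "s j = (\<Sum>i<m. t i * inner (u i) (b j))" for j
    have e: "(\<Sum>i<m. t i * (\<Sum>j<N. \<gamma> j * inner (u i) (b j))) = (\<Sum>j<N. s j * \<gamma> j)" for \<gamma> :: "nat \<Rightarrow> real"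
      unfolding s_def sum_distrib_left sum_distrib_right by (subst sum.swap) (simp add: mult_ac)
    have "(\<Sum>i<m. t i *\<^sub>R u i) = (\<Sum>i<m. t i *\<^sub>R (\<Sum>j<N. inner (u i) (b j) *\<^sub>R b j))"
      by (intro sum.cong) (auto simp: ub[symmetric])
    also have "\<dots> = (\<Sum>j<N. s j *\<^sub>R b j)"
      unfolding s_def scaleR_sum_right scaleR_sum_left by (subst sum.swap) simp
    finally have "(norm (\<Sum>i<m. t i *\<^sub>R u i))\<^sup>2 = (norm (\<Sum>j<N. s j *\<^sub>R b j))\<^sup>2" by simp
    then have "(\<Sum>j<N. (s j)\<^sup>2) = (\<Sum>i<m. (t i)\<^sup>2)" by (simp add: orthonormal_expansion_norm[OF u] orthonormal_expansion_norm[OF b])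
    then show "(\<integral>\<gamma>. cos (c + (\<Sum>i<m. t i * (\<Sum>j<N. \<gamma> j * inner (u i) (b j)))) \<partial>std_gauss N) = exp (- (\<Sum>i<m. (t i)\<^sup>2) / 2) * cos c"
      unfolding e by (simp add: std_gauss_cos)
  qed
  also have "\<dots> = gaussian_sum_norm N (\<lambda>j. \<Sum>i<m. inner (u i) (b j) *\<^sub>R y i)"
    by (simp add: gaussian_sum_norm_L2 sum_rebase)
  finally show ?thesis by simp
qed

text \<open>Every representation gives the value obtained from a common orthonormal family of two
  representations.\<close>

lemma gamma_norm_fin_rep:
  fixes R :: "'e::real_inner \<Rightarrow>\<^sub>L 'x::real_normed_vector"
  assumes R: "finite_rank_rep R m e x"
  shows "gamma_norm_fin R = gaussian_sum_norm m x"
  unfolding gamma_norm_fin_def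
proof (rule the_equality)
  show "\<exists>m' e' x'. finite_rank_rep R m' e' x' \<and> gaussian_sum_norm m x = gaussian_sum_norm m' x'" using R by blast
  fix c assume "\<exists>m' e' x'. finite_rank_rep R m' e' x' \<and> c = gaussian_sum_norm m' x'"
  then obtain k f y where R': "finite_rank_rep R k f y" and c: "c = gaussian_sum_norm k y" by blast
  have r1: "\<And>h. R h = (\<Sum>i<m. inner h (e i) *\<^sub>R x i)" and r2: "\<And>h. R h = (\<Sum>i<k. inner h (f i) *\<^sub>R y i)"
    using R R' unfolding finite_rank_rep_def by blast+
  obtain N b where b: "finite_rank_rep R N b (\<lambda>j. R (b j))"
    and eb: "\<And>i. i < m \<Longrightarrow> e i = (\<Sum>j<N. inner (e i) (b j) *\<^sub>R b j)" and fb: "\<And>i. i < k \<Longrightarrow> f i = (\<Sum>j<N. inner (f i) (b j) *\<^sub>R b j)"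
    using finite_rank_common[OF r1 r2] by metis
  have ob: "orthonormal_fam N b" by (rule finite_rank_rep_orthonormal[OF b])
  have "gaussian_sum_norm m x = gaussian_sum_norm N (\<lambda>j. R (b j))"
    using gaussian_sum_norm_rotate[OF finite_rank_rep_orthonormal[OF R] ob eb, of x] by (simp only: r1 inner_commute[of "b _"])
  moreover have "gaussian_sum_norm k y = gaussian_sum_norm N (\<lambda>j. R (b j))"
    using gaussian_sum_norm_rotate[OF finite_rank_rep_orthonormal[OF R'] ob fb, of y] by (simp only: r2 inner_commute[of "b _"])
  ultimately show "c = gaussian_sum_norm m x" using c by simp
qed

lemma gamma_norm_fin_nonneg: "finite_rank R \<Longrightarrow> 0 \<le> gamma_norm_fin R"
proof -
  assume "finite_rank R"
  then obtain m e x where "finite_rank_rep R m e x" by (auto simp: finite_rank_def)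
  from gamma_norm_fin_rep[OF this] show ?thesis by (simp add: gaussian_sum_norm_L2 L2_norm_nonneg)
qed

lemma gamma_norm_fin_triangle:
  assumes "finite_rank R" "finite_rank S"
  shows "\<bar>gamma_norm_fin R - gamma_norm_fin S\<bar> \<le> gamma_norm_fin (R - S)"
proof -
  have main: "gamma_norm_fin R \<le> gamma_norm_fin S + gamma_norm_fin (R - S) \<and> gamma_norm_fin (R - S) = gamma_norm_fin (S - R)"
    if fr: "finite_rank R" "finite_rank S" for R S :: "'a \<Rightarrow>\<^sub>L 'b"
  proof -
    obtain N b where b: "finite_rank_rep R N b (\<lambda>j. R (b j))" "finite_rank_rep S N b (\<lambda>j. S (b j))"
      using finite_rank_common_rep[OF fr] .
    let ?G = "std_gauss N"
    let ?V = "\<lambda>A \<gamma>. \<Sum>k<N. \<gamma> k *\<^sub>R blinfun_apply A (b k)"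
    have L: "(\<lambda>\<gamma>. norm (?V A \<gamma>)) \<in> L2 ?G" for A :: "'a \<Rightarrow>\<^sub>L 'b" by (rule L2_norm_sum_scaleR(2)) (rule std_gauss_L2)
    have e: "gamma_norm_fin A = L2_norm ?G (\<lambda>\<gamma>. norm (?V A \<gamma>))" if "finite_rank_rep A N b (\<lambda>j. A (b j))" for A
      using gamma_norm_fin_rep[OF that] by (simp add: gaussian_sum_norm_L2)
    have V: "?V (R - S) \<gamma> = ?V R \<gamma> - ?V S \<gamma>" "?V (S - R) \<gamma> = ?V S \<gamma> - ?V R \<gamma>" for \<gamma>
      by (simp_all add: blinfun.diff_left scaleR_diff_right sum_subtractf)
    have "L2_norm ?G (\<lambda>\<gamma>. norm (?V R \<gamma>)) \<le> L2_norm ?G (\<lambda>\<gamma>. norm (?V S \<gamma>) + norm (?V (R - S) \<gamma>))"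
    proof (rule L2_norm_mono(2)[OF L2_add[OF L L]])
      show "(\<lambda>\<gamma>. norm (?V R \<gamma>)) \<in> borel_measurable ?G" using L by (rule L2_D)
      show "AE \<gamma> in ?G. \<bar>norm (?V R \<gamma>)\<bar> \<le> \<bar>norm (?V S \<gamma>) + norm (?V (R - S) \<gamma>)\<bar>"
        unfolding V by (intro always_eventually allI) (smt (verit) norm_ge_zero norm_triangle_sub)
    qed
    also have "\<dots> \<le> L2_norm ?G (\<lambda>\<gamma>. norm (?V S \<gamma>)) + L2_norm ?G (\<lambda>\<gamma>. norm (?V (R - S) \<gamma>))"
      by (rule L2_norm_add_le[OF L L])
    finally have "gamma_norm_fin R \<le> gamma_norm_fin S + gamma_norm_fin (R - S)"
      by (simp only: e[OF b(1)] e[OF b(2)] e[OF finite_rank_rep_diff[OF b]])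
    moreover have "gamma_norm_fin (R - S) = gamma_norm_fin (S - R)"
      unfolding e[OF finite_rank_rep_diff[OF b]] e[OF finite_rank_rep_diff[OF b(2,1)]] V by (simp add: norm_minus_commute)
    ultimately show ?thesis by blast
  qed
  show ?thesis using main[OF assms] main[OF assms(2,1)] by linarith
qed



section \<open>Approximation by finite rank operators\<close>

text \<open>By induction, since a new basis vector \<open>b0\<close> has positive distance \<open>d\<close> to the span of the others.
  If the distance were zero, approximants of \<open>- b0\<close> in this span would have convergent coordinates
  by the induction hypothesis, and \<open>b0\<close> would lie in the span.\<close>

lemma independent_coordinates_bounded:
  fixes B :: "'x::real_normed_vector set"
  assumes "finite B" "independent B"
  shows "\<exists>c\<ge>0. \<forall>a. \<forall>b\<in>B. \<bar>a b\<bar> \<le> c * norm (\<Sum>b\<in>B. a b *\<^sub>R b)"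
  using assms
proof (induction B rule: finite_induct)
  case empty then show ?case by (intro exI[of _ 0]) auto
next
  case (insert b0 B)
  have ind: "independent B" "b0 \<notin> span B" using insert.prems insert.hyps by (auto simp: independent_insert)
  obtain c where c: "0 \<le> c" "\<And>a b. b \<in> B \<Longrightarrow> \<bar>a b\<bar> \<le> c * norm (\<Sum>b\<in>B. a b *\<^sub>R b)" using insert.IH[OF ind(1)] by blast
  have "\<exists>d>0. \<forall>a. d \<le> norm (b0 + (\<Sum>b\<in>B. a b *\<^sub>R b))"
  proof (rule ccontr)
    assume "\<not> ?thesis"
    then have "\<exists>a. norm (b0 + (\<Sum>b\<in>B. a b *\<^sub>R b)) < inverse (real (Suc k))" for k
      by (meson inverse_positive_iff_positive not_le of_nat_0_less_iff zero_less_Suc)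
    then obtain a where a: "\<And>k. norm (b0 + (\<Sum>b\<in>B. a k b *\<^sub>R b)) < inverse (real (Suc k))" by metis
    define s where "s k = (\<Sum>b\<in>B. a k b *\<^sub>R b)" for k
    have "(\<lambda>k. norm (b0 + s k)) \<longlonglongrightarrow> 0"
      by (rule tendsto_sandwich[OF _ _ tendsto_const LIMSEQ_inverse_real_of_nat])
         (use a in \<open>auto intro!: always_eventually less_imp_le simp: s_def\<close>)
    then have "(\<lambda>k. b0 + s k) \<longlonglongrightarrow> 0" by (simp add: tendsto_norm_zero_iff)
    then have slim: "s \<longlonglongrightarrow> - b0" using tendsto_add[of "\<lambda>k. b0 + s k" 0 sequentially "\<lambda>k. - b0" "- b0"] by simp
    have "convergent (\<lambda>k. a k b)" if b: "b \<in> B" for b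
    proof -
      have Cs: "Cauchy s" using slim by (rule LIMSEQ_imp_Cauchy)
      have "Cauchy (\<lambda>k. a k b)"
      proof (rule CauchyI)
        fix e :: real assume e: "0 < e"
        obtain M where M: "\<And>m n. m \<ge> M \<Longrightarrow> n \<ge> M \<Longrightarrow> norm (s m - s n) < e / (c + 1)"
          using CauchyD[OF Cs, of "e / (c + 1)"] e c(1) by (auto simp: add_nonneg_pos)
        show "\<exists>M. \<forall>m\<ge>M. \<forall>n\<ge>M. norm (a m b - a n b) < e"
        proof (intro exI[of _ M] allI impI)
          fix m n assume mn: "m \<ge> M" "n \<ge> M"
          have "\<bar>a m b - a n b\<bar> \<le> c * norm (s m - s n)"
            using c(2)[OF b, of "\<lambda>b. a m b - a n b"] by (simp add: s_def scaleR_diff_left sum_subtractf)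
          also have "\<dots> \<le> (c + 1) * norm (s m - s n)" by (intro mult_right_mono) auto
          also have "\<dots> < e" using M[OF mn] c(1) by (simp add: field_simps)
          finally show "norm (a m b - a n b) < e" by simp
        qed
      qed
      then show ?thesis by (rule Cauchy_convergent)
    qed
    then have "\<And>b. b \<in> B \<Longrightarrow> (\<lambda>k. a k b) \<longlonglongrightarrow> lim (\<lambda>k. a k b)" by (simp add: convergent_LIMSEQ_iff)
    then have "s \<longlonglongrightarrow> (\<Sum>b\<in>B. lim (\<lambda>k. a k b) *\<^sub>R b)" unfolding s_def by (intro tendsto_sum tendsto_scaleR tendsto_const) auto
    with slim have "- b0 = (\<Sum>b\<in>B. lim (\<lambda>k. a k b) *\<^sub>R b)" by (rule LIMSEQ_unique)
    moreover have "(\<Sum>b\<in>B. lim (\<lambda>k. a k b) *\<^sub>R b) \<in> span B" by (intro span_sum span_scale span_base)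
    ultimately have "- b0 \<in> span B" by simp
    from span_neg[OF this] have "b0 \<in> span B" by simp
    then show False using ind by simp
  qed
  then obtain d where d: "0 < d" "\<And>a. d \<le> norm (b0 + (\<Sum>b\<in>B. a b *\<^sub>R b))" by blast
  show ?case
  proof (intro exI[of _ "1 / d + c * (1 + norm b0 / d)"] conjI allI ballI)
    show "0 \<le> 1 / d + c * (1 + norm b0 / d)" using c d by simp
    fix a b assume b: "b \<in> insert b0 B"
    define t where "t = (\<Sum>b\<in>B. a b *\<^sub>R b)"
    define s where "s = a b0 *\<^sub>R b0 + t"
    have s: "(\<Sum>b\<in>insert b0 B. a b *\<^sub>R b) = s" using insert.hyps by (simp add: s_def t_def)
    have a0: "\<bar>a b0\<bar> \<le> norm s / d"
    proof (cases "a b0 = 0")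
      case False
      have "s = a b0 *\<^sub>R (b0 + (\<Sum>b\<in>B. (a b / a b0) *\<^sub>R b))"
        using False by (simp add: s_def t_def scaleR_add_right scaleR_sum_right)
      then have "norm s = \<bar>a b0\<bar> * norm (b0 + (\<Sum>b\<in>B. (a b / a b0) *\<^sub>R b))" by simp
      also have "\<dots> \<ge> \<bar>a b0\<bar> * d" using d(2)[of "\<lambda>b. a b / a b0"] by (intro mult_left_mono) auto
      finally show ?thesis using d(1) by (simp add: field_simps)
    qed (use d in simp)
    have t: "norm t \<le> norm s * (1 + norm b0 / d)"
    proof -
      have "norm t \<le> norm s + \<bar>a b0\<bar> * norm b0" using norm_triangle_ineq4[of s "a b0 *\<^sub>R b0"] by (simp add: s_def)
      also have "\<dots> \<le> norm s + norm s / d * norm b0" using a0 by (intro add_left_mono mult_right_mono) auto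
      finally show ?thesis by (simp add: algebra_simps)
    qed
    have nn: "0 \<le> c * (1 + norm b0 / d) * norm s" "0 \<le> norm s / d" using c d by auto
    show "\<bar>a b\<bar> \<le> (1 / d + c * (1 + norm b0 / d)) * norm (\<Sum>b\<in>insert b0 B. a b *\<^sub>R b)"
    proof (cases "b = b0")
      case True
      then show ?thesis unfolding s using a0 nn by (simp add: distrib_right)
    next
      case False
      then have "\<bar>a b\<bar> \<le> c * norm t" using c(2)[of b a] b by (simp add: t_def)
      also have "\<dots> \<le> c * (norm s * (1 + norm b0 / d))" using t c(1) by (rule mult_left_mono)
      also have "\<dots> \<le> norm s / d + c * (norm s * (1 + norm b0 / d))" using nn by simp
      also have "\<dots> = (1 / d + c * (1 + norm b0 / d)) * norm s" by (simp add: algebra_simps)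
      finally show ?thesis unfolding s .
    qed
  qed
qed

text \<open>The coordinates of \<open>T x\<close> in a basis of the range are bounded functionals of \<open>x\<close>. The
  approximation property gets all its functionals from here.\<close>

lemma finite_rank_functionals:
  fixes T :: "'x::real_normed_vector \<Rightarrow>\<^sub>L 'y::real_normed_vector"
  assumes "finite B" "range (blinfun_apply T) \<subseteq> span B"
  obtains m :: nat and \<phi> :: "nat \<Rightarrow> 'x \<Rightarrow>\<^sub>L real" and b where "\<And>x. T x = (\<Sum>j<m. \<phi> j x *\<^sub>R b j)"
proof -
  obtain A where A: "A \<subseteq> B" "independent A" "B \<subseteq> span A" using maximal_independent_subset[of B] by blast
  have fA: "finite A" using A(1) assms(1) finite_subset by blast
  have TA: "T x \<in> span A" for x
    using assms(2) A(3) span_mono[of B "span A"] by (auto simp: span_span)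
  obtain c where c: "0 \<le> c" "\<And>a b. b \<in> A \<Longrightarrow> \<bar>a b\<bar> \<le> c * norm (\<Sum>b\<in>A. a b *\<^sub>R b)"
    using independent_coordinates_bounded[OF fA A(2)] by blast
  have rep: "(\<Sum>b\<in>A. representation A (T x) b *\<^sub>R b) = T x" for x
    by (rule sum_representation_eq[OF A(2) TA fA order_refl])
  define \<psi> where "\<psi> b = Blinfun (\<lambda>x. representation A (T x) b)" for b
  have bl: "bounded_linear (\<lambda>x. representation A (T x) b)" if b: "b \<in> A" for b
  proof (rule bounded_linear_intro[where K="c * norm T"])
    fix x y and r :: real
    show "representation A (T (x + y)) b = representation A (T x) b + representation A (T y) b"
      by (simp add: blinfun.add_right representation_add[OF A(2) TA TA])
    show "representation A (T (r *\<^sub>R x)) b = r *\<^sub>R representation A (T x) b"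
      by (simp add: blinfun.scaleR_right representation_scale[OF A(2) TA])
    have "\<bar>representation A (T x) b\<bar> \<le> c * norm (T x)" using c(2)[OF b, of "representation A (T x)"] by (simp add: rep)
    also have "\<dots> \<le> c * (norm T * norm x)" by (intro mult_left_mono norm_blinfun c)
    finally show "norm (representation A (T x) b) \<le> norm x * (c * norm T)" by (simp add: mult_ac)
  qed
  have \<psi>: "\<psi> b x = representation A (T x) b" if "b \<in> A" for b x
    unfolding \<psi>_def by (simp add: bounded_linear_Blinfun_apply[OF bl[OF that]])
  obtain h where h: "bij_betw h {0..<card A} A" using ex_bij_betw_nat_finite[OF fA] by blast
  have "T x = (\<Sum>j<card A. \<psi> (h j) x *\<^sub>R h j)" for x
  proof -
    have "T x = (\<Sum>b\<in>A. \<psi> b x *\<^sub>R b)" using rep[of x] by (simp add: \<psi>)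
    also have "\<dots> = (\<Sum>j<card A. \<psi> (h j) x *\<^sub>R h j)"
      using sum.reindex_bij_betw[OF h, of "\<lambda>b. \<psi> b x *\<^sub>R b"] by (simp add: atLeast0LessThan)
    finally show ?thesis .
  qed
  then show ?thesis by (rule that)
qed

context prob_space
begin

text \<open>For each \<open>k\<close> a simple function is within \<open>c k\<close> of \<open>\<xi>\<close> outside a small event. Outside the
  union of these events \<open>\<xi>\<close> is, for every \<open>k\<close>, within \<open>c k\<close> of a finite set, hence in a
  closed and totally bounded set.\<close>

lemma strongly_measurable_tight:
  fixes \<xi> :: "'a \<Rightarrow> 'x::banach"
  assumes \<xi>: "strongly_measurable M \<xi>" and d: "0 < d"
  obtains K where "compact K" "\<exists>A\<in>events. prob A \<le> d \<and> (\<forall>\<omega>\<in>space M - A. \<xi> \<omega> \<in> K)"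
proof -
  define c where "c k = inverse (real (Suc k))" for k
  have c0: "0 < c k" for k by (simp add: c_def)
  have "\<exists>s. simple_function M s \<and> tail (\<lambda>\<omega>. \<xi> \<omega> - s \<omega>) (c k) < d * (1/2) ^ Suc k" for k
    using simple_function_approx[OF \<xi> c0[of k], of "d * (1/2) ^ Suc k"] d by (metis mult_pos_pos zero_less_power half_gt_zero_iff zero_less_one)
  then obtain s where s: "\<And>k. simple_function M (s k)" "\<And>k. tail (\<lambda>\<omega>. \<xi> \<omega> - s k \<omega>) (c k) < d * (1/2) ^ Suc k" by metis
  define B where "B k = {\<omega>\<in>space M. c k < norm (\<xi> \<omega> - s k \<omega>)}" for k
  have B: "B k \<in> events" for k
    unfolding B_def by (intro tail_sets strongly_measurable_diff \<xi> simple_strongly_measurable s)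
  define A where "A = (\<Union>k. B k)"
  have A: "A \<in> events" unfolding A_def using B by blast
  have sumB: "summable (\<lambda>k. prob (B k))"
    by (rule summable_comparison_test'[of "\<lambda>k. d * (1/2) ^ Suc k" 0])
       (use s(2) in \<open>auto intro!: summable_mult summable_geometric less_imp_le simp: tail_def B_def\<close>)
  have "prob A \<le> (\<Sum>k. prob (B k))" unfolding A_def by (intro finite_measure_subadditive_countably) (use B sumB in auto)
  also have "\<dots> \<le> (\<Sum>k. d * (1/2) ^ Suc k)"
    by (intro suminf_le sumB) (use s(2) in \<open>auto intro!: summable_mult summable_geometric less_imp_le simp: tail_def B_def\<close>)
  also have "\<dots> = d" using power_half_series by (subst suminf_mult) (auto simp: sums_iff)
  finally have pA: "prob A \<le> d" .
  define K where "K = (\<Inter>k. \<Union>y\<in>s k ` space M. cball y (c k))"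
  have fin: "finite (s k ` space M)" for k using s(1) by (simp add: simple_function_def)
  have "compact K"
    unfolding compact_eq_totally_bounded
  proof (intro conjI allI impI)
    have "closed K" unfolding K_def by (intro closed_INT ballI closed_UN fin) auto
    then show "Topological_Spaces.complete K" by (simp add: complete_eq_closed)
    fix e :: real assume "0 < e"
    then obtain k where k: "c k < e" unfolding c_def using reals_Archimedean by blast
    have "K \<subseteq> (\<Union>y\<in>s k ` space M. cball y (c k))" by (auto simp: K_def)
    also have "\<dots> \<subseteq> (\<Union>y\<in>s k ` space M. ball y e)" using k by fastforce
    finally show "\<exists>F. finite F \<and> K \<subseteq> (\<Union>x\<in>F. ball x e)" using fin by blast
  qed
  moreover have "\<xi> \<omega> \<in> K" if "\<omega> \<in> space M - A" for \<omega>
  proof -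
    have "\<xi> \<omega> \<in> cball (s k \<omega>) (c k)" for k
      using that by (auto simp: A_def B_def dist_norm norm_minus_commute not_less)
    then show ?thesis using that unfolding K_def by blast
  qed
  ultimately show ?thesis using that A pA by blast
qed

text \<open>The approximation property is applied to a compact set which carries \<open>\<xi>\<close> up to probability
  \<open>d\<close>.\<close>

lemma approximation_property_conv:
  fixes \<xi> :: "'a \<Rightarrow> 'x::banach"
  assumes ap: "approximation_property TYPE('x)" and \<xi>: "strongly_measurable M \<xi>" and cd: "0 < c" "0 < d"
  obtains T :: "'x \<Rightarrow>\<^sub>L 'x" and m :: nat and \<phi> :: "nat \<Rightarrow> 'x \<Rightarrow>\<^sub>L real" and b
    where "\<And>x. T x = (\<Sum>j<m. \<phi> j x *\<^sub>R b j)" "tail (\<lambda>\<omega>. T (\<xi> \<omega>) - \<xi> \<omega>) c \<le> d"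
proof -
  obtain K A where K: "compact K" "A \<in> events" "prob A \<le> d" "\<And>\<omega>. \<omega> \<in> space M - A \<Longrightarrow> \<xi> \<omega> \<in> K"
    using strongly_measurable_tight[OF \<xi> cd(2)] by metis
  obtain T :: "'x \<Rightarrow>\<^sub>L 'x" and B where T: "finite B" "range (blinfun_apply T) \<subseteq> span B" "\<And>x. x \<in> K \<Longrightarrow> norm (x - T x) \<le> c"
    using ap[unfolded approximation_property_def, rule_format, OF cd(1) K(1)] by auto
  obtain m :: nat and \<phi> :: "nat \<Rightarrow> 'x \<Rightarrow>\<^sub>L real" and b where rep: "\<And>x. T x = (\<Sum>j<m. \<phi> j x *\<^sub>R b j)"
    by (rule finite_rank_functionals[OF T(1,2)]) (rule that)
  have "tail (\<lambda>\<omega>. T (\<xi> \<omega>) - \<xi> \<omega>) c \<le> prob A"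
    unfolding tail_def
  proof (intro finite_measure_mono K(2) subsetI)
    fix \<omega> assume "\<omega> \<in> {\<omega> \<in> space M. c < norm (T (\<xi> \<omega>) - \<xi> \<omega>)}"
    then show "\<omega> \<in> A" using T(3)[of "\<xi> \<omega>"] K(4)[of \<omega>] by (force simp: norm_minus_commute)
  qed
  with K(3) have "tail (\<lambda>\<omega>. T (\<xi> \<omega>) - \<xi> \<omega>) c \<le> d" by simp
  with rep show ?thesis by (rule that)
qed

text \<open>A finite rank operator \<open>T = \<Sum>\<^sub>j \<phi>\<^sub>j b\<^sub>j\<close> kills \<open>\<eta>\<close> almost
  surely, and \<open>T \<eta>\<close> is close to \<open>\<eta>\<close> in probability for suitable \<open>T\<close>.\<close>

lemma functionals_separate:
  fixes \<eta> :: "'a \<Rightarrow> 'x::banach"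
  assumes ap: "approximation_property TYPE('x)" and \<eta>: "strongly_measurable M \<eta>"
    and z: "\<And>\<phi> :: 'x \<Rightarrow>\<^sub>L real. AE \<omega> in M. \<phi> (\<eta> \<omega>) = 0"
  shows "AE \<omega> in M. \<eta> \<omega> = 0"
proof (rule tail_zero_imp_AE[OF \<eta>])
  fix c :: real assume c: "0 < c"
  have "tail \<eta> c \<le> d" if d: "0 < d" for d
  proof -
    obtain T :: "'x \<Rightarrow>\<^sub>L 'x" and m :: nat and \<phi> :: "nat \<Rightarrow> 'x \<Rightarrow>\<^sub>L real" and b
      where T: "\<And>x. T x = (\<Sum>j<m. \<phi> j x *\<^sub>R b j)" "tail (\<lambda>\<omega>. T (\<eta> \<omega>) - \<eta> \<omega>) c \<le> d"
      by (rule approximation_property_conv[OF ap \<eta> c d]) (rule that)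
    have "AE \<omega> in M. \<forall>j\<in>{..<m}. \<phi> j (\<eta> \<omega>) = 0" by (rule AE_finite_allI) (use z in auto)
    then have "AE \<omega> in M. norm (\<eta> \<omega>) \<le> norm (T (\<eta> \<omega>) - \<eta> \<omega>)" by eventually_elim (simp add: T(1))
    then have "tail \<eta> c \<le> tail (\<lambda>\<omega>. T (\<eta> \<omega>) - \<eta> \<omega>) c"
      by (intro tail_AE_le strongly_measurable_diff strongly_measurable_blinfun \<eta>)
    with T(2) show ?thesis by simp
  qed
  then have "tail \<eta> c \<le> 0 + d" if "0 < d" for d using that by (metis add_0)
  then have "tail \<eta> c \<le> 0" by (rule field_le_epsilon)
  then show "tail \<eta> c = 0" using tail_nonneg[of \<eta> c] by simp
qed

end

section \<open>Finite-dimensional chaos\<close>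

text \<open>Elimination of the equation \<open>s\<close> with the pivot \<open>p\<close>.\<close>

lemma homogeneous_system_nontrivial:
  fixes a :: "'k \<Rightarrow> 's \<Rightarrow> real"
  assumes "finite S" "finite K" "card S < card K"
  shows "\<exists>\<beta>. (\<exists>k\<in>K. \<beta> k \<noteq> 0) \<and> (\<forall>s\<in>S. (\<Sum>k\<in>K. \<beta> k * a k s) = 0)"
  using assms
proof (induction S arbitrary: K a rule: finite_induct)
  case empty
  then obtain k where "k \<in> K" by fastforce
  then show ?case by (intro exI[of _ "\<lambda>_. 1"]) auto
next
  case (insert s S)
  show ?case
  proof (cases "\<forall>k\<in>K. a k s = 0")
    case True
    obtain \<beta> where "\<exists>k\<in>K. \<beta> k \<noteq> 0" "\<forall>s\<in>S. (\<Sum>k\<in>K. \<beta> k * a k s) = 0"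
      using insert.IH[of K a] insert.prems insert.hyps by auto
    then show ?thesis using True by (intro exI[of _ \<beta>]) auto
  next
    case False
    then obtain p where p: "p \<in> K" "a p s \<noteq> 0" by blast
    define K' where "K' = K - {p}"
    have K': "finite K'" "card S < card K'" using insert p by (auto simp: K'_def card_Diff_singleton)
    define a' where "a' k t = a k t - a k s / a p s * a p t" for k t
    obtain \<beta> where \<beta>: "\<exists>k\<in>K'. \<beta> k \<noteq> 0" "\<And>t. t \<in> S \<Longrightarrow> (\<Sum>k\<in>K'. \<beta> k * a' k t) = 0"
      using insert.IH[OF K', of a'] by blast
    define q where "q = - (\<Sum>k\<in>K'. \<beta> k * a k s) / a p s"
    define \<gamma> where "\<gamma> = \<beta>(p := q)"
    have sum: "(\<Sum>k\<in>K. \<gamma> k * a k t) = q * a p t + (\<Sum>k\<in>K'. \<beta> k * a k t)" for t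
    proof -
      have "(\<Sum>k\<in>K. \<gamma> k * a k t) = \<gamma> p * a p t + (\<Sum>k\<in>K'. \<gamma> k * a k t)"
        unfolding K'_def using p insert.prems(1) by (subst sum.remove[of K p]) auto
      also have "(\<Sum>k\<in>K'. \<gamma> k * a k t) = (\<Sum>k\<in>K'. \<beta> k * a k t)" by (intro sum.cong) (auto simp: \<gamma>_def K'_def)
      finally show ?thesis by (simp add: \<gamma>_def)
    qed
    have "(\<Sum>k\<in>K. \<gamma> k * a k t) = 0" if t: "t \<in> insert s S" for t
    proof (cases "t = s")
      case True then show ?thesis unfolding sum using p by (simp add: q_def)
    next
      case f: False
      have "(\<Sum>k\<in>K'. \<beta> k * a' k t) = (\<Sum>k\<in>K'. \<beta> k * a k t - \<beta> k * a k s * (a p t / a p s))"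
        by (intro sum.cong) (auto simp: a'_def algebra_simps)
      also have "\<dots> = (\<Sum>k\<in>K'. \<beta> k * a k t) - (\<Sum>k\<in>K'. \<beta> k * a k s) * (a p t / a p s)"
        by (simp add: sum_subtractf sum_distrib_right sum_divide_distrib)
      also have "\<dots> = q * a p t + (\<Sum>k\<in>K'. \<beta> k * a k t)" by (simp add: q_def)
      finally show ?thesis unfolding sum using \<beta>(2)[of t] t f by simp
    qed
    moreover have "\<exists>k\<in>K. \<gamma> k \<noteq> 0" using \<beta>(1) by (auto simp: \<gamma>_def K'_def)
    ultimately show ?thesis by blast
  qed
qed

lemma power_sum_monomials:
  fixes a w :: "nat \<Rightarrow> real"
  shows "(\<Sum>i<d. a i * w i) ^ j = (\<Sum>f\<in>{..<j} \<rightarrow>\<^sub>E {..<d}. (\<Prod>l<j. a (f l)) * (\<Prod>l<j. w (f l)))"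
proof -
  have "(\<Sum>i<d. a i * w i) ^ j = (\<Prod>l<j. \<Sum>i<d. a i * w i)" by simp
  also have "\<dots> = (\<Sum>f\<in>{..<j} \<rightarrow>\<^sub>E {..<d}. \<Prod>l<j. a (f l) * w (f l))"
    by (rule prod_sum_PiE) auto
  finally show ?thesis by (simp add: prod.distrib)
qed

text \<open>An orthonormal family of maximal length admits no nonzero residual.\<close>

lemma finite_dimensional_basis:
  assumes no: "\<not> (\<exists>v :: nat \<Rightarrow> 'v::real_inner. orthonormal_fam m v)"
  obtains d and b :: "nat \<Rightarrow> 'v::real_inner" where "\<And>x. x = (\<Sum>i<d. inner x (b i) *\<^sub>R b i)"
proof -
  define Q where "Q k \<longleftrightarrow> (\<exists>v :: nat \<Rightarrow> 'v. orthonormal_fam k v)" for k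
  have sub: "Q k" if "Q l" "k \<le> l" for k l using that unfolding Q_def orthonormal_fam_def by (meson less_le_trans)
  have bound: "k \<le> m" if "Q k" for k using sub[OF that, of m] no by (force simp: Q_def)
  have "Q 0" by (simp add: Q_def orthonormal_fam_def)
  define d where "d = (GREATEST k. Q k)"
  have "Q d" unfolding d_def by (rule GreatestI_nat[of Q 0 m, OF \<open>Q 0\<close> bound])
  have nd: "\<not> Q (Suc d)" using Greatest_le_nat[of Q "Suc d" m] bound by (auto simp: d_def)
  obtain b :: "nat \<Rightarrow> 'v" where b: "orthonormal_fam d b" using \<open>Q d\<close> by (auto simp: Q_def)
  have "x = (\<Sum>i<d. inner x (b i) *\<^sub>R b i)" for x
  proof (rule ccontr)
    assume "x \<noteq> (\<Sum>i<d. inner x (b i) *\<^sub>R b i)"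
    define r where "r = x - (\<Sum>i<d. inner x (b i) *\<^sub>R b i)"
    have r: "r \<noteq> 0" using \<open>x \<noteq> _\<close> by (simp add: r_def)
    have "orthonormal_fam (Suc d) (b(d := r /\<^sub>R norm r))"
      by (rule orthonormal_fam_snoc[OF b]) (use r orthonormal_residual[OF b] in \<open>auto simp: r_def\<close>)
    then show False using nd by (auto simp: Q_def)
  qed
  then show ?thesis by (rule that)
qed

lemma (in gaussian_space) W_linear_combination:
  assumes v: "v = (\<Sum>i<d. c i *\<^sub>R b i)"
  shows "AE \<omega> in M. W v \<omega> = (\<Sum>i<(d::nat). c i * W (b i) \<omega>)"
proof -
  define c' where "c' i = (if i = d then - 1 else c i)" for i
  define b' where "b' i = (if i = d then v else b i)" for i
  have s: "(\<Sum>i<Suc d. c' i * W (b' i) \<omega>) = (\<Sum>i<d. c i * W (b i) \<omega>) - W v \<omega>" for \<omega>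
    by (simp add: c'_def b'_def)
  have "(\<Sum>i<Suc d. c' i *\<^sub>R b' i) = 0" using v by (simp add: c'_def b'_def)
  then have "(\<integral>\<omega>. ((\<Sum>i<d. c i * W (b i) \<omega>) - W v \<omega>)\<^sup>2 \<partial>M) = 0"
    using W_sum_variance[of c' b' "Suc d"] unfolding s by simp
  moreover have "integrable M (\<lambda>\<omega>. ((\<Sum>i<d. c i * W (b i) \<omega>) - W v \<omega>)\<^sup>2)"
    by (intro L2_D(2) L2_diff L2_sum L2_cmult W_L2)
  ultimately have "AE \<omega> in M. ((\<Sum>i<d. c i * W (b i) \<omega>) - W v \<omega>)\<^sup>2 = 0"
    by (subst (asm) integral_nonneg_eq_0_iff_AE) auto
  then show ?thesis by eventually_elim simp
qed

text \<open>All Hermite variables of degree at most \<open>n\<close> are combinations of the monomials of degree at most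
  \<open>n\<close> in the variables of an orthonormal basis. A monomial is indexed by its degree \<open>j\<close> and the
  map from its \<open>j\<close> factors to the basis. For \<open>n = 0\<close> the constant suffices, whatever the
  dimension.\<close>

lemma (in gaussian_space) finite_dimensional_hermite:
  assumes fd: "n = 0 \<or> (\<exists>m. \<not> (\<exists>v :: nat \<Rightarrow> 'v. orthonormal_fam m v))"
  obtains S :: "(nat \<times> (nat \<Rightarrow> nat)) set" and f :: "(nat \<times> (nat \<Rightarrow> nat)) \<Rightarrow> 'o \<Rightarrow> real" where "finite S"
    "\<And>k v. k \<le> n \<Longrightarrow> \<exists>c. AE \<omega> in M. hermite k (W v \<omega>) = (\<Sum>s\<in>S. c s * f s \<omega>)"
proof (cases "n = 0")
  case True
  show ?thesis
  proof (rule that[of "{undefined}" "\<lambda>_ _. 1"])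
    show "\<exists>c. AE \<omega> in M. hermite k (W v \<omega>) = (\<Sum>s\<in>{undefined}. c s * 1)" if "k \<le> n" for k v
      using that True by (intro exI[of _ "\<lambda>_. 1"]) (simp add: hermite_0)
  qed simp
next
  case False
  then obtain m where "\<not> (\<exists>v :: nat \<Rightarrow> 'v. orthonormal_fam m v)" using fd by blast
  then obtain d and b :: "nat \<Rightarrow> 'v" where b: "\<And>x. x = (\<Sum>i<d. inner x (b i) *\<^sub>R b i)" by (rule finite_dimensional_basis) blast
  define S where "S = (SIGMA j:{..n}. {..<j} \<rightarrow>\<^sub>E {..<d})"
  define f where "f s \<omega> = (\<Prod>l<fst s. W (b (snd s l)) \<omega>)" for s :: "nat \<times> (nat \<Rightarrow> nat)" and \<omega>
  have fS: "finite S" unfolding S_def by (intro finite_SigmaI finite_PiE) auto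
  show ?thesis
  proof (rule that[OF fS])
    fix k v assume k: "k \<le> n"
    obtain p where p: "degree p \<le> k" "hermite k = poly p" using hermite_poly by blast
    define a where "a i = inner v (b i)" for i
    define c where "c s = coeff p (fst s) * (\<Prod>l<fst s. a (snd s l))" for s
    have e: "poly p (\<Sum>i<d. a i * W (b i) \<omega>) = (\<Sum>s\<in>S. c s * f s \<omega>)" for \<omega>
    proof -
      have "poly p x = (\<Sum>j\<le>n. coeff p j * x ^ j)" for x
        unfolding poly_altdef using p(1) k by (intro sum.mono_neutral_left) (auto simp: coeff_eq_0)
      then have "poly p (\<Sum>i<d. a i * W (b i) \<omega>) = (\<Sum>j\<le>n. \<Sum>f'\<in>{..<j} \<rightarrow>\<^sub>E {..<d}. coeff p j * ((\<Prod>l<j. a (f' l)) * (\<Prod>l<j. W (b (f' l)) \<omega>)))"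
        by (simp add: power_sum_monomials sum_distrib_left)
      also have "\<dots> = (\<Sum>(j, f')\<in>S. coeff p j * ((\<Prod>l<j. a (f' l)) * (\<Prod>l<j. W (b (f' l)) \<omega>)))"
        unfolding S_def by (rule sum.Sigma) (auto intro!: finite_PiE)
      finally show ?thesis by (simp add: c_def f_def case_prod_unfold mult.assoc)
    qed
    have "AE \<omega> in M. W v \<omega> = (\<Sum>i<d. a i * W (b i) \<omega>)"
      unfolding a_def by (rule W_linear_combination) (rule b)
    then have "AE \<omega> in M. hermite k (W v \<omega>) = (\<Sum>s\<in>S. c s * f s \<omega>)"
      by eventually_elim (simp only: p(2) e)
    then show "\<exists>c. AE \<omega> in M. hermite k (W v \<omega>) = (\<Sum>s\<in>S. c s * f s \<omega>)" by blast
  qed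
qed



section \<open>Polynomial approximation in the chaos\<close>

lemma hermite_sum_simps:
  "hermite_sum [] w = 0"
  "hermite_sum ((k, v, y) # xs) w = hermite k (w v) *\<^sub>R y + hermite_sum xs w"
  "hermite_sum (xs @ ys) w = hermite_sum xs w + hermite_sum ys w"
  by (simp_all add: hermite_sum_def)

lemma hermite_sum_concat:
  "hermite_sum (concat (map g [0..<m])) w = (\<Sum>i<m. hermite_sum (g i) w)"
  by (induction m) (simp_all add: hermite_sum_simps)

lemma hermite_sum_scale:
  "hermite_sum (map (\<lambda>(k, v, c). (k, v, c *\<^sub>R x)) xs) w = hermite_sum xs w *\<^sub>R (x :: 'x::real_normed_vector)"
  for xs :: "(nat \<times> 'v \<times> real) list"
  by (induction xs) (auto simp: hermite_sum_simps scaleR_add_left)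

lemma hermite_sum_map: "hermite_sum (map (\<lambda>j. (k j, v j, c j)) [0..<m]) w = (\<Sum>j<m. hermite (k j) (w (v j)) *\<^sub>R c j)"
  by (induction m) (simp_all add: hermite_sum_simps add.commute)

lemma Lr_norm_2:
  assumes "(\<lambda>\<omega>. norm (F \<omega>)) \<in> L2 M"
  shows "Lr_norm M 2 F = ennreal (L2_norm M (\<lambda>\<omega>. norm (F \<omega>)))"
proof -
  have "(\<integral>\<^sup>+\<omega>. ennreal (norm (F \<omega>) powr 2) \<partial>M) = (\<integral>\<^sup>+\<omega>. ennreal ((norm (F \<omega>))\<^sup>2) \<partial>M)"
    by (intro nn_integral_cong) (simp add: powr_numeral)
  also have "\<dots> = ennreal (\<integral>\<omega>. (norm (F \<omega>))\<^sup>2 \<partial>M)"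
    by (rule nn_integral_eq_integral) (use L2_D(2)[OF assms] in auto)
  finally show ?thesis by (simp add: Lr_norm_def L2_norm_def powr_half_sqrt)
qed

lemma L2_closed_span_add:
  assumes "f \<in> L2_closed_span M A" "g \<in> L2_closed_span M A" and A: "A \<subseteq> L2 M"
  shows "(\<lambda>\<omega>. f \<omega> + g \<omega>) \<in> L2_closed_span M A"
proof -
  have L: "f \<in> L2 M" "g \<in> L2 M" using assms by (auto simp: L2_closed_span_def)
  show ?thesis
    unfolding L2_closed_span_def
  proof (intro CollectI conjI allI impI L2_add L)
    fix \<epsilon> :: real assume "0 < \<epsilon>"
    then have e: "0 < \<epsilon> / 2" by simp
    obtain m :: nat and c u where 1: "\<forall>i<m. u i \<in> A" "L2_norm M (\<lambda>\<omega>. f \<omega> - (\<Sum>i<m. c i * u i \<omega>)) < \<epsilon> / 2"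
      using assms(1) e unfolding L2_closed_span_def by blast
    obtain k :: nat and d v where 2: "\<forall>i<k. v i \<in> A" "L2_norm M (\<lambda>\<omega>. g \<omega> - (\<Sum>i<k. d i * v i \<omega>)) < \<epsilon> / 2"
      using assms(2) e unfolding L2_closed_span_def by blast
    define w where "w i = (if i < m then u i else v (i - m))" for i
    define b where "b i = (if i < m then c i else d (i - m))" for i
    have s: "(\<Sum>i<m + k. b i * w i \<omega>) = (\<Sum>i<m. c i * u i \<omega>) + (\<Sum>i<k. d i * v i \<omega>)" for \<omega>
    proof -
      have "(\<Sum>i<m + k. b i * w i \<omega>) = (\<Sum>i<m. b i * w i \<omega>) + (\<Sum>i<k. b (m + i) * w (m + i) \<omega>)"
        by (induction k) auto
      then show ?thesis by (simp add: b_def w_def)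
    qed
    have "L2_norm M (\<lambda>\<omega>. (f \<omega> - (\<Sum>i<m. c i * u i \<omega>)) + (g \<omega> - (\<Sum>i<k. d i * v i \<omega>)))
       \<le> L2_norm M (\<lambda>\<omega>. f \<omega> - (\<Sum>i<m. c i * u i \<omega>)) + L2_norm M (\<lambda>\<omega>. g \<omega> - (\<Sum>i<k. d i * v i \<omega>))"
      using 1 2 A by (intro L2_norm_add_le L2_diff L2_sum L2_cmult L) auto
    also have "\<dots> < \<epsilon>" using 1 2 by simp
    finally have "L2_norm M (\<lambda>\<omega>. f \<omega> + g \<omega> - (\<Sum>i<m + k. b i * w i \<omega>)) < \<epsilon>" unfolding s by (simp add: algebra_simps)
    moreover have "\<forall>i<m + k. w i \<in> A" using 1 2 by (auto simp: w_def)
    ultimately show "\<exists>m c g'. (\<forall>i<m. g' i \<in> A) \<and> L2_norm M (\<lambda>\<omega>. f \<omega> + g \<omega> - (\<Sum>i<(m::nat). c i * g' i \<omega>)) < \<epsilon>" by blast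
  qed
qed

lemma L2_closed_span_cmult:
  assumes "f \<in> L2_closed_span M A"
  shows "(\<lambda>\<omega>. r * f \<omega>) \<in> L2_closed_span M A"
  unfolding L2_closed_span_def
proof (intro CollectI conjI allI impI L2_cmult)
  show "f \<in> L2 M" using assms by (auto simp: L2_closed_span_def)
  fix \<epsilon> :: real assume e: "0 < \<epsilon>"
  then have "0 < \<epsilon> / (\<bar>r\<bar> + 1)" by (simp add: add_nonneg_pos)
  then obtain m :: nat and c u where 1: "\<forall>i<m. u i \<in> A" "L2_norm M (\<lambda>\<omega>. f \<omega> - (\<Sum>i<m. c i * u i \<omega>)) < \<epsilon> / (\<bar>r\<bar> + 1)"
    using assms unfolding L2_closed_span_def by blast
  have "L2_norm M (\<lambda>\<omega>. r * f \<omega> - (\<Sum>i<m. r * c i * u i \<omega>)) = L2_norm M (\<lambda>\<omega>. r * (f \<omega> - (\<Sum>i<m. c i * u i \<omega>)))"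
    by (simp add: right_diff_distrib sum_distrib_left mult.assoc)
  also have "\<dots> = \<bar>r\<bar> * L2_norm M (\<lambda>\<omega>. f \<omega> - (\<Sum>i<m. c i * u i \<omega>))" by (rule L2_norm_cmult)
  also have "\<dots> \<le> (\<bar>r\<bar> + 1) * L2_norm M (\<lambda>\<omega>. f \<omega> - (\<Sum>i<m. c i * u i \<omega>))" by (intro mult_right_mono L2_norm_nonneg) simp
  also have "\<dots> < \<epsilon>" using 1(2) by (simp add: pos_less_divide_eq add_nonneg_pos mult.commute)
  finally show "\<exists>m c g'. (\<forall>i<m. g' i \<in> A) \<and> L2_norm M (\<lambda>\<omega>. r * f \<omega> - (\<Sum>i<(m::nat). c i * g' i \<omega>)) < \<epsilon>"
    using 1(1) by (intro exI[of _ m] exI[of _ "\<lambda>i. r * c i"] exI[of _ u]) (simp add: mult.assoc)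
qed

lemma L2_closed_span_base:
  assumes "f \<in> A" "f \<in> L2 M"
  shows "f \<in> L2_closed_span M A"
  unfolding L2_closed_span_def
proof (intro CollectI conjI allI impI assms)
  fix \<epsilon> :: real assume "0 < \<epsilon>"
  then show "\<exists>m c g. (\<forall>i<m. g i \<in> A) \<and> L2_norm M (\<lambda>\<omega>. f \<omega> - (\<Sum>i<(m::nat). c i * g i \<omega>)) < \<epsilon>"
    using assms by (intro exI[of _ "Suc 0"] exI[of _ "\<lambda>_. 1"] exI[of _ "\<lambda>_. f"]) (simp add: L2_norm_def)
qed

context gaussian_space
begin

lemma hermite_L2: "(\<lambda>\<omega>. hermite k (W v \<omega>)) \<in> L2 M"
proof -
  obtain p where "hermite k = poly p" using hermite_poly by blast
  then show ?thesis using W_poly_L2[of p v] by simp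
qed

lemma hermite_sum_L2: "(\<lambda>\<omega>. hermite_sum ys (\<lambda>v. W v \<omega>)) \<in> L2 M" for ys :: "(nat \<times> 'v \<times> real) list"
proof (induction ys)
  case (Cons a ys)
  obtain k v y where a: "a = (k, v, y)" by (cases a) auto
  show ?case unfolding a hermite_sum_simps
    using L2_add[OF L2_cmult[OF hermite_L2, of y] Cons] by (simp add: mult.commute)
qed (simp add: hermite_sum_simps L2_zero)

lemma chaos_L2: "chaos M W k \<subseteq> L2 M" by (auto simp: chaos_def L2_closed_span_def)

lemma chaos_upto_L2: "f \<in> chaos_upto M W n \<Longrightarrow> f \<in> L2 M" by (simp add: chaos_upto_def)

lemma chaos_approx:
  assumes "f \<in> chaos M W k" "0 < \<epsilon>"
  obtains ys :: "(nat \<times> 'v \<times> real) list" where "\<And>j v y. (j, v, y) \<in> set ys \<Longrightarrow> j = k"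
    "L2_norm M (\<lambda>\<omega>. f \<omega> - hermite_sum ys (\<lambda>v. W v \<omega>)) < \<epsilon>"
proof -
  obtain m :: nat and c g where g: "\<forall>i<m. g i \<in> {(\<lambda>\<omega>. hermite k (W v \<omega>)) | v. norm v = 1}"
    "L2_norm M (\<lambda>\<omega>. f \<omega> - (\<Sum>i<m. c i * g i \<omega>)) < \<epsilon>"
    using assms unfolding chaos_def L2_closed_span_def by blast
  then have "\<forall>i\<in>{..<m}. \<exists>v. g i = (\<lambda>\<omega>. hermite k (W v \<omega>))" by blast
  from bchoice[OF this] obtain v where v: "\<And>i. i < m \<Longrightarrow> g i = (\<lambda>\<omega>. hermite k (W (v i) \<omega>))" by auto
  have "hermite_sum (map (\<lambda>j. (k, v j, c j)) [0..<m]) (\<lambda>v. W v \<omega>) = (\<Sum>i<m. c i * g i \<omega>)" for \<omega>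
    unfolding hermite_sum_map by (intro sum.cong) (auto simp: v)
  then show ?thesis using g(2) by (intro that[of "map (\<lambda>j. (k, v j, c j)) [0..<m]"]) auto
qed

lemma chaos_upto_approx:
  assumes f: "f \<in> chaos_upto M W n" and \<epsilon>: "0 < \<epsilon>"
  obtains ys :: "(nat \<times> 'v \<times> real) list" where "\<And>j v y. (j, v, y) \<in> set ys \<Longrightarrow> j \<le> n"
    "L2_norm M (\<lambda>\<omega>. f \<omega> - hermite_sum ys (\<lambda>v. W v \<omega>)) < \<epsilon>"
proof -
  obtain g where g: "\<And>i. i \<le> n \<Longrightarrow> g i \<in> chaos M W i" "AE \<omega> in M. f \<omega> = (\<Sum>i\<le>n. g i \<omega>)"
    using f by (auto simp: chaos_upto_def)
  define \<delta> where "\<delta> = \<epsilon> / real (Suc n)"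
  have \<delta>: "0 < \<delta>" using \<epsilon> by (simp add: \<delta>_def)
  have "\<forall>i\<in>{..n}. \<exists>ys :: (nat \<times> 'v \<times> real) list. (\<forall>(j, v, y) \<in> set ys. j = i) \<and> L2_norm M (\<lambda>\<omega>. g i \<omega> - hermite_sum ys (\<lambda>v. W v \<omega>)) < \<delta>"
  proof
    fix i assume "i \<in> {..n}"
    then obtain ys :: "(nat \<times> 'v \<times> real) list" where "\<And>j v y. (j, v, y) \<in> set ys \<Longrightarrow> j = i"
      "L2_norm M (\<lambda>\<omega>. g i \<omega> - hermite_sum ys (\<lambda>v. W v \<omega>)) < \<delta>"
      using chaos_approx[OF g(1) \<delta>, of i] by auto
    then show "\<exists>ys :: (nat \<times> 'v \<times> real) list. (\<forall>(j, v, y) \<in> set ys. j = i) \<and> L2_norm M (\<lambda>\<omega>. g i \<omega> - hermite_sum ys (\<lambda>v. W v \<omega>)) < \<delta>"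
      by (intro exI[of _ ys]) auto
  qed
  from bchoice[OF this] obtain h :: "nat \<Rightarrow> (nat \<times> 'v \<times> real) list" where
    h0: "\<forall>i\<in>{..n}. (\<forall>(j, v, y) \<in> set (h i). j = i) \<and> L2_norm M (\<lambda>\<omega>. g i \<omega> - hermite_sum (h i) (\<lambda>v. W v \<omega>)) < \<delta>" by (rule exE)
  then have h: "(\<forall>(j, v, y) \<in> set (h i). j = i) \<and> L2_norm M (\<lambda>\<omega>. g i \<omega> - hermite_sum (h i) (\<lambda>v. W v \<omega>)) < \<delta>" if "i \<le> n" for i
    using that by blast
  define ys where "ys = concat (map h [0..<Suc n])"
  have s: "hermite_sum ys w = (\<Sum>i\<le>n. hermite_sum (h i) w)" for w
    unfolding ys_def hermite_sum_concat lessThan_Suc_atMost ..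
  have gL: "g i \<in> L2 M" if "i \<le> n" for i using g(1)[OF that] chaos_L2 by blast
  have "L2_norm M (\<lambda>\<omega>. f \<omega> - hermite_sum ys (\<lambda>v. W v \<omega>)) = L2_norm M (\<lambda>\<omega>. \<Sum>i\<le>n. g i \<omega> - hermite_sum (h i) (\<lambda>v. W v \<omega>))"
  proof (rule L2_norm_cong_AE)
    show "(\<lambda>\<omega>. f \<omega> - hermite_sum ys (\<lambda>v. W v \<omega>)) \<in> borel_measurable M"
      by (intro L2_D(1) L2_diff hermite_sum_L2 chaos_upto_L2[OF f])
    show "(\<lambda>\<omega>. \<Sum>i\<le>n. g i \<omega> - hermite_sum (h i) (\<lambda>v. W v \<omega>)) \<in> borel_measurable M"
      by (intro L2_D(1) L2_sum L2_diff hermite_sum_L2 gL) auto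
    show "AE \<omega> in M. \<bar>f \<omega> - hermite_sum ys (\<lambda>v. W v \<omega>)\<bar> = \<bar>\<Sum>i\<le>n. g i \<omega> - hermite_sum (h i) (\<lambda>v. W v \<omega>)\<bar>"
      using g(2) by eventually_elim (simp add: s sum_subtractf)
  qed
  also have "\<dots> \<le> (\<Sum>i\<le>n. L2_norm M (\<lambda>\<omega>. g i \<omega> - hermite_sum (h i) (\<lambda>v. W v \<omega>)))"
    by (intro L2_norm_sum_le L2_diff hermite_sum_L2 gL) auto
  also have "\<dots> < (\<Sum>i\<le>n. \<delta>)" by (intro sum_strict_mono) (use h in auto)
  also have "\<dots> = \<epsilon>" by (simp add: \<delta>_def)
  finally have "L2_norm M (\<lambda>\<omega>. f \<omega> - hermite_sum ys (\<lambda>v. W v \<omega>)) < \<epsilon>" .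
  moreover have "j \<le> n" if j: "(j, v, y) \<in> set ys" for j v y
  proof -
    obtain i where i: "i \<le> n" "(j, v, y) \<in> set (h i)" using j by (auto simp: ys_def less_Suc_eq_le simp del: upt_Suc)
    then show ?thesis using h[OF i(1)] by auto
  qed
  ultimately show ?thesis using that by blast
qed

lemma chaos_upto_add:
  assumes "f \<in> chaos_upto M W n" "g \<in> chaos_upto M W n"
  shows "(\<lambda>\<omega>. f \<omega> + g \<omega>) \<in> chaos_upto M W n"
proof -
  obtain u v where "\<And>i. i \<le> n \<Longrightarrow> u i \<in> chaos M W i" "AE \<omega> in M. f \<omega> = (\<Sum>i\<le>n. u i \<omega>)"
    "\<And>i. i \<le> n \<Longrightarrow> v i \<in> chaos M W i" "AE \<omega> in M. g \<omega> = (\<Sum>i\<le>n. v i \<omega>)"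
    using assms by (auto simp: chaos_upto_def)
  moreover from this(2,4) have "AE \<omega> in M. f \<omega> + g \<omega> = (\<Sum>i\<le>n. u i \<omega> + v i \<omega>)" by eventually_elim (simp add: sum.distrib)
  ultimately show ?thesis
    using assms unfolding chaos_upto_def
    by (intro CollectI conjI L2_add exI[of _ "\<lambda>i \<omega>. u i \<omega> + v i \<omega>"])
       (auto simp: chaos_def intro!: L2_closed_span_add hermite_L2)
qed

lemma chaos_upto_cmult:
  assumes "f \<in> chaos_upto M W n"
  shows "(\<lambda>\<omega>. r * f \<omega>) \<in> chaos_upto M W n"
proof -
  obtain u where "\<And>i. i \<le> n \<Longrightarrow> u i \<in> chaos M W i" "AE \<omega> in M. f \<omega> = (\<Sum>i\<le>n. u i \<omega>)"
    using assms by (auto simp: chaos_upto_def)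
  moreover from this(2) have "AE \<omega> in M. r * f \<omega> = (\<Sum>i\<le>n. r * u i \<omega>)" by eventually_elim (simp add: sum_distrib_left)
  ultimately show ?thesis
    using assms unfolding chaos_upto_def
    by (intro CollectI conjI L2_cmult exI[of _ "\<lambda>i \<omega>. r * u i \<omega>"]) (auto simp: chaos_def intro!: L2_closed_span_cmult)
qed

lemma chaos_upto_cong_AE:
  assumes "f \<in> chaos_upto M W n" "g \<in> borel_measurable M" "AE \<omega> in M. g \<omega> = f \<omega>"
  shows "g \<in> chaos_upto M W n"
proof -
  obtain u where u: "\<And>i. i \<le> n \<Longrightarrow> u i \<in> chaos M W i" "AE \<omega> in M. f \<omega> = (\<Sum>i\<le>n. u i \<omega>)"
    using assms by (auto simp: chaos_upto_def)
  from u(2) assms(3) have "AE \<omega> in M. g \<omega> = (\<Sum>i\<le>n. u i \<omega>)" by eventually_elim simp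
  then show ?thesis unfolding chaos_upto_def using u(1) L2_cong_AE[OF chaos_upto_L2[OF assms(1)] assms(2,3)] by blast
qed

lemma chaos_upto_zero: "(\<lambda>\<omega>. 0) \<in> chaos_upto M W n"
  unfolding chaos_upto_def
proof (intro CollectI conjI L2_zero exI[of _ "\<lambda>i \<omega>. 0"] allI impI)
  show "(\<lambda>\<omega>. 0) \<in> chaos M W i" for i
    unfolding chaos_def L2_closed_span_def
    by (intro CollectI conjI L2_zero allI impI exI[of _ "0::nat"]) (simp add: L2_norm_def)
qed simp

lemma W_in_chaos_upto:
  assumes "1 \<le> n" "norm v = 1"
  shows "W v \<in> chaos_upto M W n"
proof -
  have z: "(\<lambda>\<omega>. 0) \<in> chaos M W i" for i
    unfolding chaos_def L2_closed_span_def
    by (intro CollectI conjI L2_zero allI impI exI[of _ "0::nat"]) (simp add: L2_norm_def)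
  have "(\<lambda>\<omega>. hermite (Suc 0) (W v \<omega>)) \<in> chaos M W (Suc 0)"
    unfolding chaos_def by (rule L2_closed_span_base[OF _ hermite_L2]) (use assms in blast)
  then have W1: "W v \<in> chaos M W (Suc 0)" by (simp add: hermite_1)
  define g where "g i = (if i = Suc 0 then W v else (\<lambda>\<omega>. 0))" for i
  have "(\<Sum>i\<le>n. g i \<omega>) = (\<Sum>i\<le>n. if i = Suc 0 then W v \<omega> else 0)" for \<omega>
    by (intro sum.cong) (auto simp: g_def)
  then have "W v \<omega> = (\<Sum>i\<le>n. g i \<omega>)" for \<omega> using assms by simp
  moreover have "g i \<in> chaos M W i" for i using z W1 by (auto simp: g_def)
  ultimately show ?thesis unfolding chaos_upto_def using W_L2 by blast
qed

lemma gaussian_sum_norm_W: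
  fixes x :: "nat \<Rightarrow> 'x::real_normed_vector"
  assumes v: "orthonormal_fam m v"
  shows "gaussian_sum_norm m x = L2_norm M (\<lambda>\<omega>. norm (\<Sum>k<m. W (v k) \<omega> *\<^sub>R x k))"
proof (rule gaussian_sum_norm_eq[where X="\<lambda>k. W (v k)"])
  show "(\<integral>\<omega>. cos (c + (\<Sum>i<m. t i * W (v i) \<omega>)) \<partial>M) = exp (- (\<Sum>i<m. (t i)\<^sup>2) / 2) * cos c" for t c
    using W_sum_cos[of c t v m] orthonormal_expansion_norm[OF v, of t] by simp
qed (rule W_measurable)

end

text \<open>For families of bounded length, all the sums with orthonormal coefficients are comparable with the
  sum of the norms.\<close>

lemma orthonormal_sum_bounds:
  fixes x :: "nat \<Rightarrow> 'x::real_normed_vector"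
  assumes f: "\<And>k. k < m \<Longrightarrow> f k \<in> L2 P"
    and on: "\<And>i j. i < m \<Longrightarrow> j < m \<Longrightarrow> (\<integral>\<omega>. f i \<omega> * f j \<omega> \<partial>P) = (if i = j then 1 else 0)"
  shows "L2_norm P (\<lambda>\<omega>. norm (\<Sum>k<m. f k \<omega> *\<^sub>R x k)) \<le> (\<Sum>k<m. norm (x k))"
    and "j < m \<Longrightarrow> norm (x j) \<le> L2_norm P (\<lambda>\<omega>. norm (\<Sum>k<m. f k \<omega> *\<^sub>R x k))"
    and "(\<Sum>k<m. norm (x k)) \<le> real m * L2_norm P (\<lambda>\<omega>. norm (\<Sum>k<m. f k \<omega> *\<^sub>R x k))"
proof -
  have n1: "L2_norm P (f k) = 1" if "k < m" for k
    using on[OF that that] by (simp add: L2_norm_def power2_eq_square)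
  show "L2_norm P (\<lambda>\<omega>. norm (\<Sum>k<m. f k \<omega> *\<^sub>R x k)) \<le> (\<Sum>k<m. norm (x k))"
    using L2_norm_sum_scaleR(3)[of m f P x, OF f] n1 by simp
  show le: "norm (x j) \<le> L2_norm P (\<lambda>\<omega>. norm (\<Sum>k<m. f k \<omega> *\<^sub>R x k))" if j: "j < m" for j
  proof -
    have "(\<Sum>k<m. (\<integral>\<omega>. f j \<omega> * f k \<omega> \<partial>P) *\<^sub>R x k) = (\<Sum>k<m. if k = j then x k else 0)"
      using on[OF j] by (intro sum.cong) auto
    then have "(\<Sum>k<m. (\<integral>\<omega>. f j \<omega> * f k \<omega> \<partial>P) *\<^sub>R x k) = x j" using j by simp
    then show ?thesis using norm_coefficient_le[of m f P "f j" x, OF f f[OF j]] n1[OF j] by simp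
  qed
  have "(\<Sum>k<m. norm (x k)) \<le> (\<Sum>k<m. L2_norm P (\<lambda>\<omega>. norm (\<Sum>k<m. f k \<omega> *\<^sub>R x k)))" by (intro sum_mono le) simp
  then show "(\<Sum>k<m. norm (x k)) \<le> real m * L2_norm P (\<lambda>\<omega>. norm (\<Sum>k<m. f k \<omega> *\<^sub>R x k))" by simp
qed

section \<open>Isometries into a finite chaos\<close>

text \<open>The stochastic integral, seen as an isometry. The subspace \<open>D\<close> will be spanned by step functions
  tensored with vectors of \<open>U\<close>, where membership in the chaos is inherited from the process; the
  whole space is then reached by approximation.\<close>

locale chaos_isometry = gaussian_space M W
  for M :: "'o measure" and W :: "'v::real_inner \<Rightarrow> 'o \<Rightarrow> real" +
  fixes n :: nat and I :: "'e::real_inner \<Rightarrow> 'o \<Rightarrow> real" and D :: "'e set"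
  assumes I_linear: "L2_linear M I" and I_isometry: "\<And>h. L2_norm M (I h) = norm h"
    and D_subspace: "subspace D" and D_dense: "closure D = UNIV"
    and D_chaos: "\<And>h. h \<in> D \<Longrightarrow> I h \<in> chaos_upto M W n"
begin

lemma I_L2: "I h \<in> L2 M" using I_linear by (simp add: L2_linear_def)

lemma I_measurable[measurable]: "I h \<in> borel_measurable M" by (rule L2_D(1)[OF I_L2])

lemma I_add: "AE \<omega> in M. I (h + k) \<omega> = I h \<omega> + I k \<omega>" using I_linear by (simp add: L2_linear_def)

lemma I_scale: "AE \<omega> in M. I (c *\<^sub>R h) \<omega> = c * I h \<omega>" using I_linear by (simp add: L2_linear_def)

lemma I_diff: "AE \<omega> in M. I (h - k) \<omega> = I h \<omega> - I k \<omega>"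
  using I_add[of h "(- 1) *\<^sub>R k"] I_scale[of "- 1" k] by eventually_elim simp

lemma I_sum: "AE \<omega> in M. I (\<Sum>i<(m::nat). c i *\<^sub>R h i) \<omega> = (\<Sum>i<m. c i * I (h i) \<omega>)"
proof (induction m)
  case 0
  show ?case using I_scale[of 0 0] by eventually_elim simp
next
  case (Suc m)
  show ?case using Suc I_add[of "\<Sum>i<m. c i *\<^sub>R h i" "c m *\<^sub>R h m"] I_scale[of "c m" "h m"] by eventually_elim simp
qed

lemma I_norm_diff: "L2_norm M (\<lambda>\<omega>. I h \<omega> - I k \<omega>) = norm (h - k)"
proof -
  have "L2_norm M (\<lambda>\<omega>. I h \<omega> - I k \<omega>) = L2_norm M (I (h - k))"
    by (rule L2_norm_cong_AE) (use I_diff[of h k] in auto)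
  then show ?thesis by (simp add: I_isometry)
qed

lemma I_inner: "(\<integral>\<omega>. I h \<omega> * I k \<omega> \<partial>M) = inner h k"
proof -
  have "(L2_norm M (\<lambda>\<omega>. I h \<omega> - I k \<omega>))\<^sup>2 = (\<integral>\<omega>. (I h \<omega>)\<^sup>2 - 2 * (I h \<omega> * I k \<omega>) + (I k \<omega>)\<^sup>2 \<partial>M)"
    unfolding L2_norm_power2 by (intro arg_cong[where f="integral\<^sup>L M"] ext) (simp add: power2_eq_square algebra_simps)
  also have "\<dots> = (L2_norm M (I h))\<^sup>2 - 2 * (\<integral>\<omega>. I h \<omega> * I k \<omega> \<partial>M) + (L2_norm M (I k))\<^sup>2"
    using L2_D(2)[OF I_L2] L2_mult_integrable[OF I_L2 I_L2] by (simp add: L2_norm_power2)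
  finally have "(norm (h - k))\<^sup>2 = (norm h)\<^sup>2 - 2 * (\<integral>\<omega>. I h \<omega> * I k \<omega> \<partial>M) + (norm k)\<^sup>2"
    by (simp add: I_norm_diff I_isometry)
  then show ?thesis by (simp add: power2_norm_eq_inner inner_diff_left inner_diff_right inner_commute)
qed

lemma I_approx:
  assumes \<epsilon>: "0 < \<epsilon>"
  obtains ys :: "(nat \<times> 'v \<times> real) list" where "\<And>j v y. (j, v, y) \<in> set ys \<Longrightarrow> j \<le> n"
    "L2_norm M (\<lambda>\<omega>. I h \<omega> - hermite_sum ys (\<lambda>v. W v \<omega>)) < \<epsilon>"
proof -
  have "h \<in> closure D" using D_dense by simp
  then obtain k where k: "k \<in> D" "dist k h < \<epsilon> / 2" using \<epsilon> unfolding closure_approachable by (meson half_gt_zero)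
  obtain ys :: "(nat \<times> 'v \<times> real) list" where ys: "\<And>j v y. (j, v, y) \<in> set ys \<Longrightarrow> j \<le> n"
    "L2_norm M (\<lambda>\<omega>. I k \<omega> - hermite_sum ys (\<lambda>v. W v \<omega>)) < \<epsilon> / 2"
    using chaos_upto_approx[OF D_chaos[OF k(1)], of "\<epsilon> / 2"] \<epsilon> by auto
  have "L2_norm M (\<lambda>\<omega>. (I h \<omega> - I k \<omega>) + (I k \<omega> - hermite_sum ys (\<lambda>v. W v \<omega>)))
      \<le> L2_norm M (\<lambda>\<omega>. I h \<omega> - I k \<omega>) + L2_norm M (\<lambda>\<omega>. I k \<omega> - hermite_sum ys (\<lambda>v. W v \<omega>))"
    by (intro L2_norm_add_le L2_diff I_L2 hermite_sum_L2)
  also have "\<dots> < \<epsilon>" using ys(2) k(2) by (simp add: I_norm_diff dist_norm norm_minus_commute)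
  finally have "L2_norm M (\<lambda>\<omega>. I h \<omega> - hermite_sum ys (\<lambda>v. W v \<omega>)) < \<epsilon>" by simp
  with ys(1) show ?thesis by (rule that)
qed

definition chaos_sum :: "nat \<Rightarrow> (nat \<Rightarrow> 'e) \<Rightarrow> (nat \<Rightarrow> 'x::real_normed_vector) \<Rightarrow> 'o \<Rightarrow> 'x" where
  "chaos_sum m h x \<omega> = (\<Sum>k<m. I (h k) \<omega> *\<^sub>R x k)"

lemma chaos_sum_sm: "strongly_measurable M (chaos_sum m h x)"
  unfolding chaos_sum_def[abs_def] by (rule L2_norm_sum_scaleR(1)) (rule I_L2)

lemma chaos_sum_L2: "(\<lambda>\<omega>. norm (chaos_sum m h x \<omega>)) \<in> L2 M"
  unfolding chaos_sum_def by (rule L2_norm_sum_scaleR(2)) (rule I_L2)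

text \<open>Chaos sums are \<open>L\<^sup>2\<close>-limits of Hermite polynomials of degree at most \<open>n\<close>, and the tail
  inequality survives the limit.\<close>

lemma chaos_sum_self_improving:
  obtains C where "2 \<le> C" "\<And>m h (x :: nat \<Rightarrow> 'x::real_normed_vector). self_improving C (real (2 * n + 1)) (chaos_sum m h x)"
proof -
  show ?thesis
  proof (rule hermite_sum_self_improving[where n=n and 'x='x])
    fix C0 assume C0: "2 \<le> C0"
      "\<And>xs :: (nat \<times> 'v \<times> 'x) list. (\<And>k v y. (k, v, y) \<in> set xs \<Longrightarrow> k \<le> n) \<Longrightarrow>
         self_improving C0 (real (2 * n + 1)) (\<lambda>\<omega>. hermite_sum xs (\<lambda>v. W v \<omega>))"
    have "self_improving (4 * C0) (real (2 * n + 1)) (chaos_sum m h x)" for m h and x :: "nat \<Rightarrow> 'x"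
    proof -
      define \<delta> where "\<delta> i = inverse (real (Suc i))" for i
      have \<delta>: "0 < \<delta> i" for i by (simp add: \<delta>_def)
      define P where "P i k ys \<longleftrightarrow> (\<forall>(j, v, y) \<in> set ys. j \<le> n) \<and> L2_norm M (\<lambda>\<omega>. I (h k) \<omega> - hermite_sum ys (\<lambda>v. W v \<omega>)) < \<delta> i"
        for i k and ys :: "(nat \<times> 'v \<times> real) list"
      have "\<exists>ys. P i k ys" for i k
      proof -
        obtain ys :: "(nat \<times> 'v \<times> real) list" where "\<And>j v y. (j, v, y) \<in> set ys \<Longrightarrow> j \<le> n"
          "L2_norm M (\<lambda>\<omega>. I (h k) \<omega> - hermite_sum ys (\<lambda>v. W v \<omega>)) < \<delta> i"
          by (rule I_approx[OF \<delta>], rule that) blast+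
        then show ?thesis unfolding P_def by (intro exI[of _ ys]) auto
      qed
      then obtain ys where ysP: "\<And>i k. P i k (ys i k)" by metis
      then have ys: "(\<forall>(j, v, y) \<in> set (ys i k). j \<le> n) \<and> L2_norm M (\<lambda>\<omega>. I (h k) \<omega> - hermite_sum (ys i k) (\<lambda>v. W v \<omega>)) < \<delta> i" for i k
        by (simp add: P_def)
      define zs where "zs i = concat (map (\<lambda>k. map (\<lambda>(j, v, c). (j, v, c *\<^sub>R x k)) (ys i k)) [0..<m])" for i
      define F where "F i \<omega> = hermite_sum (zs i) (\<lambda>v. W v \<omega>)" for i \<omega>
      have F: "F i \<omega> = (\<Sum>k<m. hermite_sum (ys i k) (\<lambda>v. W v \<omega>) *\<^sub>R x k)" for i \<omega>
        by (simp add: F_def zs_def hermite_sum_concat hermite_sum_scale)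
      have diff: "F i \<omega> - chaos_sum m h x \<omega> = (\<Sum>k<m. (hermite_sum (ys i k) (\<lambda>v. W v \<omega>) - I (h k) \<omega>) *\<^sub>R x k)" for i \<omega>
        by (simp add: F chaos_sum_def scaleR_diff_left sum_subtractf)
      have "self_improving C0 (real (2 * n + 1)) (F i)" for i
        unfolding F_def[abs_def] by (rule C0(2)) (use ys in \<open>fastforce simp: zs_def\<close>)
      moreover have "conv_prob F (chaos_sum m h x)"
      proof (rule conv_prob_L2)
        show L: "(\<lambda>\<omega>. norm (F i \<omega> - chaos_sum m h x \<omega>)) \<in> L2 M" for i
          unfolding diff by (rule L2_norm_sum_scaleR(2)) (intro L2_diff hermite_sum_L2 I_L2)
        have le: "L2_norm M (\<lambda>\<omega>. norm (F i \<omega> - chaos_sum m h x \<omega>)) \<le> (\<Sum>k<m. \<delta> i * norm (x k))" for i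
        proof -
          have "L2_norm M (\<lambda>\<omega>. norm (F i \<omega> - chaos_sum m h x \<omega>)) \<le> (\<Sum>k<m. L2_norm M (\<lambda>\<omega>. hermite_sum (ys i k) (\<lambda>v. W v \<omega>) - I (h k) \<omega>) * norm (x k))"
            unfolding diff by (rule L2_norm_sum_scaleR(3)) (intro L2_diff hermite_sum_L2 I_L2)
          also have "\<dots> \<le> (\<Sum>k<m. \<delta> i * norm (x k))"
          proof (intro sum_mono mult_right_mono)
            fix k
            have "L2_norm M (\<lambda>\<omega>. hermite_sum (ys i k) (\<lambda>v. W v \<omega>) - I (h k) \<omega>) = L2_norm M (\<lambda>\<omega>. I (h k) \<omega> - hermite_sum (ys i k) (\<lambda>v. W v \<omega>))"
              by (simp add: L2_norm_def power2_commute)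
            then show "L2_norm M (\<lambda>\<omega>. hermite_sum (ys i k) (\<lambda>v. W v \<omega>) - I (h k) \<omega>) \<le> \<delta> i" using ys[of k i] ys[of i k] by simp
          qed simp
          finally show ?thesis .
        qed
        have "(\<lambda>i. \<Sum>k<m. \<delta> i * norm (x k)) \<longlonglongrightarrow> (\<Sum>k<m. 0 * norm (x k))"
          unfolding \<delta>_def by (intro tendsto_sum tendsto_mult tendsto_const LIMSEQ_inverse_real_of_nat)
        then have lim: "(\<lambda>i. \<Sum>k<m. \<delta> i * norm (x k)) \<longlonglongrightarrow> 0" by simp
        show "(\<lambda>i. L2_norm M (\<lambda>\<omega>. norm (F i \<omega> - chaos_sum m h x \<omega>))) \<longlonglongrightarrow> 0"
          by (rule tendsto_sandwich[OF _ _ tendsto_const lim]; intro always_eventually allI L2_norm_nonneg le)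
      qed
      ultimately show ?thesis using C0(1) by (intro self_improving_limit chaos_sum_sm) auto
    qed
    moreover have "2 \<le> 4 * C0" using C0(1) by simp
    ultimately show ?thesis using that by blast
  qed
qed

lemma chaos_sum_diff_norm:
  "L2_norm M (\<lambda>\<omega>. norm (chaos_sum m h x \<omega>)) \<le> L2_norm M (\<lambda>\<omega>. norm (chaos_sum m h' x \<omega>)) + (\<Sum>k<m. norm (h k - h' k) * norm (x k))"
proof -
  have d: "chaos_sum m h x \<omega> - chaos_sum m h' x \<omega> = (\<Sum>k<m. (I (h k) \<omega> - I (h' k) \<omega>) *\<^sub>R x k)" for \<omega>
    by (simp add: chaos_sum_def scaleR_diff_left sum_subtractf)
  have L: "(\<lambda>\<omega>. norm (chaos_sum m h x \<omega> - chaos_sum m h' x \<omega>)) \<in> L2 M"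
    unfolding d by (rule L2_norm_sum_scaleR(2)) (intro L2_diff I_L2)
  have "L2_norm M (\<lambda>\<omega>. norm (chaos_sum m h x \<omega>)) \<le> L2_norm M (\<lambda>\<omega>. norm (chaos_sum m h' x \<omega>) + norm (chaos_sum m h x \<omega> - chaos_sum m h' x \<omega>))"
  proof (rule L2_norm_mono(2)[OF L2_add[OF chaos_sum_L2 L] L2_D(1)[OF chaos_sum_L2]], intro always_eventually allI)
    fix \<omega>
    have "norm (chaos_sum m h x \<omega>) \<le> norm (chaos_sum m h' x \<omega>) + norm (chaos_sum m h x \<omega> - chaos_sum m h' x \<omega>)"
      by (rule norm_triangle_sub)
    then show "\<bar>norm (chaos_sum m h x \<omega>)\<bar> \<le> \<bar>norm (chaos_sum m h' x \<omega>) + norm (chaos_sum m h x \<omega> - chaos_sum m h' x \<omega>)\<bar>" by simp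
  qed
  also have "\<dots> \<le> L2_norm M (\<lambda>\<omega>. norm (chaos_sum m h' x \<omega>)) + L2_norm M (\<lambda>\<omega>. norm (chaos_sum m h x \<omega> - chaos_sum m h' x \<omega>))"
    by (rule L2_norm_add_le[OF chaos_sum_L2 L])
  also have "L2_norm M (\<lambda>\<omega>. norm (chaos_sum m h x \<omega> - chaos_sum m h' x \<omega>)) \<le> (\<Sum>k<m. norm (h k - h' k) * norm (x k))"
    unfolding d using L2_norm_sum_scaleR(3)[of m "\<lambda>k \<omega>. I (h k) \<omega> - I (h' k) \<omega>" M x] L2_diff[OF I_L2 I_L2] by (simp add: I_norm_diff)
  finally show ?thesis by simp
qed

text \<open>If an orthonormal family were longer than the number of monomials, its polynomial approximants would
  satisfy a nontrivial linear relation \<open>\<beta>\<close>. The corresponding combination of the family has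
  norm \<open>b = \<parallel>\<beta>\<parallel>\<close>, but differs from zero by less than \<open>b\<close>.\<close>

lemma finite_dimensional_bound:
  assumes fd: "n = 0 \<or> (\<exists>m. \<not> (\<exists>v :: nat \<Rightarrow> 'v. orthonormal_fam m v))"
  obtains d where "\<And>m (e :: nat \<Rightarrow> 'e). orthonormal_fam m e \<Longrightarrow> m \<le> d"
proof -
  obtain S :: "(nat \<times> (nat \<Rightarrow> nat)) set" and f where S: "finite S"
    "\<And>k v. k \<le> n \<Longrightarrow> \<exists>c. AE \<omega> in M. hermite k (W v \<omega>) = (\<Sum>s\<in>S. c s * f s \<omega>)"
    by (rule finite_dimensional_hermite[OF fd], rule that) blast+
  have poly: "\<exists>c. AE \<omega> in M. hermite_sum ys (\<lambda>v. W v \<omega>) = (\<Sum>s\<in>S. c s * f s \<omega>)"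
    if "\<And>j v y. (j, v, y) \<in> set ys \<Longrightarrow> j \<le> n" for ys :: "(nat \<times> 'v \<times> real) list"
    using that
  proof (induction ys)
    case Nil
    then show ?case by (intro exI[of _ "\<lambda>_. 0"]) (simp add: hermite_sum_simps)
  next
    case (Cons a ys)
    obtain j v y where a: "a = (j, v, y)" by (cases a) auto
    have "j \<le> n" using Cons.prems[of j v y] a by simp
    from S(2)[OF this] obtain c where c: "AE \<omega> in M. hermite j (W v \<omega>) = (\<Sum>s\<in>S. c s * f s \<omega>)" by blast
    have "\<exists>c. AE \<omega> in M. hermite_sum ys (\<lambda>v. W v \<omega>) = (\<Sum>s\<in>S. c s * f s \<omega>)"
      by (rule Cons.IH) (use Cons.prems in \<open>auto\<close>)
    then obtain c' where c': "AE \<omega> in M. hermite_sum ys (\<lambda>v. W v \<omega>) = (\<Sum>s\<in>S. c' s * f s \<omega>)" by blast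
    from c c' have "AE \<omega> in M. hermite_sum (a # ys) (\<lambda>v. W v \<omega>) = (\<Sum>s\<in>S. (y * c s + c' s) * f s \<omega>)"
      by eventually_elim (simp add: a hermite_sum_simps sum.distrib sum_distrib_left algebra_simps)
    then show ?case by (intro exI[of _ "\<lambda>s. y * c s + c' s"])
  qed
  have "m \<le> card S" if e: "orthonormal_fam m e" for m and e :: "nat \<Rightarrow> 'e"
  proof (rule ccontr)
    assume "\<not> m \<le> card S"
    then have m: "card S < card {..<m}" "0 < m" by auto
    \<comment> \<open>Small enough for \<open>m\<close> errors of size \<open>b \<epsilon>\<close> to stay below \<open>b\<close>.\<close>
    define \<epsilon> where "\<epsilon> = 1 / (real m + 1)"
    have \<epsilon>: "0 < \<epsilon>" by (simp add: \<epsilon>_def)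
    define P where "P k ys c \<longleftrightarrow> L2_norm M (\<lambda>\<omega>. I (e k) \<omega> - hermite_sum ys (\<lambda>v. W v \<omega>)) < \<epsilon> \<and>
       (AE \<omega> in M. hermite_sum ys (\<lambda>v. W v \<omega>) = (\<Sum>s\<in>S. c s * f s \<omega>))" for k c and ys :: "(nat \<times> 'v \<times> real) list"
    have "\<exists>ys c. P k ys c" for k
    proof -
      obtain ys :: "(nat \<times> 'v \<times> real) list" where ys: "\<And>j v y. (j, v, y) \<in> set ys \<Longrightarrow> j \<le> n"
        "L2_norm M (\<lambda>\<omega>. I (e k) \<omega> - hermite_sum ys (\<lambda>v. W v \<omega>)) < \<epsilon>" by (rule I_approx[OF \<epsilon>], rule that) blast+
      have "\<exists>c. AE \<omega> in M. hermite_sum ys (\<lambda>v. W v \<omega>) = (\<Sum>s\<in>S. c s * f s \<omega>)"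
        by (rule poly) (rule ys(1))
      with ys(2) show ?thesis unfolding P_def by blast
    qed
    then obtain ys c where P: "\<And>k. P k (ys k) (c k)" by metis
    have ys: "\<And>k. L2_norm M (\<lambda>\<omega>. I (e k) \<omega> - hermite_sum (ys k) (\<lambda>v. W v \<omega>)) < \<epsilon>"
      and c: "\<And>k. AE \<omega> in M. hermite_sum (ys k) (\<lambda>v. W v \<omega>) = (\<Sum>s\<in>S. c k s * f s \<omega>)" using P by (simp_all add: P_def)
    obtain \<beta> where \<beta>: "\<exists>k\<in>{..<m}. \<beta> k \<noteq> 0" "\<And>s. s \<in> S \<Longrightarrow> (\<Sum>k<m. \<beta> k * c k s) = 0"
      using homogeneous_system_nontrivial[OF S(1) _ m(1), of c] by auto
    define b where "b = sqrt (\<Sum>k<m. (\<beta> k)\<^sup>2)"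
    have "0 < (\<Sum>k<m. (\<beta> k)\<^sup>2)" using \<beta>(1) by (auto intro!: sum_pos2)
    then have b: "0 < b" "b\<^sup>2 = (\<Sum>k<m. (\<beta> k)\<^sup>2)" by (auto simp: b_def)
    have \<beta>b: "\<bar>\<beta> k\<bar> \<le> b" if "k < m" for k
    proof -
      have "(\<beta> k)\<^sup>2 \<le> b\<^sup>2" unfolding b(2) using that by (intro member_le_sum) auto
      then show ?thesis using b(1) by (simp add: abs_le_square_iff[symmetric])
    qed
    have "b = norm (\<Sum>k<m. \<beta> k *\<^sub>R e k)" using orthonormal_expansion_norm[OF e, of \<beta>] b by (simp add: b_def real_sqrt_unique)
    also have "\<dots> = L2_norm M (I (\<Sum>k<m. \<beta> k *\<^sub>R e k))" by (simp add: I_isometry)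
    also have "\<dots> = L2_norm M (\<lambda>\<omega>. \<Sum>k<m. \<beta> k * (I (e k) \<omega> - hermite_sum (ys k) (\<lambda>v. W v \<omega>)))"
    proof (rule L2_norm_cong_AE)
      show "(\<lambda>\<omega>. \<Sum>k<m. \<beta> k * (I (e k) \<omega> - hermite_sum (ys k) (\<lambda>v. W v \<omega>))) \<in> borel_measurable M"
        by (intro L2_D(1) L2_sum L2_cmult L2_diff I_L2 hermite_sum_L2)
      have "AE \<omega> in M. \<forall>k\<in>{..<m}. hermite_sum (ys k) (\<lambda>v. W v \<omega>) = (\<Sum>s\<in>S. c k s * f s \<omega>)"
        by (rule AE_finite_allI) (use c in auto)
      then show "AE \<omega> in M. \<bar>I (\<Sum>k<m. \<beta> k *\<^sub>R e k) \<omega>\<bar> = \<bar>\<Sum>k<m. \<beta> k * (I (e k) \<omega> - hermite_sum (ys k) (\<lambda>v. W v \<omega>))\<bar>"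
        using I_sum[of \<beta> e m]
      proof eventually_elim
        case (elim \<omega>)
        have "(\<Sum>k<m. \<beta> k * hermite_sum (ys k) (\<lambda>v. W v \<omega>)) = (\<Sum>k<m. \<Sum>s\<in>S. \<beta> k * c k s * f s \<omega>)"
          using elim(1) by (intro sum.cong) (auto simp: sum_distrib_left mult.assoc)
        also have "\<dots> = (\<Sum>s\<in>S. (\<Sum>k<m. \<beta> k * c k s) * f s \<omega>)" by (subst sum.swap) (simp add: sum_distrib_right)
        also have "\<dots> = 0" using \<beta>(2) by simp
        finally show ?case using elim(2) by (simp add: right_diff_distrib sum_subtractf)
      qed
    qed simp
    also have "\<dots> \<le> (\<Sum>k<m. L2_norm M (\<lambda>\<omega>. \<beta> k * (I (e k) \<omega> - hermite_sum (ys k) (\<lambda>v. W v \<omega>))))"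
      by (intro L2_norm_sum_le L2_cmult L2_diff I_L2 hermite_sum_L2)
    also have "\<dots> \<le> (\<Sum>k<m. b * \<epsilon>)"
      unfolding L2_norm_cmult using \<beta>b ys b(1) by (intro sum_mono mult_mono L2_norm_nonneg) (auto intro: less_imp_le)
    also have "\<dots> < b" using b(1) by (simp add: \<epsilon>_def field_simps)
    finally show False by simp
  qed
  then show ?thesis by (rule that)
qed

text \<open>With enough room for a Gaussian family \<open>W (v k)\<close> in the chaos this is goodness, first for families
  in \<open>D\<close> and then for all by approximation. Without it, orthonormal families have bounded length
  \<open>d\<close> and both sums are comparable with the sum of the norms.\<close>

lemma chaos_sum_gaussian_comparison:
  assumes good: "n_good M W n TYPE('x::banach)"
  obtains c1 c2 where "0 < c1" "0 < c2"
    "\<And>m e (x :: nat \<Rightarrow> 'x). orthonormal_fam m e \<Longrightarrow>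
       c1 * gaussian_sum_norm m x \<le> L2_norm M (\<lambda>\<omega>. norm (chaos_sum m e x \<omega>)) \<and>
       L2_norm M (\<lambda>\<omega>. norm (chaos_sum m e x \<omega>)) \<le> c2 * gaussian_sum_norm m x"
proof (cases "n = 0 \<or> (\<exists>m. \<not> (\<exists>v :: nat \<Rightarrow> 'v. orthonormal_fam m v))")
  case True
  obtain d where d: "\<And>m (e :: nat \<Rightarrow> 'e). orthonormal_fam m e \<Longrightarrow> m \<le> d"
    by (rule finite_dimensional_bound[OF True], rule that) blast
  show ?thesis
  proof (rule that[of "1 / (real d + 1)" "real d + 1"])
    show "0 < 1 / (real d + 1)" "0 < real d + 1" by auto
    fix m and e :: "nat \<Rightarrow> 'e" and x :: "nat \<Rightarrow> 'x"
    assume e: "orthonormal_fam m e"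
    have md: "real m \<le> real d + 1" using d[OF e] by simp
    let ?p = "L2_norm M (\<lambda>\<omega>. norm (chaos_sum m e x \<omega>))" and ?g = "gaussian_sum_norm m x"
    have p: "?p \<le> (\<Sum>k<m. norm (x k))" "(\<Sum>k<m. norm (x k)) \<le> real m * ?p"
      unfolding chaos_sum_def using orthonormal_famD[OF e] by (auto intro!: orthonormal_sum_bounds I_L2 simp: I_inner)
    have g: "?g \<le> (\<Sum>k<m. norm (x k))" "(\<Sum>k<m. norm (x k)) \<le> real m * ?g"
      unfolding gaussian_sum_norm_L2 by (auto intro!: orthonormal_sum_bounds std_gauss_L2 simp: std_gauss_cov)
    have g0: "0 \<le> ?g" by (simp add: gaussian_sum_norm_L2 L2_norm_nonneg)
    have p0: "0 \<le> ?p" by (simp add: L2_norm_nonneg)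
    have "?g \<le> (real d + 1) * ?p" using g(1) p(2) mult_right_mono[OF md p0] by linarith
    moreover have "?p \<le> (real d + 1) * ?g" using p(1) g(2) mult_right_mono[OF md g0] by linarith
    ultimately show "1 / (real d + 1) * ?g \<le> ?p \<and> ?p \<le> (real d + 1) * ?g" by (simp add: field_simps)
  qed
next
  case False
  then have n1: "1 \<le> n" and V: "\<exists>v :: nat \<Rightarrow> 'v. orthonormal_fam m v" for m by auto
  obtain c1 c2 where c: "0 < c1" "0 < c2" and cmp: "\<And>m e1 e2 (x :: nat \<Rightarrow> 'x).
     L2_orthonormal M m e1 \<and> (\<forall>k<m. e1 k \<in> chaos_upto M W n) \<and>
     L2_orthonormal M m e2 \<and> (\<forall>k<m. e2 k \<in> chaos_upto M W n) \<Longrightarrow>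
       ennreal c1 * Lr_norm M 2 (\<lambda>\<omega>. \<Sum>k<m. e2 k \<omega> *\<^sub>R x k)
         \<le> Lr_norm M 2 (\<lambda>\<omega>. \<Sum>k<m. e1 k \<omega> *\<^sub>R x k) \<and>
       Lr_norm M 2 (\<lambda>\<omega>. \<Sum>k<m. e1 k \<omega> *\<^sub>R x k)
         \<le> ennreal c2 * Lr_norm M 2 (\<lambda>\<omega>. \<Sum>k<m. e2 k \<omega> *\<^sub>R x k)"
    using good unfolding n_good_def by blast
  show ?thesis
  proof (rule that[OF c])
    fix m and e :: "nat \<Rightarrow> 'e" and x :: "nat \<Rightarrow> 'x"
    assume e: "orthonormal_fam m e"
    obtain v :: "nat \<Rightarrow> 'v" where v: "orthonormal_fam m v" using V by blast
    let ?p = "\<lambda>e. L2_norm M (\<lambda>\<omega>. norm (chaos_sum m e x \<omega>))" and ?g = "gaussian_sum_norm m x"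
    have g: "?g = L2_norm M (\<lambda>\<omega>. norm (\<Sum>k<m. W (v k) \<omega> *\<^sub>R x k))" by (rule gaussian_sum_norm_W[OF v])
    have WL: "(\<lambda>\<omega>. norm (\<Sum>k<m. W (v k) \<omega> *\<^sub>R x k)) \<in> L2 M" by (rule L2_norm_sum_scaleR(2)) (rule W_L2)
    have g0: "0 \<le> ?g" by (simp add: gaussian_sum_norm_L2 L2_norm_nonneg)
    have onD: "c1 * ?g \<le> ?p e' \<and> ?p e' \<le> c2 * ?g" if e': "orthonormal_fam m e'" "\<And>k. k < m \<Longrightarrow> e' k \<in> D" for e'
    proof -
      have "L2_orthonormal M m (\<lambda>k. I (e' k))" using orthonormal_famD[OF e'(1)] by (simp add: L2_orthonormal_def I_L2 I_inner)
      moreover have "L2_orthonormal M m (\<lambda>k. W (v k))" using orthonormal_famD[OF v] by (simp add: L2_orthonormal_def W_L2 W_cov)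
      moreover have "\<forall>k<m. I (e' k) \<in> chaos_upto M W n" using e'(2) D_chaos by blast
      moreover have "\<forall>k<m. W (v k) \<in> chaos_upto M W n" using W_in_chaos_upto[OF n1 orthonormal_fam_norm[OF v]] by blast
      ultimately have "ennreal c1 * Lr_norm M 2 (\<lambda>\<omega>. \<Sum>k<m. W (v k) \<omega> *\<^sub>R x k) \<le> Lr_norm M 2 (\<lambda>\<omega>. \<Sum>k<m. I (e' k) \<omega> *\<^sub>R x k) \<and>
        Lr_norm M 2 (\<lambda>\<omega>. \<Sum>k<m. I (e' k) \<omega> *\<^sub>R x k) \<le> ennreal c2 * Lr_norm M 2 (\<lambda>\<omega>. \<Sum>k<m. W (v k) \<omega> *\<^sub>R x k)"
        by (intro cmp) auto
      moreover have "Lr_norm M 2 (\<lambda>\<omega>. \<Sum>k<m. W (v k) \<omega> *\<^sub>R x k) = ennreal ?g" unfolding g by (rule Lr_norm_2[OF WL])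
      moreover have "Lr_norm M 2 (\<lambda>\<omega>. \<Sum>k<m. I (e' k) \<omega> *\<^sub>R x k) = ennreal (?p e')"
        using Lr_norm_2[OF chaos_sum_L2[of m e' x]] by (simp add: chaos_sum_def[abs_def])
      ultimately show ?thesis using c g0 by (simp add: ennreal_mult[symmetric] L2_norm_nonneg)
    qed
    have lim: "c1 * ?g \<le> ?p e + \<epsilon> \<and> ?p e \<le> c2 * ?g + \<epsilon>" if \<epsilon>: "0 < \<epsilon>" for \<epsilon>
    proof -
      define s where "s = (\<Sum>k<m. norm (x k))"
      have s0: "0 \<le> s" by (simp add: s_def sum_nonneg)
      define \<delta> where "\<delta> = \<epsilon> / (s + 1)"
      have \<delta>: "0 < \<delta>" using \<epsilon> s0 by (simp add: \<delta>_def)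
      have ds: "\<delta> * s \<le> \<epsilon>" using \<epsilon> s0 by (simp add: \<delta>_def field_simps)
      obtain e' where e': "orthonormal_fam m e'" "\<And>i. i < m \<Longrightarrow> e' i \<in> D" "\<And>i. i < m \<Longrightarrow> norm (e' i - e i) < \<delta>"
        using orthonormal_approx[OF subspace_add[OF D_subspace] subspace_scale[OF D_subspace] D_dense e \<delta>] by blast
      have "(\<Sum>k<m. norm (e k - e' k) * norm (x k)) \<le> (\<Sum>k<m. \<delta> * norm (x k))"
        using e'(3) by (intro sum_mono mult_right_mono) (auto simp: norm_minus_commute intro: less_imp_le)
      also have "\<dots> \<le> \<epsilon>" using ds by (simp add: s_def sum_distrib_left)
      finally have le: "(\<Sum>k<m. norm (e k - e' k) * norm (x k)) \<le> \<epsilon>" .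
      then have le': "(\<Sum>k<m. norm (e' k - e k) * norm (x k)) \<le> \<epsilon>" by (simp add: norm_minus_commute)
      show ?thesis using chaos_sum_diff_norm[of m e x e'] chaos_sum_diff_norm[of m e' x e] le le' onD[OF e'(1,2)] by linarith
    qed
    show "c1 * ?g \<le> ?p e \<and> ?p e \<le> c2 * ?g"
      by (intro conjI; rule field_le_epsilon) (use lim in blast)+
  qed
qed

end



section \<open>Integrals of finite rank operators\<close>

lemma (in prob_space) L2_from_tail:
  assumes F: "self_improving C N F" and N: "1 \<le> N" and C: "2 \<le> C" and c: "0 < c" and small: "N * tail F c \<le> 1/2"
  shows "L2_norm M (\<lambda>\<omega>. norm (F \<omega>)) \<le> sqrt (moment_const C 2) * c"
proof -
  have "(\<integral>\<^sup>+\<omega>. ennreal ((norm (F \<omega>))\<^sup>2) \<partial>M) = (\<integral>\<^sup>+\<omega>. ennreal (norm (F \<omega>) powr 2) \<partial>M)"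
    by (intro nn_integral_cong) (simp add: powr_numeral)
  also have "\<dots> \<le> ennreal (moment_const C 2 * c powr 2)" by (rule self_improving_moment[OF F N C c small]) simp
  finally have le: "(\<integral>\<^sup>+\<omega>. ennreal ((norm (F \<omega>))\<^sup>2) \<partial>M) \<le> ennreal (moment_const C 2 * c\<^sup>2)" using c by (simp add: powr_numeral)
  have nn: "0 \<le> moment_const C 2 * c\<^sup>2" using moment_const_ge1[OF C, of 2] by simp
  have [measurable]: "(\<lambda>\<omega>. norm (F \<omega>)) \<in> borel_measurable M"
    using F by (intro strongly_measurable_norm) (simp add: self_improving_def)
  have "(\<integral>\<omega>. (norm (F \<omega>))\<^sup>2 \<partial>M) = enn2real (\<integral>\<^sup>+\<omega>. ennreal ((norm (F \<omega>))\<^sup>2) \<partial>M)"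
    by (rule integral_eq_nn_integral) auto
  also have "\<dots> \<le> enn2real (ennreal (moment_const C 2 * c\<^sup>2))" by (rule enn2real_mono[OF le]) simp
  also have "\<dots> = moment_const C 2 * c\<^sup>2" using nn by simp
  finally have "sqrt (\<integral>\<omega>. (norm (F \<omega>))\<^sup>2 \<partial>M) \<le> sqrt (moment_const C 2 * c\<^sup>2)" by (rule real_sqrt_le_mono)
  then show ?thesis using c by (simp add: L2_norm_def real_sqrt_mult)
qed

lemma (in prob_space) conv_prob_cong_AE:
  assumes "conv_prob F f" "\<And>k. strongly_measurable M (F k)" "\<And>k. strongly_measurable M (G k)"
    "strongly_measurable M f" "strongly_measurable M g"
    "\<And>k. AE \<omega> in M. F k \<omega> = G k \<omega>" "AE \<omega> in M. f \<omega> = g \<omega>"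
  shows "conv_prob G g"
proof -
  have "tail (\<lambda>\<omega>. G k \<omega> - g \<omega>) c = tail (\<lambda>\<omega>. F k \<omega> - f \<omega>) c" for k c
  proof (rule tail_cong_AE)
    show "AE \<omega> in M. G k \<omega> - g \<omega> = F k \<omega> - f \<omega>" using assms(6)[of k] assms(7) by eventually_elim simp
  qed (intro strongly_measurable_diff assms)+
  then show ?thesis using assms(1) by (simp add: conv_prob_def)
qed

context chaos_isometry
begin

lemma I_sm: "strongly_measurable M (I h)"
  by (rule strongly_measurable_real) (rule I_measurable)

lemma chaos_sum_rebase:
  assumes u: "\<And>i. i < m \<Longrightarrow> u i = (\<Sum>j<N. inner (u i) (b j) *\<^sub>R b j)"
  shows "AE \<omega> in M. chaos_sum m u y \<omega> = chaos_sum N b (\<lambda>j. \<Sum>i<m. inner (u i) (b j) *\<^sub>R y i) \<omega>"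
proof -
  have "AE \<omega> in M. \<forall>i\<in>{..<m}. I (u i) \<omega> = (\<Sum>j<N. inner (u i) (b j) * I (b j) \<omega>)"
  proof (rule AE_finite_allI)
    fix i assume "i \<in> {..<m}"
    then have "u i = (\<Sum>j<N. inner (u i) (b j) *\<^sub>R b j)" using u by simp
    then have e: "I (u i) = I (\<Sum>j<N. inner (u i) (b j) *\<^sub>R b j)" by (rule arg_cong)
    show "AE \<omega> in M. I (u i) \<omega> = (\<Sum>j<N. inner (u i) (b j) * I (b j) \<omega>)" unfolding e by (rule I_sum)
  qed simp
  then show ?thesis
  proof eventually_elim
    case (elim \<omega>)
    then have "chaos_sum m u y \<omega> = (\<Sum>i<m. (\<Sum>j<N. I (b j) \<omega> * inner (u i) (b j)) *\<^sub>R y i)"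
      unfolding chaos_sum_def by (intro sum.cong) (auto simp: mult.commute)
    then show ?case unfolding chaos_sum_def by (simp only: sum_rebase)
  qed
qed

text \<open>Another choice of the representation changes the integral on a null set only.\<close>

definition op_integral :: "('e \<Rightarrow>\<^sub>L 'x::real_normed_vector) \<Rightarrow> 'o \<Rightarrow> 'x" where
  "op_integral A = (SOME F. \<exists>m e x. finite_rank_rep A m e x \<and> F = chaos_sum m e x)"

lemma op_integral_rep:
  assumes "finite_rank A"
  obtains m e x where "finite_rank_rep A m e x" "op_integral A = chaos_sum m e x"
proof -
  have "\<exists>F m e x. finite_rank_rep A m e x \<and> F = chaos_sum m e x" using assms by (auto simp: finite_rank_def)
  from someI_ex[OF this] that show ?thesis unfolding op_integral_def by blast
qed

lemma op_integral_sm: "finite_rank A \<Longrightarrow> strongly_measurable M (op_integral A)"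
  by (erule op_integral_rep) (simp add: chaos_sum_sm)

lemma op_integral_L2: "finite_rank A \<Longrightarrow> (\<lambda>\<omega>. norm (op_integral A \<omega>)) \<in> L2 M"
  by (erule op_integral_rep) (simp add: chaos_sum_L2)

lemma op_integral_eq:
  fixes A :: "'e \<Rightarrow>\<^sub>L 'x::real_normed_vector" and u :: "nat \<Rightarrow> 'e" and y :: "nat \<Rightarrow> 'x"
  assumes A: "\<And>h. A h = (\<Sum>i<m. inner h (u i) *\<^sub>R y i)"
  shows "AE \<omega> in M. op_integral A \<omega> = chaos_sum m u y \<omega>"
proof -
  obtain k f z where f: "finite_rank_rep A k f z" "op_integral A = chaos_sum k f z" by (rule op_integral_rep[OF finite_rankI[OF A]])
  have A': "\<And>h. A h = (\<Sum>i<k. inner h (f i) *\<^sub>R z i)" using f(1) unfolding finite_rank_rep_def by blast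
  show ?thesis
  proof (rule finite_rank_common[OF A A'])
    fix N :: nat and b :: "nat \<Rightarrow> 'e"
    assume ub: "\<And>i. i < m \<Longrightarrow> u i = (\<Sum>j<N. inner (u i) (b j) *\<^sub>R b j)" and fb: "\<And>i. i < k \<Longrightarrow> f i = (\<Sum>j<N. inner (f i) (b j) *\<^sub>R b j)"
    have e1: "(\<lambda>j. \<Sum>i<m. inner (u i) (b j) *\<^sub>R y i) = (\<lambda>j. A (b j))" by (simp only: A inner_commute[of "b _"])
    have e2: "(\<lambda>j. \<Sum>i<k. inner (f i) (b j) *\<^sub>R z i) = (\<lambda>j. A (b j))" by (simp only: A' inner_commute[of "b _"])
    have p1: "AE \<omega> in M. chaos_sum m u y \<omega> = chaos_sum N b (\<lambda>j. A (b j)) \<omega>"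
      unfolding e1[symmetric] by (rule chaos_sum_rebase) (rule ub)
    have p2: "AE \<omega> in M. chaos_sum k f z \<omega> = chaos_sum N b (\<lambda>j. A (b j)) \<omega>"
      unfolding e2[symmetric] by (rule chaos_sum_rebase) (rule fb)
    from p1 p2 show ?thesis unfolding f(2) by eventually_elim simp
  qed
qed

lemma op_integral_diff:
  assumes "finite_rank A" "finite_rank B"
  shows "AE \<omega> in M. op_integral (A - B) \<omega> = op_integral A \<omega> - op_integral B \<omega>"
proof -
  obtain N b where b: "finite_rank_rep A N b (\<lambda>j. A (b j))" "finite_rank_rep B N b (\<lambda>j. B (b j))"
    by (rule finite_rank_common_rep[OF assms])
  have e: "AE \<omega> in M. op_integral R \<omega> = chaos_sum N b (\<lambda>j. R (b j)) \<omega>" if "finite_rank_rep R N b (\<lambda>j. R (b j))" for R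
    by (rule op_integral_eq) (use that in \<open>unfold finite_rank_rep_def, blast\<close>)
  from e[OF b(1)] e[OF b(2)] e[OF finite_rank_rep_diff[OF b]] show ?thesis
    by eventually_elim (simp add: chaos_sum_def blinfun.diff_left scaleR_diff_right sum_subtractf)
qed

lemma op_integral_functional:
  fixes A :: "'e \<Rightarrow>\<^sub>L 'x::real_normed_vector" and \<phi> :: "'x \<Rightarrow>\<^sub>L real"
  assumes A: "finite_rank A"
  obtains k where "\<And>h. inner k h = \<phi> (A h)" "AE \<omega> in M. \<phi> (op_integral A \<omega>) = I k \<omega>"
proof -
  obtain m e x where e: "finite_rank_rep A m e x" "op_integral A = chaos_sum m e x" by (rule op_integral_rep[OF A])
  define k where "k = (\<Sum>i<m. \<phi> (x i) *\<^sub>R e i)"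
  have "A h = (\<Sum>i<m. inner h (e i) *\<^sub>R x i)" for h using e(1) unfolding finite_rank_rep_def by blast
  then have "\<phi> (A h) = (\<Sum>i<m. inner h (e i) * \<phi> (x i))" for h
    by (simp add: blinfun.sum_right blinfun.scaleR_right)
  moreover have "inner k h = (\<Sum>i<m. \<phi> (x i) * inner (e i) h)" for h
    by (simp add: k_def inner_sum_left)
  ultimately have "inner k h = \<phi> (A h)" for h by (simp add: inner_commute[of h] mult.commute)
  moreover have "AE \<omega> in M. \<phi> (op_integral A \<omega>) = I k \<omega>"
    using I_sum[of "\<lambda>i. \<phi> (x i)" e m] unfolding k_def e(2)
    by eventually_elim (simp add: chaos_sum_def blinfun.sum_right blinfun.scaleR_right mult.commute)
  ultimately show ?thesis by (rule that)
qed

text \<open>The vector \<open>A h\<close> is the expectation of \<open>I h\<close> times the integral.\<close>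

lemma op_integral_operator_bound:
  assumes A: "finite_rank A"
  shows "norm A \<le> L2_norm M (\<lambda>\<omega>. norm (op_integral A \<omega>))"
proof (rule norm_blinfun_bound[OF L2_norm_nonneg])
  fix h
  obtain m e x where e: "finite_rank_rep A m e x" "op_integral A = chaos_sum m e x" by (rule op_integral_rep[OF A])
  have "A h = (\<Sum>k<m. (\<integral>\<omega>. I h \<omega> * I (e k) \<omega> \<partial>M) *\<^sub>R x k)"
    unfolding I_inner using e(1) unfolding finite_rank_rep_def by blast
  also have "norm \<dots> \<le> L2_norm M (I h) * L2_norm M (\<lambda>\<omega>. norm (\<Sum>k<m. I (e k) \<omega> *\<^sub>R x k))"
    by (rule norm_coefficient_le) (rule I_L2)+
  finally show "norm (A h) \<le> L2_norm M (\<lambda>\<omega>. norm (op_integral A \<omega>)) * norm h"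
    by (simp add: e(2) chaos_sum_def I_isometry mult.commute)
qed

text \<open>On the chaos convergence in probability is convergence in \<open>L\<^sup>2\<close>, and \<open>I\<close> is an isometry.\<close>

lemma I_conv_prob_imp_conv:
  assumes "conv_prob (\<lambda>k. I (u k)) (I v)"
  shows "u \<longlonglongrightarrow> v"
proof -
  obtain C where C: "2 \<le> C" "\<And>m h (x :: nat \<Rightarrow> real). self_improving C (real (2 * n + 1)) (chaos_sum m h x)"
    by (rule chaos_sum_self_improving[where 'x=real]) blast
  define N where "N = real (2 * n + 1)"
  have N: "1 \<le> N" by (simp add: N_def)
  have P: "chaos_sum (Suc 0) (\<lambda>_. u k - v) (\<lambda>_. 1::real) = I (u k - v)" for k by (simp add: chaos_sum_def fun_eq_iff)
  have si: "self_improving C N (I (u k - v))" for k using C(2)[of "Suc 0" "\<lambda>_. u k - v" "\<lambda>_. 1"] unfolding P N_def .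
  have t: "tail (I (u k - v)) c = tail (\<lambda>\<omega>. I (u k) \<omega> - I v \<omega>) c" for k c
    by (rule tail_cong_AE) (auto intro!: strongly_measurable_diff strongly_measurable_real I_diff)
  have "(\<lambda>k. norm (u k - v)) \<longlonglongrightarrow> 0"
  proof (rule LIMSEQ_I)
    fix \<epsilon> :: real assume \<epsilon>: "0 < \<epsilon>"
    define K where "K = sqrt (moment_const C 2) + 1"
    have K: "0 < K" unfolding K_def using moment_const_ge1[OF C(1), of 2] by (simp add: add_nonneg_pos)
    define c where "c = \<epsilon> / K"
    have c: "0 < c" using \<epsilon> K by (simp add: c_def)
    have "eventually (\<lambda>k. tail (\<lambda>\<omega>. I (u k) \<omega> - I v \<omega>) c < 1 / (2 * N)) sequentially"
      by (rule conv_probD[OF assms c]) (use N in simp)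
    then obtain k0 where k0: "\<And>k. k \<ge> k0 \<Longrightarrow> tail (I (u k - v)) c < 1 / (2 * N)" unfolding t by (auto simp: eventually_sequentially)
    show "\<exists>k0. \<forall>k\<ge>k0. norm (norm (u k - v) - 0) < \<epsilon>"
    proof (intro exI[of _ k0] allI impI)
      fix k assume "k \<ge> k0"
      then have "N * tail (I (u k - v)) c \<le> 1 / 2" using k0[of k] N by (simp add: field_simps)
      from L2_from_tail[OF si N C(1) c this] have "L2_norm M (\<lambda>\<omega>. norm (I (u k - v) \<omega>)) \<le> sqrt (moment_const C 2) * c" .
      also have "L2_norm M (\<lambda>\<omega>. norm (I (u k - v) \<omega>)) = norm (u k - v)" using I_isometry[of "u k - v"] by (simp add: L2_norm_def)
      also have "sqrt (moment_const C 2) * c < K * c" using c by (simp add: K_def)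
      also have "\<dots> = \<epsilon>" using K by (simp add: c_def)
      finally show "norm (norm (u k - v) - 0) < \<epsilon>" by simp
    qed
  qed
  then show ?thesis by (subst tendsto_dist_iff) (simp add: dist_norm)
qed

end

section \<open>Radonification and integrability\<close>

locale good_chaos_isometry = chaos_isometry M W n I D
  for M :: "'o measure" and W :: "'v::real_inner \<Rightarrow> 'o \<Rightarrow> real" and n
    and I :: "'e::{real_inner, complete_space} \<Rightarrow> 'o \<Rightarrow> real" and D +
  fixes X :: "'x::banach itself"
  assumes good: "n_good M W n X" and ap: "approximation_property X"
begin

text \<open>The integral of \<open>G\<close> in terms of its associated operator \<open>B\<close>.\<close>

definition represents :: "('o \<Rightarrow> 'x) \<Rightarrow> (('x \<Rightarrow>\<^sub>L real) \<Rightarrow>\<^sub>L 'e) \<Rightarrow> bool" where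
  "represents \<xi> B \<longleftrightarrow> strongly_measurable M \<xi> \<and> (\<forall>\<phi>. AE \<omega> in M. blinfun_apply \<phi> (\<xi> \<omega>) = I (blinfun_apply B \<phi>) \<omega>)"

lemma approximable: "approximation_property TYPE('x)" using ap by (simp add: approximation_property_def)

lemma comparable: "n_good M W n TYPE('x)" using good by (simp add: n_good_def)

lemma op_integral_comparison:
  obtains c1 c2 where "0 < c1" "0 < c2" "\<And>A :: 'e \<Rightarrow>\<^sub>L 'x. finite_rank A \<Longrightarrow>
    c1 * gamma_norm_fin A \<le> L2_norm M (\<lambda>\<omega>. norm (op_integral A \<omega>)) \<and> L2_norm M (\<lambda>\<omega>. norm (op_integral A \<omega>)) \<le> c2 * gamma_norm_fin A"
proof (rule chaos_sum_gaussian_comparison[OF comparable])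
  fix c1 c2 assume c: "0 < c1" "0 < c2" and cmp: "\<And>m e (x :: nat \<Rightarrow> 'x). orthonormal_fam m e \<Longrightarrow>
       c1 * gaussian_sum_norm m x \<le> L2_norm M (\<lambda>\<omega>. norm (chaos_sum m e x \<omega>)) \<and>
       L2_norm M (\<lambda>\<omega>. norm (chaos_sum m e x \<omega>)) \<le> c2 * gaussian_sum_norm m x"
  have "c1 * gamma_norm_fin A \<le> L2_norm M (\<lambda>\<omega>. norm (op_integral A \<omega>)) \<and> L2_norm M (\<lambda>\<omega>. norm (op_integral A \<omega>)) \<le> c2 * gamma_norm_fin A"
    if A: "finite_rank A" for A :: "'e \<Rightarrow>\<^sub>L 'x"
  proof -
    obtain m e x where e: "finite_rank_rep A m e x" "op_integral A = chaos_sum m e x" by (rule op_integral_rep[OF A])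
    show ?thesis using cmp[OF finite_rank_rep_orthonormal[OF e(1)], of x] gamma_norm_fin_rep[OF e(1)] by (simp add: e(2))
  qed
  then show ?thesis by (rule that[OF c])
qed

text \<open>Smallness in probability of the integral of a finite rank operator makes its \<open>\<gamma>\<close>-norm and
  its operator norm small. This is what lets convergence in probability produce
  \<open>\<gamma>\<close>-radonifying operators.\<close>

lemma op_integral_tail_control:
  obtains C N K where "2 \<le> C" "1 \<le> N" "0 < K" "\<And>A :: 'e \<Rightarrow>\<^sub>L 'x. finite_rank A \<Longrightarrow> self_improving C N (op_integral A)"
    "\<And>(A :: 'e \<Rightarrow>\<^sub>L 'x) c. finite_rank A \<Longrightarrow> 0 < c \<Longrightarrow> N * tail (op_integral A) c \<le> 1/2 \<Longrightarrow> gamma_norm_fin A \<le> K * c \<and> norm A \<le> K * c"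
proof -
  define N where "N = real (2 * n + 1)"
  have N: "1 \<le> N" by (simp add: N_def)
  obtain C where C: "2 \<le> C" "\<And>m h (x :: nat \<Rightarrow> 'x). self_improving C (real (2 * n + 1)) (chaos_sum m h x)"
    by (rule chaos_sum_self_improving[where 'x='x]) blast
  have si: "self_improving C N (op_integral A)" if "finite_rank A" for A :: "'e \<Rightarrow>\<^sub>L 'x"
    by (rule op_integral_rep[OF that]) (simp only: C(2) N_def)
  show ?thesis
  proof (rule op_integral_comparison)
    fix c1 c2 assume c: "0 < c1" "0 < (c2::real)" and cmp: "\<And>A :: 'e \<Rightarrow>\<^sub>L 'x. finite_rank A \<Longrightarrow>
      c1 * gamma_norm_fin A \<le> L2_norm M (\<lambda>\<omega>. norm (op_integral A \<omega>)) \<and> L2_norm M (\<lambda>\<omega>. norm (op_integral A \<omega>)) \<le> c2 * gamma_norm_fin A"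
    define L where "L = sqrt (moment_const C 2)"
    have L: "0 < L" using moment_const_ge1[OF C(1), of 2] by (simp add: L_def)
    define K where "K = L / c1 + L"
    have K: "0 < K" using L c by (simp add: K_def add_pos_pos)
    have "gamma_norm_fin A \<le> K * a \<and> norm A \<le> K * a"
      if A: "finite_rank A" and a: "0 < a" and small: "N * tail (op_integral A) a \<le> 1/2" for A :: "'e \<Rightarrow>\<^sub>L 'x" and a
    proof -
      have le: "L2_norm M (\<lambda>\<omega>. norm (op_integral A \<omega>)) \<le> L * a"
        unfolding L_def by (rule L2_from_tail[OF si[OF A] N C(1) a small])
      have "c1 * gamma_norm_fin A \<le> L * a" using cmp[OF A] le by linarith
      then have "gamma_norm_fin A \<le> L / c1 * a" using c by (simp add: field_simps)
      moreover have "norm A \<le> L * a" using op_integral_operator_bound[OF A] le by linarith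
      moreover have "0 \<le> L / c1 * a" "0 \<le> L * a" using L a c by auto
      ultimately show ?thesis by (simp add: K_def distrib_right)
    qed
    then show ?thesis using that[OF C(1) N K si] by blast
  qed
qed

lemma represents_unique:
  assumes "represents \<xi> B" "represents \<eta> B"
  shows "AE \<omega> in M. \<xi> \<omega> = \<eta> \<omega>"
proof -
  have "AE \<omega> in M. \<xi> \<omega> - \<eta> \<omega> = 0"
  proof (rule functionals_separate[OF approximable])
    show "strongly_measurable M (\<lambda>\<omega>. \<xi> \<omega> - \<eta> \<omega>)" using assms by (intro strongly_measurable_diff) (auto simp: represents_def)
    fix \<phi> :: "'x \<Rightarrow>\<^sub>L real"
    have "AE \<omega> in M. \<phi> (\<xi> \<omega>) = I (B \<phi>) \<omega>" "AE \<omega> in M. \<phi> (\<eta> \<omega>) = I (B \<phi>) \<omega>" using assms by (auto simp: represents_def)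
    then show "AE \<omega> in M. \<phi> (\<xi> \<omega> - \<eta> \<omega>) = 0" by eventually_elim (simp add: blinfun.diff_right)
  qed
  then show ?thesis by eventually_elim simp
qed

text \<open>The comparison makes the integrals Cauchy in \<open>L\<^sup>2\<close>, hence in probability. The limit is
  identified through functionals: \<open>\<phi>\<close> applied to the integral of \<open>S i\<close> is \<open>I (k i)\<close> with
  \<open>k i\<close> the adjoint of \<open>S i\<close> at \<open>\<phi>\<close>, and \<open>k i\<close> tends to \<open>B \<phi>\<close>.\<close>

lemma gamma_approx_integral:
  fixes R :: "'e \<Rightarrow>\<^sub>L 'x"
  assumes S: "gamma_approx S R" and R: "adjoint_in_X B R"
  obtains \<xi> where "represents \<xi> B" "conv_prob (\<lambda>k. op_integral (S k)) \<xi>"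
proof -
  have fr: "finite_rank (S k)" for k using S by (simp add: gamma_approx_def)
  have lim: "S \<longlonglongrightarrow> R" using S by (simp add: gamma_approx_def)
  obtain c1 c2 where c: "0 < c1" "0 < c2" and cmp: "\<And>A :: 'e \<Rightarrow>\<^sub>L 'x. finite_rank A \<Longrightarrow>
      c1 * gamma_norm_fin A \<le> L2_norm M (\<lambda>\<omega>. norm (op_integral A \<omega>)) \<and> L2_norm M (\<lambda>\<omega>. norm (op_integral A \<omega>)) \<le> c2 * gamma_norm_fin A"
    by (rule op_integral_comparison) blast
  have sm: "strongly_measurable M (op_integral (S k))" for k by (rule op_integral_sm[OF fr])
  obtain \<xi> where \<xi>: "strongly_measurable M \<xi>" "conv_prob (\<lambda>k. op_integral (S k)) \<xi>"
  proof (rule conv_prob_complete[of "\<lambda>k. op_integral (S k)", OF sm])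
    fix a d :: real assume a: "0 < a" and d: "0 < d"
    define \<epsilon> where "\<epsilon> = a * min d 1 / (2 * c2)"
    have \<epsilon>: "0 < \<epsilon>" using a d c by (simp add: \<epsilon>_def)
    obtain N where N: "\<And>i j. i \<ge> N \<Longrightarrow> j \<ge> N \<Longrightarrow> gamma_norm_fin (S i - S j) < \<epsilon>"
      using S \<epsilon> unfolding gamma_approx_def by blast
    have "tail (\<lambda>\<omega>. op_integral (S i) \<omega> - op_integral (S j) \<omega>) a < d" if ij: "i \<ge> N" "j \<ge> N" for i j
    proof -
      have frd: "finite_rank (S i - S j)" by (rule finite_rank_diff[OF fr fr])
      have "tail (\<lambda>\<omega>. op_integral (S i) \<omega> - op_integral (S j) \<omega>) a = tail (op_integral (S i - S j)) a"
        by (rule tail_cong_AE) (use op_integral_diff[OF fr fr, of i j] in \<open>auto intro!: strongly_measurable_diff sm op_integral_sm frd\<close>)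
      also have "\<dots> \<le> (L2_norm M (\<lambda>\<omega>. norm (op_integral (S i - S j) \<omega>)) / a)\<^sup>2" by (rule tail_chebyshev[OF op_integral_L2[OF frd] a])
      also have "\<dots> \<le> (c2 * \<epsilon> / a)\<^sup>2"
      proof (intro power_mono divide_right_mono)
        have "L2_norm M (\<lambda>\<omega>. norm (op_integral (S i - S j) \<omega>)) \<le> c2 * gamma_norm_fin (S i - S j)" using cmp[OF frd] by blast
        also have "\<dots> \<le> c2 * \<epsilon>" using N[OF ij] c by (intro mult_left_mono) auto
        finally show "L2_norm M (\<lambda>\<omega>. norm (op_integral (S i - S j) \<omega>)) \<le> c2 * \<epsilon>" .
      qed (use a L2_norm_nonneg[of M "\<lambda>\<omega>. norm (op_integral (S i - S j) \<omega>)"] in auto)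
      also have "c2 * \<epsilon> / a = min d 1 / 2" using a c by (simp add: \<epsilon>_def)
      also have "(min d 1 / 2)\<^sup>2 < d"
      proof -
        have "(min d 1 / 2)\<^sup>2 \<le> (min d 1 / 2) * 1" unfolding power2_eq_square using d by (intro mult_left_mono) auto
        also have "\<dots> < d" using d by auto
        finally show ?thesis .
      qed
      finally show ?thesis .
    qed
    then show "\<exists>N. \<forall>i\<ge>N. \<forall>j\<ge>N. tail (\<lambda>\<omega>. op_integral (S i) \<omega> - op_integral (S j) \<omega>) a < d" by blast
  qed (rule that)
  have "AE \<omega> in M. \<phi> (\<xi> \<omega>) = I (B \<phi>) \<omega>" for \<phi> :: "'x \<Rightarrow>\<^sub>L real"
  proof -
    have "\<exists>k. (\<forall>h. inner k h = \<phi> (S i h)) \<and> (AE \<omega> in M. \<phi> (op_integral (S i) \<omega>) = I k \<omega>)" for i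
      by (rule op_integral_functional[OF fr[of i], where \<phi>=\<phi>]) blast
    then obtain k where k: "\<And>i h. inner (k i) h = \<phi> (S i h)" "\<And>i. AE \<omega> in M. \<phi> (op_integral (S i) \<omega>) = I (k i) \<omega>" by metis
    have Bh: "inner (B \<phi>) h = \<phi> (R h)" for h
    proof -
      have "banach_adjoint B h = bidual_embedding (R h)" using R by (simp add: adjoint_in_X_def)
      then have "blinfun_apply (banach_adjoint B h) \<phi> = blinfun_apply (bidual_embedding (R h)) \<phi>" by simp
      then show ?thesis by simp
    qed
    have kB: "norm (k i - B \<phi>) \<le> norm \<phi> * norm (S i - R)" for i
    proof (cases "k i - B \<phi> = 0")
      case False
      let ?v = "k i - B \<phi>"
      have "norm ?v * norm ?v = inner ?v ?v" by (simp add: power2_norm_eq_inner[symmetric] power2_eq_square)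
      also have "\<dots> = \<phi> ((S i - R) ?v)" by (simp add: inner_diff_left k(1) Bh blinfun.diff_left blinfun.diff_right)
      also have "\<dots> \<le> norm (\<phi> ((S i - R) ?v))" by simp
      also have "\<dots> \<le> norm \<phi> * norm ((S i - R) ?v)" by (rule norm_blinfun)
      also have "\<dots> \<le> norm \<phi> * (norm (S i - R) * norm ?v)" by (intro mult_left_mono norm_blinfun) simp
      finally have "norm ?v * norm ?v \<le> (norm \<phi> * norm (S i - R)) * norm ?v" by (simp add: mult.assoc)
      then show ?thesis using False by (simp only: mult_le_cancel_right) auto
    qed simp
    have "conv_prob (\<lambda>i. I (k i)) (I (B \<phi>))"
    proof (rule conv_prob_L2)
      show "(\<lambda>\<omega>. norm (I (k i) \<omega> - I (B \<phi>) \<omega>)) \<in> L2 M" for i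
        using L2_diff[OF I_L2[of "k i"] I_L2[of "B \<phi>"]] by (auto simp: L2_def)
      have e: "L2_norm M (\<lambda>\<omega>. norm (I (k i) \<omega> - I (B \<phi>) \<omega>)) = norm (k i - B \<phi>)" for i
        using I_norm_diff[of "k i" "B \<phi>"] by (simp add: L2_norm_def)
      have "(\<lambda>i. norm \<phi> * norm (S i - R)) \<longlonglongrightarrow> norm \<phi> * norm (R - R)" by (intro tendsto_intros lim)
      then have l: "(\<lambda>i. norm \<phi> * norm (S i - R)) \<longlonglongrightarrow> 0" by simp
      show "(\<lambda>i. L2_norm M (\<lambda>\<omega>. norm (I (k i) \<omega> - I (B \<phi>) \<omega>))) \<longlonglongrightarrow> 0"
        unfolding e by (rule tendsto_sandwich[OF _ _ tendsto_const l]; intro always_eventually allI kB norm_ge_zero)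
    qed
    moreover have "conv_prob (\<lambda>i. I (k i)) (\<lambda>\<omega>. \<phi> (\<xi> \<omega>))"
      by (rule conv_prob_cong_AE[OF conv_prob_blinfun[OF sm \<xi>(1,2), of \<phi>]])
         (auto intro!: strongly_measurable_blinfun sm \<xi> I_sm k)
    ultimately have "AE \<omega> in M. I (B \<phi>) \<omega> = \<phi> (\<xi> \<omega>)"
      by (intro conv_prob_unique[where F="\<lambda>i. I (k i)"]) (auto intro!: strongly_measurable_blinfun \<xi> I_sm)
    then show ?thesis by eventually_elim simp
  qed
  then have "represents \<xi> B" using \<xi>(1) by (simp add: represents_def)
  then show ?thesis using \<xi>(2) by (rule that)
qed

text \<open>Finite rank operators \<open>T\<close> close to the identity in probability under the law of \<open>\<xi>\<close> turn
  \<open>\<xi>\<close> into integrals of the operators \<open>T R\<close>, written through \<open>B\<close> before the adjoint \<open>R\<close> is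
  known to take values in \<open>X\<close>. Since the differences are chaos sums, the operators are Cauchy in the
  \<open>\<gamma>\<close>-norm and in the operator norm, and their limit is the adjoint.\<close>

lemma represents_imp_radonifying:
  assumes \<xi>: "represents \<xi> B"
  shows "\<exists>R. adjoint_in_X B R \<and> gamma_radonifying R"
proof -
  have sm: "strongly_measurable M \<xi>" and rep: "\<And>\<phi>. AE \<omega> in M. blinfun_apply \<phi> (\<xi> \<omega>) = I (blinfun_apply B \<phi>) \<omega>" using \<xi> by (auto simp: represents_def)
  define \<delta> where "\<delta> k = inverse (real (Suc k))" for k
  have \<delta>: "0 < \<delta> k" for k by (simp add: \<delta>_def)
  define P where "P k A \<longleftrightarrow> finite_rank A \<and> tail (\<lambda>\<omega>. op_integral A \<omega> - \<xi> \<omega>) (\<delta> k) \<le> \<delta> k" for k and A :: "'e \<Rightarrow>\<^sub>L 'x"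
  have "\<exists>A. P k A" for k
  proof (rule approximation_property_conv[OF approximable sm \<delta>[of k] \<delta>[of k]])
    fix T :: "'x \<Rightarrow>\<^sub>L 'x" and m :: nat and \<phi> :: "nat \<Rightarrow> 'x \<Rightarrow>\<^sub>L real" and b
    assume T: "\<And>x. T x = (\<Sum>j<m. \<phi> j x *\<^sub>R b j)" "tail (\<lambda>\<omega>. T (\<xi> \<omega>) - \<xi> \<omega>) (\<delta> k) \<le> \<delta> k"
    define A where "A = Blinfun (\<lambda>h. \<Sum>j<m. inner h (B (\<phi> j)) *\<^sub>R b j)"
    have "bounded_linear (\<lambda>h. \<Sum>j<m. inner h (B (\<phi> j)) *\<^sub>R b j)"
      by (intro bounded_linear_sum bounded_linear_scaleR_const bounded_linear_inner_left)
    then have A: "A h = (\<Sum>j<m. inner h (B (\<phi> j)) *\<^sub>R b j)" for h by (simp add: A_def bounded_linear_Blinfun_apply)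
    have fA: "finite_rank A" by (rule finite_rankI[OF A])
    have "AE \<omega> in M. \<forall>j\<in>{..<m}. \<phi> j (\<xi> \<omega>) = I (B (\<phi> j)) \<omega>" by (rule AE_finite_allI) (use rep in auto)
    with op_integral_eq[OF A] have "AE \<omega> in M. op_integral A \<omega> = T (\<xi> \<omega>)"
    proof eventually_elim
      case (elim \<omega>)
      then show ?case unfolding T(1) chaos_sum_def by simp
    qed
    then have "tail (\<lambda>\<omega>. op_integral A \<omega> - \<xi> \<omega>) (\<delta> k) = tail (\<lambda>\<omega>. T (\<xi> \<omega>) - \<xi> \<omega>) (\<delta> k)"
      by (intro tail_cong_AE strongly_measurable_diff strongly_measurable_blinfun op_integral_sm[OF fA] sm) auto
    with T(2) fA show ?thesis unfolding P_def by auto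
  qed
  then obtain S where SP: "\<And>k. P k (S k)" by metis
  then have fr: "finite_rank (S k)" and St: "tail (\<lambda>\<omega>. op_integral (S k) \<omega> - \<xi> \<omega>) (\<delta> k) \<le> \<delta> k" for k by (auto simp: P_def)
  have smS: "strongly_measurable M (op_integral (S k))" for k by (rule op_integral_sm[OF fr])
  have \<delta>0: "\<delta> \<longlonglongrightarrow> 0" unfolding \<delta>_def by (rule LIMSEQ_inverse_real_of_nat)
  have conv: "conv_prob (\<lambda>k. op_integral (S k)) \<xi>"
    unfolding conv_prob_def
  proof (intro allI impI)
    fix c :: real assume c: "0 < c"
    show "(\<lambda>k. tail (\<lambda>\<omega>. op_integral (S k) \<omega> - \<xi> \<omega>) c) \<longlonglongrightarrow> 0"
    proof (rule tendsto_sandwich[OF _ _ tendsto_const \<delta>0])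
      have "eventually (\<lambda>k. \<delta> k < c) sequentially" by (rule order_tendstoD(2)[OF \<delta>0 c])
      then show "\<forall>\<^sub>F k in sequentially. tail (\<lambda>\<omega>. op_integral (S k) \<omega> - \<xi> \<omega>) c \<le> \<delta> k"
      proof eventually_elim
        case (elim k)
        have "tail (\<lambda>\<omega>. op_integral (S k) \<omega> - \<xi> \<omega>) c \<le> tail (\<lambda>\<omega>. op_integral (S k) \<omega> - \<xi> \<omega>) (\<delta> k)"
          using elim by (intro tail_mono strongly_measurable_diff smS sm) simp
        with St[of k] show ?case by simp
      qed
    qed (intro always_eventually allI tail_nonneg)
  qed
  show ?thesis
  proof (rule op_integral_tail_control)
    fix C N K :: real
    assume N: "1 \<le> N" and K: "0 < K"
      and control: "\<And>(A :: 'e \<Rightarrow>\<^sub>L 'x) c. finite_rank A \<Longrightarrow> 0 < c \<Longrightarrow> N * tail (op_integral A) c \<le> 1/2 \<Longrightarrow> gamma_norm_fin A \<le> K * c \<and> norm A \<le> K * c"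
    have cauchy: "\<exists>k0. \<forall>i\<ge>k0. \<forall>j\<ge>k0. gamma_norm_fin (S i - S j) < \<epsilon> \<and> norm (S i - S j) < \<epsilon>" if \<epsilon>: "0 < \<epsilon>" for \<epsilon>
    proof -
      define c where "c = \<epsilon> / (2 * K)"
      have c: "0 < c" using \<epsilon> K by (simp add: c_def)
      have "0 < c / 2" "0 < 1 / (4 * N)" using c N by auto
      from conv_probD[OF conv this] obtain k0 where
        k0: "\<And>k. k \<ge> k0 \<Longrightarrow> tail (\<lambda>\<omega>. op_integral (S k) \<omega> - \<xi> \<omega>) (c / 2) < 1 / (4 * N)" by (auto simp: eventually_sequentially)
      have "gamma_norm_fin (S i - S j) < \<epsilon> \<and> norm (S i - S j) < \<epsilon>" if ij: "i \<ge> k0" "j \<ge> k0" for i j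
      proof -
        have frd: "finite_rank (S i - S j)" by (rule finite_rank_diff[OF fr fr])
        have "tail (op_integral (S i - S j)) c = tail (\<lambda>\<omega>. op_integral (S i) \<omega> - op_integral (S j) \<omega>) c"
          by (rule tail_cong_AE[OF op_integral_sm[OF frd] strongly_measurable_diff[OF smS smS] op_integral_diff[OF fr fr]])
        also have "\<dots> \<le> tail (\<lambda>\<omega>. op_integral (S i) \<omega> - \<xi> \<omega>) (c / 2) + tail (\<lambda>\<omega>. op_integral (S j) \<omega> - \<xi> \<omega>) (c / 2)"
        proof (rule tail_add)
          fix \<omega>
          have "norm ((op_integral (S i) \<omega> - \<xi> \<omega>) - (op_integral (S j) \<omega> - \<xi> \<omega>)) \<le> norm (op_integral (S i) \<omega> - \<xi> \<omega>) + norm (op_integral (S j) \<omega> - \<xi> \<omega>)"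
            by (rule norm_triangle_ineq4)
          then show "norm (op_integral (S i) \<omega> - op_integral (S j) \<omega>) \<le> norm (op_integral (S i) \<omega> - \<xi> \<omega>) + norm (op_integral (S j) \<omega> - \<xi> \<omega>)" by simp
        qed (auto intro!: strongly_measurable_diff smS sm)
        also have "\<dots> \<le> 1 / (4 * N) + 1 / (4 * N)" using k0[OF ij(1)] k0[OF ij(2)] by linarith
        finally have "N * tail (op_integral (S i - S j)) c \<le> N * (1 / (4 * N) + 1 / (4 * N))" using N by (intro mult_left_mono) auto
        also have "\<dots> = 1 / 2" using N by (simp add: field_simps)
        finally have le: "N * tail (op_integral (S i - S j)) c \<le> 1/2" .
        have "K * c = \<epsilon> / 2" using K by (simp add: c_def)
        with control[OF frd c le] \<epsilon> show ?thesis by linarith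
      qed
      then show ?thesis by blast
    qed
    have "Cauchy S"
      by (rule CauchyI) (use cauchy in blast)
    then obtain R where R: "S \<longlonglongrightarrow> R" using Cauchy_convergent convergent_def by blast
    have "gamma_approx S R" unfolding gamma_approx_def using fr R cauchy by meson
    then have "gamma_radonifying R" by (auto simp: gamma_radonifying_def)
    moreover have "adjoint_in_X B R"
      unfolding adjoint_in_X_def
    proof (intro allI blinfun_eqI)
      fix h and \<phi> :: "'x \<Rightarrow>\<^sub>L real"
      have "\<exists>k. (\<forall>h. inner k h = \<phi> (S i h)) \<and> (AE \<omega> in M. \<phi> (op_integral (S i) \<omega>) = I k \<omega>)" for i
        by (rule op_integral_functional[OF fr[of i], where \<phi>=\<phi>]) blast
      then obtain k where k: "\<And>i h. inner (k i) h = \<phi> (S i h)" "\<And>i. AE \<omega> in M. \<phi> (op_integral (S i) \<omega>) = I (k i) \<omega>" by metis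
      have "conv_prob (\<lambda>i. I (k i)) (I (B \<phi>))"
        by (rule conv_prob_cong_AE[OF conv_prob_blinfun[OF smS sm conv, of \<phi>]])
           (auto intro!: strongly_measurable_blinfun smS sm I_sm k rep)
      then have "k \<longlonglongrightarrow> B \<phi>" by (rule I_conv_prob_imp_conv)
      then have 1: "(\<lambda>i. inner (k i) h) \<longlonglongrightarrow> inner (B \<phi>) h" by (intro tendsto_intros)
      have 2: "(\<lambda>i. inner (k i) h) \<longlonglongrightarrow> \<phi> (R h)" unfolding k(1) by (intro tendsto_intros R)
      show "blinfun_apply (banach_adjoint B h) \<phi> = blinfun_apply (bidual_embedding (R h)) \<phi>"
        using LIMSEQ_unique[OF 1 2] by simp
    qed
    ultimately show ?thesis by blast
  qed
qed

text \<open>Two approximating sequences have integrals with the same limit, because functionals separate. The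
  integrals of the differences tend to zero in probability, hence the \<open>\<gamma>\<close>-norms of the
  differences tend to zero.\<close>

lemma gamma_norm_limit:
  fixes R :: "'e \<Rightarrow>\<^sub>L 'x"
  assumes S: "gamma_approx S R" and R: "adjoint_in_X B R"
  shows "(\<lambda>k. gamma_norm_fin (S k)) \<longlonglongrightarrow> gamma_norm R"
proof -
  have ex: "\<exists>c. (\<lambda>k. gamma_norm_fin (S k)) \<longlonglongrightarrow> c"
  proof -
    have "Cauchy (\<lambda>k. gamma_norm_fin (S k))"
    proof (rule CauchyI)
      fix e :: real assume "0 < e"
      then obtain N where N: "\<And>i j. i \<ge> N \<Longrightarrow> j \<ge> N \<Longrightarrow> gamma_norm_fin (S i - S j) < e" using S unfolding gamma_approx_def by blast
      have "norm (gamma_norm_fin (S i) - gamma_norm_fin (S j)) < e" if "i \<ge> N" "j \<ge> N" for i j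
        using gamma_norm_fin_triangle[of "S i" "S j"] N[OF that] S unfolding gamma_approx_def by fastforce
      then show "\<exists>N. \<forall>m\<ge>N. \<forall>n\<ge>N. norm (gamma_norm_fin (S m) - gamma_norm_fin (S n)) < e" by blast
    qed
    then show ?thesis using Cauchy_convergent convergent_def by blast
  qed
  then obtain a where a: "(\<lambda>k. gamma_norm_fin (S k)) \<longlonglongrightarrow> a" by blast
  have "b = a" if S': "gamma_approx S' R" and b: "(\<lambda>k. gamma_norm_fin (S' k)) \<longlonglongrightarrow> b" for S' b
  proof -
    have fr: "finite_rank (S k)" "finite_rank (S' k)" for k using S S' by (auto simp: gamma_approx_def)
    obtain \<xi> where \<xi>: "represents \<xi> B" "conv_prob (\<lambda>k. op_integral (S k)) \<xi>" by (rule gamma_approx_integral[OF S R])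
    obtain \<eta> where \<eta>: "represents \<eta> B" "conv_prob (\<lambda>k. op_integral (S' k)) \<eta>" by (rule gamma_approx_integral[OF S' R])
    have sm: "strongly_measurable M \<xi>" "strongly_measurable M \<eta>" using \<xi> \<eta> by (auto simp: represents_def)
    have frd: "finite_rank (S k - S' k)" for k by (rule finite_rank_diff[OF fr])
    have "conv_prob (\<lambda>k. op_integral (S k - S' k)) (\<lambda>\<omega>. 0)"
    proof (rule conv_prob_cong_AE[OF conv_prob_diff[OF op_integral_sm[OF fr(1)] op_integral_sm[OF fr(2)] sm \<xi>(2) \<eta>(2)]])
      show "AE \<omega> in M. op_integral (S k) \<omega> - op_integral (S' k) \<omega> = op_integral (S k - S' k) \<omega>" for k using op_integral_diff[OF fr, of k k] by eventually_elim simp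
      show "AE \<omega> in M. \<xi> \<omega> - \<eta> \<omega> = 0" using represents_unique[OF \<xi>(1) \<eta>(1)] by eventually_elim simp
    qed (auto intro!: strongly_measurable_diff op_integral_sm fr frd sm strongly_measurable_const)
    note conv = this
    have "(\<lambda>k. gamma_norm_fin (S k - S' k)) \<longlonglongrightarrow> 0"
    proof (rule op_integral_tail_control)
      fix C N K :: real
      assume N: "1 \<le> N" and K: "0 < K"
        and control: "\<And>(A :: 'e \<Rightarrow>\<^sub>L 'x) c. finite_rank A \<Longrightarrow> 0 < c \<Longrightarrow> N * tail (op_integral A) c \<le> 1/2 \<Longrightarrow> gamma_norm_fin A \<le> K * c \<and> norm A \<le> K * c"
      show ?thesis
      proof (rule LIMSEQ_I)
        fix e :: real assume e: "0 < e"
        define c where "c = e / (2 * K)"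
        have c: "0 < c" "0 < 1 / (2 * N)" using e K N by (auto simp: c_def)
        from conv_probD[OF conv this] obtain k0 where k0: "\<And>k. k \<ge> k0 \<Longrightarrow> tail (op_integral (S k - S' k)) c < 1 / (2 * N)"
          by (auto simp: eventually_sequentially)
        have "norm (gamma_norm_fin (S k - S' k) - 0) < e" if k: "k \<ge> k0" for k
        proof -
          have "N * tail (op_integral (S k - S' k)) c \<le> 1 / 2" using k0[OF k] N by (simp add: field_simps)
          from control[OF frd c(1) this] have "gamma_norm_fin (S k - S' k) \<le> K * c" by blast
          also have "\<dots> < e" using K e by (simp add: c_def)
          finally show ?thesis using gamma_norm_fin_nonneg[OF frd[of k]] by simp
        qed
        then show "\<exists>k0. \<forall>k\<ge>k0. norm (gamma_norm_fin (S k - S' k) - 0) < e" by blast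
      qed
    qed
    note z = this
    have "(\<lambda>k. gamma_norm_fin (S k) - gamma_norm_fin (S' k)) \<longlonglongrightarrow> 0"
      by (rule tendsto_rabs_zero_cancel, rule tendsto_sandwich[OF _ _ tendsto_const z])
         (auto intro!: always_eventually gamma_norm_fin_triangle fr)
    moreover have "(\<lambda>k. gamma_norm_fin (S k) - gamma_norm_fin (S' k)) \<longlonglongrightarrow> a - b" by (intro tendsto_diff a b)
    ultimately have "a - b = 0" using LIMSEQ_unique by blast
    then show ?thesis by simp
  qed
  then have "gamma_norm R = a" unfolding gamma_norm_def using S a by (intro the_equality) blast+
  then show ?thesis using a by simp
qed

theorem integrable_iff_radonifying:
  "(\<exists>\<xi>. represents \<xi> B) \<longleftrightarrow> (\<exists>R. adjoint_in_X B R \<and> gamma_radonifying R)"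
proof
  assume "\<exists>R. adjoint_in_X B R \<and> gamma_radonifying R"
  then obtain R S where "adjoint_in_X B R" "gamma_approx S R" by (auto simp: gamma_radonifying_def)
  from gamma_approx_integral[OF this(2,1)] show "\<exists>\<xi>. represents \<xi> B" by blast
qed (auto dest: represents_imp_radonifying)

text \<open>Both bounds go through tails at a level \<open>c\<close>. From above, Chebyshev's inequality makes the tail of
  \<open>\<xi>\<close> small at a multiple of the \<open>\<gamma>\<close>-norm, which bounds the moment of order \<open>r\<close>. From
  below, Markov's inequality makes it small at a multiple of the \<open>L\<^sup>r\<close>-norm, which bounds the
  \<open>\<gamma>\<close>-norms of the approximants. The levels are increased by \<open>\<epsilon>\<close> or \<open>e\<close> to be
  positive even if the norms vanish.\<close>

theorem integral_norm_comparison: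
  assumes r: "0 < r"
  shows "\<exists>c1>0. \<exists>c2>0. \<forall>B R \<xi>. adjoint_in_X B R \<and> gamma_radonifying R \<and> represents \<xi> B \<longrightarrow>
    ennreal (c1 * gamma_norm R) \<le> Lr_norm M r \<xi> \<and> Lr_norm M r \<xi> \<le> ennreal (c2 * gamma_norm R)"
proof (rule op_integral_comparison, rule op_integral_tail_control)
  fix b1 b2 C N K :: real
  assume b: "0 < b1" "0 < b2" and cmp: "\<And>A :: 'e \<Rightarrow>\<^sub>L 'x. finite_rank A \<Longrightarrow>
      b1 * gamma_norm_fin A \<le> L2_norm M (\<lambda>\<omega>. norm (op_integral A \<omega>)) \<and> L2_norm M (\<lambda>\<omega>. norm (op_integral A \<omega>)) \<le> b2 * gamma_norm_fin A"
    and C: "2 \<le> C" and N: "1 \<le> N" and K: "0 < K"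
    and si: "\<And>A :: 'e \<Rightarrow>\<^sub>L 'x. finite_rank A \<Longrightarrow> self_improving C N (op_integral A)"
    and control: "\<And>(A :: 'e \<Rightarrow>\<^sub>L 'x) c. finite_rank A \<Longrightarrow> 0 < c \<Longrightarrow> N * tail (op_integral A) c \<le> 1/2 \<Longrightarrow> gamma_norm_fin A \<le> K * c \<and> norm A \<le> K * c"
  define \<delta> where "\<delta> = 1 / (4 * N)"
  have \<delta>: "0 < \<delta>" "N * (2 * \<delta>) = 1 / 2" using N by (auto simp: \<delta>_def)
  \<comment> \<open>Chosen so that Chebyshev at the level \<open>L (a + \<epsilon>)\<close> gives a tail of at most \<open>2 \<delta>\<close>.\<close>
  define L where "L = 2 * b2 / sqrt (2 * \<delta>)"
  have L: "0 < L" using b \<delta> by (simp add: L_def)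
  define Q where "Q = moment_const (4 * C) r powr (1 / r)"
  have Mc: "1 \<le> moment_const (4 * C) r" using C by (intro moment_const_ge1) simp
  have Q: "0 < Q" using Mc by (simp add: Q_def)
  \<comment> \<open>Chosen so that Markov at the level \<open>L' (s + e)\<close> gives a tail of at most \<open>\<delta>\<close>.\<close>
  define L' where "L' = \<delta> powr (- (1 / r))"
  have L': "0 < L'" using \<delta> by (simp add: L'_def)
  define c1 where "c1 = 1 / (2 * K * L')"
  define c2 where "c2 = Q * L"
  have c12: "0 < c1" "0 < c2" using K L' Q L by (auto simp: c1_def c2_def)
  have main: "ennreal (c1 * gamma_norm R) \<le> Lr_norm M r \<xi> \<and> Lr_norm M r \<xi> \<le> ennreal (c2 * gamma_norm R)"
    if R: "adjoint_in_X B R" and rad: "gamma_radonifying R" and \<xi>: "represents \<xi> B" for B and R :: "'e \<Rightarrow>\<^sub>L 'x" and \<xi>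
  proof -
    obtain S where S: "gamma_approx S R" using rad by (auto simp: gamma_radonifying_def)
    have fr: "finite_rank (S k)" for k using S by (simp add: gamma_approx_def)
    have smS: "strongly_measurable M (op_integral (S k))" for k by (rule op_integral_sm[OF fr])
    obtain \<eta> where \<eta>: "represents \<eta> B" "conv_prob (\<lambda>k. op_integral (S k)) \<eta>" by (rule gamma_approx_integral[OF S R])
    have sm: "strongly_measurable M \<xi>" "strongly_measurable M \<eta>" using \<xi> \<eta> by (auto simp: represents_def)
    have conv: "conv_prob (\<lambda>k. op_integral (S k)) \<xi>"
      by (rule conv_prob_cong_AE[OF \<eta>(2) smS smS sm(2,1) _ represents_unique[OF \<eta>(1) \<xi>]]) simp
    have \<xi>si: "self_improving (4 * C) N \<xi>"
      by (rule self_improving_limit[OF si[OF fr] _ _ sm(1) conv]) (use N C in auto)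
    define a where "a = gamma_norm R"
    have a: "(\<lambda>k. gamma_norm_fin (S k)) \<longlonglongrightarrow> a" unfolding a_def by (rule gamma_norm_limit[OF S R])
    have a0: "0 \<le> a" by (rule LIMSEQ_le_const[OF a]) (use gamma_norm_fin_nonneg[OF fr] in blast)
    have tz: "(\<lambda>k. tail (\<lambda>\<omega>. op_integral (S k) \<omega> - \<xi> \<omega>) c) \<longlonglongrightarrow> 0" if "0 < c" for c using conv that by (simp add: conv_prob_def)
    define J where "J = (\<integral>\<^sup>+\<omega>. ennreal (norm (\<xi> \<omega>) powr r) \<partial>M)"
    have upper: "J \<le> ennreal (moment_const (4 * C) r * (L * (a + \<epsilon>)) powr r)" if \<epsilon>: "0 < \<epsilon>" for \<epsilon>
    proof -
      define c where "c = L * (a + \<epsilon>)"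
      have c: "0 < c" using L a0 \<epsilon> by (simp add: c_def)
      have "tail \<xi> c \<le> (2 * b2 * gamma_norm_fin (S k) / c)\<^sup>2 + tail (\<lambda>\<omega>. op_integral (S k) \<omega> - \<xi> \<omega>) (c / 2)" for k
      proof -
        have "tail \<xi> c \<le> tail (op_integral (S k)) (c / 2) + tail (\<lambda>\<omega>. \<xi> \<omega> - op_integral (S k) \<omega>) (c / 2)"
          by (rule tail_triangle[OF sm(1) smS]) simp
        also have "tail (op_integral (S k)) (c / 2) \<le> (L2_norm M (\<lambda>\<omega>. norm (op_integral (S k) \<omega>)) / (c / 2))\<^sup>2"
          by (rule tail_chebyshev[OF op_integral_L2[OF fr]]) (use c in simp)
        also have "\<dots> \<le> (b2 * gamma_norm_fin (S k) / (c / 2))\<^sup>2"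
          using cmp[OF fr[of k]] c by (intro power_mono divide_right_mono) (auto simp: L2_norm_nonneg)
        finally show ?thesis by (simp add: tail_minus[of \<xi>] mult_ac)
      qed
      moreover have "(\<lambda>k. (2 * b2 * gamma_norm_fin (S k) / c)\<^sup>2 + tail (\<lambda>\<omega>. op_integral (S k) \<omega> - \<xi> \<omega>) (c / 2)) \<longlonglongrightarrow> (2 * b2 * a / c)\<^sup>2 + 0"
        using c by (intro tendsto_intros a tz) auto
      ultimately have "tail \<xi> c \<le> (2 * b2 * a / c)\<^sup>2 + 0" by (intro LIMSEQ_le_const) auto
      also have "2 * b2 * a / c = sqrt (2 * \<delta>) * (a / (a + \<epsilon>))"
      proof -
        have gen: "2 * b2 * a / (2 * b2 / q * w) = q * (a / w)" if "q \<noteq> 0" "w \<noteq> 0" for q w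
          using b that by (simp add: field_simps)
        show ?thesis unfolding c_def L_def by (rule gen) (use \<delta> a0 \<epsilon> in auto)
      qed
      also have "(sqrt (2 * \<delta>) * (a / (a + \<epsilon>)))\<^sup>2 + 0 \<le> (sqrt (2 * \<delta>) * 1)\<^sup>2 + 0"
        using a0 \<epsilon> \<delta> by (intro add_right_mono power_mono mult_left_mono) (auto simp: divide_le_eq)
      finally have "tail \<xi> c \<le> 2 * \<delta>" using \<delta> by simp
      then have "N * tail \<xi> c \<le> 1 / 2" using mult_left_mono[of "tail \<xi> c" "2 * \<delta>" N] N \<delta>(2) by simp
      from self_improving_moment[OF \<xi>si N _ c this r] C show ?thesis by (simp add: J_def c_def)
    qed
    have Jfin: "J \<noteq> \<top>" using upper[of 1] by (auto simp: top_unique)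
    define s where "s = enn2real J powr (1 / r)"
    have s0: "0 \<le> s" by (simp add: s_def)
    have Lr: "Lr_norm M r \<xi> = ennreal s" using Jfin by (simp add: Lr_norm_def J_def[symmetric] s_def)
    have sr: "s powr r = enn2real J" using r by (simp add: s_def powr_powr enn2real_nonneg)
    have "s \<le> c2 * a"
    proof (rule field_le_epsilon)
      fix e :: real assume e: "0 < e"
      define \<epsilon> where "\<epsilon> = e / c2"
      have \<epsilon>: "0 < \<epsilon>" using e c12 by (simp add: \<epsilon>_def)
      have nn: "0 \<le> moment_const (4 * C) r * (L * (a + \<epsilon>)) powr r" using Mc by simp
      have "enn2real J \<le> moment_const (4 * C) r * (L * (a + \<epsilon>)) powr r"
        using enn2real_mono[OF upper[OF \<epsilon>]] nn by simp
      then have "s \<le> (moment_const (4 * C) r * (L * (a + \<epsilon>)) powr r) powr (1 / r)"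
        unfolding s_def using r by (intro powr_mono2) auto
      also have "\<dots> = Q * (L * (a + \<epsilon>))"
        using Mc L a0 \<epsilon> r by (simp add: Q_def powr_mult powr_powr)
      also have "\<dots> = c2 * a + e" using c12 by (simp add: c2_def[symmetric] mult.assoc[symmetric] distrib_left \<epsilon>_def)
      finally show "s \<le> c2 * a + e" .
    qed
    moreover have "c1 * a \<le> s"
    proof (rule field_le_epsilon)
      fix e :: real assume e: "0 < e"
      define c where "c = L' * (s + e)"
      have c: "0 < c" using L' s0 e by (simp add: c_def)
      have cr: "c powr r = (s + e) powr r / \<delta>"
      proof -
        have "- (1 / r) * r = - 1" using r by simp
        then have "L' powr r = 1 / \<delta>" unfolding L'_def powr_powr using \<delta> by (simp only: powr_minus_divide) simp
        then show ?thesis using L' s0 e by (simp add: c_def powr_mult)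
      qed
      have [measurable]: "(\<lambda>\<omega>. norm (\<xi> \<omega>)) \<in> borel_measurable M" by (rule strongly_measurable_norm[OF sm(1)])
      have "ennreal (c powr r) * emeasure M {\<omega>\<in>space M. c < norm (\<xi> \<omega>)} = (\<integral>\<^sup>+\<omega>. ennreal (c powr r) * indicator {\<omega>\<in>space M. c < norm (\<xi> \<omega>)} \<omega> \<partial>M)"
        by (subst nn_integral_cmult_indicator) auto
      also have "\<dots> \<le> J" unfolding J_def
      proof (rule nn_integral_mono)
        fix \<omega>
        show "ennreal (c powr r) * indicator {\<omega>\<in>space M. c < norm (\<xi> \<omega>)} \<omega> \<le> ennreal (norm (\<xi> \<omega>) powr r)"
          using c r by (auto simp: indicator_def intro!: ennreal_leI powr_mono2)
      qed
      finally have "ennreal (c powr r * tail \<xi> c) \<le> J" by (simp add: emeasure_eq_measure tail_def ennreal_mult)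
      then have "enn2real (ennreal (c powr r * tail \<xi> c)) \<le> enn2real J" using Jfin by (intro enn2real_mono) (auto simp: less_top)
      then have "c powr r * tail \<xi> c \<le> s powr r" using mult_nonneg_nonneg[OF _ tail_nonneg, of "c powr r" \<xi> c] by (simp add: sr)
      also have "\<dots> \<le> (s + e) powr r" using s0 e r by (intro powr_mono2) auto
      finally have "(s + e) powr r * tail \<xi> c \<le> (s + e) powr r * \<delta>" using \<delta> by (simp add: cr field_simps)
      moreover have "0 < (s + e) powr r" using s0 e by simp
      ultimately have tc: "tail \<xi> c \<le> \<delta>" by (simp only: mult_le_cancel_left_pos)
      have "eventually (\<lambda>k. tail (\<lambda>\<omega>. op_integral (S k) \<omega> - \<xi> \<omega>) c < \<delta>) sequentially" by (rule conv_probD[OF conv c \<delta>(1)])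
      then have ev: "eventually (\<lambda>k. gamma_norm_fin (S k) \<le> K * (2 * c)) sequentially"
      proof eventually_elim
        case (elim k)
        have "tail (op_integral (S k)) (2 * c) \<le> tail \<xi> c + tail (\<lambda>\<omega>. op_integral (S k) \<omega> - \<xi> \<omega>) c"
          by (rule tail_triangle[OF smS sm(1)]) simp
        also have "\<dots> \<le> 2 * \<delta>" using tc elim by linarith
        finally have "N * tail (op_integral (S k)) (2 * c) \<le> 1 / 2" using mult_left_mono[of "tail (op_integral (S k)) (2 * c)" "2 * \<delta>" N] N \<delta>(2) by simp
        with control[OF fr[of k], of "2 * c"] c show ?case by simp
      qed
      have "a \<le> K * (2 * c)" by (rule tendsto_upperbound[OF a ev]) simp
      then show "c1 * a \<le> s + e" using K L' by (simp add: c1_def c_def field_simps)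
    qed
    ultimately show ?thesis unfolding Lr a_def[symmetric] by (auto intro!: ennreal_leI)
  qed
  show ?thesis by (rule exI[of _ c1], intro conjI c12(1), rule exI[of _ c2], intro conjI c12(2)) (use main in blast)
qed

end



section \<open>Stochastic integrals with respect to a fractional process\<close>

lemma step_function_interval:
  assumes "a \<in> T" "b \<in> T" "a \<le> b"
  shows "(\<lambda>x. c * indicator {a..<b} x) \<in> step_functions T"
  unfolding step_functions_def
  by (intro CollectI exI[of _ "Suc 0"] exI[of _ "\<lambda>_. c"] exI[of _ "\<lambda>j. if j = 0 then a else b"]) (use assms in auto)

lemma emb_step_span:
  fixes emb :: "(real \<Rightarrow> real) \<Rightarrow> 'd::{real_inner, complete_space}"
  assumes DH: "is_DH H T emb" and f: "f \<in> step_functions T"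
  shows "emb f \<in> span {emb (indicator {a..<b}) | a b. a \<in> T \<and> b \<in> T \<and> a \<le> b}"
proof -
  let ?S = "span {emb (indicator {a..<b}) | a b. a \<in> T \<and> b \<in> T \<and> a \<le> b}"
  have add: "emb (\<lambda>x. f x + g x) = emb f + emb g" if "f \<in> step_functions T" "g \<in> step_functions T" for f g
    using DH that by (simp add: is_DH_def)
  have scale: "emb (\<lambda>x. c * f x) = c *\<^sub>R emb f" if "f \<in> step_functions T" for c f
    using DH that by (simp add: is_DH_def)
  obtain m :: nat and c t where f: "f = (\<lambda>x. \<Sum>j=1..m. c j * indicator {t (j - 1)..<t j} x)"
    and t: "\<And>j. j \<in> {1..m} \<Longrightarrow> t (j - 1) \<in> T \<and> t j \<in> T \<and> t (j - 1) \<le> t j"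
    using f by (auto simp: step_functions_def)
  have "k \<le> m \<Longrightarrow> (\<lambda>x. \<Sum>j=1..k. c j * indicator {t (j - 1)..<t j} x) \<in> step_functions T \<and>
      emb (\<lambda>x. \<Sum>j=1..k. c j * indicator {t (j - 1)..<t j} x) \<in> ?S" for k
  proof (induction k)
    case 0
    have z: "(\<lambda>x. \<Sum>j=1..0::nat. c j * indicator {t (j - 1)..<t j} x) \<in> step_functions T"
      unfolding step_functions_def by (intro CollectI exI[of _ "0::nat"] exI[of _ c] exI[of _ t]) auto
    have "emb (\<lambda>x. \<Sum>j=1..0::nat. c j * indicator {t (j - 1)..<t j} x) = 0" using scale[OF z, of 0] by simp
    then show ?case using z span_zero by auto
  next
    case (Suc k)
    let ?g = "\<lambda>x. c (Suc k) * indicator {t k..<t (Suc k)} x"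
    have tk: "t k \<in> T" "t (Suc k) \<in> T" "t k \<le> t (Suc k)" using t[of "Suc k"] Suc.prems by auto
    have g: "?g \<in> step_functions T" by (rule step_function_interval[OF tk])
    have i: "indicator {t k..<t (Suc k)} \<in> step_functions T" using step_function_interval[OF tk, of 1] by simp
    have eg: "emb ?g = c (Suc k) *\<^sub>R emb (indicator {t k..<t (Suc k)})" by (rule scale[OF i])
    have gS: "emb ?g \<in> ?S" unfolding eg using tk by (intro span_scale span_base) blast
    have IH: "(\<lambda>x. \<Sum>j=1..k. c j * indicator {t (j - 1)..<t j} x) \<in> step_functions T"
      "emb (\<lambda>x. \<Sum>j=1..k. c j * indicator {t (j - 1)..<t j} x) \<in> ?S" using Suc by auto
    have e: "(\<lambda>x. \<Sum>j=1..Suc k. c j * indicator {t (j - 1)..<t j} x) = (\<lambda>x. (\<Sum>j=1..k. c j * indicator {t (j - 1)..<t j} x) + ?g x)"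
      by simp
    have "(\<lambda>x. \<Sum>j=1..Suc k. c j * indicator {t (j - 1)..<t j} x) \<in> step_functions T"
      unfolding step_functions_def using Suc.prems t by (intro CollectI exI[of _ "Suc k"] exI[of _ c] exI[of _ t]) auto
    moreover have "emb (\<lambda>x. \<Sum>j=1..Suc k. c j * indicator {t (j - 1)..<t j} x) \<in> ?S"
      unfolding e add[OF IH(1) g] by (rule span_add[OF IH(2) gS])
    ultimately show ?case by blast
  qed
  from this[of m] show ?thesis by (simp add: f)
qed

lemma associated_operator_unique:
  assumes tens: "is_hilbert_tensor tens" and A: "associated_operator tens G A" and B: "associated_operator tens G B"
  shows "A = B"
proof (rule blinfun_eqI)
  fix \<phi>
  define v where "v = A \<phi> - B \<phi>"
  have "inner v (tens g u) = 0" for g u using A B by (simp add: v_def associated_operator_def inner_diff_left)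
  then have z: "span {tens g u | g u. True} \<subseteq> {x. inner v x = 0}"
    by (intro span_minimal subspace_hyperplane) auto
  have "closed {x. inner v x = 0}" by (intro closed_Collect_eq continuous_intros)
  then have "closure (span {tens g u | g u. True}) \<subseteq> {x. inner v x = 0}" using z by (intro closure_minimal) auto
  moreover have "v \<in> closure (span {tens g u | g u. True})" using tens by (simp add: is_hilbert_tensor_def)
  ultimately have "inner v v = 0" by blast
  then show "A \<phi> = B \<phi>" by (simp add: v_def)
qed

lemma subspace_closure:
  fixes S :: "'e::real_normed_vector set"
  assumes S: "subspace S"
  shows "subspace (closure S)"
proof (rule subspaceI)
  show "0 \<in> closure S" using subspace_0[OF S] closure_subset by blast
  fix x y and c :: real
  assume x: "x \<in> closure S"
  then obtain f where f: "\<And>k. f k \<in> S" "f \<longlonglongrightarrow> x" by (auto simp: closure_sequential)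
  show "c *\<^sub>R x \<in> closure S"
    unfolding closure_sequential by (intro exI[of _ "\<lambda>k. c *\<^sub>R f k"]) (use f S in \<open>auto intro!: tendsto_intros subspace_scale\<close>)
  assume y: "y \<in> closure S"
  then obtain g where g: "\<And>k. g k \<in> S" "g \<longlonglongrightarrow> y" by (auto simp: closure_sequential)
  show "x + y \<in> closure S"
    unfolding closure_sequential by (intro exI[of _ "\<lambda>k. f k + g k"]) (use f g S in \<open>auto intro!: tendsto_intros subspace_add\<close>)
qed

text \<open>Step functions are dense in the first factor, and tensoring with a fixed vector is continuous.\<close>

lemma step_tensors_dense:
  fixes tens :: "'d::{real_inner, complete_space} \<Rightarrow> 'u::{real_inner, complete_space} \<Rightarrow> 'e::{real_inner, complete_space}"
  assumes DH: "is_DH H T emb" and tens: "is_hilbert_tensor tens"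
  shows "closure (span {tens (emb f) u | f u. f \<in> step_functions T}) = UNIV"
proof -
  let ?D = "span {tens (emb f) u | f u. f \<in> step_functions T}"
  have bil: "bilinear tens" and ti: "\<And>g u g' u'. inner (tens g u) (tens g' u') = inner g g' * inner u u'"
    and td: "closure (span {tens g u | g u. True}) = UNIV" using tens by (auto simp: is_hilbert_tensor_def)
  have "tens g u \<in> closure ?D" for g u
  proof -
    have "g \<in> closure (emb ` step_functions T)" using DH by (simp add: is_DH_def)
    then obtain h where h: "\<And>k. h k \<in> emb ` step_functions T" "h \<longlonglongrightarrow> g" unfolding closure_sequential by blast
    have n: "norm (tens a u) = norm a * norm u" for a using ti[of a u a u] by (simp add: norm_eq_sqrt_inner real_sqrt_mult)
    have d: "norm (tens (h k) u - tens g u) = norm (h k - g) * norm u" for k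
      using bilinear_lsub[OF bil, of "h k" g u] n[of "h k - g"] by simp
    have "(\<lambda>k. norm (h k - g) * norm u) \<longlonglongrightarrow> norm (g - g) * norm u" by (intro tendsto_intros h)
    then have "(\<lambda>k. norm (tens (h k) u - tens g u)) \<longlonglongrightarrow> 0" unfolding d by simp
    then have "(\<lambda>k. tens (h k) u) \<longlonglongrightarrow> tens g u" by (simp add: tendsto_norm_zero_iff LIM_zero_iff)
    moreover have "tens (h k) u \<in> ?D" for k 
    proof -
      obtain f where "f \<in> step_functions T" "h k = emb f" using h(1)[of k] by blast
      then show ?thesis by (intro span_base CollectI exI[of _ f] exI[of _ u]) simp
    qed
    ultimately show ?thesis unfolding closure_sequential by (intro exI[of _ "\<lambda>k. tens (h k) u"] conjI allI)
  qed
  then have "span {tens g u | g u. True} \<subseteq> closure ?D" by (intro span_minimal subspace_closure subspace_span) auto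
  then have "closure (span {tens g u | g u. True}) \<subseteq> closure ?D" by (intro closure_minimal) auto
  then show ?thesis using td by auto
qed

lemma (in gaussian_space) L2_linear_chaos_subspace:
  assumes A: "L2_linear M A"
  shows "subspace {h. A h \<in> chaos_upto M W n}"
proof (rule subspaceI)
  have meas: "A h \<in> borel_measurable M" for h using A by (auto simp: L2_linear_def intro: L2_D(1))
  have add: "AE \<omega> in M. A (h + k) \<omega> = A h \<omega> + A k \<omega>" and scale: "AE \<omega> in M. A (c *\<^sub>R h) \<omega> = c * A h \<omega>" for h k c
    using A by (auto simp: L2_linear_def)
  have "AE \<omega> in M. A 0 \<omega> = 0" using scale[of 0 0] by simp
  then show "0 \<in> {h. A h \<in> chaos_upto M W n}" using chaos_upto_cong_AE[OF chaos_upto_zero meas] by blast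
  show "x + y \<in> {h. A h \<in> chaos_upto M W n}" if "x \<in> {h. A h \<in> chaos_upto M W n}" "y \<in> {h. A h \<in> chaos_upto M W n}" for x y
    using chaos_upto_cong_AE[OF chaos_upto_add meas add] that by blast
  show "c *\<^sub>R x \<in> {h. A h \<in> chaos_upto M W n}" if "x \<in> {h. A h \<in> chaos_upto M W n}" for c x
    using chaos_upto_cong_AE[OF chaos_upto_cmult meas scale] that by blast
qed

text \<open>By linearity from increments of the process, first in the integrand and then over elementary
  tensors.\<close>

lemma (in gaussian_space) tensor_integral_chaos:
  fixes tens :: "'d::{real_inner, complete_space} \<Rightarrow> 'u::{real_inner, complete_space} \<Rightarrow> 'e::{real_inner, complete_space}"
  assumes DH: "is_DH H T emb" and J: "is_scalar_integral M Z T emb J" and I: "is_tensor_integral M tens J I"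
    and Z: "lives_in_chaos M W n S Z" and TS: "T \<subseteq> S"
    and h: "h \<in> span {tens (emb f) u | f u. f \<in> step_functions T}"
  shows "I h \<in> chaos_upto M W n"
proof -
  have JL: "L2_linear M (\<lambda>g. J g u)" for u using J by (simp add: is_scalar_integral_def L2_bounded_linear_def)
  have Jm: "J g u \<in> borel_measurable M" for g u using JL[of u] by (auto simp: L2_linear_def intro: L2_D(1))
  have IL: "L2_linear M I" using I by (simp add: is_tensor_integral_def)
  have Im: "I k \<in> borel_measurable M" for k using IL by (auto simp: L2_linear_def intro: L2_D(1))
  have "J (emb (indicator {a..<b})) u \<in> chaos_upto M W n" if "a \<in> T" "b \<in> T" "a \<le> b" for a b u
  proof (rule chaos_upto_cong_AE[OF _ Jm])
    have "Z a u \<in> chaos_upto M W n" "Z b u \<in> chaos_upto M W n" using Z TS that by (auto simp: lives_in_chaos_def)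
    then show "(\<lambda>\<omega>. Z b u \<omega> + - 1 * Z a u \<omega>) \<in> chaos_upto M W n" by (intro chaos_upto_add chaos_upto_cmult)
    have "AE \<omega> in M. J (emb (indicator {a..<b})) u \<omega> = Z b u \<omega> - Z a u \<omega>" using J that by (simp add: is_scalar_integral_def)
    then show "AE \<omega> in M. J (emb (indicator {a..<b})) u \<omega> = Z b u \<omega> + - 1 * Z a u \<omega>" by eventually_elim simp
  qed
  then have "span {emb (indicator {a..<b}) | a b. a \<in> T \<and> b \<in> T \<and> a \<le> b} \<subseteq> {g. J g u \<in> chaos_upto M W n}" for u
    by (intro span_minimal L2_linear_chaos_subspace[OF JL]) auto
  then have Jc: "J (emb f) u \<in> chaos_upto M W n" if "f \<in> step_functions T" for f u
    using emb_step_span[OF DH that] by blast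
  have "I (tens (emb f) u) \<in> chaos_upto M W n" if "f \<in> step_functions T" for f u
    by (rule chaos_upto_cong_AE[OF Jc[OF that, of u] Im]) (use I in \<open>simp add: is_tensor_integral_def\<close>)
  then have "span {tens (emb f) u | f u. f \<in> step_functions T} \<subseteq> {h. I h \<in> chaos_upto M W n}"
    by (intro span_minimal L2_linear_chaos_subspace[OF IL]) auto
  then show ?thesis using h by blast
qed

theorem theorem3p19:
  fixes M :: "'o measure"
    and W :: "'v::{real_inner, polish_space} \<Rightarrow> 'o \<Rightarrow> real"
    and n :: nat
    and H :: real
    and S T :: "real set"
    and Z :: "real \<Rightarrow> 'u::{real_inner, polish_space} \<Rightarrow> 'o \<Rightarrow> real"
    and emb :: "(real \<Rightarrow> real) \<Rightarrow> 'd::{real_inner, complete_space}"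
    and tens :: "'d \<Rightarrow> 'u \<Rightarrow> 'e::{real_inner, complete_space}"
    and J :: "'d \<Rightarrow> 'u \<Rightarrow> 'o \<Rightarrow> real"
    and I :: "'e \<Rightarrow> 'o \<Rightarrow> real"
  assumes "prob_space M"
    and "isonormal_process M W"
    and "generated_up_to_null M W"
    and "0 < H" and "H < 1"
    and "time_domain S"
    and "T \<subseteq> S" and "is_interval T"
    and "cylindrical_frac_process M H S Z"
    and "is_DH H T emb"
    and "is_hilbert_tensor tens"
    and "is_scalar_integral M Z T emb J"
    and "is_tensor_integral M tens J I"
    and "lives_in_chaos M W n S Z"
    and "n_good M W n TYPE('x::banach)"
    and "approximation_property TYPE('x)"
  shows
    "(\<forall>(G :: ('x \<Rightarrow>\<^sub>L real) \<Rightarrow> 'u \<Rightarrow> 'd) Gbar.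
        weakly_integrable G \<and> associated_operator tens G Gbar \<longrightarrow>
        (integrable_wrt M tens I G \<longleftrightarrow> (\<exists>R. adjoint_in_X Gbar R \<and> gamma_radonifying R)))
     \<and>
     (\<forall>r>0. \<exists>c1>0. \<exists>c2>0.
        \<forall>(G :: ('x \<Rightarrow>\<^sub>L real) \<Rightarrow> 'u \<Rightarrow> 'd) Gbar R \<xi>.
        weakly_integrable G \<and> associated_operator tens G Gbar \<and>
        adjoint_in_X Gbar R \<and> gamma_radonifying R \<and> is_integral M tens I G \<xi> \<longrightarrow>
          ennreal (c1 * gamma_norm R) \<le> Lr_norm M r \<xi> \<and>
          Lr_norm M r \<xi> \<le> ennreal (c2 * gamma_norm R))"
proof -
  interpret gaussian_space M W
    using assms(1,2) by (simp add: gaussian_space_def gaussian_space_axioms_def)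
  let ?D = "span {tens (emb f) u | f u. f \<in> step_functions T}"
  interpret good_chaos_isometry M W n I ?D "TYPE('x)"
  proof (unfold_locales)
    show "L2_linear M I" "\<And>h. L2_norm M (I h) = norm h" using assms(13) by (auto simp: is_tensor_integral_def)
    show "subspace ?D" by (rule subspace_span)
    show "closure ?D = UNIV" by (rule step_tensors_dense[OF assms(10,11)])
    show "I h \<in> chaos_upto M W n" if "h \<in> ?D" for h
      by (rule tensor_integral_chaos[OF assms(10,12,13,14,7) that])
    show "n_good M W n TYPE('x)" "approximation_property TYPE('x)" by (rule assms)+
  qed
  have int: "is_integral M tens I G \<xi> \<longleftrightarrow> represents \<xi> Gbar" if "associated_operator tens G Gbar"
    for G :: "('x \<Rightarrow>\<^sub>L real) \<Rightarrow> 'u \<Rightarrow> 'd" and Gbar and \<xi> :: "'o \<Rightarrow> 'x"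
    unfolding is_integral_def represents_def
    using that associated_operator_unique[OF assms(11) _ that] by blast
  show ?thesis
  proof (intro conjI allI impI)
    fix G :: "('x \<Rightarrow>\<^sub>L real) \<Rightarrow> 'u \<Rightarrow> 'd" and Gbar
    assume G: "weakly_integrable G \<and> associated_operator tens G Gbar"
    then show "integrable_wrt M tens I G \<longleftrightarrow> (\<exists>R. adjoint_in_X Gbar R \<and> gamma_radonifying R)"
      using integrable_iff_radonifying[of Gbar] int[of G Gbar] by (simp add: integrable_wrt_def)
  next
    fix r :: real assume "0 < r"
    from integral_norm_comparison[OF this] obtain c1 c2 where "0 < c1" "0 < c2" and
      c: "\<And>B R \<xi>. adjoint_in_X B R \<and> gamma_radonifying R \<and> represents \<xi> B \<Longrightarrow>
        ennreal (c1 * gamma_norm R) \<le> Lr_norm M r \<xi> \<and> Lr_norm M r \<xi> \<le> ennreal (c2 * gamma_norm R)" by blast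
    then show "\<exists>c1>0. \<exists>c2>0. \<forall>(G :: ('x \<Rightarrow>\<^sub>L real) \<Rightarrow> 'u \<Rightarrow> 'd) Gbar R \<xi>.
        weakly_integrable G \<and> associated_operator tens G Gbar \<and>
        adjoint_in_X Gbar R \<and> gamma_radonifying R \<and> is_integral M tens I G \<xi> \<longrightarrow>
          ennreal (c1 * gamma_norm R) \<le> Lr_norm M r \<xi> \<and>
          Lr_norm M r \<xi> \<le> ennreal (c2 * gamma_norm R)"
      using int by blast
  qed
qed


end
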